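(* For every finite positive constant $\alpha$ there exists a constant $C(\alpha)$, depending only on $\alpha$, such that the following holds. Let $n$ be a positive integer and let $X_1,\ldots,X_n$ be independent mean zero (real-valued) random variables with finite moments such that $$\|X_i\|_{2p}\le \alpha\|X_i\|_p\qquad\text{for every real } p\ge 2 \text{ and every } i=1,\ldots,n.$$ Then for every real $p\ge 1$ and every non-empty set $T\subset\mathbb{R}^n$, $$\biggl(\mathbb{E}\sup_{t\in T}\Bigl|\sum_{i=1}^n t_iX_i\Bigr|^p\biggr)^{1/p}\le C(\alpha)\Biggl[\mathbb{E}\sup_{t\in T}\Bigl|\sum_{i=1}^n t_iX_i\Bigr|+\sup_{t\in T}\biggl(\mathbb{E}\Bigl|\sum_{i=1}^n t_iX_i\Bigr|^p\biggr)^{1/p}\Biggr].$$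
   Context: For a random variable $S$ and $p\ge 1$, $\|S\|_p:=(\mathbb{E}|S|^p)^{1/p}$. For $t\in\mathbb{R}^n$, $t_i$ denotes the $i$-th coordinate of $t$. Expectations of nonnegative quantities and suprema may take the value $+\infty$. *)

theory Defs
  imports "HOL-Probability.Probability"
begin

text \<open>
  Real powers on \<open>[0, \<infinity>]\<close>, only meant for positive exponents \<open>p\<close>;
  in that case \<open>0\<close> is sent to \<open>0\<close> and \<open>\<infinity>\<close> to \<open>\<infinity>\<close>.
\<close>

definition ennreal_powr :: "ennreal \<Rightarrow> real \<Rightarrow> ennreal" where
  "ennreal_powr x p = (if x = \<top> then \<top> else ennreal (enn2real x powr p))"

text \<open>
  \<open>(E S\<^sup>p)\<^sup>1\<^sup>/\<^sup>p\<close> for a random variable \<open>S\<close> with values in \<open>[0, \<infinity>]\<close>; the result may be \<open>\<infinity>\<close>.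
\<close>

definition moment_norm :: "'a measure \<Rightarrow> real \<Rightarrow> ('a \<Rightarrow> ennreal) \<Rightarrow> ennreal" where
  "moment_norm M p S = ennreal_powr (\<integral>\<^sup>+ \<omega>. ennreal_powr (S \<omega>) p \<partial>M) (1 / p)"

abbreviation Lp_norm :: "'a measure \<Rightarrow> real \<Rightarrow> ('a \<Rightarrow> real) \<Rightarrow> ennreal" where
  "Lp_norm M p S \<equiv> moment_norm M p (\<lambda>\<omega>. ennreal \<bar>S \<omega>\<bar>)"

definition admissible_variables ::
  "'a measure \<Rightarrow> real \<Rightarrow> nat \<Rightarrow> (nat \<Rightarrow> 'a \<Rightarrow> real) \<Rightarrow> bool" where
  "admissible_variables M \<alpha> n X \<longleftrightarrow>
     prob_space.indep_vars M (\<lambda>_. borel) X {1..n} \<and>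
     (\<forall>i\<in>{1..n}. \<forall>q\<ge>1. integrable M (\<lambda>\<omega>. \<bar>X i \<omega>\<bar> powr q)) \<and>
     (\<forall>i\<in>{1..n}. prob_space.expectation M (X i) = 0) \<and>
     (\<forall>i\<in>{1..n}. \<forall>p\<ge>2. Lp_norm M (2 * p) (X i) \<le> ennreal \<alpha> * Lp_norm M p (X i))"

text \<open>
  The constant \<open>C\<close> works for all families of random variables on \<open>M\<close>.  Since the dimension \<open>n\<close>
  is quantified here, \<open>R\<^sup>n\<close> is represented by the extensional functions on \<open>{1..n}\<close>.
  The supremum over an arbitrary \<open>T\<close> is a lower semicontinuous function of
  \<open>(X\<^sub>1, \<dots>, X\<^sub>n)\<close>, hence measurable, so the integrals below are genuine expectations.
\<close>

definition moment_comparison :: "'a measure \<Rightarrow> real \<Rightarrow> real \<Rightarrow> bool" where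
  "moment_comparison M \<alpha> C \<longleftrightarrow>
     (\<forall>n X p T. 1 \<le> n \<longrightarrow> admissible_variables M \<alpha> n X \<longrightarrow> 1 \<le> p \<longrightarrow>
        T \<noteq> {} \<longrightarrow> T \<subseteq> ({1..n} \<rightarrow>\<^sub>E (UNIV :: real set)) \<longrightarrow>
        moment_norm M p (\<lambda>\<omega>. SUP t\<in>T. ennreal \<bar>\<Sum>i=1..n. t i * X i \<omega>\<bar>)
        \<le> ennreal C *
            ((\<integral>\<^sup>+ \<omega>. (SUP t\<in>T. ennreal \<bar>\<Sum>i=1..n. t i * X i \<omega>\<bar>) \<partial>M)
             + (SUP t\<in>T. Lp_norm M p (\<lambda>\<omega>. \<Sum>i=1..n. t i * X i \<omega>))))"

text \<open>
  The constant works on every probability space with sample points in the given type.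
\<close>

definition comparison_constant :: "'a itself \<Rightarrow> real \<Rightarrow> real \<Rightarrow> bool" where
  "comparison_constant _ \<alpha> C \<longleftrightarrow>
     (\<forall>M :: 'a measure. prob_space M \<longrightarrow> moment_comparison M \<alpha> C)"

end

theory Submission
  imports Defs
begin

text \<open>
  By separability of \<open>R\<^sup>n\<close> and monotone convergence \<open>T\<close> may be taken finite, by symmetrization the \<open>X\<^sub>i\<close> may
  be taken symmetric, and after rescaling both terms on the right are at most \<open>1\<close>. The case \<open>p < 2\<close>
  follows from \<open>p = 2\<close>, because first and second moments of \<open>\<Sum> t\<^sub>i X\<^sub>i\<close> are comparable. For \<open>p \<ge> 2\<close> let
  \<open>b\<close> be a large multiple of \<open>1 / p\<close> and split each \<open>t\<^sub>i X\<^sub>i\<close> into three parts.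

  \<^item> The part truncated at the level \<open>b\<close>, divided by \<open>b\<close>, satisfies an exponential inequality which
    bounds the exponential moment of its supremum by the exponential of a multiple of the mean
    supremum. The compensating variances are controlled by the weak moments of order \<open>p\<close>.
  \<^item> The part between \<open>b\<close> and a constant is dominated by a slowly growing function of the rank of
    \<open>\<bar>X\<^sub>i\<bar>\<close> among the multiples of its moment norms \<open>\<parallel>X\<^sub>i\<parallel>\<^sub>k\<close>. The growth condition forces the
    rank to have geometric tails, and again exponential moments are bounded by means.
  \<^item> Only few coordinates exceed a constant, by Levy's inequality and the bound for the mean, and
    there the triangle inequality with \<open>max\<^sub>t \<bar>t\<^sub>i\<bar>\<close> in place of \<open>t\<^sub>i\<close> loses nothing.

  The exponential inequalities are proved for one coordinate with an arbitrary mean supremum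
  \<open>E max\<^sub>t (V\<^sub>t + y\<^sub>t)\<close> in place of the contribution of the other coordinates, and therefore tensorize.
\<close>

subsection \<open>Maxima of finite families\<close>

text \<open>The obstacle is that the variables may have tails heavier than exponential, so no
  multiple of the supremum need have an exponential moment. Ranks repair this: Markov's inequality
  and the Paley-Zygmund inequality at the orders \<open>k + 2\<close> place the tails of the rank
  between geometric ones, up to a dilation, whatever the law is. The level
  \<open>b = \<Gamma> / p\<close> comes from the exchange between exponential and power moments:
  \<open>E exp Z \<le> exp (c * p)\<close> bounds the norm of \<open>Z\<close> of order
  \<open>p\<close> by \<open>p * exp c\<close>, and the factor \<open>b\<close> in front of
  \<open>Z\<close> removes the \<open>p\<close>. Penalties of total size O(p) are therefore
  affordable, and a weak moment of order \<open>p\<close> controls exactly that much. Each penalty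
  is the mean of the nonlinear function whose supremum it compensates. The centered function can
  then be compared with an independent copy, and contraction replaces it by a linear one; this is
  how the exponent returns to the mean of the original supremum. The mean supremum \<open>L\<close>
  enters only as a monotone, convex functional that commutes with constants and obeys a contraction
  principle.\<close>

lemma integrable_Max_real:
  fixes f :: "'t \<Rightarrow> 'a \<Rightarrow> real"
  assumes "finite T" "T \<noteq> {}" "\<And>t. t \<in> T \<Longrightarrow> integrable M (f t)"
  shows "integrable M (\<lambda>x. MAX t\<in>T. f t x)"
  using assms
proof (induction T rule: finite_ne_induct)
  case (insert t T)
  have "integrable M (\<lambda>x. max (f t x) (MAX t\<in>T. f t x))"
    using insert by (intro integrable_max) auto
  with insert show ?case by simp
qed simp

lemma Max_add_const_real:
  fixes f :: "'t \<Rightarrow> real"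
  assumes "finite T" "T \<noteq> {}"
  shows "(MAX t\<in>T. f t + c) = (MAX t\<in>T. f t) + c"
  using assms by (simp add: Max_add_commute)

lemma Max_mono_real:
  fixes f g :: "'t \<Rightarrow> real"
  assumes "finite T" "T \<noteq> {}" "\<And>t. t \<in> T \<Longrightarrow> f t \<le> g t"
  shows "(MAX t\<in>T. f t) \<le> (MAX t\<in>T. g t)"
proof -
  have "f t \<le> (MAX t\<in>T. g t)" if "t \<in> T" for t
    using assms that by (meson Max_ge finite_imageI imageI order_trans)
  with assms show ?thesis by simp
qed

lemma Max_add_le:
  fixes f g :: "'t \<Rightarrow> real"
  assumes "finite T" "T \<noteq> {}"
  shows "(MAX t\<in>T. f t + g t) \<le> (MAX t\<in>T. f t) + (MAX t\<in>T. g t)"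
proof -
  have "f t + g t \<le> (MAX t\<in>T. f t) + (MAX t\<in>T. g t)" if "t \<in> T" for t
    using assms that by (intro add_mono Max_ge) auto
  with assms show ?thesis by simp
qed

lemma Max_attained:
  fixes f :: "'t \<Rightarrow> real"
  assumes "finite T" "T \<noteq> {}"
  obtains t where "t \<in> T" "(MAX t\<in>T. f t) = f t"
proof -
  have "(MAX t\<in>T. f t) \<in> f ` T" using assms by (intro Max_in) auto
  then show ?thesis using that by blast
qed

lemma Max_cmult_real:
  fixes f :: "'t \<Rightarrow> real"
  assumes "finite T" "T \<noteq> {}" "0 \<le> c"
  shows "(MAX t\<in>T. c * f t) = c * (MAX t\<in>T. f t)"
proof (rule Max_eqI)
  obtain t where "t \<in> T" "(MAX t\<in>T. f t) = f t" using Max_attained[OF assms(1,2)] .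
  then show "c * (MAX t\<in>T. f t) \<in> (\<lambda>t. c * f t) ` T" by (metis imageI)
qed (use assms in \<open>auto intro!: mult_left_mono\<close>)

text \<open>Let \<open>s\<close> and \<open>t\<close> be the maximizers on the left. Inserting them
  into the two maxima on the right, in either order, gives \<open>v s + v t\<close> plus or minus
  \<open>a s - a t\<close>, and one of the orders produces the absolute value. This is the one-sign
  step of the contraction principle.\<close>

lemma Max_contraction:
  fixes v f a :: "'t \<Rightarrow> real"
  assumes "finite T" "T \<noteq> {}"
    and le: "\<And>s t. s \<in> T \<Longrightarrow> t \<in> T \<Longrightarrow> \<bar>f s - f t\<bar> \<le> \<bar>a s - a t\<bar>"
  shows "(MAX t\<in>T. v t + f t) + (MAX t\<in>T. v t - f t)
       \<le> (MAX t\<in>T. v t + a t) + (MAX t\<in>T. v t - a t)" (is "_ \<le> ?R")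
proof -
  obtain s where s: "s \<in> T" "(MAX t\<in>T. v t + f t) = v s + f s"
    using Max_attained[OF assms(1,2)] .
  obtain t where t: "t \<in> T" "(MAX t\<in>T. v t - f t) = v t - f t"
    using Max_attained[OF assms(1,2)] .
  have "v s + f s + (v t - f t) \<le> v s + v t + \<bar>a s - a t\<bar>"
    using le[OF s(1) t(1)] by linarith
  moreover have "v r + a r \<le> (MAX t\<in>T. v t + a t)" "v r - a r \<le> (MAX t\<in>T. v t - a t)" if "r \<in> T" for r
    using assms that by auto
  note this[OF s(1)] this[OF t(1)]
  ultimately show ?thesis using s t by linarith
qed

lemma (in pair_prob_space) integrable_fst_component:
  fixes f :: "'a \<Rightarrow> real"
  assumes "integrable M1 f"
  shows "integrable (M1 \<Otimes>\<^sub>M M2) (\<lambda>p. f (fst p))"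
  using integrable_distr[OF measurable_fst, of M1 M2 f] assms by (simp add: M2.distr_pair_fst)

lemma (in pair_prob_space) integrable_snd_component:
  fixes f :: "'b \<Rightarrow> real"
  assumes "integrable M2 f"
  shows "integrable (M1 \<Otimes>\<^sub>M M2) (\<lambda>p. f (snd p))"
proof -
  interpret S: pair_prob_space M2 M1 ..
  show ?thesis
    using S.integrable_product_swap[OF S.integrable_fst_component[OF assms]]
    by (simp add: split_beta')
qed

subsection \<open>Mean suprema\<close>

locale sup_functional = Q: prob_space Q for Q :: "'z measure" +
  fixes T :: "'t set" and v :: "'t \<Rightarrow> 'z \<Rightarrow> real"
  assumes fin: "finite T" and ne: "T \<noteq> {}"
    and int_v: "\<And>t. t \<in> T \<Longrightarrow> integrable Q (v t)"
begin

definition L :: "('t \<Rightarrow> real) \<Rightarrow> real"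
  where "L y = (\<integral>z. (MAX t\<in>T. v t z + y t) \<partial>Q)"

lemma int_L [simp]: "integrable Q (\<lambda>z. MAX t\<in>T. v t z + y t)"
  using fin ne int_v by (intro integrable_Max_real) auto

lemma L_mono: "(\<And>t. t \<in> T \<Longrightarrow> y t \<le> w t) \<Longrightarrow> L y \<le> L w"
  unfolding L_def using fin ne by (intro integral_mono int_L Max_mono_real) auto

lemma L_cong: "(\<And>t. t \<in> T \<Longrightarrow> y t = w t) \<Longrightarrow> L y = L w"
  by (intro antisym L_mono) auto

lemma L_add_const: "L (\<lambda>t. y t + c) = L y + c"
proof -
  have "L (\<lambda>t. y t + c) = (\<integral>z. (MAX t\<in>T. v t z + y t) + c \<partial>Q)"
    unfolding L_def using Max_add_const_real[OF fin ne, of "\<lambda>t. v t _ + y t" c]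
    by (simp only: add.assoc)
  also have "\<dots> = L y + c"
    unfolding L_def by (subst Bochner_Integration.integral_add) (auto simp: Q.prob_space)
  finally show ?thesis .
qed

lemma L_convex:
  assumes "0 \<le> s" "s \<le> 1"
  shows "L (\<lambda>t. (1 - s) * y t + s * w t) \<le> (1 - s) * L y + s * L w"
proof -
  have "(MAX t\<in>T. v t z + ((1 - s) * y t + s * w t))
      \<le> (1 - s) * (MAX t\<in>T. v t z + y t) + s * (MAX t\<in>T. v t z + w t)" for z
  proof -
    have "(MAX t\<in>T. v t z + ((1 - s) * y t + s * w t))
        = (MAX t\<in>T. (1 - s) * (v t z + y t) + s * (v t z + w t))"
      by (intro arg_cong[where f=Max] image_cong refl) (simp add: algebra_simps)
    also have "\<dots> \<le> (MAX t\<in>T. (1 - s) * (v t z + y t)) + (MAX t\<in>T. s * (v t z + w t))"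
      using fin ne by (rule Max_add_le)
    also have "\<dots> = (1 - s) * (MAX t\<in>T. v t z + y t) + s * (MAX t\<in>T. v t z + w t)"
      using fin ne assms by (simp add: Max_cmult_real)
    finally show ?thesis .
  qed
  then have "L (\<lambda>t. (1 - s) * y t + s * w t)
     \<le> (\<integral>z. (1 - s) * (MAX t\<in>T. v t z + y t) + s * (MAX t\<in>T. v t z + w t) \<partial>Q)"
    unfolding L_def by (intro integral_mono int_L Bochner_Integration.integrable_add
        integrable_mult_right) auto
  then show ?thesis unfolding L_def by simp
qed

lemma L_midpoint: "L (\<lambda>t. y t + w t) \<le> (L (\<lambda>t. 2 * y t) + L (\<lambda>t. 2 * w t)) / 2"
  using L_convex[of "1/2" "\<lambda>t. 2 * y t" "\<lambda>t. 2 * w t"] by simp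

lemma L_contraction:
  assumes "\<And>s t. s \<in> T \<Longrightarrow> t \<in> T \<Longrightarrow> \<bar>f s - f t\<bar> \<le> \<bar>a s - a t\<bar>"
  shows "L f + L (\<lambda>t. - f t) \<le> L a + L (\<lambda>t. - a t)"
proof -
  have eq: "L f + L (\<lambda>t. - f t) = (\<integral>z. (MAX t\<in>T. v t z + f t) + (MAX t\<in>T. v t z - f t) \<partial>Q)" for f
    unfolding L_def using int_L[of "\<lambda>t. - f t"] by simp
  show ?thesis
    unfolding eq
  proof (intro integral_mono Bochner_Integration.integrable_add int_L)
    show "integrable Q (\<lambda>z. MAX t\<in>T. v t z - f t)" "integrable Q (\<lambda>z. MAX t\<in>T. v t z - a t)"
      using int_L[of "\<lambda>t. - f t"] int_L[of "\<lambda>t. - a t"] by simp_all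
  qed (rule Max_contraction[OF fin ne assms])
qed

lemma L_lipschitz:
  assumes "\<And>t. t \<in> T \<Longrightarrow> \<bar>y t - w t\<bar> \<le> c"
  shows "\<bar>L y - L w\<bar> \<le> c"
proof -
  have "y t \<le> w t + c" "w t \<le> y t + c" if "t \<in> T" for t
    using assms[OF that] by linarith+
  then have "L y \<le> L (\<lambda>t. w t + c)" "L w \<le> L (\<lambda>t. y t + c)"
    by (simp_all add: L_mono)
  then show ?thesis unfolding L_add_const by linarith
qed

lemma L_measurable [measurable (raw)]:
  assumes [measurable]: "\<And>t. t \<in> T \<Longrightarrow> f t \<in> borel_measurable N"
  shows "(\<lambda>x. L (\<lambda>t. f t x)) \<in> borel_measurable N"
proof -
  have [measurable]: "\<And>t. t \<in> T \<Longrightarrow> v t \<in> borel_measurable Q" using int_v by auto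
  have [measurable]: "(\<lambda>p. MAX t\<in>T. v t (snd p) + f t (fst p)) \<in> borel_measurable (N \<Otimes>\<^sub>M Q)"
    using fin by (intro borel_measurable_Max) auto
  show ?thesis
    unfolding L_def
    by (intro Q.borel_measurable_lebesgue_integral) (simp add: split_beta')
qed

lemma L_bound: "\<bar>L y - L w\<bar> \<le> (\<Sum>t\<in>T. \<bar>y t - w t\<bar>)"
  using fin by (intro L_lipschitz) (auto intro: member_le_sum)

lemma L_integrable:
  assumes "prob_space N" "\<And>t. t \<in> T \<Longrightarrow> integrable N (f t)"
  shows "integrable N (\<lambda>x. L (\<lambda>t. f t x))"
proof -
  interpret N: prob_space N by fact
  have [measurable]: "\<And>t. t \<in> T \<Longrightarrow> f t \<in> borel_measurable N" using assms by auto
  show ?thesis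
  proof (rule Bochner_Integration.integrable_bound)
    show "integrable N (\<lambda>x. \<bar>L (\<lambda>_. 0)\<bar> + (\<Sum>t\<in>T. \<bar>f t x\<bar>))" using assms by auto
    show "AE x in N. norm (L (\<lambda>t. f t x)) \<le> norm (\<bar>L (\<lambda>_. 0)\<bar> + (\<Sum>t\<in>T. \<bar>f t x\<bar>))"
    proof (intro always_eventually allI)
      fix x show "norm (L (\<lambda>t. f t x)) \<le> norm (\<bar>L (\<lambda>_. 0)\<bar> + (\<Sum>t\<in>T. \<bar>f t x\<bar>))"
        using L_bound[of "\<lambda>t. f t x" "\<lambda>_. 0"] by simp
    qed
  qed simp
qed

text \<open>Jensen's inequality for the convex functional \<open>L\<close>: for fixed
  \<open>z\<close> the mean of a maximum dominates the mean of each of its terms, and Fubini's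
  theorem exchanges the two integrations.\<close>

lemma L_jensen:
  assumes "prob_space N" and int: "\<And>t. t \<in> T \<Longrightarrow> integrable N (f t)"
  shows "L (\<lambda>t. w t - (\<integral>x. f t x \<partial>N)) \<le> (\<integral>x. L (\<lambda>t. w t - f t x) \<partial>N)"
proof -
  interpret N: prob_space N by fact
  interpret P: pair_prob_space Q N ..
  have [measurable]: "\<And>t. t \<in> T \<Longrightarrow> v t \<in> borel_measurable Q" "\<And>t. t \<in> T \<Longrightarrow> f t \<in> borel_measurable N"
    using int_v int by auto
  have i1: "integrable (Q \<Otimes>\<^sub>M N) (\<lambda>p. v t (fst p) + (w t - f t (snd p)))" if "t \<in> T" for t
  proof -
    have "integrable (Q \<Otimes>\<^sub>M N) (\<lambda>p. v t (fst p))"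
      using int_v[OF that] by (rule P.integrable_fst_component)
    moreover have "integrable (Q \<Otimes>\<^sub>M N) (\<lambda>p. f t (snd p))"
      using int[OF that] by (rule P.integrable_snd_component)
    ultimately show ?thesis
      by (intro Bochner_Integration.integrable_add Bochner_Integration.integrable_diff) auto
  qed
  have i: "integrable (Q \<Otimes>\<^sub>M N) (\<lambda>(z, x). MAX t\<in>T. v t z + (w t - f t x))"
    unfolding split_beta' by (rule integrable_Max_real[OF fin ne i1])
  have "L (\<lambda>t. w t - (\<integral>x. f t x \<partial>N)) \<le> (\<integral>z. (\<integral>x. (MAX t\<in>T. v t z + (w t - f t x)) \<partial>N) \<partial>Q)"
    unfolding L_def
  proof (intro integral_mono int_L)
    show "integrable Q (\<lambda>z. \<integral>x. (MAX t\<in>T. v t z + (w t - f t x)) \<partial>N)"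
      using P.integrable_fst'[OF i] by simp
    fix z
    have "v t z + (w t - (\<integral>x. f t x \<partial>N)) \<le> (\<integral>x. (MAX t\<in>T. v t z + (w t - f t x)) \<partial>N)" if "t \<in> T" for t
    proof -
      have "v t z + (w t - (\<integral>x. f t x \<partial>N)) = (\<integral>x. v t z + (w t - f t x) \<partial>N)"
        using int[OF that] by (simp add: N.prob_space)
      also have "\<dots> \<le> (\<integral>x. (MAX t\<in>T. v t z + (w t - f t x)) \<partial>N)"
        using fin ne int that by (intro integral_mono integrable_Max_real) auto
      finally show ?thesis .
    qed
    then show "(MAX t\<in>T. v t z + (w t - (\<integral>x. f t x \<partial>N))) \<le> (\<integral>x. (MAX t\<in>T. v t z + (w t - f t x)) \<partial>N)"
      using fin ne by simp
  qed
  also have "\<dots> = (\<integral>x. L (\<lambda>t. w t - f t x) \<partial>N)"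
    unfolding L_def by (rule P.Fubini_integral[symmetric, OF i])
  finally show ?thesis .
qed

end

section \<open>The two-point exponential inequality\<close>

lemma exp_le_1_plus_2x:
  fixes y :: real
  assumes "0 \<le> y" "y \<le> 1"
  shows "exp y \<le> 1 + 2 * y"
  using exp_bound[OF assms] mult_left_mono[OF assms(2) assms(1)] by (simp add: power2_eq_square)

text \<open>The term \<open>2 * d\<^sup>2\<close> pays for both quadratic remainders: the first
  exponential is at most \<open>1 + d - d\<^sup>2\<close>, the second at most
  \<open>1 - d + d\<^sup>2\<close>.\<close>

lemma two_point_exp_small:
  fixes d :: real
  assumes "0 \<le> d" "d \<le> 1 / 2"
  shows "exp (d - 2 * d\<^sup>2) + exp (- d) \<le> 2"
proof -
  define u where "u = d - 2 * d\<^sup>2"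
  have "u = d * (1 - 2 * d)" unfolding u_def by (simp add: power2_eq_square algebra_simps)
  moreover have "d * (1 - 2 * d) \<le> d * 1" using assms by (intro mult_left_mono) auto
  ultimately have u: "0 \<le> u" "u \<le> d" using assms by simp_all
  have "exp u \<le> 1 + u + u\<^sup>2" using u assms by (intro exp_bound) auto
  moreover have "u\<^sup>2 \<le> d\<^sup>2" using u by (simp add: power_mono)
  moreover have "exp (- d) \<le> 1 - d + d\<^sup>2"
  proof -
    have "1 \<le> (1 - d + d\<^sup>2) * (1 + d + d\<^sup>2 / 2)"
    proof -
      have "(1 - d + d\<^sup>2) * (1 + d + d\<^sup>2 / 2) = 1 + d\<^sup>2 / 2 + d ^ 3 / 2 + d ^ 4 / 2"
        by (simp add: algebra_simps add_divide_distrib diff_divide_distrib power2_eq_square power3_eq_cube power4_eq_xxxx)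
      then show ?thesis using assms by simp
    qed
    also have "\<dots> \<le> (1 - d + d\<^sup>2) * exp d"
      using assms by (intro mult_left_mono exp_lower_Taylor_quadratic) auto
    finally show ?thesis by (simp add: exp_minus field_simps)
  qed
  ultimately show ?thesis unfolding u_def by linarith
qed

context sup_functional
begin

lemma two_point_aux:
  assumes "L (\<lambda>t. w t - a t) \<le> L (\<lambda>t. w t + a t)"
  shows "(exp (L (\<lambda>t. w t + a t - 2 * (a t)\<^sup>2)) + exp (L (\<lambda>t. w t - a t - 2 * (a t)\<^sup>2))) / 2
       \<le> exp ((L (\<lambda>t. w t + a t) + L (\<lambda>t. w t - a t)) / 2)"
proof -
  define c d where "c = (L (\<lambda>t. w t + a t) + L (\<lambda>t. w t - a t)) / 2"
    and "d = (L (\<lambda>t. w t + a t) - L (\<lambda>t. w t - a t)) / 2"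
  have cd: "L (\<lambda>t. w t + a t) = c + d" "L (\<lambda>t. w t - a t) = c - d"
    unfolding c_def d_def by (simp_all add: field_simps)
  have d0: "0 \<le> d" using assms unfolding d_def by simp
  have neg: "L (\<lambda>t. w t - a t - 2 * (a t)\<^sup>2) \<le> c - d"
    unfolding cd(2)[symmetric] by (rule L_mono) simp
  \<comment> \<open>Completing the square: a point between \<open>w - a\<close> and
    \<open>w + a\<close> trades the quadratic penalty against the constant
    \<open>(1 - s)\<^sup>2 / 8\<close>. The parameter \<open>s\<close> stays free until the size of
    \<open>d\<close> is known.\<close>
  have pos: "L (\<lambda>t. w t + a t - 2 * (a t)\<^sup>2) \<le> c + d * s + (1 - s)\<^sup>2 / 8" if s: "-1 \<le> s" "s \<le> 1" for s
  proof -
    define r where "r = (1 + s) / 2"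
    have r: "0 \<le> r" "r \<le> 1" using s by (auto simp: r_def)
    have "w t + a t - 2 * (a t)\<^sup>2 \<le> ((1 - r) * (w t - a t) + r * (w t + a t)) + (1 - s)\<^sup>2 / 8" for t
    proof -
      have "((1 - r) * (w t - a t) + r * (w t + a t)) + (1 - s)\<^sup>2 / 8 - (w t + a t - 2 * (a t)\<^sup>2)
          = 2 * (a t - (1 - s) / 4)\<^sup>2"
        unfolding r_def by (simp add: power2_eq_square field_simps)
      then show ?thesis by (smt (verit) zero_le_power2)
    qed
    then have "L (\<lambda>t. w t + a t - 2 * (a t)\<^sup>2)
      \<le> L (\<lambda>t. ((1 - r) * (w t - a t) + r * (w t + a t)) + (1 - s)\<^sup>2 / 8)"
      by (intro L_mono)
    also have "\<dots> \<le> (1 - r) * L (\<lambda>t. w t - a t) + r * L (\<lambda>t. w t + a t) + (1 - s)\<^sup>2 / 8"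
      unfolding L_add_const by (intro add_right_mono L_convex r)
    also have "\<dots> = c + d * s + (1 - s)\<^sup>2 / 8"
      unfolding cd r_def by (simp add: field_simps)
    finally show ?thesis .
  qed
  have "exp (L (\<lambda>t. w t + a t - 2 * (a t)\<^sup>2)) + exp (L (\<lambda>t. w t - a t - 2 * (a t)\<^sup>2)) \<le> exp c * 2"
  proof (cases "d \<le> 1 / 2")
    case True
    \<comment> \<open>The value \<open>s = 1 - 4 * d\<close> minimizes the bound \<open>pos\<close>
      and lies in the admissible range because \<open>d \<le> 1 / 2\<close>. For larger
      \<open>d\<close> the endpoint \<open>s = -1\<close> already brings both terms below
      \<open>c\<close>.\<close>
    have "L (\<lambda>t. w t + a t - 2 * (a t)\<^sup>2) \<le> c + (d - 2 * d\<^sup>2)"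
      using pos[of "1 - 4 * d"] True d0 by (simp add: power2_eq_square algebra_simps)
    then have "exp (L (\<lambda>t. w t + a t - 2 * (a t)\<^sup>2)) + exp (L (\<lambda>t. w t - a t - 2 * (a t)\<^sup>2))
      \<le> exp (c + (d - 2 * d\<^sup>2)) + exp (c + - d)"
      using neg by (intro add_mono) auto
    also have "\<dots> = exp c * (exp (d - 2 * d\<^sup>2) + exp (- d))" unfolding exp_add by (simp add: distrib_left)
    also have "\<dots> \<le> exp c * 2" using two_point_exp_small[OF d0 True] by (intro mult_left_mono) auto
    finally show ?thesis .
  next
    case False
    have "L (\<lambda>t. w t + a t - 2 * (a t)\<^sup>2) \<le> c" "L (\<lambda>t. w t - a t - 2 * (a t)\<^sup>2) \<le> c"
      using pos[of "-1"] neg False by auto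
    then have "exp (L (\<lambda>t. w t + a t - 2 * (a t)\<^sup>2)) \<le> exp c" "exp (L (\<lambda>t. w t - a t - 2 * (a t)\<^sup>2)) \<le> exp c"
      by simp_all
    then show ?thesis by linarith
  qed
  then show ?thesis unfolding c_def by simp
qed

text \<open>
  The two-point case of a convex infimum-convolution inequality: the penalty \<open>2 (a t)\<^sup>2\<close>
  turns the exponential moment of a supremum into the exponential of its mean.
\<close>
lemma two_point:
  "(exp (L (\<lambda>t. w t + a t - 2 * (a t)\<^sup>2)) + exp (L (\<lambda>t. w t - a t - 2 * (a t)\<^sup>2))) / 2
    \<le> exp ((L (\<lambda>t. w t + a t) + L (\<lambda>t. w t - a t)) / 2)"
proof (cases "L (\<lambda>t. w t - a t) \<le> L (\<lambda>t. w t + a t)")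
  case False
  then show ?thesis using two_point_aux[of w "\<lambda>t. - a t"] by (simp add: add.commute)
qed (rule two_point_aux)

end

subsection \<open>Symmetric laws and tensorization\<close>

locale symmetric_law = prob_space \<mu> for \<mu> :: "real measure" +
  assumes sets_law [measurable_cong]: "sets \<mu> = sets borel"
    and sym: "distr \<mu> borel uminus = \<mu>"
begin

lemma space_law [simp]: "space \<mu> = UNIV"
  using sets_eq_imp_space_eq[OF sets_law] by simp

lemma prob_UNIV [simp]: "prob UNIV = 1"
  using prob_space by simp

lemma nn_integral_uminus:
  assumes "f \<in> borel_measurable borel"
  shows "(\<integral>\<^sup>+x. f (- x) \<partial>\<mu>) = (\<integral>\<^sup>+x. f x \<partial>\<mu>)"
  using assms by (subst (2) sym[symmetric], subst nn_integral_distr) auto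

lemma integral_uminus:
  fixes f :: "real \<Rightarrow> real"
  assumes "f \<in> borel_measurable borel"
  shows "(\<integral>x. f (- x) \<partial>\<mu>) = (\<integral>x. f x \<partial>\<mu>)"
  using assms by (subst (2) sym[symmetric], subst integral_distr) auto

lemma integrable_uminus:
  fixes f :: "real \<Rightarrow> real"
  assumes "integrable \<mu> f"
  shows "integrable \<mu> (\<lambda>x. f (- x))"
proof -
  have "integrable (distr \<mu> borel uminus) f" using assms by (simp add: sym)
  then show ?thesis by (rule integrable_distr[rotated]) simp
qed

text \<open>Jensen's inequality replaces the mean by an independent copy \<open>y\<close>. Adding
  the integrand with \<open>x\<close> and \<open>y\<close> exchanged gives a function together with
  its negative, so \<open>L_contraction\<close> applies with
  \<open>k * \<theta> t * (\<bar>x\<bar> + \<bar>y\<bar>)\<close>. Midpoint convexity then separates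
  \<open>\<bar>x\<bar>\<close> from \<open>\<bar>y\<bar>\<close>, which is the origin of the factor
  2.\<close>

lemma centering:
  fixes f :: "'t \<Rightarrow> real \<Rightarrow> real" and \<theta> :: "'t \<Rightarrow> real"
  assumes "sup_functional Q T v"
    and [measurable]: "\<And>t. t \<in> T \<Longrightarrow> f t \<in> borel_measurable borel"
    and f: "\<And>t. t \<in> T \<Longrightarrow> integrable \<mu> (f t)" and x: "integrable \<mu> (\<lambda>x. x)"
    and k: "0 \<le> k"
    and lip: "\<And>s t x. s \<in> T \<Longrightarrow> t \<in> T \<Longrightarrow> \<bar>f s x - f t x\<bar> \<le> k * \<bar>\<theta> s - \<theta> t\<bar> * \<bar>x\<bar>"
  shows "(\<integral>x. sup_functional.L Q T v (\<lambda>t. f t x - (\<integral>x. f t x \<partial>\<mu>)) \<partial>\<mu>)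
       \<le> (\<integral>x. sup_functional.L Q T v (\<lambda>t. 2 * k * \<theta> t * x) \<partial>\<mu>)"
proof -
  interpret S: sup_functional Q T v by fact
  interpret P: pair_prob_space \<mu> \<mu> ..
  define g where "g = (\<lambda>p. S.L (\<lambda>t. f t (fst p) - f t (snd p)))"
  define m where "m x = S.L (\<lambda>t. 2 * k * \<theta> t * x) + S.L (\<lambda>t. 2 * k * \<theta> t * (- x))" for x :: real
  have g: "integrable (\<mu> \<Otimes>\<^sub>M \<mu>) g"
    unfolding g_def
    by (intro S.L_integrable P.prob_space_axioms Bochner_Integration.integrable_diff
        P.integrable_fst_component P.integrable_snd_component f)
  have intL: "integrable \<mu> (\<lambda>x. S.L (\<lambda>t. 2 * k * \<theta> t * x))"
    by (intro S.L_integrable prob_space_axioms integrable_mult_right x)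
  have intL': "integrable \<mu> (\<lambda>x. S.L (\<lambda>t. 2 * k * \<theta> t * (- x)))"
    using integrable_uminus[OF intL] .
  have m: "integrable \<mu> m"
    unfolding m_def using intL intL' by (rule Bochner_Integration.integrable_add)
  have int_m: "(\<integral>x. m x \<partial>\<mu>) = 2 * (\<integral>x. S.L (\<lambda>t. 2 * k * \<theta> t * x) \<partial>\<mu>)"
    unfolding m_def using integral_uminus[of "\<lambda>x. S.L (\<lambda>t. 2 * k * \<theta> t * x)"] intL intL'
    by (subst Bochner_Integration.integral_add) auto
  have m_abs: "m \<bar>x\<bar> = m x" for x
    unfolding m_def by (cases "0 \<le> x") simp_all
  have pt: "g (x, y) + g (y, x) \<le> (m x + m y) / 2" for x y
  proof -
    define a where "a t = k * \<theta> t * (\<bar>x\<bar> + \<bar>y\<bar>)" for t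
    have "g (x, y) + g (y, x) = S.L (\<lambda>t. f t x - f t y) + S.L (\<lambda>t. - (f t x - f t y))"
      unfolding g_def by simp
    also have "\<dots> \<le> S.L a + S.L (\<lambda>t. - a t)"
    proof (rule S.L_contraction)
      fix s t assume st: "s \<in> T" "t \<in> T"
      have "\<bar>(f s x - f s y) - (f t x - f t y)\<bar> \<le> \<bar>f s x - f t x\<bar> + \<bar>f s y - f t y\<bar>" by simp
      also have "\<dots> \<le> k * \<bar>\<theta> s - \<theta> t\<bar> * \<bar>x\<bar> + k * \<bar>\<theta> s - \<theta> t\<bar> * \<bar>y\<bar>"
        using lip st by (intro add_mono) auto
      also have "\<dots> = \<bar>a s - a t\<bar>"
        unfolding a_def using k by (simp add: abs_mult flip: left_diff_distrib right_diff_distrib distrib_left)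
      finally show "\<bar>(f s x - f s y) - (f t x - f t y)\<bar> \<le> \<bar>a s - a t\<bar>" .
    qed
    also have "\<dots> \<le> (m \<bar>x\<bar> + m \<bar>y\<bar>) / 2"
      using S.L_midpoint[of "\<lambda>t. k * \<theta> t * \<bar>x\<bar>" "\<lambda>t. k * \<theta> t * \<bar>y\<bar>"]
        S.L_midpoint[of "\<lambda>t. - (k * \<theta> t * \<bar>x\<bar>)" "\<lambda>t. - (k * \<theta> t * \<bar>y\<bar>)"]
      unfolding a_def m_def by (simp add: algebra_simps)
    also have "\<dots> = (m x + m y) / 2" by (simp only: m_abs)
    finally show ?thesis .
  qed
  have "(\<integral>x. S.L (\<lambda>t. f t x - (\<integral>x. f t x \<partial>\<mu>)) \<partial>\<mu>) \<le> (\<integral>x. (\<integral>y. g (x, y) \<partial>\<mu>) \<partial>\<mu>)"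
  proof (rule integral_mono)
    show "integrable \<mu> (\<lambda>x. S.L (\<lambda>t. f t x - (\<integral>x. f t x \<partial>\<mu>)))"
      by (intro S.L_integrable prob_space_axioms Bochner_Integration.integrable_diff f) auto
    show "integrable \<mu> (\<lambda>x. \<integral>y. g (x, y) \<partial>\<mu>)" using P.integrable_fst'[OF g] .
    fix x show "S.L (\<lambda>t. f t x - (\<integral>x. f t x \<partial>\<mu>)) \<le> (\<integral>y. g (x, y) \<partial>\<mu>)"
      unfolding g_def fst_conv snd_conv by (intro S.L_jensen prob_space_axioms f)
  qed
  also have "\<dots> = (\<integral>p. g p \<partial>(\<mu> \<Otimes>\<^sub>M \<mu>))" by (rule P.integral_fst'[OF g])
  also have "\<dots> = (\<integral>p. (g p + g (snd p, fst p)) / 2 \<partial>(\<mu> \<Otimes>\<^sub>M \<mu>))"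
  proof -
    have sw: "integrable (\<mu> \<Otimes>\<^sub>M \<mu>) (\<lambda>p. g (snd p, fst p))"
      using P.integrable_product_swap[OF g] by (simp add: split_beta')
    have "(\<integral>p. g (snd p, fst p) \<partial>(\<mu> \<Otimes>\<^sub>M \<mu>)) = (\<integral>p. g p \<partial>(\<mu> \<Otimes>\<^sub>M \<mu>))"
      using P.integral_product_swap[of g] g by (simp add: split_beta')
    then show ?thesis using g sw by simp
  qed
  also have "\<dots> \<le> (\<integral>p. (m (fst p) + m (snd p)) / 4 \<partial>(\<mu> \<Otimes>\<^sub>M \<mu>))"
  proof (rule integral_mono)
    show "integrable (\<mu> \<Otimes>\<^sub>M \<mu>) (\<lambda>p. (g p + g (snd p, fst p)) / 2)"
      using P.integrable_product_swap[OF g] g by (simp add: split_beta')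
    show "integrable (\<mu> \<Otimes>\<^sub>M \<mu>) (\<lambda>p. (m (fst p) + m (snd p)) / 4)"
      using P.integrable_fst_component[OF m] P.integrable_snd_component[OF m] by simp
    fix p show "(g p + g (snd p, fst p)) / 2 \<le> (m (fst p) + m (snd p)) / 4"
      using pt[of "fst p" "snd p"] by simp
  qed
  also have "\<dots> = (\<integral>x. m x \<partial>\<mu>) / 2"
  proof -
    have "(\<integral>p. m (fst p) \<partial>(\<mu> \<Otimes>\<^sub>M \<mu>)) = (\<integral>x. m x \<partial>\<mu>)"
      using P.integral_fst'[OF P.integrable_fst_component[OF m]] by (simp add: prob_space)
    moreover have "(\<integral>p. m (snd p) \<partial>(\<mu> \<Otimes>\<^sub>M \<mu>)) = (\<integral>x. m x \<partial>\<mu>)"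
      using P.integral_fst'[OF P.integrable_snd_component[OF m]] by (simp add: prob_space)
    ultimately show ?thesis
      using P.integrable_fst_component[OF m] P.integrable_snd_component[OF m] by simp
  qed
  finally show ?thesis unfolding int_m by simp
qed

end

lemma (in sup_functional) L_average:
  assumes "\<And>t. t \<in> T \<Longrightarrow> y t = (u t + w t) / 2"
  shows "L y \<le> (L u + L w) / 2"
proof -
  have "L y = L (\<lambda>t. (1 - 1 / 2) * u t + (1 / 2) * w t)"
    by (rule L_cong) (simp add: assms field_simps)
  also have "\<dots> \<le> (1 - 1 / 2) * L u + (1 / 2) * L w" by (rule L_convex) auto
  finally show ?thesis by simp
qed

section \<open>Product measures and tensorization\<close>

locale real_laws =
  fixes \<mu> :: "nat \<Rightarrow> real measure"
  assumes prob_law: "\<And>i. prob_space (\<mu> i)"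
    and sets_laws [measurable_cong]: "\<And>i. sets (\<mu> i) = sets borel"
begin

lemma space_laws [simp]: "space (\<mu> i) = UNIV"
  using sets_eq_imp_space_eq[OF sets_laws] by simp

sublocale product_sigma_finite \<mu>
  by (intro product_sigma_finite.intro prob_space_imp_sigma_finite prob_law)

lemma prob_PiM: "prob_space (PiM I \<mu>)"
  by (intro prob_space_PiM prob_law)

lemma distr_component_laws: "i \<in> I \<Longrightarrow> distr (PiM I \<mu>) (\<mu> i) (\<lambda>x. x i) = \<mu> i"
  by (intro distr_PiM_component prob_law)

lemma integrable_component:
  fixes f :: "real \<Rightarrow> real"
  assumes "i \<in> I" "integrable (\<mu> i) f"
  shows "integrable (PiM I \<mu>) (\<lambda>x. f (x i))"
  using assms integrable_distr[of "\<lambda>x. x i" "PiM I \<mu>" "\<mu> i" f] by (simp add: distr_component_laws)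

lemma integral_component:
  fixes f :: "real \<Rightarrow> real"
  assumes [measurable]: "f \<in> borel_measurable borel" and "i \<in> I"
  shows "(\<integral>x. f (x i) \<partial>PiM I \<mu>) = (\<integral>x. f x \<partial>\<mu> i)"
  using assms
  by (subst distr_component_laws[OF assms(2), symmetric], subst integral_distr) auto

text \<open>The new coordinate must be integrated last, so that the inner integral is a mean
  supremum in which that coordinate is a parameter. The enlarged product is identified with an image
  of a binary product under coordinate update, and Fubini's theorem exchanges the order.\<close>

lemma integral_insert_rev:
  fixes f :: "(nat \<Rightarrow> real) \<Rightarrow> real"
  assumes "finite I" "i \<notin> I" and f: "integrable (PiM (insert i I) \<mu>) f"
  shows "(\<integral>x. f x \<partial>PiM (insert i I) \<mu>) = (\<integral>y. (\<integral>x. f (x(i := y)) \<partial>PiM I \<mu>) \<partial>\<mu> i)"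
    and "integrable (\<mu> i) (\<lambda>y. \<integral>x. f (x(i := y)) \<partial>PiM I \<mu>)"
proof -
  interpret I: prob_space "PiM I \<mu>" by (rule prob_PiM)
  interpret i: prob_space "\<mu> i" by (rule prob_law)
  interpret P: pair_prob_space "PiM I \<mu>" "\<mu> i" ..
  have f': "integrable (PiM I \<mu> \<Otimes>\<^sub>M \<mu> i) (\<lambda>(x, y). f (x(i := y)))"
  proof -
    have "distr (PiM I \<mu> \<Otimes>\<^sub>M \<mu> i) (PiM (insert i I) \<mu>) (\<lambda>(x, y). x(i := y)) = PiM (insert i I) \<mu>"
    proof (rule PiM_eqI)
      show "finite (insert i I)" using assms by simp
      fix A assume A: "\<And>j. j \<in> insert i I \<Longrightarrow> A j \<in> sets (\<mu> j)"
      have "emeasure (distr (PiM I \<mu> \<Otimes>\<^sub>M \<mu> i) (PiM (insert i I) \<mu>) (\<lambda>(x, y). x(i := y))) (Pi\<^sub>E (insert i I) A)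
        = emeasure (PiM I \<mu> \<Otimes>\<^sub>M \<mu> i) ((\<lambda>(x, y). x(i := y)) -` Pi\<^sub>E (insert i I) A \<inter> space (PiM I \<mu> \<Otimes>\<^sub>M \<mu> i))"
        using A assms(1) by (subst emeasure_distr) (auto intro!: sets_PiM_I_finite)
      also have "(\<lambda>(x, y). x(i := y)) -` Pi\<^sub>E (insert i I) A \<inter> space (PiM I \<mu> \<Otimes>\<^sub>M \<mu> i) = Pi\<^sub>E I A \<times> A i"
        using assms(2) by (auto simp: space_pair_measure space_PiM PiE_iff extensional_def split: if_splits) 
      also have "emeasure (PiM I \<mu> \<Otimes>\<^sub>M \<mu> i) (Pi\<^sub>E I A \<times> A i) = (\<Prod>j\<in>I. emeasure (\<mu> j) (A j)) * emeasure (\<mu> i) (A i)"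
        using A assms(1) by (subst sigma_finite_measure.emeasure_pair_measure_Times[OF prob_space_imp_sigma_finite[OF prob_law]]) (auto intro!: sets_PiM_I_finite simp: emeasure_PiM)
      finally show "emeasure (distr (PiM I \<mu> \<Otimes>\<^sub>M \<mu> i) (PiM (insert i I) \<mu>) (\<lambda>(x, y). x(i := y))) (Pi\<^sub>E (insert i I) A)
        = (\<Prod>j\<in>insert i I. emeasure (\<mu> j) (A j))"
        unfolding prod.insert[OF assms(1,2)] mult.commute[of "emeasure (\<mu> i) (A i)"] .
    qed simp
    then have "integrable (distr (PiM I \<mu> \<Otimes>\<^sub>M \<mu> i) (PiM (insert i I) \<mu>) (\<lambda>(x, y). x(i := y))) f"
      using f by simp
    then have "integrable (PiM I \<mu> \<Otimes>\<^sub>M \<mu> i) (\<lambda>p. f ((\<lambda>(x, y). x(i := y)) p))"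
      by (rule integrable_distr[rotated]) simp
    then show ?thesis by (simp only: split_beta')
  qed
  have "(\<integral>x. f x \<partial>PiM (insert i I) \<mu>) = (\<integral>x. (\<integral>y. f (x(i := y)) \<partial>\<mu> i) \<partial>PiM I \<mu>)"
    using assms by (rule product_integral_insert)
  also have "\<dots> = (\<integral>y. (\<integral>x. f (x(i := y)) \<partial>PiM I \<mu>) \<partial>\<mu> i)"
    by (rule P.Fubini_integral[symmetric, OF f'])
  finally show "(\<integral>x. f x \<partial>PiM (insert i I) \<mu>) = (\<integral>y. (\<integral>x. f (x(i := y)) \<partial>PiM I \<mu>) \<partial>\<mu> i)" .
  show "integrable (\<mu> i) (\<lambda>y. \<integral>x. f (x(i := y)) \<partial>PiM I \<mu>)"
    by (rule P.integrable_snd[OF f'])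
qed

lemma integrable_sum_components:
  fixes f :: "nat \<Rightarrow> real \<Rightarrow> real"
  assumes "\<And>i. i \<in> I \<Longrightarrow> integrable (\<mu> i) (f i)"
  shows "integrable (PiM I \<mu>) (\<lambda>x. c + (\<Sum>i\<in>I. f i (x i)))"
proof -
  interpret prob_space "PiM I \<mu>" by (rule prob_PiM)
  have "integrable (PiM I \<mu>) (\<lambda>x. f i (x i))" if "i \<in> I" for i
    using that assms by (intro integrable_component)
  then show ?thesis by simp
qed

text \<open>
  Inequalities of the form \<open>E exp (L a) \<le> exp (E (L b))\<close> tensorize: integrating out one coordinate
  turns the remaining supremum into the functional \<open>L\<close> of the next one.
\<close>
theorem exp_sup_tensorization:
  fixes a b :: "'t \<Rightarrow> nat \<Rightarrow> real \<Rightarrow> real"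
  assumes "finite I" and T: "finite T" "T \<noteq> {}"
    and a [measurable]: "\<And>t i. t \<in> T \<Longrightarrow> i \<in> I \<Longrightarrow> a t i \<in> borel_measurable borel"
    and b: "\<And>t i. t \<in> T \<Longrightarrow> i \<in> I \<Longrightarrow> integrable (\<mu> i) (b t i)"
    and one: "\<And>i (Q :: (nat \<Rightarrow> real) measure) v. i \<in> I \<Longrightarrow> sup_functional Q T v \<Longrightarrow>
       (\<integral>\<^sup>+x. exp (sup_functional.L Q T v (\<lambda>t. a t i x)) \<partial>\<mu> i)
       \<le> exp (\<integral>x. sup_functional.L Q T v (\<lambda>t. b t i x) \<partial>\<mu> i)"
  shows "(\<integral>\<^sup>+x. exp (MAX t\<in>T. c t + (\<Sum>i\<in>I. a t i (x i))) \<partial>PiM I \<mu>)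
       \<le> exp (\<integral>x. (MAX t\<in>T. c t + (\<Sum>i\<in>I. b t i (x i))) \<partial>PiM I \<mu>)"
  using \<open>finite I\<close> a b one
\<comment> \<open>The shift \<open>c\<close> is generalized because it receives the value
  \<open>a t i y\<close> of the coordinate that is held fixed.\<close>
proof (induction I arbitrary: c rule: finite_induct)
  case empty
  interpret prob_space "PiM {} \<mu>" by (rule prob_PiM)
  show ?case by (simp add: prob_space emeasure_space_1)
next
  case (insert i I)
  note [measurable] = insert.prems(1)
  interpret I: prob_space "PiM I \<mu>" by (rule prob_PiM)
  define v where "v t x = c t + (\<Sum>j\<in>I. b t j (x j))" for t x
  interpret S: sup_functional "PiM I \<mu>" T v
  proof
    show "integrable (PiM I \<mu>) (v t)" if "t \<in> T" for t
      unfolding v_def using insert.prems(2) that by (intro integrable_sum_components) auto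
  qed (use T in auto)
  have meas: "(\<lambda>x. ennreal (exp (MAX t\<in>T. c t + (\<Sum>j\<in>insert i I. a t j (x j))))) \<in> borel_measurable (PiM (insert i I) \<mu>)"
    using T by (intro measurable_compose[OF _ measurable_ennreal] measurable_compose[OF _ borel_measurable_exp]
         borel_measurable_Max) auto
  have "(\<integral>\<^sup>+x. exp (MAX t\<in>T. c t + (\<Sum>j\<in>insert i I. a t j (x j))) \<partial>PiM (insert i I) \<mu>)
    = (\<integral>\<^sup>+y. (\<integral>\<^sup>+x. exp (MAX t\<in>T. c t + (\<Sum>j\<in>insert i I. a t j ((x(i := y)) j))) \<partial>PiM I \<mu>) \<partial>\<mu> i)"
    by (rule product_nn_integral_insert_rev[OF insert.hyps meas])
  also have "\<dots> = (\<integral>\<^sup>+y. (\<integral>\<^sup>+x. exp (MAX t\<in>T. (c t + a t i y) + (\<Sum>j\<in>I. a t j (x j))) \<partial>PiM I \<mu>) \<partial>\<mu> i)"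
  proof -
    have "(\<Sum>j\<in>I. a t j ((x(i := y)) j)) = (\<Sum>j\<in>I. a t j (x j))" for t x y
      using insert.hyps by (intro sum.cong) auto
    then show ?thesis using insert.hyps by (simp add: add.assoc)
  qed
  also have "\<dots> \<le> (\<integral>\<^sup>+y. exp (\<integral>x. (MAX t\<in>T. (c t + a t i y) + (\<Sum>j\<in>I. b t j (x j))) \<partial>PiM I \<mu>) \<partial>\<mu> i)"
    by (intro nn_integral_mono insert.IH) (use insert.prems in auto)
  \<comment> \<open>After the induction hypothesis the other coordinates appear only through the
    \<open>b\<close>-process, whose mean supremum is an instance of \<open>L\<close>; the
    one-coordinate hypothesis applies to it.\<close>
  also have "\<dots> = (\<integral>\<^sup>+y. exp (S.L (\<lambda>t. a t i y)) \<partial>\<mu> i)"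
    unfolding S.L_def v_def by (simp add: ac_simps)
  also have "\<dots> \<le> exp (\<integral>y. S.L (\<lambda>t. b t i y) \<partial>\<mu> i)"
    by (intro insert.prems(3)) (auto intro: S.sup_functional_axioms)
  also have "(\<integral>y. S.L (\<lambda>t. b t i y) \<partial>\<mu> i)
      = (\<integral>x. (MAX t\<in>T. c t + (\<Sum>j\<in>insert i I. b t j (x j))) \<partial>PiM (insert i I) \<mu>)"
  proof -
    have "integrable (PiM (insert i I) \<mu>) (\<lambda>x. MAX t\<in>T. c t + (\<Sum>j\<in>insert i I. b t j (x j)))"
      using insert.prems(2) by (intro integrable_Max_real T integrable_sum_components)
    from integral_insert_rev(1)[OF insert.hyps this] show ?thesis
      unfolding S.L_def v_def using insert.hyps
      by (auto intro!: Bochner_Integration.integral_cong arg_cong[where f = Max] image_cong sum.cong)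
  qed
  finally show ?case .
qed

end

section \<open>The exponential inequality for bounded odd functions\<close>

context symmetric_law
begin

text \<open>
  For a signed part the two-point inequality produces \<open>a + 2 a\<^sup>2\<close>, whose average over the sign is
  nonnegative and small, so that \<open>exp y \<le> 1 + 2 y\<close> can be integrated in \<open>x\<close>.
\<close>
lemma exp_signed:
  fixes a :: "'t \<Rightarrow> real \<Rightarrow> real"
  assumes "sup_functional Q T v"
    and a [measurable]: "\<And>t. t \<in> T \<Longrightarrow> a t \<in> borel_measurable borel"
    and odd: "\<And>t x. t \<in> T \<Longrightarrow> a t (- x) = - a t x"
    and bnd: "\<And>t x. t \<in> T \<Longrightarrow> \<bar>a t x\<bar> \<le> 1 / 2"
  shows "(\<integral>\<^sup>+x. exp (sup_functional.L Q T v (\<lambda>t. a t x - \<pi> t)) \<partial>\<mu>)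
    \<le> exp (\<integral>x. sup_functional.L Q T v (\<lambda>t. 2 * a t x + 4 * (a t x)\<^sup>2 - \<pi> t) \<partial>\<mu>)"
proof -
  interpret S: sup_functional Q T v by fact
  define \<rho> where "\<rho> s x = (S.L (\<lambda>t. s * (a t x + 2 * (a t x)\<^sup>2) - \<pi> t)
      + S.L (\<lambda>t. s * (- a t x + 2 * (a t x)\<^sup>2) - \<pi> t)) / 2" for s x :: real
  have \<rho>0: "\<rho> 0 x = S.L (\<lambda>t. - \<pi> t)" for x unfolding \<rho>_def by simp
  have a_int: "integrable \<mu> (a t)" if "t \<in> T" for t
    using that bnd[OF that] by (intro integrable_const_bound[where B = "1/2"]) auto
  have a2_int: "integrable \<mu> (\<lambda>x. (a t x)\<^sup>2)" if "t \<in> T" for t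
  proof (intro integrable_const_bound[where B = "1/4"] always_eventually allI)
    fix x have "\<bar>a t x\<bar>\<^sup>2 \<le> (1/2)\<^sup>2" using bnd[OF that, of x] by (intro power_mono) auto
    then show "norm ((a t x)\<^sup>2) \<le> 1 / 4" by (simp add: power2_eq_square)
  qed (use that in simp)
  have intL: "integrable \<mu> (\<lambda>x. S.L (\<lambda>t. s * (r * a t x + 2 * (a t x)\<^sup>2) - \<pi> t))" for s r :: real
    by (intro S.L_integrable prob_space_axioms) (simp add: a_int a2_int)
  have \<rho>_int: "integrable \<mu> (\<rho> s)" for s
    unfolding \<rho>_def using intL[of s 1] intL[of s "-1"] by simp
  \<comment> \<open>Convexity in the scale: passing from scale 2 to scale 1 halves the increment
    over \<open>\<rho> 0\<close>. The factor 2 in \<open>exp y \<le> 1 + 2 * y\<close> restores it,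
    so that exactly \<open>\<rho> 2\<close> remains in the final exponent.\<close>
  have mid: "\<rho> 1 x \<le> \<rho> 0 x + (\<rho> 2 x - \<rho> 0 x) / 2" for x
  proof -
    have "S.L (\<lambda>t. a t x + 2 * (a t x)\<^sup>2 - \<pi> t)
       \<le> (S.L (\<lambda>t. - \<pi> t) + S.L (\<lambda>t. 2 * (a t x + 2 * (a t x)\<^sup>2) - \<pi> t)) / 2"
      by (rule S.L_average) (simp add: field_simps)
    moreover have "S.L (\<lambda>t. - a t x + 2 * (a t x)\<^sup>2 - \<pi> t)
       \<le> (S.L (\<lambda>t. - \<pi> t) + S.L (\<lambda>t. 2 * (- a t x + 2 * (a t x)\<^sup>2) - \<pi> t)) / 2"
      by (rule S.L_average) (simp add: field_simps)
    ultimately show ?thesis unfolding \<rho>0 unfolding \<rho>_def by (simp add: field_simps)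
  qed
  have lower: "\<rho> 0 x \<le> \<rho> 2 x" for x
  proof -
    have "\<rho> 0 x \<le> S.L (\<lambda>t. 4 * (a t x)\<^sup>2 - \<pi> t)" unfolding \<rho>0 by (intro S.L_mono) simp
    also have "\<dots> \<le> \<rho> 2 x"
      unfolding \<rho>_def by (rule S.L_average) (simp add: field_simps)
    finally show ?thesis .
  qed
  \<comment> \<open>The bound 2 becomes 1 after halving, which is the range of
    \<open>exp_le_1_plus_2x\<close>. It comes from \<open>\<bar>a t x\<bar> \<le> 1 / 2\<close>, by
    which both \<open>r * a t x\<close> and \<open>2 * (a t x)\<^sup>2\<close> are at most
    \<open>1 / 2\<close>.\<close>
  have upper: "\<rho> 2 x - \<rho> 0 x \<le> 2" for x
  proof -
    have sq: "(a t x)\<^sup>2 \<le> 1/4" if "t \<in> T" for t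
      using power_mono[of "\<bar>a t x\<bar>" "1/2" 2] bnd[OF that, of x] by (simp add: power2_eq_square)
    have "S.L (\<lambda>t. 2 * (r * a t x + 2 * (a t x)\<^sup>2) - \<pi> t) \<le> S.L (\<lambda>t. - \<pi> t + 2)" if "\<bar>r\<bar> \<le> 1" for r :: real
    proof (rule S.L_mono)
      fix t assume t: "t \<in> T"
      have "r * a t x \<le> \<bar>r\<bar> * \<bar>a t x\<bar>" by (simp flip: abs_mult)
      also have "\<dots> \<le> 1 * (1/2)" using bnd[OF t, of x] that by (intro mult_mono) auto
      finally show "2 * (r * a t x + 2 * (a t x)\<^sup>2) - \<pi> t \<le> - \<pi> t + 2" using sq[OF t] by simp
    qed
    from this[of 1] this[of "-1"] show ?thesis
      unfolding \<rho>0 unfolding \<rho>_def S.L_add_const by (simp add: field_simps)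
  qed
  have two: "(exp (S.L (\<lambda>t. a t x - \<pi> t)) + exp (S.L (\<lambda>t. - a t x - \<pi> t))) / 2 \<le> exp (\<rho> 1 x)" for x
  proof -
    \<comment> \<open>The base point is raised by \<open>2 * (a t x)\<^sup>2\<close> in advance, so
      that the penalty in \<open>two_point\<close> cancels on the left and appears as a gain on the
      right.\<close>
    have "S.L (\<lambda>t. 2 * (a t x)\<^sup>2 - \<pi> t + a t x - 2 * (a t x)\<^sup>2) = S.L (\<lambda>t. a t x - \<pi> t)"
      "S.L (\<lambda>t. 2 * (a t x)\<^sup>2 - \<pi> t - a t x - 2 * (a t x)\<^sup>2) = S.L (\<lambda>t. - a t x - \<pi> t)"
      "S.L (\<lambda>t. 2 * (a t x)\<^sup>2 - \<pi> t + a t x) = S.L (\<lambda>t. 1 * (a t x + 2 * (a t x)\<^sup>2) - \<pi> t)"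
      "S.L (\<lambda>t. 2 * (a t x)\<^sup>2 - \<pi> t - a t x) = S.L (\<lambda>t. 1 * (- a t x + 2 * (a t x)\<^sup>2) - \<pi> t)"
      by (rule S.L_cong; simp)+
    with S.two_point[of "\<lambda>t. 2 * (a t x)\<^sup>2 - \<pi> t" "\<lambda>t. a t x"] show ?thesis
      unfolding \<rho>_def by simp
  qed
  have [measurable]: "(\<lambda>x. S.L (\<lambda>t. a t x - \<pi> t)) \<in> borel_measurable borel"
    "(\<lambda>x. S.L (\<lambda>t. - a t x - \<pi> t)) \<in> borel_measurable borel" by measurable
  have swap: "(\<integral>\<^sup>+x. exp (S.L (\<lambda>t. - a t x - \<pi> t)) \<partial>\<mu>) = (\<integral>\<^sup>+x. exp (S.L (\<lambda>t. a t x - \<pi> t)) \<partial>\<mu>)"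
  proof -
    have "S.L (\<lambda>t. - a t x - \<pi> t) = S.L (\<lambda>t. a t (- x) - \<pi> t)" for x
      by (rule S.L_cong) (simp add: odd)
    then show ?thesis
      using nn_integral_uminus[of "\<lambda>x. ennreal (exp (S.L (\<lambda>t. a t x - \<pi> t)))"] by simp
  qed
  have "(\<integral>\<^sup>+x. exp (S.L (\<lambda>t. a t x - \<pi> t)) \<partial>\<mu>)
      = ((\<integral>\<^sup>+x. exp (S.L (\<lambda>t. a t x - \<pi> t)) \<partial>\<mu>) + (\<integral>\<^sup>+x. exp (S.L (\<lambda>t. - a t x - \<pi> t)) \<partial>\<mu>)) / 2"
    unfolding swap by (simp add: ennreal_divide_times mult_2_right[symmetric] ennreal_mult_divide_eq flip: mult_2)
  also have "\<dots> = (\<integral>\<^sup>+x. (ennreal (exp (S.L (\<lambda>t. a t x - \<pi> t))) + exp (S.L (\<lambda>t. - a t x - \<pi> t))) / 2 \<partial>\<mu>)"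
    by (subst nn_integral_add[symmetric]) (auto simp: nn_integral_divide)
  also have "\<dots> \<le> (\<integral>\<^sup>+x. exp (\<rho> 1 x) \<partial>\<mu>)"
  proof (rule nn_integral_mono)
    fix x
    have "(ennreal (exp (S.L (\<lambda>t. a t x - \<pi> t))) + exp (S.L (\<lambda>t. - a t x - \<pi> t))) / 2
      = ennreal ((exp (S.L (\<lambda>t. a t x - \<pi> t)) + exp (S.L (\<lambda>t. - a t x - \<pi> t))) / 2)"
      by (simp add: ennreal_plus[symmetric] divide_ennreal[symmetric] del: ennreal_plus)
    also have "\<dots> \<le> exp (\<rho> 1 x)" using two[of x] by simp
    finally show "(ennreal (exp (S.L (\<lambda>t. a t x - \<pi> t))) + exp (S.L (\<lambda>t. - a t x - \<pi> t))) / 2 \<le> exp (\<rho> 1 x)" .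
  qed
  also have "\<dots> \<le> (\<integral>\<^sup>+x. exp (S.L (\<lambda>t. - \<pi> t)) * (1 + (\<rho> 2 x - \<rho> 0 x)) \<partial>\<mu>)"
  proof (intro nn_integral_mono ennreal_leI)
    fix x
    have "exp (\<rho> 1 x) \<le> exp (\<rho> 0 x) * exp ((\<rho> 2 x - \<rho> 0 x) / 2)"
      using mid[of x] by (simp flip: exp_add)
    also have "\<dots> \<le> exp (\<rho> 0 x) * (1 + 2 * ((\<rho> 2 x - \<rho> 0 x) / 2))"
      using lower[of x] upper[of x] by (intro mult_left_mono exp_le_1_plus_2x) auto
    also have "2 * ((\<rho> 2 x - \<rho> 0 x) / 2) = \<rho> 2 x - \<rho> 0 x" by (simp only: field_sum_of_halves mult_2)
    finally show "exp (\<rho> 1 x) \<le> exp (S.L (\<lambda>t. - \<pi> t)) * (1 + (\<rho> 2 x - \<rho> 0 x))"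
      unfolding \<rho>0 .
  qed
  also have "\<dots> = (\<integral>x. exp (S.L (\<lambda>t. - \<pi> t)) * (1 + (\<rho> 2 x - \<rho> 0 x)) \<partial>\<mu>)"
    using lower \<rho>_int[of 2] \<rho>_int[of 0]
    by (intro nn_integral_eq_integral) (auto intro!: always_eventually mult_nonneg_nonneg add_nonneg_nonneg)
  also have "\<dots> = exp (S.L (\<lambda>t. - \<pi> t)) * (1 + ((\<integral>x. \<rho> 2 x \<partial>\<mu>) - S.L (\<lambda>t. - \<pi> t)))"
    using \<rho>_int[of 2] by (simp add: \<rho>0)
  also have "\<dots> \<le> exp (S.L (\<lambda>t. - \<pi> t)) * exp ((\<integral>x. \<rho> 2 x \<partial>\<mu>) - S.L (\<lambda>t. - \<pi> t))"
    by (intro ennreal_leI mult_left_mono exp_ge_add_one_self) simp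
  also have "\<dots> = exp (\<integral>x. \<rho> 2 x \<partial>\<mu>)" by (simp flip: exp_add)
  also have "(\<integral>x. \<rho> 2 x \<partial>\<mu>) = (\<integral>x. S.L (\<lambda>t. 2 * a t x + 4 * (a t x)\<^sup>2 - \<pi> t) \<partial>\<mu>)"
  proof -
    define g where "g x = S.L (\<lambda>t. 2 * a t x + 4 * (a t x)\<^sup>2 - \<pi> t)" for x
    have [measurable]: "g \<in> borel_measurable borel" unfolding g_def by measurable
    have g: "integrable \<mu> g" using intL[of 2 1] by (simp add: g_def[abs_def] algebra_simps)
    have "S.L (\<lambda>t. 2 * (- a t x + 2 * (a t x)\<^sup>2) - \<pi> t) = g (- x)" for x
      unfolding g_def by (rule S.L_cong) (simp add: odd)
    then have "\<rho> 2 x = (g x + g (- x)) / 2" for x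
      unfolding \<rho>_def g_def by (simp add: algebra_simps)
    then have "(\<integral>x. \<rho> 2 x \<partial>\<mu>) = (\<integral>x. (g x + g (- x)) / 2 \<partial>\<mu>)" by (simp only:)
    then show ?thesis
      using g integrable_uminus[OF g] integral_uminus[of g] by (simp add: g_def[symmetric])
  qed
  finally show ?thesis .
qed

end

lemma (in prob_space) integral_affine_two:
  fixes f g :: "'a \<Rightarrow> real"
  assumes "integrable M f" "integrable M g"
  shows "(\<integral>x. a + (b * f x + c * g x) \<partial>M) = a + (b * (\<integral>x. f x \<partial>M) + c * (\<integral>x. g x \<partial>M))"
  using assms by (simp add: prob_space)

subsection \<open>Laws with regular moments\<close>

text \<open>The hypothesis \<open>regular\<close> is the comparison of the norms of orders
  \<open>2 * r\<close> and \<open>r\<close>, raised to the power \<open>2 * r\<close>; in this form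
  it is an inequality between finite real integrals.\<close>

locale regular_law = symmetric_law \<mu> for \<mu> :: "real measure" +
  fixes \<alpha> :: real
  assumes \<alpha>_ge_1: "1 \<le> \<alpha>"
    and moments: "\<And>r. 1 \<le> r \<Longrightarrow> integrable \<mu> (\<lambda>x. \<bar>x\<bar> powr r)"
    and regular: "\<And>r. 2 \<le> r \<Longrightarrow>
      (\<integral>x. \<bar>x\<bar> powr (2 * r) \<partial>\<mu>) \<le> \<alpha> powr (2 * r) * (\<integral>x. \<bar>x\<bar> powr r \<partial>\<mu>)\<^sup>2"
begin

definition h :: "real \<Rightarrow> real"
  where "h r = (\<integral>x. \<bar>x\<bar> powr r \<partial>\<mu>) powr (1 / r)"

lemma H_nonneg [simp]: "0 \<le> (\<integral>x. \<bar>x\<bar> powr r \<partial>\<mu>)"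
  by (rule Bochner_Integration.integral_nonneg) simp

lemma h_nonneg [simp]: "0 \<le> h r"
  unfolding h_def by simp

lemma h_powr: "0 < r \<Longrightarrow> h r powr r = (\<integral>x. \<bar>x\<bar> powr r \<partial>\<mu>)"
  unfolding h_def by (simp add: powr_powr)

lemma integrable_id: "integrable \<mu> (\<lambda>x. x)"
proof -
  have "integrable \<mu> (\<lambda>x. \<bar>x\<bar>)" using moments[of 1] by simp
  then show ?thesis by (subst integrable_abs_iff[symmetric]) simp_all
qed

lemma integrable_indicator_borel:
  "S \<in> sets borel \<Longrightarrow> integrable \<mu> (indicator S :: real \<Rightarrow> real)"
  by (intro integrable_real_indicator) (auto simp: sets_law less_top[symmetric])

text \<open>Lyapunov's inequality. Young's inequality with the constant 1 as second factor bounds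
  \<open>\<bar>x\<bar> powr r\<close>, normalized by \<open>h s\<close>, by an affine function of
  \<open>\<bar>x\<bar> powr s\<close>; integration gives the claim.\<close>

lemma h_mono:
  assumes "1 \<le> r" "r \<le> s"
  shows "h r \<le> h s"
proof (cases "h s = 0")
  case True
  then have "(\<integral>x. \<bar>x\<bar> powr s \<partial>\<mu>) = 0" unfolding h_def using assms by simp
  then have "AE x in \<mu>. \<bar>x\<bar> powr s = 0"
    using moments[of s] assms by (subst (asm) integral_nonneg_eq_0_iff_AE) auto
  then have "AE x in \<mu>. \<bar>x\<bar> powr r = 0" by eventually_elim simp
  then have "(\<integral>x. \<bar>x\<bar> powr r \<partial>\<mu>) = 0" by (rule integral_eq_zero_AE)
  then show ?thesis unfolding h_def using assms by simp
next
  case False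
  then have hs: "0 < h s" using h_nonneg[of s] by linarith
  have pt: "\<bar>x\<bar> powr r \<le> h s powr r * (r / s * (\<bar>x\<bar> powr s / h s powr s) + (1 - r / s))" for x
  proof (cases "x = 0")
    case True
    then show ?thesis using assms by simp
  next
    case False
    have "(\<bar>x\<bar> / h s) powr r = ((\<bar>x\<bar> / h s) powr s) powr (r / s) * 1 powr (1 - r / s)"
    proof -
      have "s * (r / s) = r" using assms by simp
      then show ?thesis by (simp only: powr_powr powr_one_eq_one mult_1_right)
    qed
    also have "\<dots> \<le> r / s * (\<bar>x\<bar> / h s) powr s + (1 - r / s) * 1"
      using assms False hs by (intro Youngs_inequality_0) auto
    also have "(\<bar>x\<bar> / h s) powr s = \<bar>x\<bar> powr s / h s powr s" using hs by (simp add: powr_divide)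
    finally have "\<bar>x\<bar> powr r / h s powr r \<le> r / s * (\<bar>x\<bar> powr s / h s powr s) + (1 - r / s)"
      using hs by (simp add: powr_divide)
    then show ?thesis using hs by (simp add: divide_le_eq mult.commute)
  qed
  have "h r powr r = (\<integral>x. \<bar>x\<bar> powr r \<partial>\<mu>)" using assms by (simp add: h_powr)
  also have "\<dots> \<le> (\<integral>x. h s powr r * (r / s * (\<bar>x\<bar> powr s / h s powr s) + (1 - r / s)) \<partial>\<mu>)"
    using assms moments by (intro integral_mono pt) auto
  also have "\<dots> = h s powr r * (r / s * (h s powr s / h s powr s) + (1 - r / s))"
    using assms moments[of s] by (simp add: h_powr[symmetric])
  also have "\<dots> = h s powr r" using hs by simp
  finally have le: "h r powr r \<le> h s powr r" .
  show ?thesis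
  proof (rule ccontr)
    assume "\<not> h r \<le> h s"
    then have "h s powr r < h r powr r" using assms by (intro powr_less_mono2) auto
    with le show False by simp
  qed
qed

lemma h_double:
  assumes "2 \<le> r"
  shows "h (2 * r) \<le> \<alpha> * h r"
proof -
  have "h (2 * r) \<le> (\<alpha> powr (2 * r) * (\<integral>x. \<bar>x\<bar> powr r \<partial>\<mu>)\<^sup>2) powr (1 / (2 * r))"
    unfolding h_def using assms by (intro powr_mono2 regular) auto
  also have "\<dots> = \<alpha> * ((\<integral>x. \<bar>x\<bar> powr r \<partial>\<mu>) powr 2) powr (1 / (2 * r))"
    using assms \<alpha>_ge_1 by (simp add: powr_mult powr_powr)
  also have "\<dots> = \<alpha> * h r" unfolding h_def powr_powr using assms by simp
  finally show ?thesis .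
qed

text \<open>Markov's inequality of order \<open>r\<close>. The event is strict so that the bound
  survives \<open>h r = 0\<close>, where the variable vanishes almost surely.\<close>

lemma tail_upper:
  assumes "1 \<le> r" "0 < A"
  shows "prob {x. A * h r < \<bar>x\<bar>} \<le> A powr (- r)"
proof (cases "h r = 0")
  case True
  then have "(\<integral>x. \<bar>x\<bar> powr r \<partial>\<mu>) = 0" unfolding h_def using assms by simp
  then have "AE x in \<mu>. \<bar>x\<bar> powr r = 0"
    using moments[of r] assms by (subst (asm) integral_nonneg_eq_0_iff_AE) auto
  then have "AE x in \<mu>. \<not> A * h r < \<bar>x\<bar>" by eventually_elim (simp add: True)
  then have "prob {x \<in> space \<mu>. A * h r < \<bar>x\<bar>} = 0" by (subst prob_eq_0) auto
  then show ?thesis by simp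
next
  case False
  then have "0 < h r" using h_nonneg[of r] by linarith
  then have pos: "0 < A * h r" using assms by simp
  have "(A * h r) powr r * prob {x. A * h r < \<bar>x\<bar>} = (\<integral>x. (A * h r) powr r * indicator {x. A * h r < \<bar>x\<bar>} x \<partial>\<mu>)"
    by simp
  also have "\<dots> \<le> (\<integral>x. \<bar>x\<bar> powr r \<partial>\<mu>)"
  proof (rule integral_mono)
    show "integrable \<mu> (\<lambda>x. (A * h r) powr r * indicator {x. A * h r < \<bar>x\<bar>} x)"
      by (intro integrable_mult_right integrable_indicator_borel) measurable
  qed (use assms pos moments[of r] in \<open>auto simp: indicator_def intro!: powr_mono2\<close>)
  also have "\<dots> = h r powr r" using assms by (simp add: h_powr)
  finally have "A powr r * h r powr r * prob {x. A * h r < \<bar>x\<bar>} \<le> h r powr r"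
    using assms by (simp add: powr_mult)
  moreover have "0 < h r powr r" using False by simp
  ultimately have "A powr r * prob {x. A * h r < \<bar>x\<bar>} \<le> 1"
    by (metis mult.assoc mult.commute mult_le_cancel_left_pos mult.right_neutral)
  then show ?thesis using assms by (simp add: powr_minus field_simps)
qed

text \<open>The Paley-Zygmund inequality for \<open>\<bar>x\<bar> powr r\<close>.\<close>
lemma tail_lower:
  assumes "2 \<le> r"
  shows "\<alpha> powr (- 2 * r) / 2 \<le> prob {x. h r / 2 \<le> \<bar>x\<bar>}"
proof (cases "h r = 0")
  case True
  have "\<alpha> powr (- 2 * r) \<le> 1" using \<alpha>_ge_1 assms by (simp add: powr_le_one_le ge_one_powr_ge_zero powr_minus inverse_le_1_iff)
  then show ?thesis using True by simp
next
  case False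
  then have hr: "0 < h r" using h_nonneg[of r] by linarith
  define P where "P = prob {x. h r / 2 \<le> \<bar>x\<bar>}"
  define H where "H = (\<integral>x. \<bar>x\<bar> powr r \<partial>\<mu>)"
  have H: "H = h r powr r" "0 < H" using assms hr by (auto simp: H_def h_powr[symmetric])
  \<comment> \<open>Small values use up \<open>H / 4\<close>. This weight gives
    \<open>3 / 8 * H\<close>, half of what is left, to the moment of order \<open>2 * r\<close>, and
    the other half must come from the event.\<close>
  define \<theta> where "\<theta> = 3 / (4 * (\<alpha> powr (2 * r) * H))"
  have apos: "0 < \<alpha> powr (2 * r)" using \<alpha>_ge_1 by simp
  then have \<theta>: "0 < \<theta>" using H by (simp add: \<theta>_def)
  have half: "(h r / 2) powr r \<le> H / 4"
  proof -
    have "(1/2 :: real) powr r \<le> (1/2) powr 2" using assms by (intro powr_mono') auto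
    then have "(1/2 :: real) powr r \<le> 1 / 4" by (simp add: power2_eq_square)
    then have "h r powr r * (1/2) powr r \<le> h r powr r * (1 / 4)" by (intro mult_left_mono) auto
    moreover have "(h r / 2) powr r = h r powr r * (1/2) powr r"
      using powr_mult[of "h r" "1/2" r] by simp
    ultimately show ?thesis unfolding H(1) by linarith
  qed
  have pt: "\<bar>x\<bar> powr r \<le> H / 4 + (\<theta> / 2 * \<bar>x\<bar> powr (2 * r) + 1 / (2 * \<theta>) * indicator {x. h r / 2 \<le> \<bar>x\<bar>} x)" for x
  proof (cases "h r / 2 \<le> \<bar>x\<bar>")
    case True
    have "0 \<le> (\<theta> * \<bar>x\<bar> powr r - 1)\<^sup>2" by simp
    then have "2 * \<theta> * \<bar>x\<bar> powr r \<le> \<theta> * (\<theta> * \<bar>x\<bar> powr (2 * r)) + 1"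
      by (simp add: power2_eq_square algebra_simps powr_add[symmetric])
    then have "\<bar>x\<bar> powr r \<le> \<theta> / 2 * \<bar>x\<bar> powr (2 * r) + 1 / (2 * \<theta>)"
      using \<theta> by (simp add: field_simps)
    moreover have ind: "indicator {x. h r / 2 \<le> \<bar>x\<bar>} x = (1 :: real)" using True by simp
    ultimately show ?thesis unfolding ind using H(2) by linarith
  next
    case False
    then have "\<bar>x\<bar> powr r \<le> (h r / 2) powr r" using assms by (intro powr_mono2) auto
    then show ?thesis using half False \<theta> by (simp add: add_increasing2)
  qed
  have i2: "integrable \<mu> (\<lambda>x. \<bar>x\<bar> powr (2 * r))" using assms by (intro moments) simp
  have "H \<le> (\<integral>x. H / 4 + (\<theta> / 2 * \<bar>x\<bar> powr (2 * r) + 1 / (2 * \<theta>) * indicator {x. h r / 2 \<le> \<bar>x\<bar>} x) \<partial>\<mu>)"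
  proof -
    have "integrable \<mu> (\<lambda>x. H / 4 + (\<theta> / 2 * \<bar>x\<bar> powr (2 * r) + 1 / (2 * \<theta>) * indicator {x. h r / 2 \<le> \<bar>x\<bar>} x))"
      by (intro Bochner_Integration.integrable_add integrable_mult_right i2 integrable_indicator_borel) auto
    then have "(\<integral>x. \<bar>x\<bar> powr r \<partial>\<mu>) \<le> (\<integral>x. H / 4 + (\<theta> / 2 * \<bar>x\<bar> powr (2 * r) + 1 / (2 * \<theta>) * indicator {x. h r / 2 \<le> \<bar>x\<bar>} x) \<partial>\<mu>)"
      using assms moments[of r] by (intro integral_mono pt) auto
    then show ?thesis by (simp add: H_def)
  qed
  also have "\<dots> = H / 4 + (\<theta> / 2 * (\<integral>x. \<bar>x\<bar> powr (2 * r) \<partial>\<mu>) + 1 / (2 * \<theta>) * P)"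
  proof -
    have i: "integrable \<mu> (indicator {x. h r / 2 \<le> \<bar>x\<bar>} :: real \<Rightarrow> real)"
      by (rule integrable_indicator_borel) measurable
    have P: "(\<integral>x. indicator {x. h r / 2 \<le> \<bar>x\<bar>} x \<partial>\<mu>) = P" unfolding P_def by simp
    show ?thesis by (subst integral_affine_two[OF i2 i]) (simp only: P)
  qed
  also have "\<dots> \<le> H / 4 + (\<theta> / 2 * (\<alpha> powr (2 * r) * H\<^sup>2) + 1 / (2 * \<theta>) * P)"
  proof -
    have "\<theta> / 2 * (\<integral>x. \<bar>x\<bar> powr (2 * r) \<partial>\<mu>) \<le> \<theta> / 2 * (\<alpha> powr (2 * r) * H\<^sup>2)"
      using \<theta> by (intro mult_left_mono regular[OF assms, folded H_def]) simp
    then show ?thesis by linarith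
  qed
  also have "\<theta> / 2 * (\<alpha> powr (2 * r) * H\<^sup>2) = 3 / 8 * H"
    using H(2) apos unfolding \<theta>_def power2_eq_square by (simp add: field_simps)
  also have "1 / (2 * \<theta>) = 2 / 3 * \<alpha> powr (2 * r) * H"
    using H(2) apos unfolding \<theta>_def by (simp add: field_simps)
  finally have "3 / 8 * H \<le> 2 / 3 * \<alpha> powr (2 * r) * H * P" by simp
  then have "3 / 8 * H \<le> (2 / 3 * \<alpha> powr (2 * r) * P) * H" by (simp only: ac_simps)
  then have "3 / 8 \<le> 2 / 3 * \<alpha> powr (2 * r) * P" using H by (simp only: mult_le_cancel_right_pos)
  then show ?thesis unfolding P_def using apos by (simp add: powr_minus field_simps)
qed

lemma lower_tail_scaled:
  assumes "2 \<le> r"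
  shows "\<alpha> powr (- 2 * r) / 4 \<le> prob {x. \<bar>\<theta>\<bar> * h r / 2 \<le> \<theta> * x}"
proof -
  let ?E = "\<lambda>s. {x. \<bar>\<theta>\<bar> * h r / 2 \<le> s * \<theta> * x}"
  have m [measurable]: "?E s \<in> sets borel" for s by measurable
  have eq: "prob (?E (-1)) = prob (?E 1)"
  proof -
    have "prob (?E 1) = measure (distr \<mu> borel uminus) (?E 1)" by (simp add: sym)
    also have "\<dots> = prob (uminus -` ?E 1 \<inter> space \<mu>)" by (rule measure_distr) auto
    finally show ?thesis by (simp add: vimage_def)
  qed
  have "\<alpha> powr (- 2 * r) / 2 \<le> prob {x. h r / 2 \<le> \<bar>x\<bar>}" by (rule tail_lower[OF assms])
  also have "\<dots> \<le> prob (?E 1 \<union> ?E (-1))"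
  proof (rule finite_measure_mono)
    show "{x. h r / 2 \<le> \<bar>x\<bar>} \<subseteq> ?E 1 \<union> ?E (-1)"
    proof
      fix x assume "x \<in> {x. h r / 2 \<le> \<bar>x\<bar>}"
      then have "\<bar>\<theta>\<bar> * (h r / 2) \<le> \<bar>\<theta>\<bar> * \<bar>x\<bar>" by (intro mult_left_mono) auto
      also have "\<dots> = \<bar>\<theta> * x\<bar>" by (simp add: abs_mult)
      finally show "x \<in> ?E 1 \<union> ?E (-1)" by (auto simp: abs_if split: if_splits)
    qed
  qed (use m in auto)
  also have "\<dots> \<le> prob (?E 1) + prob (?E (-1))"
    using m by (intro measure_Un_le) (auto simp: sets_law)
  also have "\<dots> = 2 * prob (?E 1)" using eq by simp
  finally show ?thesis by simp
qed

text \<open>Let \<open>2 * R\<close> be the first order in the dyadic sequence from \<open>p\<close>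
  at which \<open>\<tau> * h\<close> exceeds \<open>2 * B\<close>. Doubling keeps
  \<open>\<tau> * h (2 * R)\<close> below \<open>2 * B * \<alpha>\<close>, so a Markov estimate at
  order \<open>2 * R\<close> makes the left side at most \<open>\<beta> powr R\<close>. The
  Paley-Zygmund inequality at the same order makes the event on the right at least as likely. Very
  large values thus cost no more than the probability of exceeding the much smaller level
  \<open>B\<close>.\<close>

lemma large_part:
  assumes p: "2 \<le> p" and \<tau>: "0 \<le> \<tau>" and B: "1 \<le> B" and le: "\<tau> * h p \<le> 2 * B"
  defines "\<kappa> \<equiv> 16 * B\<^sup>2 * \<alpha> ^ 6"
  shows "(\<integral>x. indicator {x. \<kappa> < \<tau> * \<bar>x\<bar>} x * (2 * \<tau> * \<bar>x\<bar>) powr p \<partial>\<mu>) \<le> prob {x. B < \<tau> * \<bar>x\<bar>}"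
proof -
  have \<kappa>: "1 \<le> \<kappa>"
  proof -
    have "1 * 1 \<le> B\<^sup>2 * \<alpha> ^ 6" using B \<alpha>_ge_1 by (intro mult_mono one_le_power) auto
    then show ?thesis unfolding \<kappa>_def by simp
  qed
  define f where "f x = indicator {x. \<kappa> < \<tau> * \<bar>x\<bar>} x * (2 * \<tau> * \<bar>x\<bar>) powr p" for x :: real
  have f_int: "integrable \<mu> f"
  proof (rule Bochner_Integration.integrable_bound)
    show "integrable \<mu> (\<lambda>x. (2 * \<tau>) powr p * \<bar>x\<bar> powr p)" using moments[of p] p by simp
    show "f \<in> borel_measurable \<mu>" unfolding f_def by measurable
    show "AE x in \<mu>. norm (f x) \<le> norm ((2 * \<tau>) powr p * \<bar>x\<bar> powr p)"
      unfolding f_def using \<tau> by (intro always_eventually allI) (auto simp: indicator_def powr_mult)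
  qed
  \<comment> \<open>The constant \<open>\<kappa>\<close> is chosen so that
    \<open>2 * (2 * B * \<alpha>)\<^sup>2 / \<kappa>\<close> equals this ratio: its power
    \<open>R\<close> carries the factor \<open>\<alpha> powr (- 4 * R)\<close> of
    \<open>tail_lower\<close> at order \<open>2 * R\<close>, and the remaining
    \<open>(1 / 2) powr R\<close> pays for the division by 2 there.\<close>
  define \<beta> where "\<beta> = \<alpha> powr (-4) / 2"
  have \<beta>: "0 < \<beta>" "\<beta> \<le> 1 / 2"
    using \<alpha>_ge_1 by (auto simp: \<beta>_def powr_minus inverse_le_1_iff ge_one_powr_ge_zero)
  have est: "(\<integral>x. f x \<partial>\<mu>) \<le> \<beta> powr R" if R: "p \<le> R" "\<tau> * h (2 * R) \<le> 2 * B * \<alpha>" for R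
  proof -
    have pt: "f x \<le> 2 powr p * \<kappa> powr (p - 2 * R) * (\<tau> powr (2 * R) * \<bar>x\<bar> powr (2 * R))" for x
    proof (cases "\<kappa> < \<tau> * \<bar>x\<bar>")
      case True
      define y where "y = \<tau> * \<bar>x\<bar>"
      have y: "\<kappa> < y" using True by (simp add: y_def)
      have "y powr (p - 2 * R) \<le> \<kappa> powr (p - 2 * R)"
        using y \<kappa> R p by (intro powr_mono2') auto
      then have "y powr (2 * R) * y powr (p - 2 * R) \<le> y powr (2 * R) * \<kappa> powr (p - 2 * R)"
        by (intro mult_left_mono) auto
      then have "y powr p \<le> \<kappa> powr (p - 2 * R) * y powr (2 * R)"
        using y \<kappa> by (simp add: powr_add[symmetric] mult.commute)
      then have "2 powr p * y powr p \<le> 2 powr p * (\<kappa> powr (p - 2 * R) * y powr (2 * R))"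
        by (intro mult_left_mono) auto
      moreover have "f x = 2 powr p * y powr p"
        unfolding f_def y_def using True by (simp add: powr_mult[symmetric] mult.assoc)
      moreover have "y powr (2 * R) = \<tau> powr (2 * R) * \<bar>x\<bar> powr (2 * R)"
        unfolding y_def using \<tau> by (simp add: powr_mult)
      ultimately show ?thesis by (simp add: mult.assoc)
    qed (simp add: f_def)
    have i: "integrable \<mu> (\<lambda>x. \<bar>x\<bar> powr (2 * R))" using p R by (intro moments) simp
    have "(\<integral>x. f x \<partial>\<mu>) \<le> (\<integral>x. 2 powr p * \<kappa> powr (p - 2 * R) * (\<tau> powr (2 * R) * \<bar>x\<bar> powr (2 * R)) \<partial>\<mu>)"
      using i by (intro integral_mono f_int pt) simp
    also have "\<dots> = 2 powr p * \<kappa> powr (p - 2 * R) * (\<tau> powr (2 * R) * h (2 * R) powr (2 * R))"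
      using p R by (simp add: h_powr)
    also have "\<dots> = 2 powr p * \<kappa> powr (p - 2 * R) * (\<tau> * h (2 * R)) powr (2 * R)"
      using \<tau> by (simp add: powr_mult)
    also have "\<dots> \<le> 2 powr R * \<kappa> powr (- R) * (2 * B * \<alpha>) powr (2 * R)"
    proof -
      have "0 \<le> \<tau> * h (2 * R)" using \<tau> by simp
      then have "(\<tau> * h (2 * R)) powr (2 * R) \<le> (2 * B * \<alpha>) powr (2 * R)"
        using R p by (intro powr_mono2) auto
      moreover have "2 powr p * \<kappa> powr (p - 2 * R) \<le> 2 powr R * \<kappa> powr (- R)"
        using R \<kappa> by (intro mult_mono powr_mono) auto
      ultimately show ?thesis by - (rule mult_mono; simp)
    qed
    also have "\<dots> = (2 * (2 * B * \<alpha>)\<^sup>2 / \<kappa>) powr R"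
    proof -
      have "(2 * B * \<alpha>) powr (2 * R) = ((2 * B * \<alpha>)\<^sup>2) powr R"
        using B \<alpha>_ge_1 by (simp add: powr_powr[symmetric])
      then show ?thesis
        using B \<alpha>_ge_1 \<kappa> by (simp add: powr_mult powr_divide powr_minus_divide)
    qed
    also have "2 * (2 * B * \<alpha>)\<^sup>2 / \<kappa> = \<beta>"
      unfolding \<kappa>_def \<beta>_def using B \<alpha>_ge_1
      by (simp add: powr_minus power2_eq_square field_simps eval_nat_numeral)
    finally show ?thesis .
  qed
  have "(\<integral>x. f x \<partial>\<mu>) \<le> prob {x. B < \<tau> * \<bar>x\<bar>}"
  proof (cases "\<forall>j::nat. \<tau> * h (p * 2 ^ j) \<le> 2 * B")
    case True
    \<comment> \<open>If no norm along the sequence exceeds \<open>2 * B\<close>, the estimate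
      \<open>est\<close> is available at arbitrarily high orders and forces the integral to be
      zero.\<close>
    have "(\<integral>x. f x \<partial>\<mu>) \<le> (1 / 2) ^ j" for j :: nat
    proof -
      have pj: "p * 1 \<le> p * 2 ^ j" using p by (intro mult_left_mono) auto
      have "\<tau> * h (2 * (p * 2 ^ j)) \<le> 2 * B * 1" using True[rule_format, of "Suc j"] by (simp add: ac_simps)
      also have "\<dots> \<le> 2 * B * \<alpha>" using B \<alpha>_ge_1 by (intro mult_left_mono) auto
      finally have "(\<integral>x. f x \<partial>\<mu>) \<le> \<beta> powr (p * 2 ^ j)" using pj by (intro est) auto
      also have "\<dots> \<le> (1/2) powr (p * 2 ^ j)" using \<beta> p by (intro powr_mono2) auto
      also have "\<dots> \<le> (1/2) powr (real j)"
      proof (rule powr_mono')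
        have "real j \<le> 2 ^ j" by (metis less_exp less_imp_le of_nat_le_iff of_nat_numeral of_nat_power)
        also have "\<dots> \<le> p * 2 ^ j" using p by simp
        finally show "real j \<le> p * 2 ^ j" .
      qed auto
      finally show ?thesis by (simp add: powr_realpow)
    qed
    then have "(\<integral>x. f x \<partial>\<mu>) \<le> 0"
      by (intro LIMSEQ_le_const[OF LIMSEQ_power_zero[of "1/2 :: real"]]) auto
    then show ?thesis using measure_nonneg order_trans by blast
  next
    case False
    then obtain j where j: "\<not> \<tau> * h (p * 2 ^ j) \<le> 2 * B" "\<And>i. i < j \<Longrightarrow> \<tau> * h (p * 2 ^ i) \<le> 2 * B"
      using exists_least_iff[of "\<lambda>j. \<not> \<tau> * h (p * 2 ^ j) \<le> 2 * B"] by auto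
    have "j \<noteq> 0" using j(1) le by (cases j) auto
    then obtain i where i: "j = Suc i" using not0_implies_Suc by blast
    define R where "R = p * 2 ^ i"
    have Rp: "p \<le> R" using p unfolding R_def by simp
    have hR: "\<tau> * h R \<le> 2 * B" using j(2)[of i] i by (simp add: R_def)
    have hR2: "2 * B < \<tau> * h (2 * R)" using j(1) i by (simp add: R_def ac_simps)
    have "\<tau> * h (2 * R) \<le> \<tau> * (\<alpha> * h R)" using \<tau> Rp p by (intro mult_left_mono h_double) auto
    also have "\<dots> = \<alpha> * (\<tau> * h R)" by simp
    also have "\<dots> \<le> \<alpha> * (2 * B)" using hR \<alpha>_ge_1 by (intro mult_left_mono) auto
    finally have "(\<integral>x. f x \<partial>\<mu>) \<le> \<beta> powr R" using Rp by (intro est) (auto simp: ac_simps)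
    also have "\<dots> = \<alpha> powr (- 4 * R) * (1 / 2) powr R"
      unfolding \<beta>_def using \<alpha>_ge_1 powr_mult[of "\<alpha> powr (-4)" "1/2" R] by (simp add: powr_powr)
    also have "\<dots> \<le> \<alpha> powr (- 4 * R) * (1 / 2) powr 1"
      using Rp p by (intro mult_left_mono powr_mono') auto
    also have "\<dots> = \<alpha> powr (- 2 * (2 * R)) / 2" by simp
    also have "\<dots> \<le> prob {x. h (2 * R) / 2 \<le> \<bar>x\<bar>}" using Rp p by (intro tail_lower) auto
    also have "\<dots> \<le> prob {x. B < \<tau> * \<bar>x\<bar>}"
    proof (rule finite_measure_mono)
      show "{x. h (2 * R) / 2 \<le> \<bar>x\<bar>} \<subseteq> {x. B < \<tau> * \<bar>x\<bar>}"
      proof safe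
        fix x :: real assume "h (2 * R) / 2 \<le> \<bar>x\<bar>"
        then have "\<tau> * (h (2 * R) / 2) \<le> \<tau> * \<bar>x\<bar>" using \<tau> by (intro mult_left_mono)
        then show "B < \<tau> * \<bar>x\<bar>" using hR2 by simp
      qed
    qed simp
    finally show ?thesis .
  qed
  then show ?thesis unfolding f_def .
qed

end

subsection \<open>Ranks and their exponential moments\<close>

text \<open>This is the summed-by-parts form of
  \<open>E exp g \<le> exp (g 0) * (1 + 2 * E (g - g 0))\<close> for a rank with tails
  \<open>\<delta> ^ Suc k\<close>: increments of at most \<open>1 / 4\<close> grow more slowly than
  the tails decay. The number \<open>1 / 12\<close> is the fixed point of
  \<open>S \<mapsto> (1 / 4) * (1 / 4 + S)\<close>. The induction removes the first step and shifts
  \<open>g\<close>.\<close>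

lemma geometric_exp_sum:
  fixes g :: "nat \<Rightarrow> real"
  assumes \<delta>: "0 \<le> \<delta>" "\<delta> \<le> 1 / 4"
    and g: "\<And>k. g k \<le> g (Suc k)" "\<And>k. g (Suc k) - g k \<le> 1 / 4"
  shows "(\<Sum>k<N. \<delta> ^ Suc k * (g (Suc k) - g k)) \<le> 1 / 12"
    and "(\<Sum>k<N. \<delta> ^ Suc k * (exp (g (Suc k)) - exp (g k)))
       \<le> 2 * exp (g 0) * (\<Sum>k<N. \<delta> ^ Suc k * (g (Suc k) - g k))"
  using g
proof (induction N arbitrary: g)
  case 0
  { case 1 then show ?case by simp next case 2 then show ?case by simp }
next
  case (Suc N)
  have shift: "(\<Sum>k<Suc N. \<delta> ^ Suc k * f k) = \<delta> * (f 0 + (\<Sum>k<N. \<delta> ^ Suc k * f (Suc k)))"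
    for f :: "nat \<Rightarrow> real"
    by (subst sum.lessThan_Suc_shift) (simp add: sum_distrib_left algebra_simps)
  { case 1
    define S where "S = (\<Sum>k<N. \<delta> ^ Suc k * (g (Suc (Suc k)) - g (Suc k)))"
    have "S \<le> 1 / 12" unfolding S_def by (rule Suc.IH(1)[of "\<lambda>k. g (Suc k)"]) (rule 1)+
    then have le: "g (Suc 0) - g 0 + S \<le> 1 / 3" using 1(2)[of 0] by simp
    have "\<delta> * (g (Suc 0) - g 0 + S) \<le> \<delta> * (1 / 3)"
      using \<delta> by (intro mult_left_mono le) simp
    also have "\<dots> \<le> 1 / 12" using \<delta> by simp
    finally show ?case unfolding shift[of "\<lambda>k. g (Suc k) - g k"] S_def .
  next
    case 2
    define S where "S = (\<Sum>k<N. \<delta> ^ Suc k * (g (Suc (Suc k)) - g (Suc k)))"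
    define D where "D = g (Suc 0) - g 0"
    have D: "0 \<le> D" "D \<le> 1 / 4" using 2[of 0] unfolding D_def by simp_all
    have S: "S \<le> 1 / 12" unfolding S_def by (rule Suc.IH(1)[of "\<lambda>k. g (Suc k)"]) (rule 2)+
    have S0: "0 \<le> S" unfolding S_def using \<delta> 2(1) by (intro sum_nonneg mult_nonneg_nonneg) auto
    have IH: "(\<Sum>k<N. \<delta> ^ Suc k * (exp (g (Suc (Suc k))) - exp (g (Suc k)))) \<le> 2 * exp (g (Suc 0)) * S"
      unfolding S_def by (rule Suc.IH(2)[of "\<lambda>k. g (Suc k)"]) (rule 2)+
    have eD: "exp (g (Suc 0)) = exp (g 0) * exp D" unfolding D_def by (simp add: exp_diff)
    have "exp D \<le> 1 + D + D\<^sup>2" using D by (intro exp_bound) auto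
    moreover have "D\<^sup>2 \<le> D * (1 / 4)" unfolding power2_eq_square using D by (intro mult_left_mono) auto
    ultimately have e1: "exp D - 1 \<le> 5 / 4 * D" by simp
    have "(exp D - 1) * (1 + 2 * S) \<le> (5 / 4 * D) * (1 + 2 * (1 / 12))"
      using S S0 D e1 by (intro mult_mono) auto
    also have "\<dots> \<le> 2 * D" using D by simp
    finally have e2: "(exp D - 1) + 2 * exp D * S \<le> 2 * (D + S)" by (simp add: algebra_simps)
    have "(\<Sum>k<Suc N. \<delta> ^ Suc k * (exp (g (Suc k)) - exp (g k)))
        \<le> \<delta> * (exp (g (Suc 0)) - exp (g 0) + 2 * exp (g (Suc 0)) * S)"
      unfolding shift[of "\<lambda>k. exp (g (Suc k)) - exp (g k)"] using \<delta> IH by (intro mult_left_mono) auto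
    also have "\<dots> = \<delta> * (exp (g 0) * ((exp D - 1) + 2 * exp D * S))"
      unfolding eD by (simp add: algebra_simps)
    also have "\<dots> \<le> \<delta> * (exp (g 0) * (2 * (D + S)))"
      using \<delta> e2 by (intro mult_left_mono) auto
    also have "\<dots> = 2 * exp (g 0) * (\<delta> * (D + S))" by simp
    also have "\<delta> * (D + S) = (\<Sum>k<Suc N. \<delta> ^ Suc k * (g (Suc k) - g k))"
      unfolding shift[of "\<lambda>k. g (Suc k) - g k"] S_def D_def by simp
    finally show ?case .
  }
qed

text \<open>
  \<open>regularized u c M s\<close> is the largest function that is 1-Lipschitz upwards and below
  \<open>k \<mapsto> min (max (s * u k - c) 0) M\<close>.
\<close>
definition regularized :: "(nat \<Rightarrow> real) \<Rightarrow> real \<Rightarrow> real \<Rightarrow> real \<Rightarrow> nat \<Rightarrow> real"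
  where "regularized u c M s k = (MIN j\<in>{..k}. min (max (s * u j - c) 0) M + (real k - real j))"

locale regularization =
  fixes u :: "nat \<Rightarrow> real" and c M :: real
  assumes u_mono: "\<And>j k. j \<le> k \<Longrightarrow> u j \<le> u k" and u_nonneg: "\<And>j. 0 \<le> u j"
    and M_nonneg: "0 \<le> M"
begin

lemma regularized_le:
  "j \<le> k \<Longrightarrow> regularized u c M s k \<le> min (max (s * u j - c) 0) M + (real k - real j)"
  unfolding regularized_def by (intro Min_le) auto

lemma regularized_attained:
  obtains j where "j \<le> k" "regularized u c M s k = min (max (s * u j - c) 0) M + (real k - real j)"
proof -
  have "regularized u c M s k \<in> (\<lambda>j. min (max (s * u j - c) 0) M + (real k - real j)) ` {..k}"
    unfolding regularized_def by (intro Min_in) auto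
  then show ?thesis using that by auto
qed

lemma regularized_nonneg: "0 \<le> regularized u c M s k"
proof -
  obtain j where "j \<le> k" "regularized u c M s k = min (max (s * u j - c) 0) M + (real k - real j)"
    by (rule regularized_attained)
  then show ?thesis using M_nonneg by simp
qed

lemma regularized_zero: "regularized u c M s 0 = min (max (s * u 0 - c) 0) M"
  unfolding regularized_def by simp

lemma regularized_Suc_ge:
  assumes "0 \<le> s"
  shows "regularized u c M s k \<le> regularized u c M s (Suc k)"
proof -
  obtain j where j: "j \<le> Suc k" "regularized u c M s (Suc k) = min (max (s * u j - c) 0) M + (real (Suc k) - real j)"
    by (rule regularized_attained)
  show ?thesis
  proof (cases "j \<le> k")
    case True
    then show ?thesis using regularized_le[OF True, of s] j by simp
  next
    case False
    then have eq: "regularized u c M s (Suc k) = min (max (s * u (Suc k) - c) 0) M"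
      using j by (simp add: le_Suc_eq)
    have "s * u k \<le> s * u (Suc k)" using assms u_mono[of k "Suc k"] by (intro mult_left_mono) auto
    moreover have "regularized u c M s k \<le> min (max (s * u k - c) 0) M"
      using regularized_le[of k k s] by simp
    ultimately show ?thesis unfolding eq by linarith
  qed
qed

lemma regularized_Suc_le: "regularized u c M s (Suc k) - regularized u c M s k \<le> 1"
proof -
  obtain j where j: "j \<le> k" "regularized u c M s k = min (max (s * u j - c) 0) M + (real k - real j)"
    by (rule regularized_attained)
  then show ?thesis using regularized_le[of j "Suc k" s] by simp
qed

lemma regularized_mono: "0 \<le> s \<Longrightarrow> j \<le> k \<Longrightarrow> regularized u c M s j \<le> regularized u c M s k"
  by (rule lift_Suc_mono_le[of "regularized u c M s"]) (rule regularized_Suc_ge)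

lemma regularized_lipschitz_aux: "regularized u c M s k - regularized u c M s' k \<le> u k * \<bar>s - s'\<bar>"
proof -
  obtain j where j: "j \<le> k" "regularized u c M s' k = min (max (s' * u j - c) 0) M + (real k - real j)"
    by (rule regularized_attained)
  have "(s - s') * u j \<le> \<bar>s - s'\<bar> * u j" using u_nonneg by (intro mult_right_mono) auto
  also have "\<dots> \<le> \<bar>s - s'\<bar> * u k" using u_mono[OF j(1)] by (intro mult_left_mono) auto
  finally have *: "s * u j - s' * u j \<le> u k * \<bar>s - s'\<bar>" by (simp add: algebra_simps)
  have "0 \<le> u k * \<bar>s - s'\<bar>" using u_nonneg by simp
  with * have "min (max (s * u j - c) 0) M \<le> min (max (s' * u j - c) 0) M + u k * \<bar>s - s'\<bar>"
    by linarith
  then show ?thesis using regularized_le[OF j(1), of s] j(2) by linarith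
qed

text \<open>A minimum of functions of \<open>s\<close> whose slopes \<open>u j\<close> with
  \<open>j \<le> k\<close> are at most \<open>u k\<close>. This estimate feeds the contraction in
  \<open>centering\<close>, where \<open>s\<close> is a coefficient of the index vector.\<close>

lemma regularized_lipschitz: "\<bar>regularized u c M s k - regularized u c M s' k\<bar> \<le> u k * \<bar>s - s'\<bar>"
  using regularized_lipschitz_aux[of s k s'] regularized_lipschitz_aux[of s' k s]
  by (simp add: abs_minus_commute abs_le_iff)

text \<open>Let \<open>j\<close> attain the minimum. For \<open>k \<le> 2 * j\<close> the doubling
  bound costs a factor \<open>\<alpha>\<close>, and the threshold \<open>c = 1 / \<alpha>\<close> is
  exactly what becomes 1 after that multiplication. For \<open>k > 2 * j\<close> the linear term
  alone is at least \<open>k / 2\<close>, so regularization loses more than the factor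
  \<open>\<alpha>\<close> only where the value is large compared with the rank itself.\<close>

lemma regularized_lower:
  assumes s: "0 \<le> s" and \<alpha>: "1 \<le> \<alpha>" "c = 1 / \<alpha>"
    and double: "\<And>j k. k \<le> 2 * j \<Longrightarrow> u k \<le> \<alpha> * u j"
  shows "min (max (s * u k - 1) 0) M \<le> \<alpha> * regularized u c M s k
       \<or> \<alpha> * real k / 2 < min (max (s * u k - 1) 0) M"
proof -
  obtain j where j: "j \<le> k" "regularized u c M s k = min (max (s * u j - c) 0) M + (real k - real j)"
    by (rule regularized_attained)
  show ?thesis
  proof (cases "k \<le> 2 * j")
    case True
    have "s * u k \<le> s * (\<alpha> * u j)" using double[OF True] s by (intro mult_left_mono)
    then have "s * u k - 1 \<le> \<alpha> * (s * u j - c)" using \<alpha> by (simp add: algebra_simps)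
    also have "\<dots> \<le> \<alpha> * max (s * u j - c) 0" using \<alpha> by (intro mult_left_mono) auto
    finally have "s * u k - 1 \<le> \<alpha> * max (s * u j - c) 0" .
    moreover have "0 \<le> \<alpha> * max (s * u j - c) 0" using \<alpha> by simp
    moreover have "M \<le> \<alpha> * M" using \<alpha> M_nonneg mult_right_mono[of 1 \<alpha> M] by simp
    moreover have "\<alpha> * min (max (s * u j - c) 0) M = min (\<alpha> * max (s * u j - c) 0) (\<alpha> * M)"
      using \<alpha> by (simp add: min_mult_distrib_left)
    ultimately have "min (max (s * u k - 1) 0) M \<le> \<alpha> * min (max (s * u j - c) 0) M" by linarith
    also have "\<dots> \<le> \<alpha> * regularized u c M s k" using j \<alpha> by (intro mult_left_mono) auto
    finally show ?thesis by simp
  next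
    case False
    then have "real k / 2 \<le> real k - real j" by linarith
    also have "\<dots> \<le> regularized u c M s k" using j M_nonneg by simp
    finally have "\<alpha> * (real k / 2) \<le> \<alpha> * regularized u c M s k" using \<alpha> by (intro mult_left_mono) auto
    then show ?thesis by linarith
  qed
qed

end

section \<open>Ranks with respect to the moment norms\<close>

context regular_law
begin

text \<open>With this level Markov's inequality bounds the tails of the rank by powers of
  \<open>1 / A\<close>, and the Paley-Zygmund lower bound of order \<open>k + 2\<close> still
  exceeds \<open>(1 / A) ^ Suc k\<close>. The factor 8 also puts \<open>1 / A\<close> below the
  ratio \<open>1 / 4\<close> of \<open>geometric_exp_sum\<close>.\<close>

definition A :: real where "A = 8 * \<alpha> ^ 4"

lemma A_ge: "8 \<le> A" unfolding A_def using one_le_power[OF \<alpha>_ge_1, of 4] by simp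

text \<open>The orders start at 2, where the growth condition begins. The cutoff \<open>N\<close>
  makes every function of the rank a finite combination of indicators.\<close>

definition tail_rank :: "nat \<Rightarrow> real \<Rightarrow> nat"
  where "tail_rank N x = card {k \<in> {..<N}. A * h (real k + 2) < \<bar>x\<bar>}"

text \<open>The norms \<open>h\<close> increase with the order, so the counted indices form an
  initial segment and the rank determines them.\<close>

lemma rank_set: "{k \<in> {..<N}. A * h (real k + 2) < \<bar>x\<bar>} = {..<tail_rank N x}"
proof -
  let ?S = "{k \<in> {..<N}. A * h (real k + 2) < \<bar>x\<bar>}"
  have down: "j \<in> ?S" if "k \<in> ?S" "j \<le> k" for j k
  proof -
    have "A * h (real j + 2) \<le> A * h (real k + 2)"
      using that A_ge by (intro mult_left_mono h_mono) auto
    then show ?thesis using that by auto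
  qed
  have "\<exists>n. ?S = {..<n}"
  proof (cases "?S = {}")
    case True
    then show ?thesis by (intro exI[of _ 0]) simp
  next
    case False
    have fin: "finite ?S" by simp
    define m where "m = Max ?S"
    have m: "m \<in> ?S" unfolding m_def by (rule Max_in[OF fin False])
    have le: "k \<le> m" if "k \<in> ?S" for k unfolding m_def by (rule Max_ge[OF fin that])
    have "?S = {..<Suc m}"
    proof (rule set_eqI)
      fix k
      have "k \<in> ?S \<longleftrightarrow> k \<le> m" using le[of k] down[OF m, of k] by argo
      then show "k \<in> ?S \<longleftrightarrow> k \<in> {..<Suc m}" unfolding lessThan_iff less_Suc_eq_le .
    qed
    then show ?thesis by (rule exI)
  qed
  then obtain n where n: "?S = {..<n}" ..
  then have "tail_rank N x = n" unfolding tail_rank_def by simp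
  with n show ?thesis by simp
qed

lemma rank_iff: "k < N \<Longrightarrow> k < tail_rank N x \<longleftrightarrow> A * h (real k + 2) < \<bar>x\<bar>"
  using rank_set[of N x] by (auto simp: set_eq_iff)

lemma rank_le: "tail_rank N x \<le> N"
proof -
  have "tail_rank N x \<le> card {..<N}" unfolding tail_rank_def by (intro card_mono) auto
  then show ?thesis by simp
qed

text \<open>Telescoping along the initial segment of \<open>rank_set\<close>. Measurability and the
  integral of any function of the rank follow from this formula.\<close>

lemma fun_rank:
  fixes g :: "nat \<Rightarrow> real"
  shows "g (tail_rank N x) = g 0 + (\<Sum>k<N. (g (Suc k) - g k) * indicator {x. A * h (real k + 2) < \<bar>x\<bar>} x)"
proof -
  have "(\<Sum>k<N. (g (Suc k) - g k) * indicator {x. A * h (real k + 2) < \<bar>x\<bar>} x)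
      = (\<Sum>k<N. if k < tail_rank N x then g (Suc k) - g k else 0)"
    by (intro sum.cong) (auto simp: rank_iff indicator_def)
  also have "\<dots> = (\<Sum>k\<in>{..<N} \<inter> {k. k < tail_rank N x}. g (Suc k) - g k)"
    by (simp add: sum.If_cases)
  also have "{..<N} \<inter> {k. k < tail_rank N x} = {..<tail_rank N x}" using rank_le[of N x] by auto
  also have "(\<Sum>k<tail_rank N x. g (Suc k) - g k) = g (tail_rank N x) - g 0"
    by (rule sum_lessThan_telescope)
  finally show ?thesis by simp
qed

lemma rank_measurable: "(\<lambda>x. g (tail_rank N (c * x))) \<in> borel_measurable borel" for g :: "nat \<Rightarrow> real"
  unfolding fun_rank by measurable

lemma measurable_law: "(f :: real \<Rightarrow> real) \<in> borel_measurable borel \<Longrightarrow> f \<in> borel_measurable \<mu>"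
  using measurable_cong_sets[OF sets_law refl] by blast

lemma integral_rank:
  fixes g :: "nat \<Rightarrow> real"
  shows "integrable \<mu> (\<lambda>x. g (tail_rank N (c * x)))"
    and "(\<integral>x. g (tail_rank N (c * x)) \<partial>\<mu>)
      = g 0 + (\<Sum>k<N. (g (Suc k) - g k) * prob {x. A * h (real k + 2) < \<bar>c * x\<bar>})"
proof -
  have ind: "indicator {x. A * h (real k + 2) < \<bar>x\<bar>} (c * x) = (indicator {x. A * h (real k + 2) < \<bar>c * x\<bar>} x :: real)"
    for k x by (simp add: indicator_def)
  have i: "integrable \<mu> (indicator {x. A * h (real k + 2) < \<bar>c * x\<bar>} :: real \<Rightarrow> real)" for k
    by (rule integrable_indicator_borel) measurable
  have i': "integrable \<mu> (\<lambda>x. (g (Suc k) - g k) * indicator {x. A * h (real k + 2) < \<bar>c * x\<bar>} x)" for k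
    by (intro integrable_mult_right i)
  show "integrable \<mu> (\<lambda>x. g (tail_rank N (c * x)))"
    unfolding fun_rank ind by (intro Bochner_Integration.integrable_add Bochner_Integration.integrable_sum i') simp
  have "(\<integral>x. g (tail_rank N (c * x)) \<partial>\<mu>) = (\<integral>x. g 0 \<partial>\<mu>)
      + (\<integral>x. (\<Sum>k<N. (g (Suc k) - g k) * indicator {x. A * h (real k + 2) < \<bar>c * x\<bar>} x) \<partial>\<mu>)"
    unfolding fun_rank ind
    by (intro Bochner_Integration.integral_add Bochner_Integration.integrable_sum i') simp
  also have "(\<integral>x. (\<Sum>k<N. (g (Suc k) - g k) * indicator {x. A * h (real k + 2) < \<bar>c * x\<bar>} x) \<partial>\<mu>)
    = (\<Sum>k<N. \<integral>x. (g (Suc k) - g k) * indicator {x. A * h (real k + 2) < \<bar>c * x\<bar>} x \<partial>\<mu>)"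
    by (intro Bochner_Integration.integral_sum i')
  finally show "(\<integral>x. g (tail_rank N (c * x)) \<partial>\<mu>)
      = g 0 + (\<Sum>k<N. (g (Suc k) - g k) * prob {x. A * h (real k + 2) < \<bar>c * x\<bar>})"
    by simp
qed

text \<open>
  Up to the dilation by \<open>4 * A\<close>, the tails of \<open>tail_rank N\<close> lie on both sides of those of one geometric
  variable of ratio \<open>1 / A\<close>.
\<close>
lemma exp_rank:
  fixes g :: "nat \<Rightarrow> real"
  assumes g: "\<And>k. g k \<le> g (Suc k)" "\<And>k. g (Suc k) - g k \<le> 1 / 4"
  shows "(\<integral>x. exp (g (tail_rank N x)) \<partial>\<mu>) \<le> exp (g 0) * (1 + 2 * ((\<integral>x. g (tail_rank N (4 * A * x)) \<partial>\<mu>) - g 0))"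
proof -
  have up: "prob {x. A * h (real k + 2) < \<bar>x\<bar>} \<le> (1 / A) ^ Suc k" for k
  proof -
    have "prob {x. A * h (real k + 2) < \<bar>x\<bar>} \<le> A powr (- (real k + 2))"
      using A_ge by (intro tail_upper) auto
    also have "\<dots> \<le> A powr (- real (Suc k))" using A_ge by (intro powr_mono) auto
    also have "\<dots> = (1 / A) ^ Suc k" using A_ge by (simp add: powr_minus powr_realpow power_one_over inverse_eq_divide del: power_Suc of_nat_Suc)
    finally show ?thesis .
  qed
  show ?thesis
  \<comment> \<open>The degenerate law is set apart because \<open>tail_lower\<close> concerns a
    non-strict event and the rank counts strict inequalities; positivity of the norms is what
    bridges the two.\<close>
  proof (cases "h 2 = 0")
    case True
    then have "(\<integral>x. \<bar>x\<bar> powr 2 \<partial>\<mu>) = 0" unfolding h_def by simp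
    then have "AE x in \<mu>. \<bar>x\<bar> powr 2 = 0"
      using moments[of 2] by (subst (asm) integral_nonneg_eq_0_iff_AE) auto
    then have AE0: "AE x in \<mu>. x = 0" by eventually_elim simp
    have r0: "tail_rank N 0 = 0"
    proof -
      have "{k \<in> {..<N}. A * h (real k + 2) < \<bar>0\<bar>} = {}"
        using A_ge by (auto simp: not_less)
      then show ?thesis unfolding tail_rank_def by (simp only: card.empty)
    qed
    have "(\<integral>x. exp (g (tail_rank N x)) \<partial>\<mu>) = (\<integral>x. exp (g 0) \<partial>\<mu>)"
    proof (rule integral_cong_AE)
      show "(\<lambda>x. exp (g (tail_rank N x))) \<in> borel_measurable \<mu>"
        using measurable_law[OF rank_measurable[of "\<lambda>k. exp (g k)" N 1]] by (simp only: mult_1)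
      show "AE x in \<mu>. exp (g (tail_rank N x)) = exp (g 0)" using AE0 by eventually_elim (simp only: r0)
      show "(\<lambda>x. exp (g 0)) \<in> borel_measurable \<mu>" by (rule measurable_const) simp
    qed
    moreover have "(\<integral>x. g (tail_rank N (4 * A * x)) \<partial>\<mu>) = (\<integral>x. g 0 \<partial>\<mu>)"
    proof (rule integral_cong_AE)
      show "AE x in \<mu>. g (tail_rank N (4 * A * x)) = g 0" using AE0 by eventually_elim (simp only: r0 mult_zero_right)
      show "(\<lambda>x. g (tail_rank N (4 * A * x))) \<in> borel_measurable \<mu>" by (rule measurable_law[OF rank_measurable])
      show "(\<lambda>x. g 0) \<in> borel_measurable \<mu>" by (rule measurable_const) simp
    qed
    ultimately show ?thesis by simp
  next
    case False
    then have h2: "0 < h 2" using h_nonneg[of 2] by linarith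
    have low: "(1 / A) ^ Suc k \<le> prob {x. A * h (real k + 2) < \<bar>4 * A * x\<bar>}" for k
    proof -
      have hk: "0 < h (real k + 2)" using h_mono[of 2 "real k + 2"] h2 by simp
      have "(1 / A) ^ Suc k = (1 / 8) ^ Suc k * (1 / \<alpha> ^ 4) ^ Suc k"
        unfolding A_def by (simp add: power_divide power_mult_distrib del: power_Suc)
      also have "\<dots> \<le> 1 / 2 * (1 / \<alpha> ^ 4) ^ Suc k"
      proof (rule mult_right_mono)
        have "(1 / 8 :: real) ^ Suc k \<le> (1 / 8) ^ 1" by (intro power_decreasing) auto
        then show "(1 / 8 :: real) ^ Suc k \<le> 1 / 2" by simp
      qed (use \<alpha>_ge_1 in simp)
      also have "(1 / \<alpha> ^ 4) ^ Suc k = \<alpha> powr (- 4 * (real k + 1))"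
      proof -
        have "(1 / \<alpha> ^ 4) = \<alpha> powr (- 4)" using \<alpha>_ge_1 by (simp add: powr_minus inverse_eq_divide)
        then have "(1 / \<alpha> ^ 4) ^ Suc k = (\<alpha> powr (- 4)) powr (real (Suc k))"
          using \<alpha>_ge_1 by (subst powr_realpow) auto
        then show ?thesis by (simp add: powr_powr add.commute)
      qed
      \<comment> \<open>Here \<open>2 * (k + 2) \<le> 4 * (k + 1)\<close> is used. The common
        exponent is \<open>Suc k\<close>, so the Markov bound with exponent \<open>k + 2\<close> has
        one power to spare.\<close>
      also have "1 / 2 * \<alpha> powr (- 4 * (real k + 1)) \<le> 1 / 2 * \<alpha> powr (- 2 * (real k + 2))"
        using \<alpha>_ge_1 by (intro mult_left_mono powr_mono) auto
      also have "\<dots> = \<alpha> powr (- 2 * (real k + 2)) / 2" by simp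
      also have "\<dots> \<le> prob {x. h (real k + 2) / 2 \<le> \<bar>x\<bar>}" by (rule tail_lower) simp
      also have "\<dots> \<le> prob {x. A * h (real k + 2) < \<bar>4 * A * x\<bar>}"
      proof (rule finite_measure_mono)
        show "{x. h (real k + 2) / 2 \<le> \<bar>x\<bar>} \<subseteq> {x. A * h (real k + 2) < \<bar>4 * A * x\<bar>}"
        proof safe
          fix x assume "h (real k + 2) / 2 \<le> \<bar>x\<bar>"
          then have "h (real k + 2) < 4 * \<bar>x\<bar>" using hk by linarith
          then have "A * h (real k + 2) < A * (4 * \<bar>x\<bar>)" using A_ge by (intro mult_strict_left_mono) auto
          then show "A * h (real k + 2) < \<bar>4 * A * x\<bar>" using A_ge by (simp add: abs_mult)
        qed
      qed measurable
      finally show ?thesis .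
    qed
    have g': "exp (g k) \<le> exp (g (Suc k))" for k using g(1) by simp
    have "(\<integral>x. exp (g (tail_rank N x)) \<partial>\<mu>)
      = exp (g 0) + (\<Sum>k<N. (exp (g (Suc k)) - exp (g k)) * prob {x. A * h (real k + 2) < \<bar>x\<bar>})"
      using integral_rank(2)[of "\<lambda>k. exp (g k)" N 1] by simp
    also have "\<dots> \<le> exp (g 0) + (\<Sum>k<N. (exp (g (Suc k)) - exp (g k)) * (1 / A) ^ Suc k)"
      using g' up by (intro add_left_mono sum_mono mult_left_mono) auto
    also have "\<dots> \<le> exp (g 0) + 2 * exp (g 0) * (\<Sum>k<N. (1 / A) ^ Suc k * (g (Suc k) - g k))"
      using geometric_exp_sum(2)[of "1 / A" g N] A_ge g by (simp add: mult.commute)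
    also have "\<dots> \<le> exp (g 0) + 2 * exp (g 0) *
        (\<Sum>k<N. prob {x. A * h (real k + 2) < \<bar>4 * A * x\<bar>} * (g (Suc k) - g k))"
      using g(1) low by (intro add_left_mono mult_left_mono sum_mono mult_right_mono) auto
    also have "(\<Sum>k<N. prob {x. A * h (real k + 2) < \<bar>4 * A * x\<bar>} * (g (Suc k) - g k))
        = (\<integral>x. g (tail_rank N (4 * A * x)) \<partial>\<mu>) - g 0"
      unfolding integral_rank(2) by (simp add: mult.commute)
    finally show ?thesis by (simp add: algebra_simps)
  qed
qed

text \<open>Measured in units of \<open>b\<close>, this is the first level not exceeded by a
  variable of rank \<open>k\<close>, as long as \<open>k\<close> is below the cutoff.\<close>

definition u :: "real \<Rightarrow> nat \<Rightarrow> real" where "u b k = A * h (real k + 2) / b"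

lemma u_props:
  assumes "0 < b"
  shows "\<And>j k. j \<le> k \<Longrightarrow> u b j \<le> u b k" and "\<And>j. 0 \<le> u b j"
    and "\<And>j k. k \<le> 2 * j \<Longrightarrow> u b k \<le> \<alpha> * u b j"
proof -
  show "u b j \<le> u b k" if "j \<le> k" for j k
    unfolding u_def using that A_ge assms by (intro divide_right_mono mult_left_mono h_mono) auto
  show "0 \<le> u b j" for j unfolding u_def using A_ge assms by simp
  show "u b k \<le> \<alpha> * u b j" if "k \<le> 2 * j" for j k
  proof -
    have "h (real k + 2) \<le> h (2 * (real j + 2))" using that by (intro h_mono) auto
    also have "\<dots> \<le> \<alpha> * h (real j + 2)" by (rule h_double) simp
    finally have "A * h (real k + 2) / b \<le> A * (\<alpha> * h (real j + 2)) / b"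
      using A_ge assms by (intro divide_right_mono mult_left_mono) auto
    then show ?thesis unfolding u_def by (simp add: ac_simps)
  qed
qed

abbreviation F :: "real \<Rightarrow> real \<Rightarrow> real \<Rightarrow> nat \<Rightarrow> real"
  where "F b M s \<equiv> regularized (u b) (1 / \<alpha>) M \<bar>s\<bar>"

text \<open>The last level counted by the rank lies below \<open>4 * A * \<bar>x\<bar>\<close>, and
  a single doubling of the order reaches the next level.\<close>

lemma rank_dilated_bound:
  assumes "0 < b" "0 < tail_rank N (4 * A * x)"
  shows "u b (tail_rank N (4 * A * x)) \<le> 4 * A * \<alpha> / b * \<bar>x\<bar>"
proof -
  define k where "k = tail_rank N (4 * A * x) - 1"
  have k: "tail_rank N (4 * A * x) = Suc k" using assms unfolding k_def by simp
  then have "k < N" using rank_le[of N "4 * A * x"] by simp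
  then have "A * h (real k + 2) < \<bar>4 * A * x\<bar>" using rank_iff[of k N "4 * A * x"] k by simp
  then have "A * h (real k + 2) \<le> A * (4 * \<bar>x\<bar>)" using A_ge by (simp add: abs_mult)
  then have hx: "h (real k + 2) \<le> 4 * \<bar>x\<bar>" using A_ge by simp
  have "h (real (Suc k) + 2) \<le> h (2 * (real k + 2))" by (intro h_mono) auto
  also have "\<dots> \<le> \<alpha> * h (real k + 2)" by (rule h_double) simp
  also have "\<dots> \<le> \<alpha> * (4 * \<bar>x\<bar>)" using hx \<alpha>_ge_1 by (intro mult_left_mono) auto
  finally have "A * h (real (Suc k) + 2) / b \<le> A * (\<alpha> * (4 * \<bar>x\<bar>)) / b"
    using A_ge assms by (intro divide_right_mono mult_left_mono) auto
  then show ?thesis unfolding k u_def by (simp add: ac_simps)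
qed

text \<open>The increments of \<open>F\<close> are at most 1, hence those of \<open>K\<close> at
  most \<open>1 / 2\<close>; averaging with the value at rank 0 yields a function \<open>g\<close>
  with increments at most \<open>1 / 4\<close>, as \<open>exp_rank\<close> requires. The halving in
  \<open>g\<close> also absorbs the factor 2 of that lemma, and \<open>1 + z \<le> exp z\<close>
  closes the estimate.\<close>

lemma exp_positive:
  assumes "sup_functional Q T v" and b: "0 < b" and M: "0 \<le> M"
  shows "(\<integral>\<^sup>+x. exp (sup_functional.L Q T v (\<lambda>t. (F b M (\<theta> t) (tail_rank N x) - F b M (\<theta> t) 0) / 4 - \<pi> t)) \<partial>\<mu>)
    \<le> exp (\<integral>x. sup_functional.L Q T v (\<lambda>t. (F b M (\<theta> t) (tail_rank N (4 * A * x)) - F b M (\<theta> t) 0) / 2 - \<pi> t) \<partial>\<mu>)"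
proof -
  interpret S: sup_functional Q T v by fact
  note up = u_props(1,2)[OF b]
  interpret R: regularization "u b" "1 / \<alpha>" M by unfold_locales (use up M in auto)
  define L0 where "L0 = S.L (\<lambda>t. - \<pi> t)"
  define K where "K k = S.L (\<lambda>t. (F b M (\<theta> t) k - F b M (\<theta> t) 0) / 2 - \<pi> t)" for k
  define g where "g k = (K k + L0) / 2" for k
  have K0: "K 0 = L0" unfolding K_def L0_def by simp
  have g1: "g k \<le> g (Suc k)" for k
    unfolding g_def K_def using up M
    by (intro divide_right_mono add_right_mono S.L_mono diff_right_mono R.regularized_Suc_ge) auto
  have g2: "g (Suc k) - g k \<le> 1 / 4" for k
  proof -
    have "K (Suc k) \<le> S.L (\<lambda>t. ((F b M (\<theta> t) k - F b M (\<theta> t) 0) / 2 - \<pi> t) + 1 / 2)"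
      unfolding K_def
    proof (rule S.L_mono)
      fix t
      show "(F b M (\<theta> t) (Suc k) - F b M (\<theta> t) 0) / 2 - \<pi> t \<le> ((F b M (\<theta> t) k - F b M (\<theta> t) 0) / 2 - \<pi> t) + 1 / 2"
      proof -
        have "p - q \<le> 1 \<Longrightarrow> (p - r) / 2 - c \<le> ((q - r) / 2 - c) + 1 / 2" for p q r c :: real
          by (simp add: field_simps)
        then show ?thesis using R.regularized_Suc_le[of "\<bar>\<theta> t\<bar>" k] by blast
      qed
    qed
    then have "K (Suc k) \<le> K k + 1 / 2" unfolding S.L_add_const K_def .
    then show ?thesis unfolding g_def by (simp add: field_simps)
  qed
  have avg: "S.L (\<lambda>t. (F b M (\<theta> t) k - F b M (\<theta> t) 0) / 4 - \<pi> t) \<le> g k" for k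
    unfolding g_def K_def L0_def by (rule S.L_average) (simp add: field_simps)
  have "(\<integral>\<^sup>+x. exp (S.L (\<lambda>t. (F b M (\<theta> t) (tail_rank N x) - F b M (\<theta> t) 0) / 4 - \<pi> t)) \<partial>\<mu>)
      \<le> (\<integral>\<^sup>+x. ennreal (exp (g (tail_rank N x))) \<partial>\<mu>)"
    by (intro nn_integral_mono ennreal_leI) (simp add: avg)
  also have "\<dots> = ennreal (\<integral>x. exp (g (tail_rank N x)) \<partial>\<mu>)"
    using integral_rank(1)[of "\<lambda>k. exp (g k)" N 1] by (intro nn_integral_eq_integral) auto
  also have "\<dots> \<le> ennreal (exp (g 0) * (1 + 2 * ((\<integral>x. g (tail_rank N (4 * A * x)) \<partial>\<mu>) - g 0)))"
    by (intro ennreal_leI exp_rank g1 g2)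
  also have "2 * ((\<integral>x. g (tail_rank N (4 * A * x)) \<partial>\<mu>) - g 0) = (\<integral>x. K (tail_rank N (4 * A * x)) \<partial>\<mu>) - L0"
    using integral_rank(1)[of K N "4 * A"] by (simp add: g_def K0)
  also have "ennreal (exp (g 0) * (1 + ((\<integral>x. K (tail_rank N (4 * A * x)) \<partial>\<mu>) - L0)))
      \<le> ennreal (exp L0 * exp ((\<integral>x. K (tail_rank N (4 * A * x)) \<partial>\<mu>) - L0))"
    using exp_ge_add_one_self[of "(\<integral>x. K (tail_rank N (4 * A * x)) \<partial>\<mu>) - L0"]
    by (intro ennreal_leI) (simp add: g_def K0)
  also have "\<dots> = exp (\<integral>x. K (tail_rank N (4 * A * x)) \<partial>\<mu>)" by (simp flip: exp_add)
  finally show ?thesis unfolding K_def .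
qed

text \<open>The penalty is the mean of \<open>f\<close>, so \<open>exp_positive\<close> leaves a
  centered function of the rank. It is Lipschitz in \<open>\<theta>\<close> with a multiple of
  \<open>\<bar>x\<bar>\<close> as constant, by \<open>regularized_lipschitz\<close> and
  \<open>rank_dilated_bound\<close>; \<open>centering\<close> then returns a linear process.\<close>

lemma exp_positive_centered:
  fixes \<theta> :: "'t \<Rightarrow> real" and N :: nat
  assumes Q: "sup_functional Q T v" and b: "0 < b" and M: "0 \<le> M"
  defines "f \<equiv> \<lambda>t x. (F b M (\<theta> t) (tail_rank N (4 * A * x)) - F b M (\<theta> t) 0) / 2"
  shows "(\<integral>\<^sup>+x. exp (sup_functional.L Q T v
      (\<lambda>t. (F b M (\<theta> t) (tail_rank N x) - F b M (\<theta> t) 0) / 4 - (\<integral>x. f t x \<partial>\<mu>))) \<partial>\<mu>)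
    \<le> exp (\<integral>x. sup_functional.L Q T v (\<lambda>t. 2 * (4 * A * \<alpha> / b) * \<theta> t * x) \<partial>\<mu>)"
proof -
  have meas: "f t \<in> borel_measurable borel" for t
    unfolding f_def using rank_measurable[of "\<lambda>k. (F b M (\<theta> t) k - F b M (\<theta> t) 0) / 2" N "4 * A"] by simp
  have int: "integrable \<mu> (f t)" for t
    unfolding f_def using integral_rank(1)[of "\<lambda>k. (F b M (\<theta> t) k - F b M (\<theta> t) 0) / 2" N "4 * A"] by simp
  have k0: "0 \<le> 4 * A * \<alpha> / b" using A_ge \<alpha>_ge_1 b by simp
  have lip: "\<bar>f s x - f t x\<bar> \<le> 4 * A * \<alpha> / b * \<bar>\<theta> s - \<theta> t\<bar> * \<bar>x\<bar>" for s t x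
  proof (cases "tail_rank N (4 * A * x) = 0")
    case True
    then have "\<bar>f s x - f t x\<bar> = 0" unfolding f_def by simp
    also have "0 \<le> 4 * A * \<alpha> / b * \<bar>\<theta> s - \<theta> t\<bar> * \<bar>x\<bar>"
      by (intro mult_nonneg_nonneg k0) auto
    finally show ?thesis .
  next
    case False
    let ?k = "tail_rank N (4 * A * x)"
    note up = u_props(1,2)[OF b]
  interpret R: regularization "u b" "1 / \<alpha>" M by unfold_locales (use up M in auto)
    have d: "\<bar>\<bar>\<theta> s\<bar> - \<bar>\<theta> t\<bar>\<bar> \<le> \<bar>\<theta> s - \<theta> t\<bar>" by simp
    have "\<bar>F b M (\<theta> s) j - F b M (\<theta> t) j\<bar> \<le> u b ?k * \<bar>\<theta> s - \<theta> t\<bar>" if "j \<le> ?k" for j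
    proof -
      have "\<bar>F b M (\<theta> s) j - F b M (\<theta> t) j\<bar> \<le> u b j * \<bar>\<bar>\<theta> s\<bar> - \<bar>\<theta> t\<bar>\<bar>"
        by (rule R.regularized_lipschitz)
      also have "\<dots> \<le> u b ?k * \<bar>\<theta> s - \<theta> t\<bar>" using up that d by (intro mult_mono) auto
      finally show ?thesis .
    qed
    note this[OF order.refl] this[OF le0]
    moreover have "\<bar>p - q\<bar> \<le> e \<Longrightarrow> \<bar>p' - q'\<bar> \<le> e \<Longrightarrow> \<bar>(p - p') / 2 - (q - q') / 2\<bar> \<le> e"
      for p q p' q' e :: real by (auto simp: abs_le_iff field_simps)
    ultimately have "\<bar>f s x - f t x\<bar> \<le> u b ?k * \<bar>\<theta> s - \<theta> t\<bar>"
      unfolding f_def by blast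
    also have "\<dots> \<le> 4 * A * \<alpha> / b * \<bar>x\<bar> * \<bar>\<theta> s - \<theta> t\<bar>"
      using rank_dilated_bound[OF b, of N x] False by (intro mult_right_mono) auto
    finally show ?thesis by (simp only: ac_simps)
  qed
  have "(\<integral>\<^sup>+x. exp (sup_functional.L Q T v
      (\<lambda>t. (F b M (\<theta> t) (tail_rank N x) - F b M (\<theta> t) 0) / 4 - (\<integral>x. f t x \<partial>\<mu>))) \<partial>\<mu>)
    \<le> exp (\<integral>x. sup_functional.L Q T v (\<lambda>t. f t x - (\<integral>x. f t x \<partial>\<mu>)) \<partial>\<mu>)"
    unfolding f_def by (rule exp_positive[OF Q b M])
  also have "\<dots> \<le> exp (\<integral>x. sup_functional.L Q T v (\<lambda>t. 2 * (4 * A * \<alpha> / b) * \<theta> t * x) \<partial>\<mu>)"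
    by (intro ennreal_leI exp_le_cancel_iff[THEN iffD2] centering[OF Q] meas int integrable_id k0 lip)
  finally show ?thesis .
qed

text \<open>Two estimates of the penalty, for small and for large coefficients. The quadratic one
  depends on the positive threshold \<open>1 / \<alpha>\<close>:
  \<open>max (y - 1 / \<alpha>) 0 \<le> \<alpha> / 4 * y\<^sup>2\<close> by completing the
  square.\<close>

lemma positive_mean_bounds:
  fixes \<theta> :: real and N :: nat
  assumes b: "0 < b" and M: "0 \<le> M"
  defines "f \<equiv> \<lambda>x. (F b M \<theta> (tail_rank N (4 * A * x)) - F b M \<theta> 0) / 2"
  shows "(\<integral>x. f x \<partial>\<mu>) \<le> 2 * A\<^sup>2 * \<alpha> ^ 3 * (\<bar>\<theta>\<bar> * h 2 / b)\<^sup>2"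
    and "(\<integral>x. f x \<partial>\<mu>) \<le> 2 * A * \<alpha> * (\<bar>\<theta>\<bar> * h 2 / b)"
proof -
  note up = u_props(1,2)[OF b]
  interpret R: regularization "u b" "1 / \<alpha>" M by unfold_locales (use up M in auto)
  have int: "integrable \<mu> f"
    unfolding f_def using integral_rank(1)[of "\<lambda>k. (F b M \<theta> k - F b M \<theta> 0) / 2" N "4 * A"] by simp
  define y where "y x = 4 * A * \<alpha> * \<bar>\<theta>\<bar> / b * \<bar>x\<bar>" for x :: real
  have y0: "0 \<le> y x" for x unfolding y_def using A_ge \<alpha>_ge_1 b by simp
  have le: "f x \<le> max (y x - 1 / \<alpha>) 0 / 2" for x
  proof (cases "tail_rank N (4 * A * x) = 0")
    case True
    then show ?thesis unfolding f_def by simp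
  next
    case False
    let ?k = "tail_rank N (4 * A * x)"
    have "f x \<le> F b M \<theta> ?k / 2"
      unfolding f_def using R.regularized_nonneg[of "\<bar>\<theta>\<bar>" 0] by simp
    also have "F b M \<theta> ?k \<le> max (\<bar>\<theta>\<bar> * u b ?k - 1 / \<alpha>) 0"
      using R.regularized_le[of ?k ?k "\<bar>\<theta>\<bar>"] by simp
    also have "\<bar>\<theta>\<bar> * u b ?k \<le> \<bar>\<theta>\<bar> * (4 * A * \<alpha> / b * \<bar>x\<bar>)"
      using rank_dilated_bound[OF b, of N x] False by (intro mult_left_mono) auto
    also have "\<dots> = y x" unfolding y_def by simp
    finally show ?thesis by simp
  qed
  have i1: "integrable \<mu> (\<lambda>x. \<bar>x\<bar>)" using moments[of 1] by simp
  have i2: "integrable \<mu> (\<lambda>x. \<bar>x\<bar> powr 2)" using moments[of 2] by simp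
  have h1: "(\<integral>x. \<bar>x\<bar> \<partial>\<mu>) \<le> h 2" using h_mono[of 1 2] by (simp add: h_def)
  have h2: "(\<integral>x. \<bar>x\<bar> powr 2 \<partial>\<mu>) = (h 2)\<^sup>2" using h_powr[of 2] by simp
  have "(\<integral>x. f x \<partial>\<mu>) \<le> (\<integral>x. (4 * A * \<alpha> * \<bar>\<theta>\<bar> / b) / 2 * \<bar>x\<bar> \<partial>\<mu>)"
  proof (rule integral_mono[OF int])
    fix x
    have "max (y x - 1 / \<alpha>) 0 \<le> y x" using y0[of x] \<alpha>_ge_1 by simp
    then have "max (y x - 1 / \<alpha>) 0 / 2 \<le> y x / 2" by (rule divide_right_mono) simp
    with le[of x] have "f x \<le> y x / 2" by (rule order_trans)
    also have "y x / 2 = (4 * A * \<alpha> * \<bar>\<theta>\<bar> / b) / 2 * \<bar>x\<bar>" unfolding y_def by simp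
    finally show "f x \<le> (4 * A * \<alpha> * \<bar>\<theta>\<bar> / b) / 2 * \<bar>x\<bar>" .
  qed (use i1 in simp)
  also have "\<dots> = (4 * A * \<alpha> * \<bar>\<theta>\<bar> / b) / 2 * (\<integral>x. \<bar>x\<bar> \<partial>\<mu>)" by simp
  also have "\<dots> \<le> (4 * A * \<alpha> * \<bar>\<theta>\<bar> / b) / 2 * h 2"
    using h1 A_ge \<alpha>_ge_1 b by (intro mult_left_mono) auto
  finally show "(\<integral>x. f x \<partial>\<mu>) \<le> 2 * A * \<alpha> * (\<bar>\<theta>\<bar> * h 2 / b)" by (simp add: ac_simps)
  have "(\<integral>x. f x \<partial>\<mu>) \<le> (\<integral>x. \<alpha> / 8 * (4 * A * \<alpha> * \<bar>\<theta>\<bar> / b)\<^sup>2 * \<bar>x\<bar> powr 2 \<partial>\<mu>)"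
  proof (rule integral_mono[OF int])
    fix x
    have "max (y x - 1 / \<alpha>) 0 \<le> \<alpha> / 4 * (y x)\<^sup>2"
    proof -
      have "0 \<le> \<alpha> * (y x / 2 - 1 / \<alpha>)\<^sup>2" using \<alpha>_ge_1 by simp
      also have "\<dots> = \<alpha> / 4 * (y x)\<^sup>2 - (y x - 1 / \<alpha>)"
        using \<alpha>_ge_1 by (simp add: power2_eq_square field_simps)
      finally have "y x - 1 / \<alpha> \<le> \<alpha> / 4 * (y x)\<^sup>2" by (simp only: diff_ge_0_iff_ge)
      moreover have "0 \<le> \<alpha> / 4 * (y x)\<^sup>2" using \<alpha>_ge_1 by simp
      ultimately show ?thesis by (rule max.boundedI)
    qed
    then have "max (y x - 1 / \<alpha>) 0 / 2 \<le> \<alpha> / 4 * (y x)\<^sup>2 / 2" by (rule divide_right_mono) simp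
    with le[of x] have "f x \<le> \<alpha> / 4 * (y x)\<^sup>2 / 2" by (rule order_trans)
    then have "f x \<le> \<alpha> / 8 * (y x)\<^sup>2" by simp
    also have "(y x)\<^sup>2 = (4 * A * \<alpha> * \<bar>\<theta>\<bar> / b)\<^sup>2 * \<bar>x\<bar> powr 2"
      unfolding y_def by (simp only: power_mult_distrib) simp
    finally show "f x \<le> \<alpha> / 8 * (4 * A * \<alpha> * \<bar>\<theta>\<bar> / b)\<^sup>2 * \<bar>x\<bar> powr 2"
      by (simp only: mult.assoc)
  qed (use i2 in simp)
  also have "\<dots> = \<alpha> / 8 * (4 * A * \<alpha> * \<bar>\<theta>\<bar> / b)\<^sup>2 * (h 2)\<^sup>2" by (simp only: h2[symmetric] integral_mult_right_zero)
  also have "\<dots> = 2 * A\<^sup>2 * \<alpha> ^ 3 * (\<bar>\<theta>\<bar> * h 2 / b)\<^sup>2"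
    by (simp add: power2_eq_square power3_eq_cube)
  finally show "(\<integral>x. f x \<partial>\<mu>) \<le> 2 * A\<^sup>2 * \<alpha> ^ 3 * (\<bar>\<theta>\<bar> * h 2 / b)\<^sup>2" .
qed

end

text \<open>The slope \<open>1 / 2\<close> lets truncation at level 1 respect the bound
  \<open>1 / 2\<close> that \<open>exp_signed\<close> imposes.\<close>

definition clip :: "real \<Rightarrow> real" where "clip y = max (- 1 / 2) (min (1 / 2) (y / 2))"

lemma clip_measurable [measurable]: "clip \<in> borel_measurable borel"
  unfolding clip_def[abs_def] by measurable

lemma clip_bounds: "\<bar>clip y\<bar> \<le> 1 / 2" "clip (- y) = - clip y" "\<bar>clip y - clip z\<bar> \<le> \<bar>y - z\<bar> / 2" "\<bar>clip y\<bar> \<le> \<bar>y\<bar> / 2"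
  unfolding clip_def by (simp_all add: min_def max_def abs_if)

context regular_law
begin

text \<open>By oddness the mean of \<open>2 * a + 4 * a\<^sup>2\<close> is
  \<open>4 * E a\<^sup>2\<close>, so this penalty is the centering constant. The Lipschitz factor
  \<open>3 / b\<close> is half the slope of \<open>2 * a + 4 * a\<^sup>2\<close>, which is at most 6
  for \<open>\<bar>a\<bar> \<le> 1 / 2\<close>, divided by \<open>b\<close>.\<close>

lemma exp_signed_centered:
  fixes \<theta> :: "'t \<Rightarrow> real"
  assumes Q: "sup_functional Q T v" and b: "0 < b"
  shows "(\<integral>\<^sup>+x. exp (sup_functional.L Q T v (\<lambda>t. clip (\<theta> t * x / b) - 4 * (\<integral>x. (clip (\<theta> t * x / b))\<^sup>2 \<partial>\<mu>))) \<partial>\<mu>)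
    \<le> exp (\<integral>x. sup_functional.L Q T v (\<lambda>t. 2 * (3 / b) * \<theta> t * x) \<partial>\<mu>)"
proof -
  define a where "a t x = clip (\<theta> t * x / b)" for t x
  have [measurable]: "a t \<in> borel_measurable borel" for t unfolding a_def[abs_def] by measurable
  have bnd: "\<bar>a t x\<bar> \<le> 1 / 2" for t x unfolding a_def by (rule clip_bounds)
  have odd: "a t (- x) = - a t x" for t x
    unfolding a_def using clip_bounds(2)[of "\<theta> t * x / b"] by simp
  have a_int: "integrable \<mu> (a t)" for t
    using bnd by (intro integrable_const_bound[where B = "1/2"]) auto
  have a2_int: "integrable \<mu> (\<lambda>x. (a t x)\<^sup>2)" for t
  proof (intro integrable_const_bound[where B = "1/4"] always_eventually allI)
    fix x have "\<bar>a t x\<bar>\<^sup>2 \<le> (1/2)\<^sup>2" using bnd[of t x] by (intro power_mono) auto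
    then show "norm ((a t x)\<^sup>2) \<le> 1 / 4" by (simp add: power2_eq_square)
  qed simp
  have a0: "(\<integral>x. a t x \<partial>\<mu>) = 0" for t
    using integral_uminus[of "a t"] by (simp add: odd)
  define f where "f t x = 2 * a t x + 4 * (a t x)\<^sup>2" for t x
  have f_int: "integrable \<mu> (f t)" for t unfolding f_def using a_int a2_int by simp
  have f_mean: "(\<integral>x. f t x \<partial>\<mu>) = 4 * (\<integral>x. (a t x)\<^sup>2 \<partial>\<mu>)" for t
    unfolding f_def using a_int a2_int by (simp add: a0)
  have lip: "\<bar>f s x - f t x\<bar> \<le> 3 / b * \<bar>\<theta> s - \<theta> t\<bar> * \<bar>x\<bar>" for s t x
  proof -
    have "f s x - f t x = (a s x - a t x) * (2 + 4 * (a s x + a t x))"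
      unfolding f_def by (simp add: power2_eq_square algebra_simps)
    then have "\<bar>f s x - f t x\<bar> = \<bar>a s x - a t x\<bar> * \<bar>2 + 4 * (a s x + a t x)\<bar>" by (simp add: abs_mult)
    also have "\<dots> \<le> (\<bar>\<theta> s * x / b - \<theta> t * x / b\<bar> / 2) * 6"
    proof (rule mult_mono)
      show "\<bar>a s x - a t x\<bar> \<le> \<bar>\<theta> s * x / b - \<theta> t * x / b\<bar> / 2" unfolding a_def by (rule clip_bounds)
      have "a s x \<le> 1 / 2" "- (1 / 2) \<le> a s x" "a t x \<le> 1 / 2" "- (1 / 2) \<le> a t x"
        using bnd[of s x] bnd[of t x] unfolding abs_le_iff by linarith+
      then show "\<bar>2 + 4 * (a s x + a t x)\<bar> \<le> 6" unfolding abs_le_iff by (simp add: field_simps)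
    qed auto
    also have "\<theta> s * x / b - \<theta> t * x / b = (\<theta> s - \<theta> t) * x / b" by (simp add: diff_divide_distrib left_diff_distrib)
    finally show ?thesis using b by (simp add: abs_mult ac_simps)
  qed
  have "(\<integral>\<^sup>+x. exp (sup_functional.L Q T v (\<lambda>t. a t x - 4 * (\<integral>x. (a t x)\<^sup>2 \<partial>\<mu>))) \<partial>\<mu>)
    \<le> exp (\<integral>x. sup_functional.L Q T v (\<lambda>t. 2 * a t x + 4 * (a t x)\<^sup>2 - 4 * (\<integral>x. (a t x)\<^sup>2 \<partial>\<mu>)) \<partial>\<mu>)"
    by (intro exp_signed Q odd bnd) simp
  also have "\<dots> = exp (\<integral>x. sup_functional.L Q T v (\<lambda>t. f t x - (\<integral>x. f t x \<partial>\<mu>)) \<partial>\<mu>)"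
    unfolding f_mean unfolding f_def ..
  also have "\<dots> \<le> exp (\<integral>x. sup_functional.L Q T v (\<lambda>t. 2 * (3 / b) * \<theta> t * x) \<partial>\<mu>)"
    using b by (intro ennreal_leI exp_le_cancel_iff[THEN iffD2] centering[OF Q] f_int integrable_id lip)
      (auto simp: f_def[abs_def])
  finally show ?thesis unfolding a_def .
qed

lemma signed_mean_bound:
  assumes b: "0 < b"
  shows "4 * (\<integral>x. (clip (\<theta> * x / b))\<^sup>2 \<partial>\<mu>) \<le> min ((\<bar>\<theta>\<bar> * h 2 / b)\<^sup>2) 1"
proof -
  have sq: "(clip y)\<^sup>2 \<le> 1 / 4" "(clip y)\<^sup>2 \<le> y\<^sup>2 / 4" for y
  proof -
    have "\<bar>clip y\<bar>\<^sup>2 \<le> (1/2)\<^sup>2" by (rule power_mono[OF clip_bounds(1)]) simp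
    moreover have "\<bar>clip y\<bar>\<^sup>2 \<le> (\<bar>y\<bar> / 2)\<^sup>2" by (rule power_mono[OF clip_bounds(4)]) simp
    ultimately show "(clip y)\<^sup>2 \<le> 1 / 4" "(clip y)\<^sup>2 \<le> y\<^sup>2 / 4" by (simp_all add: power2_eq_square)
  qed
  have int: "integrable \<mu> (\<lambda>x. (clip (\<theta> * x / b))\<^sup>2)"
    using sq(1) by (intro integrable_const_bound[where B = "1/4"]) auto
  have "(\<integral>x. (clip (\<theta> * x / b))\<^sup>2 \<partial>\<mu>) \<le> (\<integral>x. 1 / 4 \<partial>\<mu>)"
    by (intro integral_mono int sq) simp
  moreover have "(\<integral>x. (clip (\<theta> * x / b))\<^sup>2 \<partial>\<mu>) \<le> (\<integral>x. (\<theta> / b)\<^sup>2 / 4 * \<bar>x\<bar> powr 2 \<partial>\<mu>)"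
  proof (rule integral_mono[OF int])
    show "integrable \<mu> (\<lambda>x. (\<theta> / b)\<^sup>2 / 4 * \<bar>x\<bar> powr 2)" using moments[of 2] by simp
    fix x show "(clip (\<theta> * x / b))\<^sup>2 \<le> (\<theta> / b)\<^sup>2 / 4 * \<bar>x\<bar> powr 2"
      using sq(2)[of "\<theta> * x / b"] by (simp add: power_divide power_mult_distrib)
  qed
  moreover have "(\<integral>x. (\<theta> / b)\<^sup>2 / 4 * \<bar>x\<bar> powr 2 \<partial>\<mu>) = (\<bar>\<theta>\<bar> * h 2 / b)\<^sup>2 / 4"
  proof -
    have h2: "(\<integral>x. \<bar>x\<bar> powr 2 \<partial>\<mu>) = (h 2)\<^sup>2" using h_powr[of 2] by simp
    show ?thesis unfolding integral_mult_right_zero h2 by (simp add: power_divide power_mult_distrib)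
  qed
  moreover have "(\<integral>x. 1 / 4 \<partial>\<mu>) = (1 / 4 :: real)" by simp
  ultimately have "4 * (\<integral>x. (clip (\<theta> * x / b))\<^sup>2 \<partial>\<mu>) \<le> (\<bar>\<theta>\<bar> * h 2 / b)\<^sup>2"
    "4 * (\<integral>x. (clip (\<theta> * x / b))\<^sup>2 \<partial>\<mu>) \<le> 1" by linarith+
  then show ?thesis by (rule min.boundedI)
qed

end

subsection \<open>Weak moments of independent sums\<close>

text \<open>Adding the terms one at a time, the partial sum overshoots \<open>m\<close> by at most
  the last term.\<close>

lemma subset_sum_between:
  fixes s :: "'i \<Rightarrow> real"
  assumes "finite J" "\<And>i. i \<in> J \<Longrightarrow> 0 \<le> s i \<and> s i \<le> m" "m \<le> (\<Sum>i\<in>J. s i)" "0 \<le> m"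
  shows "\<exists>K\<subseteq>J. m \<le> (\<Sum>i\<in>K. s i) \<and> (\<Sum>i\<in>K. s i) \<le> 2 * m"
  using assms
proof (induction J rule: finite_induct)
  case empty
  then show ?case by auto
next
  case (insert i J)
  show ?case
  proof (cases "m \<le> (\<Sum>i\<in>J. s i)")
    case True
    then obtain K where "K \<subseteq> J" "m \<le> (\<Sum>i\<in>K. s i) \<and> (\<Sum>i\<in>K. s i) \<le> 2 * m"
      using insert by auto
    then show ?thesis by (intro exI[of _ K]) auto
  next
    case False
    have "s i \<le> m" using insert.prems(1) by simp
    with False have "s i + (\<Sum>i\<in>J. s i) \<le> 2 * m" by linarith
    then show ?thesis using insert.prems(2) insert.hyps
      by (intro exI[of _ "insert i J"]) simp
  qed
qed

locale regular_laws =
  fixes I :: "nat set" and \<mu> :: "nat \<Rightarrow> real measure" and \<alpha> :: real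
  assumes fin_I: "finite I" and ne_I: "I \<noteq> {}"
    and law: "\<And>i. regular_law (\<mu> i) \<alpha>"

sublocale regular_laws \<subseteq> real_laws \<mu>
proof (rule real_laws.intro)
  show "prob_space (\<mu> i)" for i
    using law[of i] by (simp add: regular_law_def symmetric_law_def)
  show "sets (\<mu> i) = sets borel" for i
    using law[of i] symmetric_law.sets_law[of "\<mu> i"] by (simp add: regular_law_def)
qed

context regular_laws
begin

abbreviation P where "P \<equiv> PiM I \<mu>"

definition hh :: "nat \<Rightarrow> real \<Rightarrow> real" where "hh i = regular_law.h (\<mu> i)"

lemma \<alpha>_ge_1: "1 \<le> \<alpha>" using regular_law.\<alpha>_ge_1[OF law] .

lemma symmetric: "symmetric_law (\<mu> i)"
  using law[of i] by (simp add: regular_law_def)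

sublocale P: prob_space P by (rule prob_PiM)

lemma hh_nonneg [simp]: "0 \<le> hh i r"
  unfolding hh_def by (rule regular_law.h_nonneg[OF law])

lemma component_measurable: "i \<in> I \<Longrightarrow> (\<lambda>x. x i) \<in> borel_measurable P"
  using measurable_component_singleton[of i I \<mu>] measurable_cong_sets[OF refl sets_laws] by blast

lemma sum_measurable [measurable]: "J \<subseteq> I \<Longrightarrow> (\<lambda>x. \<Sum>i\<in>J. t i * x i) \<in> borel_measurable P" for t :: "nat \<Rightarrow> real"
  by (intro borel_measurable_sum borel_measurable_times borel_measurable_const component_measurable) auto

lemma flip:
  assumes \<sigma>: "\<And>i. \<sigma> i = 1 \<or> \<sigma> i = (-1 :: real)"
  shows "distr P P (\<lambda>x. \<lambda>i\<in>I. \<sigma> i * x i) = P"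
proof (rule PiM_eqI)
  have [measurable]: "(\<lambda>x. \<lambda>i\<in>I. \<sigma> i * x i) \<in> measurable P P"
    by (intro measurable_restrict) measurable
  fix A assume A: "\<And>i. i \<in> I \<Longrightarrow> A i \<in> sets (\<mu> i)"
  have pre: "(\<lambda>x. \<lambda>i\<in>I. \<sigma> i * x i) -` Pi\<^sub>E I A \<inter> space P = Pi\<^sub>E I (\<lambda>i. (\<lambda>y. \<sigma> i * y) -` A i)"
    by (auto simp: space_PiM PiE_iff)
  have one: "(\<lambda>y. \<sigma> i * y) -` A i \<in> sets (\<mu> i)"
    "emeasure (\<mu> i) ((\<lambda>y. \<sigma> i * y) -` A i) = emeasure (\<mu> i) (A i)" if "i \<in> I" for i
  proof -
    interpret s: symmetric_law "\<mu> i" by (rule symmetric)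
    have Ai: "A i \<in> sets borel" using A[OF that] by (simp add: s.sets_law)
    have "(\<lambda>y. \<sigma> i * y) -` A i \<inter> space borel \<in> sets borel"
      by (rule measurable_sets[OF _ Ai]) measurable
    then show "(\<lambda>y. \<sigma> i * y) -` A i \<in> sets (\<mu> i)" by (simp add: s.sets_law)
    show "emeasure (\<mu> i) ((\<lambda>y. \<sigma> i * y) -` A i) = emeasure (\<mu> i) (A i)"
    proof (cases "\<sigma> i = 1")
      case False
      then have "\<sigma> i = -1" using \<sigma> by blast
      moreover have "emeasure (\<mu> i) (A i) = emeasure (distr (\<mu> i) borel uminus) (A i)" by (simp only: s.sym)
      moreover have "\<dots> = emeasure (\<mu> i) (uminus -` A i)"
      proof -
        have "(uminus :: real \<Rightarrow> real) \<in> measurable (\<mu> i) borel" by measurable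
        from emeasure_distr[OF this Ai] show ?thesis by simp
      qed
      moreover have "(\<lambda>y. -1 * y) = (uminus :: real \<Rightarrow> real)" by auto
      ultimately show ?thesis by (simp only:)
    qed simp
  qed
  have "emeasure (distr P P (\<lambda>x. \<lambda>i\<in>I. \<sigma> i * x i)) (Pi\<^sub>E I A)
      = emeasure P (Pi\<^sub>E I (\<lambda>i. (\<lambda>y. \<sigma> i * y) -` A i))"
    using A fin_I by (subst emeasure_distr) (auto intro!: sets_PiM_I_finite simp: pre)
  also have "\<dots> = (\<Prod>i\<in>I. emeasure (\<mu> i) ((\<lambda>y. \<sigma> i * y) -` A i))"
    by (rule emeasure_PiM[OF fin_I one(1)])
  also have "\<dots> = (\<Prod>i\<in>I. emeasure (\<mu> i) (A i))" by (intro prod.cong refl one(2))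
  finally show "emeasure (distr P P (\<lambda>x. \<lambda>i\<in>I. \<sigma> i * x i)) (Pi\<^sub>E I A) = (\<Prod>i\<in>I. emeasure (\<mu> i) (A i))" .
qed (use fin_I in simp_all)

lemma flip_measurable: "(\<lambda>x. \<lambda>i\<in>I. \<sigma> i * x i) \<in> measurable P P" for \<sigma> :: "nat \<Rightarrow> real"
  by (intro measurable_restrict) measurable

lemma integral_flip:
  fixes f :: "(nat \<Rightarrow> real) \<Rightarrow> real"
  assumes \<sigma>: "\<And>i. \<sigma> i = 1 \<or> \<sigma> i = (-1 :: real)" and f: "f \<in> borel_measurable P"
  shows "(\<integral>x. f (\<lambda>i\<in>I. \<sigma> i * x i) \<partial>P) = (\<integral>x. f x \<partial>P)"
    and "integrable P f \<Longrightarrow> integrable P (\<lambda>x. f (\<lambda>i\<in>I. \<sigma> i * x i))"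
proof -
  show "(\<integral>x. f (\<lambda>i\<in>I. \<sigma> i * x i) \<partial>P) = (\<integral>x. f x \<partial>P)"
    using integral_distr[OF flip_measurable f, of \<sigma>] flip[OF \<sigma>] by simp
  assume "integrable P f"
  then have "integrable (distr P P (\<lambda>x. \<lambda>i\<in>I. \<sigma> i * x i)) f" using flip[OF \<sigma>] by simp
  then show "integrable P (\<lambda>x. f (\<lambda>i\<in>I. \<sigma> i * x i))"
    by (rule integrable_distr[OF flip_measurable])
qed

lemma indep_components: "P.indep_vars (\<lambda>_. borel) (\<lambda>i x. x i) I"
proof -
  have "distr P (PiM I (\<lambda>_. borel)) (\<lambda>x. \<lambda>i\<in>I. x i) = distr P P (\<lambda>x. x)"
  proof (rule distr_cong)
    show "sets (PiM I (\<lambda>_. borel)) = sets P" by (intro sets_PiM_cong refl) (simp add: sets_laws)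
    show "(\<lambda>i\<in>I. x i) = x" if "x \<in> space P" for x
      using that by (auto simp: space_PiM PiE_def extensional_restrict)
  qed simp
  also have "\<dots> = P" by (rule distr_id)
  also have "P = PiM I (\<lambda>i. distr P borel (\<lambda>x. x i))"
  proof (rule PiM_cong)
    fix i assume "i \<in> I"
    then have "\<mu> i = distr P (\<mu> i) (\<lambda>x. x i)" by (simp add: distr_component_laws)
    also have "\<dots> = distr P borel (\<lambda>x. x i)" by (intro distr_cong refl) (simp add: sets_laws)
    finally show "\<mu> i = distr P borel (\<lambda>x. x i)" .
  qed simp
  finally show ?thesis
    by (subst P.indep_vars_iff_distr_eq_PiM'[OF ne_I component_measurable]) auto
qed

lemma indep_sums:
  fixes t :: "nat \<Rightarrow> real"
  assumes "J \<inter> K = {}" "J \<subseteq> I" "K \<subseteq> I"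
  shows "P.indep_var borel (\<lambda>x. \<Sum>i\<in>J. t i * x i) borel (\<lambda>x. \<Sum>i\<in>K. t i * x i)"
proof -
  have "P.indep_var borel ((\<lambda>f. \<Sum>i\<in>J. t i * f i) \<circ> (\<lambda>x. restrict (\<lambda>i. x i) J))
      borel ((\<lambda>f. \<Sum>i\<in>K. t i * f i) \<circ> (\<lambda>x. restrict (\<lambda>i. x i) K))"
    by (intro P.indep_var_compose[OF P.indep_var_restrict[OF indep_components assms]]) measurable
  moreover have "((\<lambda>f. \<Sum>i\<in>J. t i * f i) \<circ> (\<lambda>x. restrict (\<lambda>i. x i) J)) = (\<lambda>x. \<Sum>i\<in>J. t i * x i)" for J
    by (auto simp: fun_eq_iff intro!: sum.cong)
  ultimately show ?thesis by simp
qed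

section \<open>Lower tails on blocks of coordinates\<close>

definition lower_tail :: "(nat \<Rightarrow> real) \<Rightarrow> nat set \<Rightarrow> real \<Rightarrow> real"
  where "lower_tail t J y = P.prob {x \<in> space P. y \<le> (\<Sum>i\<in>J. t i * x i)}"

lemma lower_tail_nonneg [simp]: "0 \<le> lower_tail t J y" unfolding lower_tail_def by simp

text \<open>Independence makes lower tails supermultiplicative over disjoint blocks. The lower
  bounds for sums below are products of one-block bounds.\<close>

lemma lower_tail_Un:
  assumes "J \<inter> K = {}" "J \<subseteq> I" "K \<subseteq> I"
  shows "lower_tail t J y * lower_tail t K z \<le> lower_tail t (J \<union> K) (y + z)"
proof -
  have fin: "finite J" "finite K" using finite_subset[OF assms(2) fin_I] finite_subset[OF assms(3) fin_I] by simp_all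
  have "lower_tail t J y * lower_tail t K z
    = P.prob ((\<lambda>x. \<Sum>i\<in>J. t i * x i) -` {y..} \<inter> space P) * P.prob ((\<lambda>x. \<Sum>i\<in>K. t i * x i) -` {z..} \<inter> space P)"
    unfolding lower_tail_def by (intro arg_cong2[where f = "(*)"] arg_cong[where f = P.prob]) auto
  also have "\<dots> = P.prob ((\<lambda>x. (\<Sum>i\<in>J. t i * x i, \<Sum>i\<in>K. t i * x i)) -` ({y..} \<times> {z..}) \<inter> space P)"
    by (rule P.indep_varD[OF indep_sums[OF assms], symmetric]) auto
  also have "\<dots> \<le> lower_tail t (J \<union> K) (y + z)"
    unfolding lower_tail_def
  proof (rule P.finite_measure_mono)
    show "(\<lambda>x. (\<Sum>i\<in>J. t i * x i, \<Sum>i\<in>K. t i * x i)) -` ({y..} \<times> {z..}) \<inter> space P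
      \<subseteq> {x \<in> space P. y + z \<le> (\<Sum>i\<in>J \<union> K. t i * x i)}"
      using assms(1) fin by (auto simp: sum.union_disjoint intro: add_mono)
    show "{x \<in> space P. y + z \<le> (\<Sum>i\<in>J \<union> K. t i * x i)} \<in> P.events"
      using assms by (intro borel_measurable_le borel_measurable_const sum_measurable) auto
  qed
  finally show ?thesis .
qed

lemma flip_all_sum: "(\<Sum>i\<in>J. t i * (\<lambda>i\<in>I. - 1 * x i) i) = - (\<Sum>i\<in>J. t i * x i)" if "J \<subseteq> I" for t :: "nat \<Rightarrow> real"
proof -
  have "(\<Sum>i\<in>J. t i * (\<lambda>i\<in>I. - 1 * x i) i) = (\<Sum>i\<in>J. - (t i * x i))"
    using that by (intro sum.cong) auto
  then show ?thesis by (simp add: sum_negf)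
qed

lemma prob_flip:
  assumes J: "J \<subseteq> I"
  shows "P.prob {x \<in> space P. y \<le> - (\<Sum>i\<in>J. t i * x i)} = lower_tail t J y"
proof -
  let ?F = "\<lambda>x. \<lambda>i\<in>I. (-1) * x i :: real" and ?S = "{x \<in> space P. y \<le> (\<Sum>i\<in>J. t i * x i)}"
  have S: "?S \<in> sets P" using J by (intro borel_measurable_le borel_measurable_const sum_measurable)
  have "lower_tail t J y = measure (distr P P ?F) ?S"
    unfolding lower_tail_def by (subst flip) auto
  also have "\<dots> = P.prob (?F -` ?S \<inter> space P)" by (rule measure_distr[OF flip_measurable S])
  also have "?F -` ?S \<inter> space P = {x \<in> space P. y \<le> - (\<Sum>i\<in>J. t i * x i)}"
  proof -
    have "?F x \<in> space P" if "x \<in> space P" for x using measurable_space[OF flip_measurable that] .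
    then have "?F -` ?S \<inter> space P = {x \<in> space P. y \<le> (\<Sum>i\<in>J. t i * ?F x i)}" by blast
    then show ?thesis unfolding flip_all_sum[OF J] .
  qed
  finally show ?thesis ..
qed

lemma lower_tail_two_sided:
  assumes J: "J \<subseteq> I"
  shows "P.prob {x \<in> space P. y \<le> \<bar>\<Sum>i\<in>J. t i * x i\<bar>} \<le> 2 * lower_tail t J y"
proof -
  let ?S = "\<lambda>x. \<Sum>i\<in>J. t i * x i"
  have m: "{x \<in> space P. y \<le> ?S x} \<in> sets P" "{x \<in> space P. y \<le> - ?S x} \<in> sets P"
    using J by (auto intro!: borel_measurable_le borel_measurable_const sum_measurable borel_measurable_uminus)
  have "P.prob {x \<in> space P. y \<le> \<bar>?S x\<bar>} \<le> P.prob ({x \<in> space P. y \<le> ?S x} \<union> {x \<in> space P. y \<le> - ?S x})"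
    using m by (intro P.finite_measure_mono) (auto simp: abs_if)
  also have "\<dots> \<le> P.prob {x \<in> space P. y \<le> ?S x} + P.prob {x \<in> space P. y \<le> - ?S x}"
    using m by (intro measure_Un_le)
  finally show ?thesis unfolding prob_flip[OF J] by (simp add: lower_tail_def)
qed

lemma lower_tail_zero: "J \<subseteq> I \<Longrightarrow> 1 / 2 \<le> lower_tail t J 0"
  using lower_tail_two_sided[of J 0 t] P.prob_space by simp

text \<open>By symmetry the coordinates outside \<open>J\<close> have a nonnegative sum with
  probability at least \<open>1 / 2\<close>. Passing from \<open>J\<close> to all of
  \<open>I\<close> thus costs a factor 2, after which Markov's inequality applies.\<close>

lemma lower_tail_moment:
  assumes J: "J \<subseteq> I" and p: "1 \<le> p" and y: "0 \<le> y"
    and int: "integrable P (\<lambda>x. \<bar>\<Sum>i\<in>I. t i * x i\<bar> powr p)"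
    and weak: "(\<integral>x. \<bar>\<Sum>i\<in>I. t i * x i\<bar> powr p \<partial>P) \<le> 1"
  shows "y powr p * lower_tail t J y \<le> 2"
proof -
  let ?S = "\<lambda>x. \<Sum>i\<in>I. t i * x i"
  have "lower_tail t J y * (1 / 2) \<le> lower_tail t J y * lower_tail t (I - J) 0"
    by (intro mult_left_mono lower_tail_zero) auto
  also have "\<dots> \<le> lower_tail t (J \<union> (I - J)) (y + 0)" using J by (intro lower_tail_Un) auto
  also have "J \<union> (I - J) = I" using J by auto
  finally have "lower_tail t J y \<le> 2 * lower_tail t I y" by simp
  then have "y powr p * lower_tail t J y \<le> y powr p * (2 * lower_tail t I y)" by (intro mult_left_mono) auto
  also have "\<dots> = 2 * (\<integral>x. y powr p * indicator {x \<in> space P. y \<le> ?S x} x \<partial>P)"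
    unfolding lower_tail_def by simp
  also have "\<dots> \<le> 2 * (\<integral>x. \<bar>?S x\<bar> powr p \<partial>P)"
  proof (intro mult_left_mono integral_mono int)
    have "{x \<in> space P. y \<le> ?S x} \<in> sets P"
      by (intro borel_measurable_le borel_measurable_const sum_measurable) auto
    then show "integrable P (\<lambda>x. y powr p * indicator {x \<in> space P. y \<le> ?S x} x)"
      by (intro integrable_mult_right integrable_real_indicator) (auto simp: P.emeasure_eq_measure)
    fix x
    show "y powr p * indicator {x \<in> space P. y \<le> ?S x} x \<le> \<bar>?S x\<bar> powr p"
      using y p by (auto simp: indicator_def intro!: powr_mono2)
  qed simp
  also have "\<dots> \<le> 2" using weak by simp
  finally show ?thesis .
qed

text \<open>The factor \<open>1 / 4\<close> of the one-coordinate bound is absorbed into the base,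
  so that the orders simply add when coordinates are multiplied together.\<close>

lemma lower_tail_single:
  assumes "i \<in> I" "2 \<le> r"
  shows "(4 * \<alpha>\<^sup>2) powr (- r) \<le> lower_tail t {i} (\<bar>t i\<bar> * hh i r / 2)"
proof -
  interpret l: regular_law "\<mu> i" \<alpha> by (rule law)
  have "(4 * \<alpha>\<^sup>2) powr (- r) = 4 powr (- r) * (\<alpha>\<^sup>2) powr (- r)" by (rule powr_mult)
  also have "(\<alpha>\<^sup>2) powr (- r) = \<alpha> powr (- 2 * r)"
    using l.\<alpha>_ge_1 powr_powr[of \<alpha> 2 "- r"] by simp
  also have "4 powr (- r) * \<alpha> powr (- 2 * r) \<le> (4 :: real) powr (- 1) * \<alpha> powr (- 2 * r)"
    using assms by (intro mult_right_mono powr_mono) auto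
  also have "\<dots> = \<alpha> powr (- 2 * r) / 4" by (simp add: powr_minus)
  also have "\<dots> \<le> l.prob {x. \<bar>t i\<bar> * hh i r / 2 \<le> t i * x}"
    unfolding hh_def by (rule l.lower_tail_scaled[OF assms(2)])
  also have "\<dots> = measure (distr P (\<mu> i) (\<lambda>x. x i)) {x. \<bar>t i\<bar> * hh i r / 2 \<le> t i * x}"
    using assms by (simp add: distr_component_laws)
  also have "\<dots> = P.prob ((\<lambda>x. x i) -` {x. \<bar>t i\<bar> * hh i r / 2 \<le> t i * x} \<inter> space P)"
    using assms by (intro measure_distr) (auto simp: l.sets_law)
  also have "(\<lambda>x. x i) -` {x. \<bar>t i\<bar> * hh i r / 2 \<le> t i * x} \<inter> space P
      = {x \<in> space P. \<bar>t i\<bar> * hh i r / 2 \<le> (\<Sum>j\<in>{i}. t j * x j)}" by auto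
  finally show ?thesis unfolding lower_tail_def .
qed

lemma lower_tail_sum:
  assumes "J \<subseteq> I" and r: "\<And>i. i \<in> J \<Longrightarrow> 2 \<le> r i"
  shows "(4 * \<alpha>\<^sup>2) powr (- (\<Sum>i\<in>J. r i)) \<le> lower_tail t J (\<Sum>i\<in>J. \<bar>t i\<bar> * hh i (r i) / 2)"
proof -
  have "finite J" using assms fin_I finite_subset by blast
  then show ?thesis using assms
  proof (induction J rule: finite_induct)
    case empty
    then show ?case unfolding lower_tail_def using \<alpha>_ge_1 by (simp add: P.prob_space)
  next
    case (insert i J)
    have "(4 * \<alpha>\<^sup>2) powr (- (\<Sum>j\<in>insert i J. r j)) = (4 * \<alpha>\<^sup>2) powr (- r i) * (4 * \<alpha>\<^sup>2) powr (- (\<Sum>j\<in>J. r j))"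
      using insert.hyps by (simp add: powr_add[symmetric])
    also have "\<dots> \<le> lower_tail t {i} (\<bar>t i\<bar> * hh i (r i) / 2) * lower_tail t J (\<Sum>i\<in>J. \<bar>t i\<bar> * hh i (r i) / 2)"
      using insert by (intro mult_mono lower_tail_single insert.IH) auto
    also have "\<dots> \<le> lower_tail t ({i} \<union> J) (\<bar>t i\<bar> * hh i (r i) / 2 + (\<Sum>i\<in>J. \<bar>t i\<bar> * hh i (r i) / 2))"
      using insert by (intro lower_tail_Un) auto
    finally show ?case using insert.hyps by simp
  qed
qed

lemma powr_cancel_bound:
  fixes y c p :: real
  assumes "1 \<le> p" "0 \<le> y" "0 < c" "y powr p * c powr (- p) \<le> 2"
  shows "y \<le> 2 * c"
proof (rule ccontr)
  assume "\<not> y \<le> 2 * c"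
  then have "2 < y / c" using assms by (simp add: field_simps)
  have "2 powr 1 \<le> (2 :: real) powr p" using assms by (intro powr_mono) auto
  also have "\<dots> < (y / c) powr p" using assms \<open>2 < y / c\<close> by (intro powr_less_mono2) auto
  also have "\<dots> = y powr p * c powr (- p)" using assms by (simp add: powr_divide powr_minus_divide)
  finally show False using assms(4) by simp
qed

text \<open>Half of the sum is exceeded with probability at least
  \<open>(4 * \<alpha>\<^sup>2) powr (- 2 * p)\<close>, whereas the weak moment allows this only if
  half of the sum is at most \<open>2 * (4 * \<alpha>\<^sup>2)\<^sup>2\<close>. The constant 64 is
  twice this 32.\<close>

lemma weak_sum:
  assumes J: "J \<subseteq> I" and p: "1 \<le> p" and r: "\<And>i. i \<in> J \<Longrightarrow> 2 \<le> r i" and le: "(\<Sum>i\<in>J. r i) \<le> 2 * p"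
    and int: "integrable P (\<lambda>x. \<bar>\<Sum>i\<in>I. t i * x i\<bar> powr p)"
    and weak: "(\<integral>x. \<bar>\<Sum>i\<in>I. t i * x i\<bar> powr p \<partial>P) \<le> 1"
  shows "(\<Sum>i\<in>J. \<bar>t i\<bar> * hh i (r i)) \<le> 64 * \<alpha> ^ 4"
proof -
  define y where "y = (\<Sum>i\<in>J. \<bar>t i\<bar> * hh i (r i) / 2)"
  have y0: "0 \<le> y" unfolding y_def by (intro sum_nonneg) simp
  have one: "1 \<le> 4 * \<alpha>\<^sup>2" using one_le_power[OF \<alpha>_ge_1, of 2] by simp
  have "((4 * \<alpha>\<^sup>2)\<^sup>2) powr (- p) = (4 * \<alpha>\<^sup>2) powr (- (2 * p))"
    using one powr_powr[of "4 * \<alpha>\<^sup>2" 2 "- p"] by simp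
  also have "\<dots> \<le> (4 * \<alpha>\<^sup>2) powr (- (\<Sum>i\<in>J. r i))" using one le by (intro powr_mono) auto
  also have "\<dots> \<le> lower_tail t J y" unfolding y_def by (rule lower_tail_sum[OF J r])
  finally have "y powr p * ((4 * \<alpha>\<^sup>2)\<^sup>2) powr (- p) \<le> y powr p * lower_tail t J y" by (intro mult_left_mono) auto
  also have "\<dots> \<le> 2" by (rule lower_tail_moment[OF J p y0 int weak])
  finally have "y \<le> 2 * (4 * \<alpha>\<^sup>2)\<^sup>2" using one by (intro powr_cancel_bound[OF p y0]) auto
  then show ?thesis unfolding y_def sum_divide_distrib[symmetric] by (simp add: power_mult_distrib)
qed

text \<open>The size of the terms replaces the bound on the sum of the orders: were that sum above
  \<open>2 * p\<close>, a subfamily with sum between \<open>p\<close> and \<open>2 * p\<close> would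
  satisfy \<open>weak_sum\<close>, giving \<open>c * p \<le> 64 * \<alpha> ^ 4\<close>.\<close>

lemma weak_sum_large:
  assumes J: "J \<subseteq> I" and p: "1 \<le> p" and r: "\<And>i. i \<in> J \<Longrightarrow> 2 \<le> r i" "\<And>i. i \<in> J \<Longrightarrow> r i \<le> p"
    and large: "\<And>i. i \<in> J \<Longrightarrow> c * r i \<le> \<bar>t i\<bar> * hh i (r i)" and c: "64 * \<alpha> ^ 4 < c * p"
    and int: "integrable P (\<lambda>x. \<bar>\<Sum>i\<in>I. t i * x i\<bar> powr p)"
    and weak: "(\<integral>x. \<bar>\<Sum>i\<in>I. t i * x i\<bar> powr p \<partial>P) \<le> 1"
  shows "(\<Sum>i\<in>J. \<bar>t i\<bar> * hh i (r i)) \<le> 64 * \<alpha> ^ 4"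
proof (rule weak_sum[OF J p r(1) _ int weak])
  have fJ: "finite J" using J fin_I finite_subset by blast
  have c0: "0 < c" using c p \<alpha>_ge_1
    by (smt (verit) mult_nonpos_nonneg zero_le_power)
  show "(\<Sum>i\<in>J. r i) \<le> 2 * p"
  proof (rule ccontr)
    assume "\<not> (\<Sum>i\<in>J. r i) \<le> 2 * p"
    then have "p \<le> (\<Sum>i\<in>J. r i)" using p by simp
    moreover have "0 \<le> r i \<and> r i \<le> p" if "i \<in> J" for i using r(1)[OF that] r(2)[OF that] by simp
    ultimately obtain K where K: "K \<subseteq> J" "p \<le> (\<Sum>i\<in>K. r i)" "(\<Sum>i\<in>K. r i) \<le> 2 * p"
      using subset_sum_between[OF fJ, of r p] p by auto
    have "c * p \<le> c * (\<Sum>i\<in>K. r i)" using c0 K by (intro mult_left_mono) auto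
    also have "\<dots> = (\<Sum>i\<in>K. c * r i)" by (rule sum_distrib_left)
    also have "\<dots> \<le> (\<Sum>i\<in>K. \<bar>t i\<bar> * hh i (r i))" using K large by (intro sum_mono) auto
    also have "\<dots> \<le> 64 * \<alpha> ^ 4" using K J r by (intro weak_sum[OF _ p _ K(3) int weak]) auto
    finally show False using c by simp
  qed
qed

text \<open>The variance is additive, and the fourth moment is at most a multiple of its square. The
  coordinates enter one at a time; the constant 3 leaves room for the six mixed terms.\<close>

lemma second_fourth_moment:
  fixes t :: "nat \<Rightarrow> real"
  assumes "J \<subseteq> I"
  defines "V \<equiv> \<Sum>i\<in>J. (t i * hh i 2)\<^sup>2"
  shows "integrable P (\<lambda>x. (\<Sum>i\<in>J. t i * x i) ^ 4)"
    and "(\<integral>x. (\<Sum>i\<in>J. t i * x i)\<^sup>2 \<partial>P) = V"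
    and "(\<integral>x. (\<Sum>i\<in>J. t i * x i) ^ 4 \<partial>P) \<le> 3 * \<alpha> ^ 4 * V\<^sup>2"
proof -
  have int2: "integrable P (\<lambda>x. (f x)\<^sup>2)" if "integrable P (\<lambda>x. (f x) ^ 4)" "f \<in> borel_measurable P" for f :: "(nat \<Rightarrow> real) \<Rightarrow> real"
  proof (rule Bochner_Integration.integrable_bound)
    show "integrable P (\<lambda>x. 1 + (f x) ^ 4)" using that by simp
    show "AE x in P. norm ((f x)\<^sup>2) \<le> norm (1 + (f x) ^ 4)"
    proof (intro always_eventually allI)
      fix x
      have "2 * (f x)\<^sup>2 \<le> 1 + (f x) ^ 4"
        using zero_le_power2[of "(f x)\<^sup>2 - 1"] by (simp add: power2_diff)
      then have "(f x)\<^sup>2 \<le> 1 + (f x) ^ 4" using zero_le_power2[of "f x"] by linarith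
      then show "norm ((f x)\<^sup>2) \<le> norm (1 + (f x) ^ 4)" by (simp add: add_increasing)
    qed
  qed (use that in measurable)
  have single: "integrable P (\<lambda>x. (t i * x i) ^ 4)" "(\<integral>x. (t i * x i)\<^sup>2 \<partial>P) = (t i * hh i 2)\<^sup>2"
    "(\<integral>x. (t i * x i) ^ 4 \<partial>P) \<le> \<alpha> ^ 4 * ((t i * hh i 2)\<^sup>2)\<^sup>2" if "i \<in> I" for i
  proof -
    interpret l: regular_law "\<mu> i" \<alpha> by (rule law)
    have e2: "\<bar>y\<bar> powr 2 = y\<^sup>2" and e4: "\<bar>y\<bar> powr 4 = y ^ 4" for y :: real by simp_all
    have i4: "integrable (\<mu> i) (\<lambda>y. y ^ 4)" using l.moments[of 4] by simp
    show "integrable P (\<lambda>x. (t i * x i) ^ 4)"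
      using integrable_component[OF that i4] by (simp add: power_mult_distrib)
    have h2: "(\<integral>y. y\<^sup>2 \<partial>\<mu> i) = (hh i 2)\<^sup>2" using l.h_powr[of 2] by (simp add: hh_def)
    have "(\<integral>y. y ^ 4 \<partial>\<mu> i) \<le> \<alpha> powr 4 * (\<integral>y. y\<^sup>2 \<partial>\<mu> i)\<^sup>2" using l.regular[of 2] by simp
    then have h4: "(\<integral>y. y ^ 4 \<partial>\<mu> i) \<le> \<alpha> ^ 4 * ((hh i 2)\<^sup>2)\<^sup>2" using l.\<alpha>_ge_1 by (simp add: h2)
    show "(\<integral>x. (t i * x i)\<^sup>2 \<partial>P) = (t i * hh i 2)\<^sup>2"
      using integral_component[of "\<lambda>y. y\<^sup>2" i I] that by (simp add: power_mult_distrib h2)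
    have "(\<integral>x. (t i * x i) ^ 4 \<partial>P) = (t i) ^ 4 * (\<integral>y. y ^ 4 \<partial>\<mu> i)"
      using integral_component[of "\<lambda>y. y ^ 4" i I] that by (simp add: power_mult_distrib)
    also have "\<dots> \<le> (t i) ^ 4 * (\<alpha> ^ 4 * ((hh i 2)\<^sup>2)\<^sup>2)" using h4 by (intro mult_left_mono) auto
    finally show "(\<integral>x. (t i * x i) ^ 4 \<partial>P) \<le> \<alpha> ^ 4 * ((t i * hh i 2)\<^sup>2)\<^sup>2"
      by (simp add: power_mult_distrib mult.left_commute)
  qed
  have "finite J" using assms fin_I finite_subset by blast
  then have *: "integrable P (\<lambda>x. (\<Sum>i\<in>J. t i * x i) ^ 4)
    \<and> (\<integral>x. (\<Sum>i\<in>J. t i * x i)\<^sup>2 \<partial>P) = (\<Sum>i\<in>J. (t i * hh i 2)\<^sup>2)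
    \<and> (\<integral>x. (\<Sum>i\<in>J. t i * x i) ^ 4 \<partial>P) \<le> 3 * \<alpha> ^ 4 * (\<Sum>i\<in>J. (t i * hh i 2)\<^sup>2)\<^sup>2"
    using assms(1)
  proof (induction J rule: finite_induct)
    case empty
    then show ?case by simp
  next
    case (insert j J)
    define Y where "Y x = (\<Sum>i\<in>J. t i * x i)" for x
    define Z where "Z x = t j * x j" for x
    define W where "W = (\<Sum>i\<in>J. (t i * hh i 2)\<^sup>2)"
    have IH: "integrable P (\<lambda>x. Y x ^ 4)" "(\<integral>x. (Y x)\<^sup>2 \<partial>P) = W" "(\<integral>x. Y x ^ 4 \<partial>P) \<le> 3 * \<alpha> ^ 4 * W\<^sup>2"
      using insert unfolding Y_def W_def by auto
    have jI: "j \<in> I" "J \<subseteq> I" using insert by auto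
    have Zs: "integrable P (\<lambda>x. Z x ^ 4)" "(\<integral>x. (Z x)\<^sup>2 \<partial>P) = (t j * hh j 2)\<^sup>2"
      "(\<integral>x. Z x ^ 4 \<partial>P) \<le> \<alpha> ^ 4 * ((t j * hh j 2)\<^sup>2)\<^sup>2"
      using single[OF jI(1)] unfolding Z_def by auto
    have [measurable]: "Y \<in> borel_measurable P" "Z \<in> borel_measurable P"
      unfolding Y_def[abs_def] Z_def[abs_def] using jI component_measurable by auto
    have sum: "(\<Sum>i\<in>insert j J. t i * x i) = Y x + Z x" for x
      unfolding Y_def Z_def using insert by simp
    have YZ: "P.indep_var borel Y borel Z"
      using indep_sums[of J "{j}" t] insert unfolding Y_def[abs_def] Z_def[abs_def] by auto
    have Y2: "integrable P (\<lambda>x. (Y x)\<^sup>2)" and Z2: "integrable P (\<lambda>x. (Z x)\<^sup>2)"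
      using IH(1) Zs(1) by (intro int2; measurable)+
    have YZ2: "P.indep_var borel (\<lambda>x. (Y x)\<^sup>2) borel (\<lambda>x. (Z x)\<^sup>2)"
      using P.indep_var_compose[OF YZ, of "\<lambda>y. y\<^sup>2" borel "\<lambda>y. y\<^sup>2" borel] by (simp add: comp_def)
    have prod: "(\<integral>x. (Y x)\<^sup>2 * (Z x)\<^sup>2 \<partial>P) = W * (t j * hh j 2)\<^sup>2" "integrable P (\<lambda>x. (Y x)\<^sup>2 * (Z x)\<^sup>2)"
      using P.indep_var_lebesgue_integral[OF YZ2 Y2 Z2] P.indep_var_integrable[OF YZ2 Y2 Z2] IH(2) Zs(2) by auto
    have i4: "integrable P (\<lambda>x. (Y x + Z x) ^ 4)"
    proof (rule Bochner_Integration.integrable_bound)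
      show "integrable P (\<lambda>x. 2 * (Y x ^ 4 + 6 * ((Y x)\<^sup>2 * (Z x)\<^sup>2) + Z x ^ 4))"
        using IH(1) prod(2) Zs(1) by simp
      show "AE x in P. norm ((Y x + Z x) ^ 4) \<le> norm (2 * (Y x ^ 4 + 6 * ((Y x)\<^sup>2 * (Z x)\<^sup>2) + Z x ^ 4))"
      proof (intro always_eventually allI)
        fix x
        have "(Y x + Z x) ^ 4 + (Y x - Z x) ^ 4 = 2 * (Y x ^ 4 + 6 * ((Y x)\<^sup>2 * (Z x)\<^sup>2) + Z x ^ 4)"
          by (simp add: power2_eq_square power4_eq_xxxx algebra_simps)
        moreover have "0 \<le> (Y x - Z x) ^ 4" "0 \<le> (Y x + Z x) ^ 4" by simp_all
        ultimately show "norm ((Y x + Z x) ^ 4) \<le> norm (2 * (Y x ^ 4 + 6 * ((Y x)\<^sup>2 * (Z x)\<^sup>2) + Z x ^ 4))"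
          unfolding real_norm_def by linarith
      qed
    qed measurable
    \<comment> \<open>Only coordinate \<open>j\<close> is reflected, which turns
      \<open>Y + Z\<close> into \<open>Y - Z\<close>. Averaging the two removes all odd powers of
      \<open>Z\<close>.\<close>
    define \<sigma> where "\<sigma> i = (if i = j then -1 else 1 :: real)" for i
    have \<sigma>: "\<sigma> i = 1 \<or> \<sigma> i = -1" for i unfolding \<sigma>_def by simp
    have fl: "Y (\<lambda>i\<in>I. \<sigma> i * x i) = Y x" "Z (\<lambda>i\<in>I. \<sigma> i * x i) = - Z x" for x
    proof -
      show "Y (\<lambda>i\<in>I. \<sigma> i * x i) = Y x" unfolding Y_def \<sigma>_def using insert.hyps jI by (intro sum.cong) auto
      show "Z (\<lambda>i\<in>I. \<sigma> i * x i) = - Z x" unfolding Z_def \<sigma>_def using jI by simp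
    qed
    have m4: "(\<integral>x. (Y x - Z x) ^ 4 \<partial>P) = (\<integral>x. (Y x + Z x) ^ 4 \<partial>P)" "integrable P (\<lambda>x. (Y x - Z x) ^ 4)"
      using integral_flip[of \<sigma> "\<lambda>x. (Y x + Z x) ^ 4", OF \<sigma>] i4 by (simp_all add: fl)
    have i2: "integrable P (\<lambda>x. (Y x + Z x)\<^sup>2)" using i4 by (intro int2; measurable)
    have m2: "(\<integral>x. (Y x - Z x)\<^sup>2 \<partial>P) = (\<integral>x. (Y x + Z x)\<^sup>2 \<partial>P)" "integrable P (\<lambda>x. (Y x - Z x)\<^sup>2)"
      using integral_flip[of \<sigma> "\<lambda>x. (Y x + Z x)\<^sup>2", OF \<sigma>] i2 by (simp_all add: fl)
    have "2 * (\<integral>x. (Y x + Z x)\<^sup>2 \<partial>P) = (\<integral>x. (Y x + Z x)\<^sup>2 + (Y x - Z x)\<^sup>2 \<partial>P)"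
      using i2 m2 by simp
    also have "\<dots> = (\<integral>x. 2 * ((Y x)\<^sup>2 + (Z x)\<^sup>2) \<partial>P)"
      by (intro Bochner_Integration.integral_cong refl) (simp add: power2_eq_square algebra_simps)
    also have "\<dots> = 2 * (W + (t j * hh j 2)\<^sup>2)" using Y2 Z2 IH(2) Zs(2) by simp
    finally have e2: "(\<integral>x. (Y x + Z x)\<^sup>2 \<partial>P) = W + (t j * hh j 2)\<^sup>2" by simp
    have "2 * (\<integral>x. (Y x + Z x) ^ 4 \<partial>P) = (\<integral>x. (Y x + Z x) ^ 4 + (Y x - Z x) ^ 4 \<partial>P)"
      using i4 m4 by simp
    also have "\<dots> = (\<integral>x. 2 * (Y x ^ 4 + 6 * ((Y x)\<^sup>2 * (Z x)\<^sup>2) + Z x ^ 4) \<partial>P)"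
      by (intro Bochner_Integration.integral_cong refl) (simp add: power2_eq_square power4_eq_xxxx algebra_simps)
    also have "\<dots> = 2 * ((\<integral>x. Y x ^ 4 \<partial>P) + 6 * (W * (t j * hh j 2)\<^sup>2) + (\<integral>x. Z x ^ 4 \<partial>P))"
      using IH(1) prod Zs(1) by simp
    finally have "(\<integral>x. (Y x + Z x) ^ 4 \<partial>P)
        = (\<integral>x. Y x ^ 4 \<partial>P) + 6 * (W * (t j * hh j 2)\<^sup>2) + (\<integral>x. Z x ^ 4 \<partial>P)" by simp
    also have "\<dots> \<le> 3 * \<alpha> ^ 4 * W\<^sup>2 + 6 * \<alpha> ^ 4 * (W * (t j * hh j 2)\<^sup>2) + 3 * \<alpha> ^ 4 * ((t j * hh j 2)\<^sup>2)\<^sup>2"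
    proof (intro add_mono IH(3))
      have W0: "0 \<le> W" unfolding W_def by (intro sum_nonneg) simp
      have "1 * (W * (t j * hh j 2)\<^sup>2) \<le> \<alpha> ^ 4 * (W * (t j * hh j 2)\<^sup>2)"
        using W0 \<alpha>_ge_1 by (intro mult_right_mono one_le_power) auto
      then show "6 * (W * (t j * hh j 2)\<^sup>2) \<le> 6 * \<alpha> ^ 4 * (W * (t j * hh j 2)\<^sup>2)" by simp
      have "0 \<le> \<alpha> ^ 4 * ((t j * hh j 2)\<^sup>2)\<^sup>2" using \<alpha>_ge_1 by simp
      then show "(\<integral>x. Z x ^ 4 \<partial>P) \<le> 3 * \<alpha> ^ 4 * ((t j * hh j 2)\<^sup>2)\<^sup>2" using Zs(3) by linarith
    qed
    also have "\<dots> = 3 * \<alpha> ^ 4 * (W + (t j * hh j 2)\<^sup>2)\<^sup>2"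
      by (simp add: power2_eq_square algebra_simps)
    finally have e4: "(\<integral>x. (Y x + Z x) ^ 4 \<partial>P) \<le> 3 * \<alpha> ^ 4 * (W + (t j * hh j 2)\<^sup>2)\<^sup>2" .
    have "(\<Sum>i\<in>insert j J. (t i * hh i 2)\<^sup>2) = W + (t j * hh j 2)\<^sup>2"
      unfolding W_def using insert.hyps by simp
    with i4 e2 e4 show ?case unfolding sum by simp
  qed
  then show "integrable P (\<lambda>x. (\<Sum>i\<in>J. t i * x i) ^ 4)" "(\<integral>x. (\<Sum>i\<in>J. t i * x i)\<^sup>2 \<partial>P) = V"
    "(\<integral>x. (\<Sum>i\<in>J. t i * x i) ^ 4 \<partial>P) \<le> 3 * \<alpha> ^ 4 * V\<^sup>2"
    unfolding V_def by auto
qed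

text \<open>Paley-Zygmund for the square of a block sum, with the fourth moment bounded by
  \<open>3 * \<alpha> ^ 4 * V\<^sup>2\<close>. This gives \<open>1 / (12 * \<alpha> ^ 4)\<close> for
  the two-sided event, and symmetry halves it.\<close>

lemma lower_tail_block:
  fixes t :: "nat \<Rightarrow> real"
  assumes J: "J \<subseteq> I"
  defines "V \<equiv> \<Sum>i\<in>J. (t i * hh i 2)\<^sup>2"
  shows "1 / (24 * \<alpha> ^ 4) \<le> lower_tail t J (sqrt V / 2)"
proof (cases "V = 0")
  case True
  have "1 \<le> \<alpha> ^ 4" using \<alpha>_ge_1 by (rule one_le_power)
  then have "1 / (24 * \<alpha> ^ 4) \<le> 1 / 2" by (intro frac_le) auto
  also have "\<dots> \<le> lower_tail t J 0" by (rule lower_tail_zero[OF J])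
  finally show ?thesis using True by simp
next
  case False
  have V: "0 < V" using False unfolding V_def by (simp add: less_le sum_nonneg)
  define c where "c = 3 * \<alpha> ^ 4"
  have c: "0 < c" unfolding c_def using \<alpha>_ge_1 by simp
  let ?Y = "\<lambda>x. \<Sum>i\<in>J. t i * x i" and ?S = "{x \<in> space P. sqrt V / 2 \<le> \<bar>\<Sum>i\<in>J. t i * x i\<bar>}"
  note m = second_fourth_moment[OF J, of t, folded V_def]
  have Y2: "integrable P (\<lambda>x. (?Y x)\<^sup>2)"
    using m(2) V not_integrable_integral_eq by fastforce
  have S: "?S \<in> sets P"
    using J by (intro borel_measurable_le borel_measurable_const borel_measurable_abs sum_measurable)
  \<comment> \<open>With this weight the fourth-moment term is at most \<open>V / 4\<close>; the
    values below \<open>sqrt V / 2\<close> account for at most \<open>V / 2\<close>, and the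
    remaining \<open>V / 4\<close> comes from the event.\<close>
  define \<theta> where "\<theta> = 1 / (2 * c * V)"
  have \<theta>: "0 < \<theta>" unfolding \<theta>_def using c V by simp
  have pt: "(?Y x)\<^sup>2 \<le> V / 2 + (\<theta> / 2 * (?Y x) ^ 4 + 1 / (2 * \<theta>) * indicator ?S x)" if x: "x \<in> space P" for x
  proof (cases "x \<in> ?S")
    case True
    have "0 \<le> (\<theta> * (?Y x)\<^sup>2 - 1)\<^sup>2" by simp
    then have "2 * \<theta> * (?Y x)\<^sup>2 \<le> \<theta> * (\<theta> * (?Y x) ^ 4) + 1"
      by (simp add: power2_diff power_mult_distrib power2_eq_square algebra_simps power4_eq_xxxx)
    then have "(?Y x)\<^sup>2 \<le> \<theta> / 2 * (?Y x) ^ 4 + 1 / (2 * \<theta>)" using \<theta> by (simp add: field_simps)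
    moreover have ind: "indicator ?S x = (1 :: real)" using True by simp
    ultimately show ?thesis unfolding ind using V by linarith
  next
    case False
    then have "\<bar>?Y x\<bar> \<le> sqrt V / 2" using x by auto
    then have "\<bar>?Y x\<bar>\<^sup>2 \<le> (sqrt V / 2)\<^sup>2" by (intro power_mono) auto
    also have "\<dots> \<le> V / 2" using V by (simp add: power_divide)
    finally have "(?Y x)\<^sup>2 \<le> V / 2" by simp
    moreover have "0 \<le> \<theta> / 2 * (?Y x) ^ 4" using \<theta> by simp
    moreover have ind: "indicator ?S x = (0 :: real)" using False by simp
    ultimately show ?thesis unfolding ind by linarith
  qed
  have iS: "integrable P (indicator ?S :: _ \<Rightarrow> real)"
    using S by (intro integrable_real_indicator) (auto simp: P.emeasure_eq_measure)
  have "V \<le> (\<integral>x. V / 2 + (\<theta> / 2 * (?Y x) ^ 4 + 1 / (2 * \<theta>) * indicator ?S x) \<partial>P)"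
    unfolding m(2)[symmetric]
    by (rule integral_mono_AE)
       (use Y2 m(1) iS pt in \<open>auto simp: m(2) intro!: AE_I2 Bochner_Integration.integrable_add integrable_mult_right\<close>)
  also have "\<dots> = V / 2 + (\<theta> / 2 * (\<integral>x. (?Y x) ^ 4 \<partial>P) + 1 / (2 * \<theta>) * (\<integral>x. indicator ?S x \<partial>P))"
    by (rule P.integral_affine_two[OF m(1) iS])
  also have "(\<integral>x. indicator ?S x \<partial>P) = P.prob ?S" using S by simp
  also have "\<theta> / 2 * (\<integral>x. (?Y x) ^ 4 \<partial>P) \<le> \<theta> / 2 * (c * V\<^sup>2)"
    using m(3) \<theta> unfolding c_def by (intro mult_left_mono) auto
  also have "\<theta> / 2 * (c * V\<^sup>2) = V / 4"
    unfolding \<theta>_def using c V by (simp add: power2_eq_square)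
  finally have "V / 4 \<le> 1 / (2 * \<theta>) * P.prob ?S" by simp
  also have "1 / (2 * \<theta>) = c * V" unfolding \<theta>_def by simp
  finally have "V * (1 / 4) \<le> V * (c * P.prob ?S)" by (simp only: ac_simps)
  then have "1 / 4 \<le> c * P.prob ?S" using V by (simp only: mult_le_cancel_left_pos)
  also have "\<dots> \<le> c * (2 * lower_tail t J (sqrt V / 2))"
    using c by (intro mult_left_mono lower_tail_two_sided[OF J]) auto
  finally have "1 / 4 \<le> c * (2 * lower_tail t J (sqrt V / 2))" .
  moreover have "0 < \<alpha> ^ 4" using \<alpha>_ge_1 by simp
  ultimately show ?thesis unfolding c_def by (simp add: field_simps)
qed

text \<open>Blocks are split off greedily. Each has capped square sum between
  \<open>b\<^sup>2\<close> and \<open>2 * b\<^sup>2\<close>, so the total suffices for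
  \<open>m\<close> of them, and each contributes \<open>b / 2\<close> with a fixed
  probability.\<close>

lemma lower_tail_blocks:
  fixes m :: nat
  assumes "J \<subseteq> I" and b: "0 \<le> b" and "2 * real m * b\<^sup>2 \<le> (\<Sum>i\<in>J. min ((t i * hh i 2)\<^sup>2) (b\<^sup>2))"
  shows "\<exists>K\<subseteq>J. (1 / (24 * \<alpha> ^ 4)) ^ m \<le> lower_tail t K (real m * (b / 2))"
  using assms(1,3)
proof (induction m arbitrary: J)
  case 0
  then show ?case by (intro exI[of _ "{}"]) (auto simp: lower_tail_def P.prob_space)
next
  case (Suc m)
  let ?s = "\<lambda>i. min ((t i * hh i 2)\<^sup>2) (b\<^sup>2)"
  have fJ: "finite J" using Suc.prems fin_I finite_subset by blast
  have "b\<^sup>2 \<le> 2 * real (Suc m) * b\<^sup>2" by (simp add: algebra_simps add_increasing)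
  then have "b\<^sup>2 \<le> (\<Sum>i\<in>J. ?s i)" using Suc.prems(2) by linarith
  then obtain K where K: "K \<subseteq> J" "b\<^sup>2 \<le> (\<Sum>i\<in>K. ?s i)" "(\<Sum>i\<in>K. ?s i) \<le> 2 * b\<^sup>2"
    using subset_sum_between[OF fJ, of ?s "b\<^sup>2"] by auto
  have "(\<Sum>i\<in>J. ?s i) = (\<Sum>i\<in>J - K. ?s i) + (\<Sum>i\<in>K. ?s i)"
    using K(1) fJ by (rule sum.subset_diff)
  then have "2 * real m * b\<^sup>2 \<le> (\<Sum>i\<in>J - K. ?s i)"
    using K(3) Suc.prems(2) by (simp add: algebra_simps)
  then obtain K' where K': "K' \<subseteq> J - K" "(1 / (24 * \<alpha> ^ 4)) ^ m \<le> lower_tail t K' (real m * (b / 2))"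
    using Suc.IH[of "J - K"] Suc.prems(1) by auto
  have KI: "K \<subseteq> I" "K' \<subseteq> I" "K \<inter> K' = {}" using K K' Suc.prems by auto
  have "b\<^sup>2 \<le> (\<Sum>i\<in>K. (t i * hh i 2)\<^sup>2)" using K(2) by (rule order_trans) (intro sum_mono, simp)
  then have "b \<le> sqrt (\<Sum>i\<in>K. (t i * hh i 2)\<^sup>2)" by (rule real_le_rsqrt)
  then have "lower_tail t K (sqrt (\<Sum>i\<in>K. (t i * hh i 2)\<^sup>2) / 2) \<le> lower_tail t K (b / 2)"
    unfolding lower_tail_def
    by (intro P.finite_measure_mono borel_measurable_le borel_measurable_const sum_measurable KI) auto
  with lower_tail_block[OF KI(1), of t] have one: "1 / (24 * \<alpha> ^ 4) \<le> lower_tail t K (b / 2)" by simp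
  have "(1 / (24 * \<alpha> ^ 4)) ^ Suc m = 1 / (24 * \<alpha> ^ 4) * (1 / (24 * \<alpha> ^ 4)) ^ m" by simp
  also have "\<dots> \<le> lower_tail t K (b / 2) * lower_tail t K' (real m * (b / 2))"
    using one K'(2) \<alpha>_ge_1 by (intro mult_mono) auto
  also have "\<dots> \<le> lower_tail t (K \<union> K') (b / 2 + real m * (b / 2))"
    by (rule lower_tail_Un[OF KI(3,1,2)])
  also have "b / 2 + real m * (b / 2) = real (Suc m) * (b / 2)" by (simp add: algebra_simps)
  finally show ?case using K K' by (intro exI[of _ "K \<union> K'"]) auto
qed

text \<open>Too large a capped square sum would supply about \<open>p\<close> independent blocks,
  each adding \<open>b / 2\<close> with a fixed probability. The sum would then reach a multiple of
  \<open>p * b\<close> with probability exponentially small in \<open>p\<close>, which the weak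
  moment forbids for large \<open>p * b\<close>.\<close>

lemma weak_squares:
  assumes p: "1 \<le> p" and b: "0 \<le> b" and large: "2304 * \<alpha> ^ 8 < p * b"
    and int: "integrable P (\<lambda>x. \<bar>\<Sum>i\<in>I. t i * x i\<bar> powr p)"
    and weak: "(\<integral>x. \<bar>\<Sum>i\<in>I. t i * x i\<bar> powr p \<partial>P) \<le> 1"
  shows "(\<Sum>i\<in>I. min ((t i * hh i 2)\<^sup>2) (b\<^sup>2)) \<le> 4 * p * b\<^sup>2"
proof (rule ccontr)
  assume big: "\<not> ?thesis"
  \<comment> \<open>For \<open>p \<ge> 1\<close> rounding up at most doubles \<open>p\<close>. This
    is why the bound is \<open>4 * p * b\<^sup>2\<close>, while \<open>m\<close> blocks need
    \<open>2 * m * b\<^sup>2\<close>.\<close>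
  define m where "m = nat \<lceil>p\<rceil>"
  have m: "p \<le> real m" "real m \<le> 2 * p" unfolding m_def using p by linarith+
  have "2 * real m * b\<^sup>2 \<le> 2 * (2 * p) * b\<^sup>2" using m by (intro mult_right_mono mult_left_mono) auto
  also have "\<dots> \<le> (\<Sum>i\<in>I. min ((t i * hh i 2)\<^sup>2) (b\<^sup>2))" using big by simp
  finally obtain K where K: "K \<subseteq> I" "(1 / (24 * \<alpha> ^ 4)) ^ m \<le> lower_tail t K (real m * (b / 2))"
    using lower_tail_blocks[OF subset_refl b, of m t] by auto
  define c where "c = (24 * \<alpha> ^ 4)\<^sup>2"
  have a4: "1 \<le> \<alpha> ^ 4" using \<alpha>_ge_1 by (rule one_le_power)
  then have c: "0 < c" unfolding c_def using \<alpha>_ge_1 by simp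
  have "c powr (- p) = (24 * \<alpha> ^ 4) powr (- (2 * p))"
    unfolding c_def using powr_powr[of "24 * \<alpha> ^ 4" 2 "- p"] a4 by simp
  also have "\<dots> \<le> (24 * \<alpha> ^ 4) powr (- real m)" using m a4 by (intro powr_mono) auto
  also have "\<dots> = (1 / (24 * \<alpha> ^ 4)) ^ m"
    using \<alpha>_ge_1 by (simp add: powr_minus powr_realpow power_one_over inverse_eq_divide)
  also have "\<dots> \<le> lower_tail t K (real m * (b / 2))" by (rule K(2))
  finally have "(real m * (b / 2)) powr p * c powr (- p) \<le> (real m * (b / 2)) powr p * lower_tail t K (real m * (b / 2))"
    by (intro mult_left_mono) auto
  also have "\<dots> \<le> 2" using b by (intro lower_tail_moment[OF K(1) p _ int weak]) auto
  finally have "real m * (b / 2) \<le> 2 * c" using b c by (intro powr_cancel_bound[OF p]) auto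
  moreover have "p * (b / 2) \<le> real m * (b / 2)" using m b by (intro mult_right_mono) auto
  ultimately have "p * b \<le> 4 * c" by simp
  also have "4 * c = 2304 * \<alpha> ^ 8" unfolding c_def by (simp add: power_mult_distrib flip: power_mult)
  finally show False using large by simp
qed

end

subsection \<open>Moments of sums of nonnegative variables\<close>

lemma powr_add_le:
  fixes a b p :: real
  assumes "0 \<le> a" "0 \<le> b" "0 \<le> p"
  shows "(a + b) powr p \<le> 2 powr p * (a powr p + b powr p)"
proof -
  have "(a + b) powr p \<le> (2 * max a b) powr p" using assms by (intro powr_mono2) auto
  also have "\<dots> = 2 powr p * max a b powr p" using assms by (intro powr_mult)
  also have "max a b powr p \<le> a powr p + b powr p" by (simp add: max_def)
  finally show ?thesis by simp
qed

lemma powr_sum_le: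
  fixes a :: "'i \<Rightarrow> real" and p :: real
  assumes "finite J" "\<And>i. i \<in> J \<Longrightarrow> 0 \<le> a i" "0 < p"
  shows "(\<Sum>i\<in>J. a i) powr p \<le> real (card J) powr p * (\<Sum>i\<in>J. a i powr p)"
proof (cases "J = {}")
  case False
  obtain j where j: "j \<in> J" "(MAX i\<in>J. a i) = a j" using Max_attained[OF assms(1) False] .
  have "(\<Sum>i\<in>J. a i) \<le> real (card J) * a j"
    using assms j by (intro sum_bounded_above) (metis Max_ge finite_imageI imageI)
  then have "(\<Sum>i\<in>J. a i) powr p \<le> (real (card J) * a j) powr p"
    using assms by (intro powr_mono2 sum_nonneg) auto
  also have "\<dots> = real (card J) powr p * a j powr p" using assms j by (intro powr_mult)
  also have "a j powr p \<le> (\<Sum>i\<in>J. a i powr p)" using assms j by (intro member_le_sum) auto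
  finally show ?thesis by (simp add: mult_left_mono)
qed simp

lemma powr_sum_le_five:
  fixes a b c d e p :: real
  assumes "0 \<le> a" "0 \<le> b" "0 \<le> c" "0 \<le> d" "0 \<le> e" "0 < p"
  shows "(a + b + c + d + e) powr p \<le> 5 powr p * (a powr p + b powr p + c powr p + d powr p + e powr p)"
proof -
  define f where "f = (!) [a, b, c, d, e]"
  have f: "f 0 = a" "f 1 = b" "f 2 = c" "f 3 = d" "f 4 = e" unfolding f_def by simp_all
  have sum: "(\<Sum>i<5. g i) = g 0 + g 1 + g 2 + g 3 + g 4" for g :: "nat \<Rightarrow> real"
    by (simp add: eval_nat_numeral)
  have "0 \<le> f i" if "i < 5" for i
  proof -
    have "i = 0 \<or> i = 1 \<or> i = 2 \<or> i = 3 \<or> i = 4" using that by auto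
    then show ?thesis using assms f by auto
  qed
  then show ?thesis using powr_sum_le[of "{..<5}" f p] assms unfolding sum f by simp
qed

lemma prod_mono_ennreal:
  fixes f g :: "'i \<Rightarrow> ennreal"
  assumes "finite J" "\<And>i. i \<in> J \<Longrightarrow> f i \<le> g i"
  shows "(\<Prod>i\<in>J. f i) \<le> (\<Prod>i\<in>J. g i)"
  using assms by (induction J rule: finite_induct) (auto intro!: mult_mono)

lemma sum_le_prod_Suc:
  fixes a :: "'i \<Rightarrow> real"
  assumes "finite J" "\<And>i. i \<in> J \<Longrightarrow> 0 \<le> a i"
  shows "1 + (\<Sum>i\<in>J. a i) \<le> (\<Prod>i\<in>J. 1 + a i)"
  using assms
proof (induction J rule: finite_induct)
  case (insert j J)
  have "0 \<le> a j" "0 \<le> (\<Sum>i\<in>J. a i)" using insert.prems by (auto intro: sum_nonneg)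
  then have "1 + (\<Sum>i\<in>insert j J. a i) \<le> (1 + a j) * (1 + (\<Sum>i\<in>J. a i))"
    using insert.hyps by (simp add: algebra_simps)
  also have "\<dots> \<le> (1 + a j) * (\<Prod>i\<in>J. 1 + a i)"
    using insert \<open>0 \<le> a j\<close> by (intro mult_left_mono) auto
  finally show ?case using insert.hyps by simp
qed simp

text \<open>From \<open>z / p \<le> exp (z / p)\<close>, raised to the power \<open>p\<close>. The
  resulting factor \<open>p\<close> is cancelled later by the truncation level.\<close>

lemma nn_integral_powr_le_exp:
  fixes Z :: "'a \<Rightarrow> real"
  assumes Z: "Z \<in> borel_measurable M" "\<And>x. 0 \<le> Z x" and p: "0 < p"
    and exp: "(\<integral>\<^sup>+x. exp (Z x) \<partial>M) \<le> exp (c * p)"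
  shows "(\<integral>\<^sup>+x. Z x powr p \<partial>M) \<le> ennreal ((p * exp c) powr p)"
proof -
  have "Z x powr p \<le> p powr p * exp (Z x)" for x
  proof -
    have "Z x / p \<le> exp (Z x / p)" using exp_ge_add_one_self[of "Z x / p"] by linarith
    then have "(Z x / p) powr p \<le> exp (Z x / p) powr p" using Z(2)[of x] p by (intro powr_mono2) auto
    then have "Z x powr p / p powr p \<le> exp (Z x)"
      using Z(2)[of x] p by (simp add: powr_divide exp_powr_real)
    then show ?thesis using p by (simp add: field_simps)
  qed
  then have "(\<integral>\<^sup>+x. Z x powr p \<partial>M) \<le> (\<integral>\<^sup>+x. ennreal (p powr p) * ennreal (exp (Z x)) \<partial>M)"
    by (intro nn_integral_mono) (simp flip: ennreal_mult')
  also have "\<dots> = ennreal (p powr p) * (\<integral>\<^sup>+x. exp (Z x) \<partial>M)"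
    using Z by (intro nn_integral_cmult) measurable
  also have "\<dots> \<le> ennreal (p powr p) * ennreal (exp (c * p))" using exp by (intro mult_left_mono) auto
  also have "\<dots> = ennreal (p powr p * exp c powr p)" by (simp add: exp_powr_real flip: ennreal_mult')
  also have "p powr p * exp c powr p = (p * exp c) powr p" using p by (simp add: powr_mult)
  finally show ?thesis .
qed

context regular_laws
begin

lemma integrable_powr_sum:
  fixes t :: "nat \<Rightarrow> real"
  assumes "1 \<le> p"
  shows "integrable P (\<lambda>x. \<bar>\<Sum>i\<in>I. t i * x i\<bar> powr p)"
proof (rule Bochner_Integration.integrable_bound)
  have "integrable P (\<lambda>x. \<bar>t i * x i\<bar> powr p)" if "i \<in> I" for i
  proof -
    have "integrable (\<mu> i) (\<lambda>y. \<bar>t i\<bar> powr p * \<bar>y\<bar> powr p)"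
      by (intro integrable_mult_right regular_law.moments[OF law assms])
    from integrable_component[OF that this] show ?thesis by (simp add: abs_mult powr_mult)
  qed
  then show "integrable P (\<lambda>x. real (card I) powr p * (\<Sum>i\<in>I. \<bar>t i * x i\<bar> powr p))"
    by (intro integrable_mult_right Bochner_Integration.integrable_sum)
  show "(\<lambda>x. \<bar>\<Sum>i\<in>I. t i * x i\<bar> powr p) \<in> borel_measurable P"
    using sum_measurable[OF subset_refl] by measurable
  show "AE x in P. norm (\<bar>\<Sum>i\<in>I. t i * x i\<bar> powr p) \<le> norm (real (card I) powr p * (\<Sum>i\<in>I. \<bar>t i * x i\<bar> powr p))"
  proof (intro always_eventually allI)
    fix x
    have "\<bar>\<Sum>i\<in>I. t i * x i\<bar> powr p \<le> (\<Sum>i\<in>I. \<bar>t i * x i\<bar>) powr p"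
      using assms by (intro powr_mono2 sum_abs) auto
    also have "\<dots> \<le> real (card I) powr p * (\<Sum>i\<in>I. \<bar>t i * x i\<bar> powr p)"
      using assms fin_I by (intro powr_sum_le) auto
    finally show "norm (\<bar>\<Sum>i\<in>I. t i * x i\<bar> powr p) \<le> norm (real (card I) powr p * (\<Sum>i\<in>I. \<bar>t i * x i\<bar> powr p))"
      by (simp add: sum_nonneg)
  qed
qed

lemma integrable_lin: "integrable (\<mu> i) (\<lambda>y. c * y)" for c :: real
  using regular_law.integrable_id[OF law] by (intro integrable_mult_right)

lemma integrable_lin_sum: "integrable P (\<lambda>x. \<Sum>i\<in>I. t i * x i)" for t :: "nat \<Rightarrow> real"
  using integrable_sum_components[of I "\<lambda>i y. t i * y" 0] integrable_lin by simp

end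

subsection \<open>The normalized process\<close>

text \<open>The index set is closed under negation, so its linear suprema are suprema of absolute
  values and the exponential inequalities need no absolute values.\<close>

locale normalized_process = regular_laws +
  fixes T :: "(nat \<Rightarrow> real) set" and p :: real
  assumes fin_T: "finite T" and ne_T: "T \<noteq> {}"
    and uminus_T: "\<And>t. t \<in> T \<Longrightarrow> (\<lambda>i. - t i) \<in> T"
    and p_ge_2: "2 \<le> p"
    and mean: "(\<integral>x. (MAX t\<in>T. \<Sum>i\<in>I. t i * x i) \<partial>P) \<le> 1"
    and weak: "\<And>t. t \<in> T \<Longrightarrow> (\<integral>x. \<bar>\<Sum>i\<in>I. t i * x i\<bar> powr p \<partial>P) \<le> 1"
begin

definition S :: "(nat \<Rightarrow> real) \<Rightarrow> real" where "S x = (MAX t\<in>T. \<Sum>i\<in>I. t i * x i)"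

definition \<tau> :: "nat \<Rightarrow> real" where "\<tau> i = (MAX t\<in>T. \<bar>t i\<bar>)"

text \<open>The bound of \<open>weak_sum\<close> for a single coordinate of order \<open>p\<close>;
  hence \<open>\<tau> i * hh i p \<le> B\<close>, which also provides the hypothesis of
  \<open>large_part\<close>.\<close>

definition B :: real where "B = 64 * \<alpha> ^ 4"

definition \<kappa> :: real where "\<kappa> = 16 * B\<^sup>2 * \<alpha> ^ 6"

definition A :: real where "A = 8 * \<alpha> ^ 4"

text \<open>Each summand meets one requirement on \<open>p * b\<close>: \<open>6 * \<kappa>\<close>
  keeps the cap \<open>M\<close> below \<open>p / 6\<close>, \<open>2304 * \<alpha> ^ 8\<close> is
  the bound in \<open>weak_squares\<close>, and \<open>1024 * \<alpha> ^ 9\<close> the one behind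
  \<open>threshold\<close>. The final 1 makes the last two strict.\<close>

definition \<Gamma> :: real where "\<Gamma> = 6 * \<kappa> + 2304 * \<alpha> ^ 8 + 1024 * \<alpha> ^ 9 + 1"

definition b :: real where "b = \<Gamma> / p"

text \<open>In units of \<open>b\<close> this is the level \<open>\<kappa>\<close>, above which a
  coordinate is handed over to \<open>\<zeta>\<close>.\<close>

definition M :: real where "M = \<kappa> / b"

lemma A_eq: "regular_law.A \<alpha> = A"
  using regular_law.A_def[OF law] by (simp add: A_def)

lemma alpha_powers: "1 \<le> \<alpha> ^ k" using \<alpha>_ge_1 by (rule one_le_power)

lemma B_ge: "64 \<le> B" unfolding B_def using alpha_powers[of 4] by simp

lemma \<kappa>_pos: "0 < \<kappa>" unfolding \<kappa>_def using B_ge \<alpha>_ge_1 by simp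

lemma \<Gamma>_props: "6 \<le> \<Gamma>" "6 * \<kappa> \<le> \<Gamma>" "2304 * \<alpha> ^ 8 < \<Gamma>" "1024 * \<alpha> ^ 9 < \<Gamma>" "0 < \<Gamma>"
  unfolding \<Gamma>_def using \<kappa>_pos alpha_powers[of 8] alpha_powers[of 9] by linarith+

lemma b_pos: "0 < b" unfolding b_def using \<Gamma>_props p_ge_2 by simp

lemma pb: "p * b = \<Gamma>" unfolding b_def using p_ge_2 by simp

lemma M_nonneg: "0 \<le> M" unfolding M_def using \<kappa>_pos b_pos by simp

lemma A_ge: "8 \<le> A" unfolding A_def using alpha_powers[of 4] by simp

lemma \<tau>_ge: "t \<in> T \<Longrightarrow> \<bar>t i\<bar> \<le> \<tau> i"
  unfolding \<tau>_def using fin_T by (intro Max_ge) auto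

lemma \<tau>_attained: obtains t where "t \<in> T" "\<tau> i = \<bar>t i\<bar>"
  unfolding \<tau>_def using Max_attained[OF fin_T ne_T] by blast

lemma \<tau>_nonneg [simp]: "0 \<le> \<tau> i"
  using \<tau>_attained[of i] by (metis abs_ge_zero)

lemma S_ge: "t \<in> T \<Longrightarrow> (\<Sum>i\<in>I. t i * x i) \<le> S x"
  unfolding S_def using fin_T by (intro Max_ge) auto

lemma S_ge_abs: "t \<in> T \<Longrightarrow> \<bar>\<Sum>i\<in>I. t i * x i\<bar> \<le> S x"
  using S_ge[of t x] S_ge[OF uminus_T, of t x] by (simp add: sum_negf abs_le_iff)

lemma S_nonneg: "0 \<le> S x"
  using ne_T S_ge_abs by (meson abs_ge_zero ex_in_conv order_trans)

lemma S_integrable: "integrable P S"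
  unfolding S_def[abs_def] by (intro integrable_Max_real fin_T ne_T integrable_lin_sum)

lemma weak_int: "integrable P (\<lambda>x. \<bar>\<Sum>i\<in>I. t i * x i\<bar> powr p)"
  using p_ge_2 by (intro integrable_powr_sum) auto

lemma \<tau>_hh: assumes "i \<in> I" shows "\<tau> i * hh i p \<le> B"
proof -
  obtain t where t: "t \<in> T" "\<tau> i = \<bar>t i\<bar>" by (rule \<tau>_attained)
  have "(\<Sum>i\<in>{i}. \<bar>t i\<bar> * hh i p) \<le> 64 * \<alpha> ^ 4"
    using assms p_ge_2 by (intro weak_sum[of _ p _ t] weak_int weak t) auto
  then show ?thesis unfolding t(2) B_def by simp
qed

definition q :: "nat \<Rightarrow> real" where "q i = measure (\<mu> i) {y. B < \<tau> i * \<bar>y\<bar>}"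

lemma event_measurable: "i \<in> I \<Longrightarrow> {x \<in> space P. B < \<tau> i * \<bar>x i\<bar>} \<in> sets P"
  by (intro borel_measurable_less borel_measurable_const borel_measurable_times borel_measurable_abs component_measurable)

text \<open>
  Levy's argument: reflect all coordinates but the first one with \<open>\<tau> i * \<bar>x i\<bar> > B\<close>.
\<close>
lemma prob_large: "P.prob (\<Union>i\<in>I. {x \<in> space P. B < \<tau> i * \<bar>x i\<bar>}) \<le> 1 / 2"
proof -
  define E where "E i = {x \<in> space P. B < \<tau> i * \<bar>x i\<bar>}" for i
  define D where "D i = E i - (\<Union>j\<in>{j\<in>I. j < i}. E j)" for i
  have E: "E i \<in> sets P" if "i \<in> I" for i unfolding E_def using that by (rule event_measurable)
  have D: "D i \<in> sets P" if "i \<in> I" for i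
    unfolding D_def using that E fin_I by (intro sets.Diff sets.finite_UN) auto
  have cover: "(\<Union>i\<in>I. E i) = (\<Union>i\<in>I. D i)"
  proof (intro equalityI subsetI)
    fix x assume "x \<in> (\<Union>i\<in>I. E i)"
    then have ex: "\<exists>i. i \<in> I \<and> x \<in> E i" by auto
    define i where "i = (LEAST i. i \<in> I \<and> x \<in> E i)"
    have "i \<in> I \<and> x \<in> E i" unfolding i_def by (rule LeastI_ex[OF ex])
    moreover have "\<not> (j \<in> I \<and> x \<in> E j)" if "j < i" for j
      using not_less_Least[of j "\<lambda>i. i \<in> I \<and> x \<in> E i"] that unfolding i_def by blast
    ultimately show "x \<in> (\<Union>i\<in>I. D i)" unfolding D_def by blast
  qed (auto simp: D_def)
  have disj: "disjoint_family_on D I"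
    unfolding disjoint_family_on_def D_def by (auto simp: neq_iff)
  have intD: "integrable P (\<lambda>x. S x * indicator (D i) x)" if "i \<in> I" for i
    using integrable_mult_indicator[OF D[OF that] S_integrable] by (simp add: mult.commute)
  have one: "B * P.prob (D i) \<le> (\<integral>x. S x * indicator (D i) x \<partial>P)" if i: "i \<in> I" for i
  proof -
    define \<sigma> where "\<sigma> j = (if j = i then 1 else -1 :: real)" for j
    have \<sigma>: "\<sigma> j = 1 \<or> \<sigma> j = -1" for j unfolding \<sigma>_def by simp
    let ?F = "\<lambda>x. \<lambda>j\<in>I. \<sigma> j * x j"
    have FE: "?F x \<in> E j \<longleftrightarrow> x \<in> E j" if "j \<in> I" "x \<in> space P" for x j
      using measurable_space[OF flip_measurable that(2), of \<sigma>] that \<sigma>[of j] unfolding E_def by (auto simp: abs_mult)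
    have FD: "?F x \<in> D i \<longleftrightarrow> x \<in> D i" if "x \<in> space P" for x
      unfolding D_def using FE[OF _ that] i by auto
    have fm: "(\<lambda>x. S x * indicator (D i) x) \<in> borel_measurable P" using intD[OF i] by auto
    have fl: "integrable P (\<lambda>x. S (?F x) * indicator (D i) (?F x))"
      "(\<integral>x. S (?F x) * indicator (D i) (?F x) \<partial>P) = (\<integral>x. S x * indicator (D i) x \<partial>P)"
      using integral_flip[of \<sigma> "\<lambda>x. S x * indicator (D i) x", OF \<sigma> fm] intD[OF i] by auto
    \<comment> \<open>The set \<open>D i\<close> depends on absolute values only, so the reflection
      preserves it. The index vector attaining \<open>\<tau> i\<close>, with a suitable sign, has
      values at \<open>x\<close> and at its reflection that add up to
      \<open>2 * \<tau> i * \<bar>x i\<bar>\<close>.\<close>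
    have pt: "2 * B * indicator (D i) x \<le> S x * indicator (D i) x + S (?F x) * indicator (D i) (?F x)"
      if x: "x \<in> space P" for x
    proof (cases "x \<in> D i")
      case True
      obtain t where t: "t \<in> T" "\<tau> i = \<bar>t i\<bar>" by (rule \<tau>_attained)
      define s where "s = (if 0 \<le> t i * x i then t else (\<lambda>i. - t i))"
      have s: "s \<in> T" "s i * x i = \<tau> i * \<bar>x i\<bar>"
        using t uminus_T unfolding s_def by (auto simp: abs_mult[symmetric])
      have "(\<Sum>j\<in>I. s j * x j) + (\<Sum>j\<in>I. s j * ?F x j) = (\<Sum>j\<in>I. if j = i then 2 * (s i * x i) else 0)"
        unfolding sum.distrib[symmetric] by (intro sum.cong) (auto simp: \<sigma>_def)
      also have "\<dots> = 2 * (\<tau> i * \<bar>x i\<bar>)" using i fin_I s by simp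
      finally have "2 * (\<tau> i * \<bar>x i\<bar>) \<le> S x + S (?F x)"
        using S_ge[OF s(1), of x] S_ge[OF s(1), of "?F x"] by linarith
      moreover have "B < \<tau> i * \<bar>x i\<bar>" using True unfolding D_def E_def by auto
      ultimately show ?thesis using True FD[OF x] by simp
    next
      case False
      then show ?thesis using FD[OF x] by simp
    qed
    have "2 * (B * P.prob (D i)) = (\<integral>x. 2 * B * indicator (D i) x \<partial>P)"
      using D[OF i] by simp
    also have "\<dots> \<le> (\<integral>x. S x * indicator (D i) x + S (?F x) * indicator (D i) (?F x) \<partial>P)"
    proof (rule integral_mono_AE)
      show "integrable P (\<lambda>x. 2 * B * indicator (D i) x)"
        using D[OF i] by (intro integrable_mult_right integrable_real_indicator) (auto simp: P.emeasure_eq_measure)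
      show "integrable P (\<lambda>x. S x * indicator (D i) x + S (?F x) * indicator (D i) (?F x))"
        using intD[OF i] fl(1) by (rule Bochner_Integration.integrable_add)
      show "AE x in P. 2 * B * indicator (D i) x \<le> S x * indicator (D i) x + S (?F x) * indicator (D i) (?F x)"
        using pt by (intro AE_I2)
    qed
    also have "\<dots> = 2 * (\<integral>x. S x * indicator (D i) x \<partial>P)"
      using Bochner_Integration.integral_add[OF intD[OF i] fl(1)] fl(2) by simp
    finally show ?thesis by simp
  qed
  have "B * P.prob (\<Union>i\<in>I. E i) = (\<Sum>i\<in>I. B * P.prob (D i))"
    unfolding cover sum_distrib_left[symmetric]
    using D disj fin_I by (subst P.finite_measure_finite_Union) auto
  also have "\<dots> \<le> (\<Sum>i\<in>I. \<integral>x. S x * indicator (D i) x \<partial>P)" by (intro sum_mono one)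
  also have "\<dots> = (\<integral>x. (\<Sum>i\<in>I. S x * indicator (D i) x) \<partial>P)"
    by (rule Bochner_Integration.integral_sum[symmetric]) (rule intD)
  also have "\<dots> \<le> (\<integral>x. S x \<partial>P)"
  proof (rule integral_mono)
    show "integrable P (\<lambda>x. \<Sum>i\<in>I. S x * indicator (D i) x)" using intD by auto
    fix x
    have "(\<Sum>i\<in>I. indicator (D i) x) = (indicator (\<Union>i\<in>I. D i) x :: real)"
      using disj fin_I by (rule indicator_UN_disjoint[symmetric, rotated])
    then have "(\<Sum>i\<in>I. S x * indicator (D i) x) = S x * indicator (\<Union>i\<in>I. D i) x"
      by (simp add: sum_distrib_left[symmetric])
    also have "\<dots> \<le> S x" using S_nonneg[of x] by (simp add: indicator_def)
    finally show "(\<Sum>i\<in>I. S x * indicator (D i) x) \<le> S x" .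
  qed (rule S_integrable)
  also have "\<dots> \<le> 1" using mean unfolding S_def .
  finally have "B * P.prob (\<Union>i\<in>I. E i) \<le> 1" .
  moreover have "64 * P.prob (\<Union>i\<in>I. E i) \<le> B * P.prob (\<Union>i\<in>I. E i)"
    using B_ge by (intro mult_right_mono) auto
  ultimately show ?thesis unfolding E_def by linarith
qed

text \<open>By independence the probability that no coordinate is large is the product of the
  \<open>1 - q i\<close>. It is at least \<open>1 / 2\<close> by \<open>prob_large\<close> and at
  most \<open>exp\<close> of minus the sum, so the exponential of the sum is at most 2.\<close>

lemma sum_q: "(\<Sum>i\<in>I. q i) \<le> 1"
proof -
  have q01: "0 \<le> q i" "q i \<le> 1" for i
    unfolding q_def using prob_space.prob_le_1[OF prob_law] by auto
  have box: "Pi\<^sub>E I (\<lambda>i. {y. \<tau> i * \<bar>y\<bar> \<le> B}) = space P - (\<Union>i\<in>I. {x \<in> space P. B < \<tau> i * \<bar>x i\<bar>})"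
    by (auto simp: space_PiM PiE_iff not_less) (meson leD)
  have meas: "{y. \<tau> i * \<bar>y\<bar> \<le> B} \<in> sets (\<mu> i)" for i
  proof -
    have "{y. \<tau> i * \<bar>y\<bar> \<le> B} \<in> sets borel" by measurable
    then show ?thesis by (simp add: sets_laws)
  qed
  have "ennreal (1 / 2) \<le> ennreal (P.prob (space P - (\<Union>i\<in>I. {x \<in> space P. B < \<tau> i * \<bar>x i\<bar>})))"
  proof (rule ennreal_leI)
    have "(\<Union>i\<in>I. {x \<in> space P. B < \<tau> i * \<bar>x i\<bar>}) \<in> sets P"
      using fin_I event_measurable by (intro sets.finite_UN) auto
    from P.prob_compl[OF this] prob_large
    show "1 / 2 \<le> P.prob (space P - (\<Union>i\<in>I. {x \<in> space P. B < \<tau> i * \<bar>x i\<bar>}))" by linarith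
  qed
  also have "\<dots> = emeasure P (Pi\<^sub>E I (\<lambda>i. {y. \<tau> i * \<bar>y\<bar> \<le> B}))"
    unfolding box by (simp add: P.emeasure_eq_measure)
  also have "\<dots> = (\<Prod>i\<in>I. emeasure (\<mu> i) {y. \<tau> i * \<bar>y\<bar> \<le> B})"
    by (rule emeasure_PiM[OF fin_I meas])
  also have "\<dots> = (\<Prod>i\<in>I. ennreal (1 - q i))"
  proof (rule prod.cong)
    fix i
    interpret l: prob_space "\<mu> i" by (rule prob_law)
    have "{y. \<tau> i * \<bar>y\<bar> \<le> B} = space (\<mu> i) - {y. B < \<tau> i * \<bar>y\<bar>}" by auto
    moreover have "{y. B < \<tau> i * \<bar>y\<bar>} \<in> sets (\<mu> i)" by measurable
    ultimately show "emeasure (\<mu> i) {y. \<tau> i * \<bar>y\<bar> \<le> B} = ennreal (1 - q i)"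
      unfolding q_def by (simp add: l.emeasure_eq_measure l.prob_compl del: space_laws)
  qed simp
  also have "\<dots> = ennreal (\<Prod>i\<in>I. 1 - q i)" using q01 by (intro prod_ennreal) simp
  finally have "1 / 2 \<le> (\<Prod>i\<in>I. 1 - q i)" using q01 by (subst (asm) ennreal_le_iff) (auto intro: prod_nonneg)
  also have "\<dots> \<le> (\<Prod>i\<in>I. exp (- q i))"
  proof (rule prod_mono)
    fix i show "0 \<le> 1 - q i \<and> 1 - q i \<le> exp (- q i)"
      using q01[of i] exp_ge_add_one_self[of "- q i"] by simp
  qed
  also have "\<dots> = exp (- (\<Sum>i\<in>I. q i))" using fin_I by (simp add: exp_sum flip: sum_negf)
  finally have "exp (\<Sum>i\<in>I. q i) \<le> 2" by (simp add: exp_minus field_simps)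
  then have "1 + (\<Sum>i\<in>I. q i) \<le> 2" using exp_ge_add_one_self[of "\<Sum>i\<in>I. q i"] by linarith
  then show ?thesis by simp
qed

definition \<zeta> :: "nat \<Rightarrow> real \<Rightarrow> real" where "\<zeta> i y = \<tau> i * \<bar>y\<bar> * indicator {y. \<kappa> < \<tau> i * \<bar>y\<bar>} y"

lemma \<zeta>_nonneg: "0 \<le> \<zeta> i y" unfolding \<zeta>_def by simp

lemma \<zeta>_measurable [measurable]: "\<zeta> i \<in> borel_measurable borel" unfolding \<zeta>_def[abs_def] by measurable

lemma \<kappa>_ge_1: "1 \<le> \<kappa>"
proof -
  have "1 * 1 \<le> B\<^sup>2 * \<alpha> ^ 6" using B_ge \<alpha>_ge_1 by (intro mult_mono one_le_power) auto
  then show ?thesis unfolding \<kappa>_def by simp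
qed

text \<open>Replacing the sum by the larger product of the \<open>1 + \<zeta> i\<close> lets
  independence factor a power of order \<open>p\<close>. Since \<open>\<zeta> i\<close> is either
  zero or above \<open>\<kappa> \<ge> 1\<close>, \<open>large_part\<close> bounds each factor by
  \<open>1 + q i\<close>, and the product stays bounded because the \<open>q i\<close> sum to at
  most 1.\<close>

lemma part_three: "(\<integral>\<^sup>+x. (\<Sum>i\<in>I. \<zeta> i (x i)) powr p \<partial>P) \<le> ennreal (3 powr p)"
proof -
  have single: "(\<integral>\<^sup>+y. (1 + \<zeta> i y) powr p \<partial>\<mu> i) \<le> ennreal (exp (q i))" if "i \<in> I" for i
  proof -
    interpret l: regular_law "\<mu> i" \<alpha> by (rule law)
    define f where "f y = indicator {y. \<kappa> < \<tau> i * \<bar>y\<bar>} y * (2 * \<tau> i * \<bar>y\<bar>) powr p" for y :: real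
    have f0: "0 \<le> f y" for y unfolding f_def by simp
    have f_int: "integrable (\<mu> i) f"
    proof (rule Bochner_Integration.integrable_bound)
      show "integrable (\<mu> i) (\<lambda>y. (2 * \<tau> i) powr p * \<bar>y\<bar> powr p)" using l.moments[of p] p_ge_2 by simp
      show "f \<in> borel_measurable (\<mu> i)" unfolding f_def by measurable
      show "AE y in \<mu> i. norm (f y) \<le> norm ((2 * \<tau> i) powr p * \<bar>y\<bar> powr p)"
        unfolding f_def by (intro always_eventually allI) (auto simp: indicator_def powr_mult)
    qed
    have le: "(1 + \<zeta> i y) powr p \<le> 1 + f y" for y
    proof (cases "\<kappa> < \<tau> i * \<bar>y\<bar>")
      case True
      then have "\<zeta> i y = \<tau> i * \<bar>y\<bar>" by (simp add: \<zeta>_def)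
      with True have "1 + \<zeta> i y \<le> 2 * \<tau> i * \<bar>y\<bar>" using \<kappa>_ge_1 by linarith
      then have "(1 + \<zeta> i y) powr p \<le> (2 * \<tau> i * \<bar>y\<bar>) powr p"
        using p_ge_2 \<zeta>_nonneg[of i y] by (intro powr_mono2) auto
      then show ?thesis using True by (simp add: f_def)
    qed (simp add: \<zeta>_def f_def)
    have "(\<integral>y. f y \<partial>\<mu> i) \<le> q i"
      unfolding f_def q_def \<kappa>_def
      using l.large_part[OF p_ge_2 \<tau>_nonneg, of B i] B_ge \<tau>_hh[OF that] unfolding hh_def by simp
    then have "(\<integral>y. 1 + f y \<partial>\<mu> i) \<le> exp (q i)"
    proof -
      have "(\<integral>y. 1 + f y \<partial>\<mu> i) = 1 + (\<integral>y. f y \<partial>\<mu> i)" using f_int by simp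
      then show ?thesis using exp_ge_add_one_self[of "q i"] \<open>(\<integral>y. f y \<partial>\<mu> i) \<le> q i\<close> by linarith
    qed
    moreover have "(\<integral>\<^sup>+y. (1 + \<zeta> i y) powr p \<partial>\<mu> i) \<le> (\<integral>\<^sup>+y. ennreal (1 + f y) \<partial>\<mu> i)"
      by (intro nn_integral_mono ennreal_leI le)
    moreover have "(\<integral>\<^sup>+y. ennreal (1 + f y) \<partial>\<mu> i) = ennreal (\<integral>y. 1 + f y \<partial>\<mu> i)"
      using f_int f0 by (intro nn_integral_eq_integral) (auto intro!: add_nonneg_nonneg)
    ultimately show ?thesis by (metis ennreal_leI order_trans)
  qed
  have "(\<integral>\<^sup>+x. (\<Sum>i\<in>I. \<zeta> i (x i)) powr p \<partial>P) \<le> (\<integral>\<^sup>+x. (\<Prod>i\<in>I. ennreal ((1 + \<zeta> i (x i)) powr p)) \<partial>P)"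
  proof (rule nn_integral_mono)
    fix x
    have "(\<Sum>i\<in>I. \<zeta> i (x i)) \<le> (\<Prod>i\<in>I. 1 + \<zeta> i (x i))"
      using sum_le_prod_Suc[OF fin_I, of "\<lambda>i. \<zeta> i (x i)"] \<zeta>_nonneg by simp
    then have "(\<Sum>i\<in>I. \<zeta> i (x i)) powr p \<le> (\<Prod>i\<in>I. 1 + \<zeta> i (x i)) powr p"
      using p_ge_2 \<zeta>_nonneg by (intro powr_mono2 sum_nonneg) auto
    also have "\<dots> = (\<Prod>i\<in>I. (1 + \<zeta> i (x i)) powr p)"
      by (rule prod_powr_distrib)
    finally have fin: "(\<Sum>i\<in>I. \<zeta> i (x i)) powr p \<le> (\<Prod>i\<in>I. (1 + \<zeta> i (x i)) powr p)" .
    show "ennreal ((\<Sum>i\<in>I. \<zeta> i (x i)) powr p) \<le> (\<Prod>i\<in>I. ennreal ((1 + \<zeta> i (x i)) powr p))"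
    proof -
      have "(\<Prod>i\<in>I. ennreal ((1 + \<zeta> i (x i)) powr p)) = ennreal (\<Prod>i\<in>I. (1 + \<zeta> i (x i)) powr p)"
        by (rule prod_ennreal) simp
      with ennreal_leI[OF fin] show ?thesis by (simp only:)
    qed
  qed
  also have "\<dots> = (\<Prod>i\<in>I. \<integral>\<^sup>+y. ennreal ((1 + \<zeta> i y) powr p) \<partial>\<mu> i)"
    by (rule product_nn_integral_prod[OF fin_I]) measurable
  also have "\<dots> \<le> (\<Prod>i\<in>I. ennreal (exp (q i)))"
    by (intro prod_mono_ennreal fin_I single)
  also have "\<dots> = ennreal (exp (\<Sum>i\<in>I. q i))" using fin_I by (subst prod_ennreal) (auto simp: exp_sum)
  also have "\<dots> \<le> ennreal (3 powr p)"
  proof (rule ennreal_leI)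
    have "exp (\<Sum>i\<in>I. q i) \<le> exp 1" using sum_q by simp
    also have "\<dots> \<le> 3 powr 1" using exp_le by simp
    also have "\<dots> \<le> 3 powr p" using p_ge_2 by (intro powr_mono) auto
    finally show "exp (\<Sum>i\<in>I. q i) \<le> 3 powr p" .
  qed
  finally show ?thesis .
qed

end

section \<open>Exponential moments of the truncated parts\<close>

context normalized_process
begin

definition Z1 :: "(nat \<Rightarrow> real) \<Rightarrow> real" where "Z1 x = (MAX t\<in>T. \<Sum>i\<in>I. clip (t i * x i / b))"

lemma Max_linear: "(\<integral>x. (MAX t\<in>T. 0 + (\<Sum>i\<in>I. k * t i * x i)) \<partial>P) \<le> k" if "0 \<le> k"
proof -
  have "(MAX t\<in>T. 0 + (\<Sum>i\<in>I. k * t i * x i)) = k * S x" for x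
    unfolding S_def Max_cmult_real[OF fin_T ne_T that, symmetric] by (simp add: sum_distrib_left mult.assoc)
  then have "(\<integral>x. (MAX t\<in>T. 0 + (\<Sum>i\<in>I. k * t i * x i)) \<partial>P) = (\<integral>x. k * S x \<partial>P)" by (simp only:)
  also have "\<dots> \<le> k * 1" using mean that unfolding S_def[symmetric] by (simp add: mult_left_le)
  finally show ?thesis by simp
qed

lemma sum_squares:
  assumes "t \<in> T"
  shows "(\<Sum>i\<in>I. min ((\<bar>t i\<bar> * hh i 2 / b)\<^sup>2) 1) \<le> 4 * p"
proof -
  have "min ((\<bar>t i\<bar> * hh i 2 / b)\<^sup>2) 1 = min ((t i * hh i 2)\<^sup>2) (b\<^sup>2) / b\<^sup>2" for i
    using b_pos by (simp add: power_mult_distrib power_divide min_divide_distrib_right)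
  then have "(\<Sum>i\<in>I. min ((\<bar>t i\<bar> * hh i 2 / b)\<^sup>2) 1) = (\<Sum>i\<in>I. min ((t i * hh i 2)\<^sup>2) (b\<^sup>2)) / b\<^sup>2"
    by (simp add: sum_divide_distrib)
  also have "\<dots> \<le> 4 * p * b\<^sup>2 / b\<^sup>2"
    using p_ge_2 b_pos \<Gamma>_props
    by (intro divide_right_mono weak_squares weak_int weak assms) (auto simp: pb)
  also have "\<dots> = 4 * p" using b_pos by simp
  finally show ?thesis .
qed

text \<open>The penalties add up to at most \<open>c * p\<close> for every index, so removing them
  costs \<open>exp (c * p)\<close>. Tensorization leaves a linear process with mean supremum at most
  \<open>k\<close>, which contributes one further factor \<open>exp p\<close>.\<close>

lemma tensorized_bound:
  fixes a :: "(nat \<Rightarrow> real) \<Rightarrow> nat \<Rightarrow> real \<Rightarrow> real"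
  assumes a: "\<And>t i. t \<in> T \<Longrightarrow> i \<in> I \<Longrightarrow> a t i \<in> borel_measurable borel"
    and k: "0 \<le> k" "k \<le> p"
    and \<pi>: "\<And>t. t \<in> T \<Longrightarrow> (\<Sum>i\<in>I. \<pi> t i) \<le> c * p"
    and one: "\<And>i (Q :: (nat \<Rightarrow> real) measure) v. i \<in> I \<Longrightarrow> sup_functional Q T v \<Longrightarrow>
       (\<integral>\<^sup>+x. exp (sup_functional.L Q T v (\<lambda>t. a t i x - \<pi> t i)) \<partial>\<mu> i)
       \<le> exp (\<integral>x. sup_functional.L Q T v (\<lambda>t. k * t i * x) \<partial>\<mu> i)"
  shows "(\<integral>\<^sup>+x. exp (MAX t\<in>T. \<Sum>i\<in>I. a t i (x i)) \<partial>P) \<le> exp ((c + 1) * p)"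
proof -
  let ?Y = "\<lambda>x. MAX t\<in>T. 0 + (\<Sum>i\<in>I. a t i (x i) - \<pi> t i)"
  have le: "(MAX t\<in>T. \<Sum>i\<in>I. a t i (x i)) \<le> ?Y x + c * p" for x
  proof -
    have "(\<Sum>i\<in>I. a t i (x i)) \<le> ?Y x + c * p" if t: "t \<in> T" for t
    proof -
      have "0 + (\<Sum>i\<in>I. a t i (x i) - \<pi> t i) \<le> ?Y x" using t fin_T by (intro Max_ge) auto
      then show ?thesis using \<pi>[OF t] by (simp add: sum_subtractf)
    qed
    then show ?thesis using fin_T ne_T by simp
  qed
  have meas: "(\<lambda>x. ennreal (exp (?Y x))) \<in> borel_measurable P"
  proof (intro measurable_compose[OF _ measurable_ennreal] measurable_compose[OF _ borel_measurable_exp]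
      borel_measurable_Max fin_T borel_measurable_add borel_measurable_const borel_measurable_sum borel_measurable_diff)
    fix t i assume "t \<in> T" "i \<in> I"
    then show "(\<lambda>x. a t i (x i)) \<in> borel_measurable P"
      using measurable_compose[OF component_measurable a] by blast
  qed
  have "(\<integral>\<^sup>+x. exp (MAX t\<in>T. \<Sum>i\<in>I. a t i (x i)) \<partial>P) \<le> (\<integral>\<^sup>+x. ennreal (exp (c * p)) * ennreal (exp (?Y x)) \<partial>P)"
  proof (intro nn_integral_mono)
    fix x
    have "exp (MAX t\<in>T. \<Sum>i\<in>I. a t i (x i)) \<le> exp (c * p) * exp (?Y x)"
      using le[of x] by (simp add: add.commute flip: exp_add)
    then show "ennreal (exp (MAX t\<in>T. \<Sum>i\<in>I. a t i (x i))) \<le> ennreal (exp (c * p)) * ennreal (exp (?Y x))"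
      by (simp add: ennreal_leI flip: ennreal_mult')
  qed
  also have "\<dots> = ennreal (exp (c * p)) * (\<integral>\<^sup>+x. exp (?Y x) \<partial>P)"
    by (rule nn_integral_cmult[OF meas])
  also have "(\<integral>\<^sup>+x. exp (?Y x) \<partial>P) \<le> exp (\<integral>x. (MAX t\<in>T. 0 + (\<Sum>i\<in>I. k * t i * x i)) \<partial>P)"
  proof (rule exp_sup_tensorization[OF fin_I fin_T ne_T, where b = "\<lambda>t i y. k * t i * y"])
    show "(\<lambda>y. a t i y - \<pi> t i) \<in> borel_measurable borel" if "t \<in> T" "i \<in> I" for t i
      using a[OF that] by simp
    show "integrable (\<mu> i) (\<lambda>y. k * t i * y)" for t i by (rule integrable_lin)
  qed (rule one)
  also have "\<dots> \<le> exp p" using Max_linear[OF k(1)] k(2) by (intro ennreal_leI) simp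
  finally have "(\<integral>\<^sup>+x. exp (MAX t\<in>T. \<Sum>i\<in>I. a t i (x i)) \<partial>P) \<le> ennreal (exp (c * p)) * ennreal (exp p)"
    by (simp add: mult_left_mono)
  also have "\<dots> = exp ((c + 1) * p)" by (simp add: distrib_right exp_add flip: ennreal_mult')
  finally show ?thesis .
qed

lemma part_one: "(\<integral>\<^sup>+x. exp (Z1 x) \<partial>P) \<le> exp (5 * p)"
proof -
  have "(\<integral>\<^sup>+x. exp (Z1 x) \<partial>P) \<le> exp ((4 + 1) * p)"
    unfolding Z1_def
  proof (rule tensorized_bound[where k = "2 * (3 / b)" and \<pi> = "\<lambda>t i. 4 * (\<integral>x. (clip (t i * x / b))\<^sup>2 \<partial>\<mu> i)"])
    show "(\<lambda>y. clip (t i * y / b)) \<in> borel_measurable borel" for t i by measurable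
    show "0 \<le> 2 * (3 / b)" using b_pos by simp
    show "2 * (3 / b) \<le> p" using b_pos pb \<Gamma>_props(1) by (simp add: field_simps)
    show "(\<Sum>i\<in>I. 4 * (\<integral>x. (clip (t i * x / b))\<^sup>2 \<partial>\<mu> i)) \<le> 4 * p" if "t \<in> T" for t
    proof -
      have "(\<Sum>i\<in>I. 4 * (\<integral>x. (clip (t i * x / b))\<^sup>2 \<partial>\<mu> i)) \<le> (\<Sum>i\<in>I. min ((\<bar>t i\<bar> * hh i 2 / b)\<^sup>2) 1)"
        unfolding hh_def by (intro sum_mono regular_law.signed_mean_bound[OF law b_pos])
      also have "\<dots> \<le> 4 * p" by (rule sum_squares[OF that])
      finally show ?thesis .
    qed
    show "(\<integral>\<^sup>+x. exp (sup_functional.L Q T v (\<lambda>t. clip (t i * x / b) - 4 * (\<integral>x. (clip (t i * x / b))\<^sup>2 \<partial>\<mu> i))) \<partial>\<mu> i)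
       \<le> exp (\<integral>x. sup_functional.L Q T v (\<lambda>t. 2 * (3 / b) * t i * x) \<partial>\<mu> i)"
      if "sup_functional Q T v" for i and Q :: "(nat \<Rightarrow> real) measure" and v
      by (rule regular_law.exp_signed_centered[OF law that b_pos, where \<theta> = "\<lambda>t. t i"])
  qed
  then show ?thesis by simp
qed

definition R :: "nat \<Rightarrow> real \<Rightarrow> nat \<Rightarrow> real"
  where "R i s = regularized (regular_law.u (\<mu> i) \<alpha> b) (1 / \<alpha>) M \<bar>s\<bar>"

definition rk :: "nat \<Rightarrow> nat \<Rightarrow> real \<Rightarrow> nat"
  where "rk N i = regular_law.tail_rank (\<mu> i) \<alpha> N"

text \<open>The value at rank 0 is subtracted to match \<open>exp_positive\<close>;
  \<open>truncated_sum\<close> adds it back with a deterministic bound.\<close>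

definition Z2 :: "nat \<Rightarrow> (nat \<Rightarrow> real) \<Rightarrow> real"
  where "Z2 N x = (MAX t\<in>T. \<Sum>i\<in>I. (R i (t i) (rk N i (x i)) - R i (t i) 0) / 4)"

lemma threshold: "64 * \<alpha> ^ 4 < b / (2 * A * \<alpha>) * p"
proof -
  have "64 * \<alpha> ^ 4 * (2 * A * \<alpha>) = 1024 * \<alpha> ^ 9"
    unfolding A_def by (simp add: eval_nat_numeral)
  also have "\<dots> < p * b" unfolding pb by (rule \<Gamma>_props)
  finally show ?thesis using A_ge \<alpha>_ge_1 by (simp add: field_simps)
qed

lemma weak_sum_threshold:
  assumes t: "t \<in> T" and J: "J \<subseteq> I" and r: "\<And>i. i \<in> J \<Longrightarrow> 2 \<le> r i" "\<And>i. i \<in> J \<Longrightarrow> r i \<le> p"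
    and large: "\<And>i. i \<in> J \<Longrightarrow> b / (2 * A * \<alpha>) * r i \<le> \<bar>t i\<bar> * hh i (r i)"
  shows "(\<Sum>i\<in>J. \<bar>t i\<bar> * hh i (r i)) \<le> 64 * \<alpha> ^ 4"
  using p_ge_2 by (intro weak_sum_large[OF J _ r large threshold weak_int weak[OF t]]) auto

lemma part_two: "(\<integral>\<^sup>+x. exp (Z2 N x) \<partial>P) \<le> exp ((512 * \<alpha> ^ 11 + 2) * p)"
proof -
  define f where "f t i y = (R i (t i) (rk N i (4 * A * y)) - R i (t i) 0) / 2" for t :: "nat \<Rightarrow> real" and i y
  have bounds: "(\<integral>y. f t i y \<partial>\<mu> i) \<le> 2 * A\<^sup>2 * \<alpha> ^ 3 * (\<bar>t i\<bar> * hh i 2 / b)\<^sup>2"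
    "(\<integral>y. f t i y \<partial>\<mu> i) \<le> 2 * A * \<alpha> * (\<bar>t i\<bar> * hh i 2 / b)" for t i
    unfolding f_def R_def rk_def hh_def A_eq[symmetric]
    by (rule regular_law.positive_mean_bounds[OF law b_pos M_nonneg])+
  have sum: "(\<Sum>i\<in>I. \<integral>y. f t i y \<partial>\<mu> i) \<le> (512 * \<alpha> ^ 11 + 1) * p" if t: "t \<in> T" for t
  proof -
    \<comment> \<open>Small coefficients use the quadratic mean bound and are paid for by the capped
      squares; those in \<open>J\<close> use the linear bound and are paid for by the weak sum at
      order 2.\<close>
    define J where "J = {i \<in> I. b < \<bar>t i\<bar> * hh i 2}"
    have "(\<integral>y. f t i y \<partial>\<mu> i) \<le> 2 * A\<^sup>2 * \<alpha> ^ 3 * min ((\<bar>t i\<bar> * hh i 2 / b)\<^sup>2) 1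
        + (if i \<in> J then 2 * A * \<alpha> * (\<bar>t i\<bar> * hh i 2 / b) else 0)" if i: "i \<in> I" for i
    proof (cases "i \<in> J")
      case True
      have "0 \<le> 2 * A\<^sup>2 * \<alpha> ^ 3 * min ((\<bar>t i\<bar> * hh i 2 / b)\<^sup>2) 1" using \<alpha>_ge_1 by simp
      moreover have "(\<integral>y. f t i y \<partial>\<mu> i) \<le> 2 * A * \<alpha> * (\<bar>t i\<bar> * hh i 2 / b)" by (rule bounds(2))
      ultimately have "(\<integral>y. f t i y \<partial>\<mu> i) \<le> 2 * A\<^sup>2 * \<alpha> ^ 3 * min ((\<bar>t i\<bar> * hh i 2 / b)\<^sup>2) 1
        + 2 * A * \<alpha> * (\<bar>t i\<bar> * hh i 2 / b)" by (rule add_increasing)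
      then show ?thesis by (simp only: True if_True)
    next
      case False
      then have "\<bar>t i\<bar> * hh i 2 / b \<le> 1" using i b_pos unfolding J_def by simp
      then have "(\<bar>t i\<bar> * hh i 2 / b)\<^sup>2 \<le> 1" using b_pos by (intro power_le_one) auto
      then have "min ((\<bar>t i\<bar> * hh i 2 / b)\<^sup>2) 1 = (\<bar>t i\<bar> * hh i 2 / b)\<^sup>2" by (simp only: min_absorb1)
      moreover have "(\<integral>y. f t i y \<partial>\<mu> i) \<le> 2 * A\<^sup>2 * \<alpha> ^ 3 * (\<bar>t i\<bar> * hh i 2 / b)\<^sup>2" by (rule bounds(1))
      ultimately show ?thesis using False by simp
    qed
    then have "(\<Sum>i\<in>I. \<integral>y. f t i y \<partial>\<mu> i) \<le> (\<Sum>i\<in>I. 2 * A\<^sup>2 * \<alpha> ^ 3 * min ((\<bar>t i\<bar> * hh i 2 / b)\<^sup>2) 1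
        + (if i \<in> J then 2 * A * \<alpha> * (\<bar>t i\<bar> * hh i 2 / b) else 0))" by (rule sum_mono)
    also have "\<dots> = 2 * A\<^sup>2 * \<alpha> ^ 3 * (\<Sum>i\<in>I. min ((\<bar>t i\<bar> * hh i 2 / b)\<^sup>2) 1)
        + (\<Sum>i\<in>J. 2 * A * \<alpha> * (\<bar>t i\<bar> * hh i 2 / b))"
    proof -
      have "I \<inter> J = J" unfolding J_def by auto
      then show ?thesis using fin_I by (simp add: sum.distrib sum_distrib_left sum.If_cases)
    qed
    also have "(\<Sum>i\<in>J. 2 * A * \<alpha> * (\<bar>t i\<bar> * hh i 2 / b)) = 2 * A * \<alpha> / b * (\<Sum>i\<in>J. \<bar>t i\<bar> * hh i 2)"
      by (simp add: sum_distrib_left)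
    also have "2 * A * \<alpha> / b * (\<Sum>i\<in>J. \<bar>t i\<bar> * hh i 2) \<le> 2 * A * \<alpha> / b * (64 * \<alpha> ^ 4)"
    proof (intro mult_left_mono weak_sum_threshold[OF t])
      show "J \<subseteq> I" unfolding J_def by auto
      show "b / (2 * A * \<alpha>) * 2 \<le> \<bar>t i\<bar> * hh i 2" if "i \<in> J" for i
      proof -
        have "1 * 1 \<le> A * \<alpha>" using A_ge \<alpha>_ge_1 by (intro mult_mono) auto
        then have "b / (A * \<alpha>) \<le> b / 1" using b_pos by (intro divide_left_mono) auto
        also have "\<dots> \<le> \<bar>t i\<bar> * hh i 2" using that unfolding J_def by simp
        finally show ?thesis by simp
      qed
      show "0 \<le> 2 * A * \<alpha> / b" using A_ge \<alpha>_ge_1 b_pos by simp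
    qed (use p_ge_2 in auto)
    also have "2 * A * \<alpha> / b * (64 * \<alpha> ^ 4) \<le> p"
      using threshold A_ge \<alpha>_ge_1 b_pos by (simp add: field_simps)
    also have "2 * A\<^sup>2 * \<alpha> ^ 3 * (\<Sum>i\<in>I. min ((\<bar>t i\<bar> * hh i 2 / b)\<^sup>2) 1) \<le> 2 * A\<^sup>2 * \<alpha> ^ 3 * (4 * p)"
      using \<alpha>_ge_1 by (intro mult_left_mono sum_squares[OF t]) auto
    also have "2 * A\<^sup>2 * \<alpha> ^ 3 * (4 * p) = 512 * \<alpha> ^ 11 * p"
      unfolding A_def by (simp add: eval_nat_numeral)
    finally show ?thesis by (simp add: distrib_right)
  qed
  have "(\<integral>\<^sup>+x. exp (Z2 N x) \<partial>P) \<le> exp (((512 * \<alpha> ^ 11 + 1) + 1) * p)"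
    unfolding Z2_def
  proof (rule tensorized_bound[where k = "2 * (4 * A * \<alpha> / b)" and \<pi> = "\<lambda>t i. \<integral>y. f t i y \<partial>\<mu> i"])
    show "(\<lambda>y. (R i (t i) (rk N i y) - R i (t i) 0) / 4) \<in> borel_measurable borel" for t i
      unfolding rk_def using regular_law.rank_measurable[OF law[of i], of "\<lambda>k. (R i (t i) k - R i (t i) 0) / 4" N 1]
      by simp
    show "0 \<le> 2 * (4 * A * \<alpha> / b)" using b_pos A_ge \<alpha>_ge_1 by simp
    have "8 * A * \<alpha> * 1 \<le> 8 * A * \<alpha> * (16 * \<alpha> ^ 4)"
    proof (rule mult_left_mono)
      show "1 \<le> 16 * \<alpha> ^ 4" using alpha_powers[of 4] by linarith
    qed (use A_ge \<alpha>_ge_1 in simp)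
    also have "\<dots> = 1024 * \<alpha> ^ 9" unfolding A_def by (simp add: eval_nat_numeral)
    also have "\<dots> \<le> p * b" unfolding pb using \<Gamma>_props by simp
    finally show "2 * (4 * A * \<alpha> / b) \<le> p" using b_pos by (simp add: field_simps)
    show "(\<integral>\<^sup>+x. exp (sup_functional.L Q T v (\<lambda>t. (R i (t i) (rk N i x) - R i (t i) 0) / 4 - (\<integral>y. f t i y \<partial>\<mu> i))) \<partial>\<mu> i)
       \<le> exp (\<integral>x. sup_functional.L Q T v (\<lambda>t. 2 * (4 * A * \<alpha> / b) * t i * x) \<partial>\<mu> i)"
      if "sup_functional Q T v" for i and Q :: "(nat \<Rightarrow> real) measure" and v
      unfolding f_def R_def rk_def A_eq[symmetric]
      by (rule regular_law.exp_positive_centered[OF law that b_pos M_nonneg, where \<theta> = "\<lambda>t. t i" and N = N])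
  qed (rule sum)
  then show ?thesis by (simp only: add.assoc one_add_one)
qed

text \<open>The point \<open>x\<close> is fixed and its ranks prescribe the orders
  \<open>k i + 2\<close>. The weak-moment bound holds for every choice of orders, so no union over
  rank patterns is taken. Where regularization loses more than a factor \<open>\<alpha>\<close>, the
  coordinate is large for its own order, which is what \<open>weak_sum_threshold\<close> asks
  for.\<close>

lemma truncated_sum:
  assumes t: "t \<in> T" and good: "\<And>i. i \<in> I \<Longrightarrow> \<bar>x i\<bar> \<le> A * hh i (real N + 2)"
  shows "(\<Sum>i\<in>I. min (max (\<bar>t i * x i\<bar> / b - 1) 0) M) \<le> 4 * \<alpha> * Z2 N x + 2 * A * \<alpha> * (64 * \<alpha> ^ 4) / b"
proof -
  define k where "k i = rk N i (x i)" for i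
  define D where "D i = min (max (\<bar>t i\<bar> * (A * hh i (real (k i) + 2) / b) - 1) 0) M" for i
  define J where "J = {i \<in> I. \<alpha> * real (k i) / 2 < D i}"
  have c0: "0 < A * \<alpha>" using A_ge \<alpha>_ge_1 by simp
  have step: "min (max (\<bar>t i * x i\<bar> / b - 1) 0) M \<le> \<alpha> * R i (t i) (k i) + (if i \<in> J then D i else 0)"
    if i: "i \<in> I" for i
  proof -
    interpret l: regular_law "\<mu> i" \<alpha> by (rule law)
    interpret G: regularization "l.u b" "1 / \<alpha>" M
      by unfold_locales (use l.u_props(1,2)[OF b_pos] M_nonneg in auto)
    have u: "l.u b j = A * hh i (real j + 2) / b" for j
      unfolding l.u_def hh_def A_eq by simp
    have "\<bar>x i\<bar> \<le> A * hh i (real (k i) + 2)"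
    proof (cases "k i < N")
      case True
      then show ?thesis
        using l.rank_iff[OF True, of "x i"] unfolding k_def rk_def hh_def A_eq by simp
    next
      case False
      then have "k i = N" using l.rank_le[of N "x i"] unfolding k_def rk_def by simp
      then show ?thesis using good[OF i] by simp
    qed
    then have "\<bar>t i\<bar> * \<bar>x i\<bar> / b \<le> \<bar>t i\<bar> * (A * hh i (real (k i) + 2)) / b"
      using b_pos by (intro divide_right_mono mult_left_mono) auto
    then have "min (max (\<bar>t i * x i\<bar> / b - 1) 0) M \<le> D i"
      unfolding D_def by (intro min.mono max.mono) (auto simp: abs_mult)
    moreover have "D i \<le> \<alpha> * R i (t i) (k i) \<or> \<alpha> * real (k i) / 2 < D i"
      using G.regularized_lower[OF _ \<alpha>_ge_1 refl l.u_props(3)[OF b_pos], of "\<bar>t i\<bar>" "k i"]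
      unfolding D_def R_def u by simp
    moreover have "0 \<le> \<alpha> * R i (t i) (k i)"
      unfolding R_def using G.regularized_nonneg \<alpha>_ge_1 by simp
    ultimately show ?thesis using i unfolding J_def by auto
  qed
  have JI: "J \<subseteq> I" unfolding J_def by auto
  \<comment> \<open>As \<open>p \<ge> 2\<close>, the assumption forces \<open>k i \<ge> 1\<close>,
    hence \<open>p \<le> 3 * k i\<close>, while the cap \<open>M\<close> is at most
    \<open>p / 6\<close>. Consequently the orders of the coordinates in \<open>J\<close> do not
    exceed \<open>p\<close>.\<close>
  have D_small: "D i \<le> \<alpha> * real (k i) / 2" if "p < real (k i) + 2" for i
  proof -
    have "1 \<le> k i" using that p_ge_2 by (cases "k i") auto
    then have "p \<le> 3 * real (k i)" using that by linarith
    have "D i \<le> M" unfolding D_def by simp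
    also have "M = \<kappa> * p / \<Gamma>" unfolding M_def b_def by simp
    also have "\<dots> \<le> \<kappa> * (3 * real (k i)) / (6 * \<kappa>)"
      using \<Gamma>_props \<kappa>_pos p_ge_2 \<open>p \<le> 3 * real (k i)\<close> by (intro frac_le mult_left_mono) auto
    also have "\<dots> = 1 * real (k i) / 2" using \<kappa>_pos by simp
    also have "\<dots> \<le> \<alpha> * real (k i) / 2" using \<alpha>_ge_1 by (intro divide_right_mono mult_right_mono) auto
    finally show ?thesis .
  qed
  \<comment> \<open>The subtracted 1 in \<open>D i\<close> turns the lower bound
    \<open>k i / 2\<close> into \<open>(k i + 2) / 2\<close>, which matches the order
    \<open>k i + 2\<close> of the norm.\<close>
  have J_large: "(real (k i) + 2) / 2 \<le> \<bar>t i\<bar> * (A * hh i (real (k i) + 2) / b)" "D i \<le> \<bar>t i\<bar> * (A * hh i (real (k i) + 2) / b)"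
    if "i \<in> J" for i
  proof -
    have "1 * real (k i) / 2 \<le> \<alpha> * real (k i) / 2" using \<alpha>_ge_1 by (intro divide_right_mono mult_right_mono) auto
    then have "real (k i) / 2 < D i" using that unfolding J_def by simp
    moreover have "D i \<le> max (\<bar>t i\<bar> * (A * hh i (real (k i) + 2) / b) - 1) 0" unfolding D_def by simp
    moreover have "0 \<le> real (k i) / 2" by simp
    ultimately have *: "real (k i) / 2 < D i" "D i \<le> \<bar>t i\<bar> * (A * hh i (real (k i) + 2) / b) - 1"
      by (auto simp: max_def split: if_splits)
    then show "(real (k i) + 2) / 2 \<le> \<bar>t i\<bar> * (A * hh i (real (k i) + 2) / b)"
      "D i \<le> \<bar>t i\<bar> * (A * hh i (real (k i) + 2) / b)"
    proof -
      have "m / 2 < d \<Longrightarrow> d \<le> X - 1 \<Longrightarrow> (m + 2) / 2 \<le> X \<and> d \<le> X" for m d X :: real by auto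
      from this[OF *] show "(real (k i) + 2) / 2 \<le> \<bar>t i\<bar> * (A * hh i (real (k i) + 2) / b)"
        "D i \<le> \<bar>t i\<bar> * (A * hh i (real (k i) + 2) / b)" by blast+
    qed
  qed
  have "(\<Sum>i\<in>J. D i) \<le> (\<Sum>i\<in>J. A / b * (\<bar>t i\<bar> * hh i (real (k i) + 2)))"
    using J_large(2) by (intro sum_mono) (simp add: ac_simps)
  also have "\<dots> = A / b * (\<Sum>i\<in>J. \<bar>t i\<bar> * hh i (real (k i) + 2))" by (rule sum_distrib_left[symmetric])
  also have "\<dots> \<le> A / b * (64 * \<alpha> ^ 4)"
  proof (intro mult_left_mono weak_sum_threshold[OF t JI])
    show "real (k i) + 2 \<le> p" if "i \<in> J" for i
      using D_small[of i] that unfolding J_def by force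
    show "b / (2 * A * \<alpha>) * (real (k i) + 2) \<le> \<bar>t i\<bar> * hh i (real (k i) + 2)" if "i \<in> J" for i
    proof -
      have "b / (2 * A * \<alpha>) * (real (k i) + 2) = b / (A * \<alpha>) * ((real (k i) + 2) / 2)" by simp
      also have "\<dots> \<le> b / (A * \<alpha>) * (\<bar>t i\<bar> * (A * hh i (real (k i) + 2) / b))"
        using J_large(1)[OF that] b_pos c0 by (intro mult_left_mono) auto
      also have "\<dots> = \<bar>t i\<bar> * hh i (real (k i) + 2) / \<alpha>" using b_pos A_ge by simp
      also have "\<dots> \<le> \<bar>t i\<bar> * hh i (real (k i) + 2) / 1"
        using \<alpha>_ge_1 by (intro divide_left_mono) auto
      finally show ?thesis by simp
    qed
  qed (use A_ge b_pos in auto)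
  finally have sumD: "(\<Sum>i\<in>J. D i) \<le> A / b * (64 * \<alpha> ^ 4)" .
  \<comment> \<open>The value at rank 0 vanishes unless the coordinate passes this threshold, which
    is \<open>b / (2 * A * \<alpha>)\<close> times the order 2. The weak sum therefore bounds these
    values too.\<close>
  define K where "K = {i \<in> I. b / (A * \<alpha>) \<le> \<bar>t i\<bar> * hh i 2}"
  have R0: "R i (t i) 0 \<le> (if i \<in> K then A / b * (\<bar>t i\<bar> * hh i 2) else 0)" if i: "i \<in> I" for i
  proof -
    interpret l: regular_law "\<mu> i" \<alpha> by (rule law)
    interpret G: regularization "l.u b" "1 / \<alpha>" M
      by unfold_locales (use l.u_props(1,2)[OF b_pos] M_nonneg in auto)
    have u: "l.u b 0 = A * hh i 2 / b" unfolding l.u_def hh_def A_eq by simp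
    have eq: "R i (t i) 0 = min (max (\<bar>t i\<bar> * (A * hh i 2 / b) - 1 / \<alpha>) 0) M"
      unfolding R_def G.regularized_zero u ..
    show ?thesis
    proof (cases "i \<in> K")
      case True
      have "0 \<le> \<bar>t i\<bar> * (A * hh i 2 / b)" using A_ge b_pos by simp
      moreover have "0 \<le> 1 / \<alpha>" using \<alpha>_ge_1 by simp
      ultimately have "max (\<bar>t i\<bar> * (A * hh i 2 / b) - 1 / \<alpha>) 0 \<le> \<bar>t i\<bar> * (A * hh i 2 / b)" by simp
      moreover have "R i (t i) 0 \<le> max (\<bar>t i\<bar> * (A * hh i 2 / b) - 1 / \<alpha>) 0"
        unfolding eq by (rule min.cobounded1)
      ultimately have "R i (t i) 0 \<le> \<bar>t i\<bar> * (A * hh i 2 / b)" by (rule order_trans[rotated])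
      then show ?thesis using True by (simp add: ac_simps)
    next
      case False
      then have "\<bar>t i\<bar> * hh i 2 \<le> b / (A * \<alpha>)" using i unfolding K_def by simp
      then have "A / b * (\<bar>t i\<bar> * hh i 2) \<le> A / b * (b / (A * \<alpha>))" using A_ge b_pos by (intro mult_left_mono) auto
      also have "\<dots> = 1 / \<alpha>" using A_ge b_pos by simp
      finally have "max (\<bar>t i\<bar> * (A * hh i 2 / b) - 1 / \<alpha>) 0 = 0" by (simp add: ac_simps)
      then show ?thesis unfolding eq using False M_nonneg by simp
    qed
  qed
  have "(\<Sum>i\<in>I. R i (t i) 0) \<le> (\<Sum>i\<in>I. if i \<in> K then A / b * (\<bar>t i\<bar> * hh i 2) else 0)"
    by (intro sum_mono R0)
  also have "\<dots> = A / b * (\<Sum>i\<in>K. \<bar>t i\<bar> * hh i 2)"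
  proof -
    have "I \<inter> K = K" unfolding K_def by auto
    then show ?thesis using fin_I by (simp add: sum.If_cases sum_distrib_left)
  qed
  also have "\<dots> \<le> A / b * (64 * \<alpha> ^ 4)"
    using A_ge b_pos p_ge_2 by (intro mult_left_mono weak_sum_threshold[OF t]) (auto simp: K_def)
  finally have sumR0: "(\<Sum>i\<in>I. R i (t i) 0) \<le> A / b * (64 * \<alpha> ^ 4)" .
  have "(\<Sum>i\<in>I. min (max (\<bar>t i * x i\<bar> / b - 1) 0) M)
      \<le> (\<Sum>i\<in>I. \<alpha> * R i (t i) (k i) + (if i \<in> J then D i else 0))" by (intro sum_mono step)
  also have "\<dots> = \<alpha> * (\<Sum>i\<in>I. R i (t i) (k i)) + (\<Sum>i\<in>J. D i)"
  proof -
    have "I \<inter> J = J" unfolding J_def by auto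
    then show ?thesis using fin_I by (simp add: sum.distrib sum.If_cases sum_distrib_left)
  qed
  also have "(\<Sum>i\<in>I. R i (t i) (k i)) = 4 * (\<Sum>i\<in>I. (R i (t i) (k i) - R i (t i) 0) / 4) + (\<Sum>i\<in>I. R i (t i) 0)"
  proof -
    have "r = 4 * ((r - s) / 4) + s" for r s :: real by (simp add: field_simps)
    then show ?thesis unfolding sum_divide_distrib[symmetric] sum_subtractf by blast
  qed
  finally have le: "(\<Sum>i\<in>I. min (max (\<bar>t i * x i\<bar> / b - 1) 0) M)
      \<le> \<alpha> * (4 * (\<Sum>i\<in>I. (R i (t i) (k i) - R i (t i) 0) / 4) + (\<Sum>i\<in>I. R i (t i) 0)) + (\<Sum>i\<in>J. D i)" .
  have le2: "(\<Sum>i\<in>I. (R i (t i) (k i) - R i (t i) 0) / 4) \<le> Z2 N x"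
    unfolding Z2_def k_def using t fin_T by (intro Max_ge) auto
  have "(\<Sum>i\<in>I. min (max (\<bar>t i * x i\<bar> / b - 1) 0) M)
      \<le> \<alpha> * (4 * Z2 N x + A / b * (64 * \<alpha> ^ 4)) + \<alpha> * (A / b * (64 * \<alpha> ^ 4))"
  proof -
    have "1 * (A / b * (64 * \<alpha> ^ 4)) \<le> \<alpha> * (A / b * (64 * \<alpha> ^ 4))"
      using \<alpha>_ge_1 A_ge b_pos by (intro mult_right_mono) auto
    then have "(\<Sum>i\<in>J. D i) \<le> \<alpha> * (A / b * (64 * \<alpha> ^ 4))" using sumD by simp
    moreover have "\<alpha> * (4 * (\<Sum>i\<in>I. (R i (t i) (k i) - R i (t i) 0) / 4) + (\<Sum>i\<in>I. R i (t i) 0))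
        \<le> \<alpha> * (4 * Z2 N x + A / b * (64 * \<alpha> ^ 4))"
      using le2 sumR0 \<alpha>_ge_1 by (intro mult_left_mono add_mono) auto
    ultimately show ?thesis using le by linarith
  qed
  then show ?thesis by (simp add: algebra_simps)
qed

end

section \<open>Splitting a coordinate and assembling the three parts\<close>

lemma clip_decomposition:
  fixes u b \<kappa> :: real
  assumes b: "0 < b" and \<kappa>: "0 \<le> \<kappa>"
  shows "\<bar>u - 2 * b * clip (u / b)\<bar> \<le> b * min (max (\<bar>u\<bar> / b - 1) 0) (\<kappa> / b) + \<bar>u\<bar> * indicator {\<kappa><..} \<bar>u\<bar>"
proof -
  have c: "2 * b * clip (u / b) = max (- b) (min b u)"
  proof -
    consider "u \<le> - b" | "- b < u" "u < b" | "b \<le> u" by linarith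
    then show ?thesis
    proof cases
      case 1
      then have "u / b \<le> - 1" using b by (simp add: field_simps)
      then have "clip (u / b) = - 1 / 2" unfolding clip_def by simp
      then show ?thesis using 1 b by simp
    next
      case 2
      then have "- 1 < u / b" "u / b < 1" using b by (simp_all add: field_simps)
      then have "clip (u / b) = u / b / 2" unfolding clip_def by simp
      then show ?thesis using 2 b by simp
    next
      case 3
      then have "1 \<le> u / b" using b by (simp add: field_simps)
      then have "clip (u / b) = 1 / 2" unfolding clip_def by simp
      then show ?thesis using 3 b by simp
    qed
  qed
  have e: "\<bar>u - max (- b) (min b u)\<bar> = max (\<bar>u\<bar> - b) 0" using b by (auto simp: max_def min_def abs_if)
  have m0: "0 \<le> b * min (max (\<bar>u\<bar> / b - 1) 0) (\<kappa> / b)"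
    using b \<kappa> by (intro mult_nonneg_nonneg min.boundedI) auto
  show ?thesis
  proof (cases "\<bar>u\<bar> \<le> \<kappa>")
    case True
    have "b * max (\<bar>u\<bar> / b - 1) 0 = max (\<bar>u\<bar> - b) 0"
      using b by (simp add: max_mult_distrib_left right_diff_distrib)
    moreover have "max (\<bar>u\<bar> / b - 1) 0 \<le> \<kappa> / b"
    proof (rule max.boundedI)
      have "\<bar>u\<bar> / b \<le> \<kappa> / b" using True b by (intro divide_right_mono) auto
      then show "\<bar>u\<bar> / b - 1 \<le> \<kappa> / b" by simp
      show "0 \<le> \<kappa> / b" using \<kappa> b by simp
    qed
    ultimately have "b * min (max (\<bar>u\<bar> / b - 1) 0) (\<kappa> / b) = max (\<bar>u\<bar> - b) 0"
      by (simp only: min_absorb1)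
    then show ?thesis unfolding c e by simp
  next
    case False
    then have "max (\<bar>u\<bar> - b) 0 \<le> \<bar>u\<bar> * indicator {\<kappa><..} \<bar>u\<bar>" using b by simp
    then show ?thesis unfolding c e using m0 by linarith
  qed
qed

lemma nn_integral_powr_sum_five:
  fixes f1 f2 f3 f4 f5 S :: "'a \<Rightarrow> real"
  assumes meas [measurable]: "f1 \<in> borel_measurable M" "f2 \<in> borel_measurable M" "f3 \<in> borel_measurable M"
      "f4 \<in> borel_measurable M" "f5 \<in> borel_measurable M"
    and nonneg: "\<And>x. 0 \<le> f1 x" "\<And>x. 0 \<le> f2 x" "\<And>x. 0 \<le> f3 x" "\<And>x. 0 \<le> f4 x" "\<And>x. 0 \<le> f5 x" "\<And>x. 0 \<le> S x"
    and le: "\<And>x. x \<in> space M \<Longrightarrow> S x \<le> f1 x + f2 x + f3 x + f4 x + f5 x"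
    and p: "1 \<le> p" and k: "0 \<le> k"
    and bounds: "(\<integral>\<^sup>+x. f1 x powr p \<partial>M) \<le> k powr p" "(\<integral>\<^sup>+x. f2 x powr p \<partial>M) \<le> k powr p"
      "(\<integral>\<^sup>+x. f3 x powr p \<partial>M) \<le> k powr p" "(\<integral>\<^sup>+x. f4 x powr p \<partial>M) \<le> k powr p"
      "(\<integral>\<^sup>+x. f5 x powr p \<partial>M) \<le> k powr p"
  shows "(\<integral>\<^sup>+x. S x powr p \<partial>M) \<le> (25 * k) powr p"
proof -
  have "(\<integral>\<^sup>+x. S x powr p \<partial>M)
    \<le> (\<integral>\<^sup>+x. ennreal (5 powr p) * (ennreal (f1 x powr p) + ennreal (f2 x powr p) + ennreal (f3 x powr p)
          + ennreal (f4 x powr p) + ennreal (f5 x powr p)) \<partial>M)"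
  proof (rule nn_integral_mono)
    fix x assume "x \<in> space M"
    then have "S x powr p \<le> (f1 x + f2 x + f3 x + f4 x + f5 x) powr p"
      using nonneg p by (intro powr_mono2 le) auto
    also have "\<dots> \<le> 5 powr p * (f1 x powr p + f2 x powr p + f3 x powr p + f4 x powr p + f5 x powr p)"
      using nonneg p by (intro powr_sum_le_five) auto
    finally have "ennreal (S x powr p) \<le> ennreal (5 powr p * (f1 x powr p + f2 x powr p + f3 x powr p + f4 x powr p + f5 x powr p))"
      by (rule ennreal_leI)
    then show "ennreal (S x powr p) \<le> ennreal (5 powr p) * (ennreal (f1 x powr p) + ennreal (f2 x powr p)
        + ennreal (f3 x powr p) + ennreal (f4 x powr p) + ennreal (f5 x powr p))"
      by (simp add: ennreal_mult')
  qed
  also have "\<dots> = ennreal (5 powr p) * ((\<integral>\<^sup>+x. f1 x powr p \<partial>M) + (\<integral>\<^sup>+x. f2 x powr p \<partial>M)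
      + (\<integral>\<^sup>+x. f3 x powr p \<partial>M) + (\<integral>\<^sup>+x. f4 x powr p \<partial>M) + (\<integral>\<^sup>+x. f5 x powr p \<partial>M))"
    by (subst nn_integral_cmult, measurable, (subst nn_integral_add; measurable)+)
  also have "\<dots> \<le> ennreal (5 powr p) * (ennreal (k powr p) + ennreal (k powr p) + ennreal (k powr p)
      + ennreal (k powr p) + ennreal (k powr p))"
    by (intro mult_left_mono add_mono bounds) simp
  also have "\<dots> = ennreal (5 powr p * (5 * k powr p))"
    by (simp flip: ennreal_plus ennreal_mult')
  also have "\<dots> \<le> ennreal ((25 * k) powr p)"
  proof (rule ennreal_leI)
    have "5 powr 1 \<le> (5 :: real) powr p" using p by (intro powr_mono) auto
    then have "5 powr p * (5 * k powr p) \<le> 5 powr p * (5 powr p * k powr p)"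
      by (intro mult_left_mono mult_right_mono) auto
    also have "\<dots> = (5 * (5 * k)) powr p" by (simp only: powr_mult)
    finally show "5 powr p * (5 * k powr p) \<le> (25 * k) powr p" by simp
  qed
  finally show ?thesis .
qed

context normalized_process
begin

lemma component_compose:
  assumes "f \<in> borel_measurable borel" "i \<in> I"
  shows "(\<lambda>x. f (x i) :: real) \<in> borel_measurable P"
  using measurable_compose[OF component_measurable[OF assms(2)] assms(1)] .

lemma Z1_measurable: "Z1 \<in> borel_measurable P"
  unfolding Z1_def[abs_def]
  by (intro borel_measurable_Max fin_T borel_measurable_sum component_compose[where f = "\<lambda>y. clip (_ * y / b)"]) measurable

lemma Z2_measurable: "Z2 N \<in> borel_measurable P"
proof -
  have "(\<lambda>y. (R i (t i) (rk N i y) - R i (t i) 0) / 4) \<in> borel_measurable borel" for t i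
    unfolding rk_def using regular_law.rank_measurable[OF law[of i], of "\<lambda>k. (R i (t i) k - R i (t i) 0) / 4" N 1]
    by simp
  from component_compose[OF this] show ?thesis
    unfolding Z2_def[abs_def] by (intro borel_measurable_Max fin_T borel_measurable_sum)
qed

lemma Z1_abs: assumes "t \<in> T" shows "\<bar>\<Sum>i\<in>I. clip (t i * x i / b)\<bar> \<le> Z1 x"
proof (rule abs_leI)
  show "(\<Sum>i\<in>I. clip (t i * x i / b)) \<le> Z1 x"
    unfolding Z1_def using assms fin_T by (intro Max_ge) auto
  have "(\<Sum>i\<in>I. clip (- t i * x i / b)) \<le> Z1 x"
    unfolding Z1_def using uminus_T[OF assms] fin_T by (intro Max_ge) force+
  moreover have "clip (- t i * x i / b) = - clip (t i * x i / b)" for i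
    using clip_bounds(2)[of "t i * x i / b"] by simp
  ultimately show "- (\<Sum>i\<in>I. clip (t i * x i / b)) \<le> Z1 x" by (simp only: sum_negf)
qed

lemma Z1_nonneg: "0 \<le> Z1 x"
  using ne_T Z1_abs[of _ x] by (meson abs_ge_zero ex_in_conv order_trans)

lemma Z2_nonneg: "0 \<le> Z2 N x"
proof -
  obtain t where t: "t \<in> T" using ne_T by auto
  have "0 \<le> (\<Sum>i\<in>I. (R i (t i) (rk N i (x i)) - R i (t i) 0) / 4)"
  proof (rule sum_nonneg)
    fix i assume "i \<in> I"
    interpret l: regular_law "\<mu> i" \<alpha> by (rule law)
    interpret G: regularization "l.u b" "1 / \<alpha>" M
      by unfold_locales (use l.u_props(1,2)[OF b_pos] M_nonneg in auto)
    show "0 \<le> (R i (t i) (rk N i (x i)) - R i (t i) 0) / 4"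
      unfolding R_def using G.regularized_mono[of "\<bar>t i\<bar>" 0 "rk N i (x i)"] by simp
  qed
  also have "\<dots> \<le> Z2 N x" unfolding Z2_def using t fin_T by (intro Max_ge) auto
  finally show ?thesis .
qed

text \<open>Off this event no rank saturates at the cutoff \<open>N\<close>; its contribution is negligible for large \<open>N\<close>.\<close>
definition bad :: "nat \<Rightarrow> (nat \<Rightarrow> real) set"
  where "bad N = (\<Union>i\<in>I. {x \<in> space P. A * hh i (real N + 2) < \<bar>x i\<bar>})"

lemma bad_measurable: "bad N \<in> sets P"
  unfolding bad_def
  by (intro sets.finite_UN fin_I borel_measurable_less borel_measurable_const borel_measurable_abs component_measurable)

lemma prob_bad: "P.prob (bad N) \<le> real (card I) * (1 / A) ^ N"
proof -
  have "P.prob (bad N) \<le> (\<Sum>i\<in>I. P.prob {x \<in> space P. A * hh i (real N + 2) < \<bar>x i\<bar>})"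
    unfolding bad_def
    by (intro P.finite_measure_subadditive_finite fin_I)
       (auto intro!: borel_measurable_less borel_measurable_abs component_measurable)
  also have "\<dots> \<le> (\<Sum>i\<in>I. (1 / A) ^ N)"
  proof (rule sum_mono)
    fix i assume i: "i \<in> I"
    interpret l: regular_law "\<mu> i" \<alpha> by (rule law)
    have "P.prob {x \<in> space P. A * hh i (real N + 2) < \<bar>x i\<bar>}
        = measure (distr P (\<mu> i) (\<lambda>x. x i)) {y. A * hh i (real N + 2) < \<bar>y\<bar>}"
      using i by (subst measure_distr) (auto intro!: arg_cong[where f = P.prob] simp: l.sets_law)
    also have "\<dots> = l.prob {y. A * hh i (real N + 2) < \<bar>y\<bar>}" using i by (simp add: distr_component_laws)
    also have "\<dots> \<le> A powr (- (real N + 2))"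
      unfolding hh_def using A_ge by (intro l.tail_upper) auto
    also have "\<dots> \<le> A powr (- real N)" using A_ge by (intro powr_mono) auto
    also have "\<dots> = (1 / A) ^ N"
      using A_ge by (simp add: powr_minus powr_realpow power_one_over inverse_eq_divide)
    finally show "P.prob {x \<in> space P. A * hh i (real N + 2) < \<bar>x i\<bar>} \<le> (1 / A) ^ N" .
  qed
  finally show ?thesis by simp
qed

definition C0 :: real where "C0 = 2 * A * \<alpha> * (64 * \<alpha> ^ 4)"

lemma C0_nonneg: "0 \<le> C0" unfolding C0_def using A_ge \<alpha>_ge_1 by simp

lemma pointwise_bound:
  assumes x: "x \<in> space P"
  shows "S x \<le> 2 * b * Z1 x + 4 * \<alpha> * b * Z2 N x + C0 + (\<Sum>i\<in>I. \<zeta> i (x i)) + real (card I) * \<kappa> * indicator (bad N) x"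
proof -
  have "(\<Sum>i\<in>I. t i * x i) \<le> 2 * b * Z1 x + 4 * \<alpha> * b * Z2 N x + C0 + (\<Sum>i\<in>I. \<zeta> i (x i)) + real (card I) * \<kappa> * indicator (bad N) x"
    if t: "t \<in> T" for t
  proof -
    let ?m = "\<lambda>i. min (max (\<bar>t i * x i\<bar> / b - 1) 0) M"
    have "(\<Sum>i\<in>I. t i * x i) = 2 * b * (\<Sum>i\<in>I. clip (t i * x i / b)) + (\<Sum>i\<in>I. t i * x i - 2 * b * clip (t i * x i / b))"
      by (simp add: sum_subtractf sum_distrib_left)
    also have "2 * b * (\<Sum>i\<in>I. clip (t i * x i / b)) \<le> 2 * b * Z1 x"
      using Z1_abs[OF t, of x] b_pos by (intro mult_left_mono) auto
    also have "(\<Sum>i\<in>I. t i * x i - 2 * b * clip (t i * x i / b)) \<le> (\<Sum>i\<in>I. b * ?m i + \<zeta> i (x i))"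
    proof (rule sum_mono)
      fix i assume i: "i \<in> I"
      have "\<bar>t i * x i\<bar> * indicator {\<kappa><..} \<bar>t i * x i\<bar> \<le> \<zeta> i (x i)"
      proof (cases "\<kappa> < \<bar>t i * x i\<bar>")
        case True
        have le: "\<bar>t i * x i\<bar> \<le> \<tau> i * \<bar>x i\<bar>" unfolding abs_mult using \<tau>_ge[OF t] by (intro mult_right_mono) auto
        then show ?thesis using True unfolding \<zeta>_def by simp
      qed (simp add: \<zeta>_nonneg)
      then show "t i * x i - 2 * b * clip (t i * x i / b) \<le> b * ?m i + \<zeta> i (x i)"
        using clip_decomposition[OF b_pos less_imp_le[OF \<kappa>_pos], of "t i * x i"] unfolding M_def by linarith
    qed
    also have "\<dots> = b * (\<Sum>i\<in>I. ?m i) + (\<Sum>i\<in>I. \<zeta> i (x i))" by (simp add: sum.distrib sum_distrib_left)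
    also have "b * (\<Sum>i\<in>I. ?m i) \<le> 4 * \<alpha> * b * Z2 N x + C0 + real (card I) * \<kappa> * indicator (bad N) x"
    proof (cases "x \<in> bad N")
      case True
      have "(\<Sum>i\<in>I. ?m i) \<le> real (card I) * M" by (rule sum_bounded_above) simp
      then have "b * (\<Sum>i\<in>I. ?m i) \<le> b * (real (card I) * M)" using b_pos by (intro mult_left_mono) auto
      also have "\<dots> = real (card I) * \<kappa> * indicator (bad N) x" using True b_pos by (simp add: M_def)
      finally show ?thesis
        using Z2_nonneg[of N x] C0_nonneg b_pos \<alpha>_ge_1 by (simp add: add_increasing)
    next
      case False
      then have "(\<Sum>i\<in>I. ?m i) \<le> 4 * \<alpha> * Z2 N x + 2 * A * \<alpha> * (64 * \<alpha> ^ 4) / b"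
        using x by (intro truncated_sum[OF t]) (auto simp: bad_def not_less)
      then have "b * (\<Sum>i\<in>I. ?m i) \<le> b * (4 * \<alpha> * Z2 N x + C0 / b)"
        unfolding C0_def using b_pos by (intro mult_left_mono) auto
      also have "\<dots> = 4 * \<alpha> * b * Z2 N x + C0" using b_pos by (simp add: distrib_left)
      finally show ?thesis using False by simp
    qed
    finally show ?thesis by (simp add: algebra_simps)
  qed
  then show ?thesis unfolding S_def using fin_T ne_T by simp
qed

definition K :: real where
  "K = 2 * \<Gamma> * exp 5 + 4 * \<alpha> * \<Gamma> * exp (512 * \<alpha> ^ 11 + 2) + C0 + 3"

lemma K_ge: "2 * \<Gamma> * exp 5 \<le> K" "4 * \<alpha> * \<Gamma> * exp (512 * \<alpha> ^ 11 + 2) \<le> K" "C0 \<le> K" "3 \<le> K"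
proof -
  have "0 \<le> 2 * \<Gamma> * exp 5" "0 \<le> 4 * \<alpha> * \<Gamma> * exp (512 * \<alpha> ^ 11 + 2)"
    using \<Gamma>_props(5) \<alpha>_ge_1 by auto
  then show "2 * \<Gamma> * exp 5 \<le> K" "4 * \<alpha> * \<Gamma> * exp (512 * \<alpha> ^ 11 + 2) \<le> K" "C0 \<le> K" "3 \<le> K"
    unfolding K_def using C0_nonneg by linarith+
qed

text \<open>The passage from the exponential moment costs a factor \<open>p\<close>, and
  \<open>p * b = \<Gamma>\<close> turns it into a constant.\<close>

lemma scaled_exp_moment:
  assumes Z: "Z \<in> borel_measurable P" "\<And>x. 0 \<le> Z x" and c: "0 \<le> c" "c * \<Gamma> * exp k \<le> K"
    and exp: "(\<integral>\<^sup>+x. exp (Z x) \<partial>P) \<le> exp (k * p)"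
  shows "(\<integral>\<^sup>+x. (c * b * Z x) powr p \<partial>P) \<le> K powr p"
proof -
  have "(\<integral>\<^sup>+x. (c * b * Z x) powr p \<partial>P) = (\<integral>\<^sup>+x. ennreal ((c * b) powr p) * ennreal (Z x powr p) \<partial>P)"
    using c b_pos Z(2) by (intro nn_integral_cong) (simp add: powr_mult flip: ennreal_mult')
  also have "\<dots> = ennreal ((c * b) powr p) * (\<integral>\<^sup>+x. Z x powr p \<partial>P)"
    by (rule nn_integral_cmult[OF measurable_compose[OF powr_real_measurable[OF Z(1) borel_measurable_const] measurable_ennreal]])
  also have "\<dots> \<le> ennreal ((c * b) powr p) * ennreal ((p * exp k) powr p)"
    using p_ge_2 by (intro mult_left_mono nn_integral_powr_le_exp Z exp) auto
  also have "\<dots> = ennreal (((c * b) * (p * exp k)) powr p)"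
    using c b_pos p_ge_2 by (simp add: powr_mult flip: ennreal_mult')
  also have "(c * b) * (p * exp k) = c * (p * b) * exp k" by simp
  also have "ennreal ((c * (p * b) * exp k) powr p) \<le> ennreal (K powr p)"
    unfolding pb using c p_ge_2 \<Gamma>_props(5) by (intro ennreal_leI powr_mono2) auto
  finally show ?thesis .
qed

text \<open>The cutoff may depend on \<open>p\<close> and on the number of coordinates, because the
  bound for \<open>Z2 N\<close> is the same for all \<open>N\<close> and the final estimate does not
  contain \<open>N\<close>.\<close>

lemma bad_index: "\<exists>N. (\<integral>\<^sup>+x. (real (card I) * \<kappa> * indicator (bad N) x) powr p \<partial>P) \<le> K powr p"
proof -
  define c where "c = (real (card I) * \<kappa>) powr p"
  have c: "0 \<le> c" unfolding c_def by simp
  have "\<exists>N. (1 / A) ^ N < 1 / (real (card I) * c + 1)"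
    using A_ge c by (intro real_arch_pow_inv) (auto intro!: divide_pos_pos add_nonneg_pos)
  then obtain N where N: "(1 / A) ^ N < 1 / (real (card I) * c + 1)" by blast
  have den: "0 < real (card I) * c + 1" using c by (simp add: add_nonneg_pos)
  have "(\<integral>\<^sup>+x. (real (card I) * \<kappa> * indicator (bad N) x) powr p \<partial>P) = (\<integral>\<^sup>+x. ennreal c * indicator (bad N) x \<partial>P)"
    using p_ge_2 by (intro nn_integral_cong) (auto simp: indicator_def c_def)
  also have "\<dots> = ennreal (c * P.prob (bad N))"
    using c bad_measurable[of N] by (subst nn_integral_cmult_indicator) (auto simp: P.emeasure_eq_measure ennreal_mult')
  also have "\<dots> \<le> ennreal (K powr p)"
  proof (rule ennreal_leI)
    have "c * P.prob (bad N) \<le> c * (real (card I) * (1 / A) ^ N)"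
      using c by (intro mult_left_mono prob_bad)
    also have "\<dots> \<le> c * (real (card I) * (1 / (real (card I) * c + 1)))"
      using N c by (intro mult_left_mono) auto
    also have "\<dots> = real (card I) * c / (real (card I) * c + 1)" by simp
    also have "\<dots> \<le> 1" using den by (simp add: divide_le_eq)
    also have "\<dots> \<le> K powr p" using K_ge(4) p_ge_2 by (intro ge_one_powr_ge_zero) auto
    finally show "c * P.prob (bad N) \<le> K powr p" .
  qed
  finally show ?thesis by blast
qed

theorem strong_moment: "(\<integral>\<^sup>+x. S x powr p \<partial>P) \<le> (25 * K) powr p"
proof -
  obtain N where N: "(\<integral>\<^sup>+x. (real (card I) * \<kappa> * indicator (bad N) x) powr p \<partial>P) \<le> K powr p"
    using bad_index by blast
  have \<zeta>m: "(\<lambda>x. \<Sum>i\<in>I. \<zeta> i (x i)) \<in> borel_measurable P"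
    by (intro borel_measurable_sum component_compose) measurable
  have b1: "(\<integral>\<^sup>+x. (2 * b * Z1 x) powr p \<partial>P) \<le> K powr p"
    using K_ge(1) by (intro scaled_exp_moment[where k = 5] Z1_measurable Z1_nonneg part_one) auto
  have b2: "(\<integral>\<^sup>+x. (4 * \<alpha> * b * Z2 N x) powr p \<partial>P) \<le> K powr p"
    using K_ge(2) \<alpha>_ge_1
    by (intro scaled_exp_moment[where k = "512 * \<alpha> ^ 11 + 2"] Z2_measurable Z2_nonneg part_two) auto
  have b3: "(\<integral>\<^sup>+x. C0 powr p \<partial>P) \<le> K powr p"
    using C0_nonneg K_ge(3) p_ge_2 by (simp add: P.emeasure_space_1 powr_mono2 ennreal_leI)
  have b4: "(\<integral>\<^sup>+x. (\<Sum>i\<in>I. \<zeta> i (x i)) powr p \<partial>P) \<le> K powr p"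
    using part_three K_ge(4) p_ge_2 by (rule_tac order_trans[OF part_three ennreal_leI]) (intro powr_mono2, auto)
  show ?thesis
  proof (rule nn_integral_powr_sum_five[OF _ _ _ \<zeta>m _ _ _ _ _ _ _ pointwise_bound _ _ b1 b2 b3 b4 N])
    show "(\<lambda>x. 2 * b * Z1 x) \<in> borel_measurable P" "(\<lambda>x. 4 * \<alpha> * b * Z2 N x) \<in> borel_measurable P"
      using Z1_measurable Z2_measurable by auto
    show "(\<lambda>x. real (card I) * \<kappa> * indicator (bad N) x) \<in> borel_measurable P"
      using bad_measurable[of N] by simp
  qed (use b_pos Z1_nonneg Z2_nonneg \<alpha>_ge_1 C0_nonneg \<zeta>_nonneg \<kappa>_pos S_nonneg p_ge_2 K_ge(4) in
        \<open>auto intro!: mult_nonneg_nonneg sum_nonneg\<close>)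
qed

end

subsection \<open>Symmetric variables\<close>

definition sup_abs :: "nat set \<Rightarrow> (nat \<Rightarrow> real) set \<Rightarrow> (nat \<Rightarrow> real) \<Rightarrow> real"
  where "sup_abs I T x = (MAX t\<in>T. \<bar>\<Sum>i\<in>I. t i * x i\<bar>)"

lemma sup_abs_nonneg: "finite T \<Longrightarrow> T \<noteq> {} \<Longrightarrow> 0 \<le> sup_abs I T x"
  unfolding sup_abs_def by (subst Max_ge_iff) auto

lemma sup_abs_eq:
  assumes T: "finite T" "T \<noteq> {}"
  shows "(MAX t\<in>T \<union> (\<lambda>t i. - t i) ` T. \<Sum>i\<in>I. t i * x i) = sup_abs I T x"
proof (rule antisym)
  have "(\<Sum>i\<in>I. t i * x i) \<le> sup_abs I T x" "(\<Sum>i\<in>I. - t i * x i) \<le> sup_abs I T x" if "t \<in> T" for t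
  proof -
    have "\<bar>\<Sum>i\<in>I. t i * x i\<bar> \<le> sup_abs I T x" unfolding sup_abs_def using T that by (intro Max_ge) auto
    then show "(\<Sum>i\<in>I. t i * x i) \<le> sup_abs I T x" "(\<Sum>i\<in>I. - t i * x i) \<le> sup_abs I T x"
      by (simp_all add: sum_negf)
  qed
  then show "(MAX t\<in>T \<union> (\<lambda>t i. - t i) ` T. \<Sum>i\<in>I. t i * x i) \<le> sup_abs I T x"
    using T by (subst Max_le_iff) auto
  have "\<bar>\<Sum>i\<in>I. t i * x i\<bar> \<le> (MAX t\<in>T \<union> (\<lambda>t i. - t i) ` T. \<Sum>i\<in>I. t i * x i)" if "t \<in> T" for t
  proof (rule abs_leI)
    show "(\<Sum>i\<in>I. t i * x i) \<le> (MAX t\<in>T \<union> (\<lambda>t i. - t i) ` T. \<Sum>i\<in>I. t i * x i)"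
      using T that by (intro Max_ge) auto
    have "(\<Sum>i\<in>I. - t i * x i) \<le> (MAX t\<in>T \<union> (\<lambda>t i. - t i) ` T. \<Sum>i\<in>I. t i * x i)"
      using T that by (intro Max_ge image_eqI[where x = "\<lambda>i. - t i"]) auto
    then show "- (\<Sum>i\<in>I. t i * x i) \<le> (MAX t\<in>T \<union> (\<lambda>t i. - t i) ` T. \<Sum>i\<in>I. t i * x i)"
      by (simp add: sum_negf)
  qed
  then show "sup_abs I T x \<le> (MAX t\<in>T \<union> (\<lambda>t i. - t i) ` T. \<Sum>i\<in>I. t i * x i)"
    unfolding sup_abs_def using T by simp
qed

context regular_laws
begin

lemma sup_abs_integrable: "finite T \<Longrightarrow> T \<noteq> {} \<Longrightarrow> integrable P (sup_abs I T)"
  unfolding sup_abs_def[abs_def] by (intro integrable_Max_real integrable_abs integrable_lin_sum)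

text \<open>The second conclusion carries the bound on \<open>K\<close> out of the locale: it is a
  fact about \<open>\<alpha>\<close> alone, obtained there in the presence of a process.\<close>

lemma strong_moment_ge_2:
  assumes T: "finite T" "T \<noteq> {}" and p: "2 \<le> p" and mean: "(\<integral>x. sup_abs I T x \<partial>P) \<le> 1"
    and weak: "\<And>t. t \<in> T \<Longrightarrow> (\<integral>x. \<bar>\<Sum>i\<in>I. t i * x i\<bar> powr p \<partial>P) \<le> 1"
  shows "(\<integral>\<^sup>+x. sup_abs I T x powr p \<partial>P) \<le> (25 * normalized_process.K \<alpha>) powr p"
    and "3 \<le> normalized_process.K \<alpha>"
proof -
  let ?T = "T \<union> (\<lambda>t i. - t i) ` T"
  interpret N: normalized_process I \<mu> \<alpha> ?T p
  proof
    show "finite ?T" "?T \<noteq> {}" using T by auto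
    show "2 \<le> p" by (rule p)
    show "(\<integral>x. (MAX t\<in>?T. \<Sum>i\<in>I. t i * x i) \<partial>P) \<le> 1" unfolding sup_abs_eq[OF T] by (rule mean)
    show "(\<lambda>i. - t i) \<in> ?T" if "t \<in> ?T" for t
      using that by (auto simp: image_iff)
    show "(\<integral>x. \<bar>\<Sum>i\<in>I. t i * x i\<bar> powr p \<partial>P) \<le> 1" if "t \<in> ?T" for t
      using that weak by (auto simp: sum_negf)
  qed
  show "(\<integral>\<^sup>+x. sup_abs I T x powr p \<partial>P) \<le> (25 * normalized_process.K \<alpha>) powr p"
    using N.strong_moment unfolding N.S_def sup_abs_eq[OF T] .
  show "3 \<le> normalized_process.K \<alpha>" by (rule N.K_ge)
qed

end

lemma sup_abs_scale:
  assumes "finite T" "T \<noteq> {}" "0 \<le> c"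
  shows "sup_abs I ((\<lambda>t i. c * t i) ` T) x = c * sup_abs I T x"
proof -
  have "sup_abs I ((\<lambda>t i. c * t i) ` T) x = (MAX t\<in>T. c * \<bar>\<Sum>i\<in>I. t i * x i\<bar>)"
    unfolding sup_abs_def image_image using assms(3)
    by (simp add: mult.assoc abs_mult flip: sum_distrib_left)
  also have "\<dots> = c * sup_abs I T x" unfolding sup_abs_def by (rule Max_cmult_real[OF assms])
  finally show ?thesis .
qed

lemma sup_abs_ge: "finite T \<Longrightarrow> t \<in> T \<Longrightarrow> \<bar>\<Sum>i\<in>I. t i * x i\<bar> \<le> sup_abs I T x"
  unfolding sup_abs_def by (intro Max_ge) auto

lemma sup_abs_le_iff: "finite T \<Longrightarrow> T \<noteq> {} \<Longrightarrow> sup_abs I T x \<le> c \<longleftrightarrow> (\<forall>t\<in>T. \<bar>\<Sum>i\<in>I. t i * x i\<bar> \<le> c)"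
  unfolding sup_abs_def by (subst Max_le_iff) auto

text \<open>Bernoulli's inequality: the right side is convex and the left side is its tangent at
  1.\<close>

lemma powr_ge_tangent:
  fixes y r :: real
  assumes "0 \<le> y" "1 \<le> r"
  shows "r * y - r + 1 \<le> y powr r"
proof (cases "y = 0")
  case False
  then have "(y powr r) powr (1 / r) * 1 powr (1 - 1 / r) \<le> 1 / r * y powr r + (1 - 1 / r) * 1"
    using assms by (intro Youngs_inequality_0) auto
  then have "y \<le> 1 / r * y powr r + (1 - 1 / r)" using assms by (simp add: powr_powr)
  then have "r * y \<le> r * (1 / r * y powr r + (1 - 1 / r))" using assms by (intro mult_left_mono) auto
  also have "\<dots> = y powr r + r - 1" using assms by (simp add: algebra_simps)
  finally show ?thesis by simp
qed (use assms in simp)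

text \<open>Jensen's inequality from the tangent line at the mean, stated so that the right side may
  be infinite.\<close>

lemma (in prob_space) power_mean:
  fixes f :: "'a \<Rightarrow> real"
  assumes f: "integrable M f" "\<And>x. 0 \<le> f x" and r: "1 \<le> r"
  shows "ennreal ((\<integral>x. f x \<partial>M) powr r) \<le> (\<integral>\<^sup>+x. f x powr r \<partial>M)"
proof (cases "(\<integral>\<^sup>+x. f x powr r \<partial>M) = \<top>")
  case False
  have [measurable]: "f \<in> borel_measurable M" using f by auto
  have int: "integrable M (\<lambda>x. f x powr r)"
    using False by (intro integrableI_nonneg) (auto simp: less_top)
  define m where "m = (\<integral>x. f x \<partial>M)"
  have m0: "0 \<le> m" unfolding m_def using f by (intro Bochner_Integration.integral_nonneg) auto
  have "m powr r \<le> (\<integral>x. f x powr r \<partial>M)"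
  proof (cases "m = 0")
    case True
    then show ?thesis using r by (simp add: Bochner_Integration.integral_nonneg)
  next
    case False
    then have m: "0 < m" using m0 by simp
    have "m powr r = (\<integral>x. m powr r * (r / m * f x + (1 - r)) \<partial>M)"
      using f m by (simp add: prob_space m_def[symmetric])
    also have "\<dots> \<le> (\<integral>x. f x powr r \<partial>M)"
    proof (rule integral_mono)
      show "integrable M (\<lambda>x. m powr r * (r / m * f x + (1 - r)))" using f by simp
      fix x
      have "r * (f x / m) - r + 1 \<le> (f x / m) powr r" using f m r by (intro powr_ge_tangent) auto
      then have "m powr r * (r * (f x / m) - r + 1) \<le> m powr r * (f x / m) powr r" by (intro mult_left_mono) auto
      also have "\<dots> = f x powr r" using m f(2)[of x] by (simp add: powr_divide)
      finally show "m powr r * (r / m * f x + (1 - r)) \<le> f x powr r" by (simp add: algebra_simps)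
    qed (rule int)
    finally show ?thesis .
  qed
  then show ?thesis
    unfolding m_def using int by (subst nn_integral_eq_integral) (auto intro: ennreal_leI)
qed simp

section \<open>All orders from one on, for symmetric variables\<close>

context regular_laws
begin

text \<open>The factor 4800 is the product of 25 from \<open>strong_moment_ge_2\<close>, 96 from
  comparing first and second moments, and 2 from passing below order 2.\<close>

definition sym_const :: real where "sym_const = 4800 * \<alpha> ^ 4 * normalized_process.K \<alpha>"

theorem strong_moment_symmetric:
  assumes T: "finite T" "T \<noteq> {}" and p: "1 \<le> p" and mean: "(\<integral>x. sup_abs I T x \<partial>P) \<le> 1"
    and weak: "\<And>t. t \<in> T \<Longrightarrow> (\<integral>x. \<bar>\<Sum>i\<in>I. t i * x i\<bar> powr p \<partial>P) \<le> 1"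
  shows "(\<integral>\<^sup>+x. sup_abs I T x powr p \<partial>P) \<le> sym_const powr p"
proof -
  define K where "K = normalized_process.K \<alpha>"
  define v where "v = 96 * \<alpha> ^ 4"
  have a4: "1 \<le> \<alpha> ^ 4" using \<alpha>_ge_1 by (rule one_le_power)
  have v: "1 \<le> v" unfolding v_def using a4 by linarith
  have c: "sym_const = 50 * v * K" unfolding sym_const_def v_def K_def by simp
  show ?thesis
  proof (cases "2 \<le> p")
    case True
    note s = strong_moment_ge_2[OF T True mean weak, folded K_def]
    have "1 * (25 * K) \<le> (2 * v) * (25 * K)" using s(2) v by (intro mult_right_mono) auto
    then have "25 * K \<le> sym_const" unfolding c by simp
    then have "(25 * K) powr p \<le> sym_const powr p" using s(2) p by (intro powr_mono2) auto
    then show ?thesis using s(1) by (meson ennreal_leI order_trans)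
  next
    case False
    let ?T = "(\<lambda>t i. 1 / v * t i) ` T"
    have T': "finite ?T" "?T \<noteq> {}" using T by auto
    have sc: "sup_abs I ?T x = 1 / v * sup_abs I T x" for x
      using v by (intro sup_abs_scale T) auto
    \<comment> \<open>The mean bound controls the first moment of each sum, and
      \<open>lower_tail_block\<close> bounds its standard deviation by a multiple of that moment:
      \<open>sqrt V / 2 \<le> 2 * 24 * \<alpha> ^ 4\<close>. This is where
      \<open>v = 96 * \<alpha> ^ 4\<close> comes from.\<close>
    have sq: "(\<integral>x. (\<Sum>i\<in>I. t i * x i)\<^sup>2 \<partial>P) \<le> v\<^sup>2" if t: "t \<in> T" for t
    proof -
      define V where "V = (\<Sum>i\<in>I. (t i * hh i 2)\<^sup>2)"
      have V0: "0 \<le> V" unfolding V_def by (intro sum_nonneg) simp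
      have "(\<integral>x. \<bar>\<Sum>i\<in>I. t i * x i\<bar> powr 1 \<partial>P) \<le> (\<integral>x. sup_abs I T x \<partial>P)"
        using sup_abs_ge[OF T(1) t] integrable_powr_sum[of 1 t] sup_abs_integrable[OF T]
        by (intro integral_mono) auto
      then have "(\<integral>x. \<bar>\<Sum>i\<in>I. t i * x i\<bar> powr 1 \<partial>P) \<le> 1" using mean by simp
      then have "(sqrt V / 2) powr 1 * lower_tail t I (sqrt V / 2) \<le> 2"
        using V0 by (intro lower_tail_moment integrable_powr_sum) auto
      moreover have "(sqrt V / 2) * (1 / (24 * \<alpha> ^ 4)) \<le> (sqrt V / 2) * lower_tail t I (sqrt V / 2)"
        using V0 unfolding V_def by (intro mult_left_mono lower_tail_block) auto
      ultimately have "(sqrt V / 2) * (1 / (24 * \<alpha> ^ 4)) \<le> 2" using V0 by simp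
      moreover have "0 < \<alpha> ^ 4" using \<alpha>_ge_1 by simp
      ultimately have "sqrt V \<le> v" unfolding v_def by (simp add: field_simps)
      then have "(sqrt V)\<^sup>2 \<le> v\<^sup>2" using V0 by (intro power_mono) auto
      then show ?thesis using second_fourth_moment(2)[OF subset_refl, of t] V0 unfolding V_def by simp
    qed
    have "(\<integral>\<^sup>+x. sup_abs I ?T x powr 2 \<partial>P) \<le> (25 * K) powr 2" and K3: "3 \<le> K"
      unfolding K_def
    proof (rule strong_moment_ge_2[OF T'])
      have "1 / v * (\<integral>x. sup_abs I T x \<partial>P) \<le> 1 / v * 1" using mean v by (intro mult_left_mono) auto
      also have "\<dots> \<le> 1" using v by simp
      finally have m: "(\<integral>x. sup_abs I ?T x \<partial>P) \<le> 1" unfolding sc by simp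
      then show "(\<integral>x. sup_abs I ?T x \<partial>P) \<le> 1" .
      have w: "(\<integral>x. \<bar>\<Sum>i\<in>I. t i * x i\<bar> powr 2 \<partial>P) \<le> 1" if t: "t \<in> ?T" for t
      proof -
        obtain s where s: "s \<in> T" "t = (\<lambda>i. 1 / v * s i)" using t by auto
        have "(\<Sum>i\<in>I. t i * x i) = 1 / v * (\<Sum>i\<in>I. s i * x i)" for x
          unfolding s sum_distrib_left by (simp add: mult.assoc)
        then have "(\<integral>x. \<bar>\<Sum>i\<in>I. t i * x i\<bar> powr 2 \<partial>P) = (\<integral>x. (\<Sum>i\<in>I. s i * x i)\<^sup>2 / v\<^sup>2 \<partial>P)"
          by (simp add: power_divide)
        also have "\<dots> \<le> v\<^sup>2 / v\<^sup>2" using sq[OF s(1)] by (simp add: divide_right_mono)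
        finally show ?thesis using v by simp
      qed
      then show "\<And>t. t \<in> ?T \<Longrightarrow> (\<integral>x. \<bar>\<Sum>i\<in>I. t i * x i\<bar> powr 2 \<partial>P) \<le> 1" .
      show "3 \<le> normalized_process.K \<alpha>"
        by (rule strong_moment_ge_2(2)[OF T' order.refl m w])
    qed simp
    \<comment> \<open>This bounds the norm of order 2 of the supremum. After division by
      \<open>w\<close> the inequality \<open>y powr p \<le> 1 + y\<^sup>2\<close> gives at most 2,
      and \<open>2 \<le> 2 powr p\<close>.\<close>
    define w where "w = 25 * K * v"
    have w: "0 < w" unfolding w_def using K3 v by simp
    have S0: "0 \<le> sup_abs I T x" for x by (rule sup_abs_nonneg[OF T])
    have Sm: "sup_abs I T \<in> borel_measurable P" using sup_abs_integrable[OF T] by auto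
    have pt: "sup_abs I T x powr p \<le> w powr p * (1 + 1 / (25 * K)\<^sup>2 * (sup_abs I ?T x powr 2))" for x
    proof -
      define y where "y = sup_abs I T x / w"
      have y0: "0 \<le> y" unfolding y_def using S0 w by simp
      have "y powr p \<le> 1 + y\<^sup>2"
      proof (cases "y \<le> 1")
        case True
        then have "y powr p \<le> 1" using y0 p by (intro powr_le1) auto
        then show ?thesis by (simp add: add_increasing2)
      next
        case F: False
        then have "y powr p \<le> y powr 2" using False by (intro powr_mono) auto
        then show ?thesis using y0 by simp
      qed
      then have "w powr p * y powr p \<le> w powr p * (1 + y\<^sup>2)" by (intro mult_left_mono) auto
      moreover have "w powr p * y powr p = sup_abs I T x powr p"
        unfolding y_def using w S0 by (simp add: powr_divide)
      moreover have "y\<^sup>2 = 1 / (25 * K)\<^sup>2 * (sup_abs I ?T x powr 2)"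
        unfolding y_def sc w_def using S0[of x] v by (simp add: power_divide power_mult_distrib)
      ultimately show ?thesis by simp
    qed
    have "(\<integral>\<^sup>+x. sup_abs I T x powr p \<partial>P)
      \<le> (\<integral>\<^sup>+x. ennreal (w powr p) * (1 + ennreal (1 / (25 * K)\<^sup>2) * ennreal (sup_abs I ?T x powr 2)) \<partial>P)"
    proof (rule nn_integral_mono)
      fix x
      have "ennreal (sup_abs I T x powr p) \<le> ennreal (w powr p * (1 + 1 / (25 * K)\<^sup>2 * (sup_abs I ?T x powr 2)))"
        by (rule ennreal_leI[OF pt])
      also have "\<dots> = ennreal (w powr p) * (1 + ennreal (1 / (25 * K)\<^sup>2) * ennreal (sup_abs I ?T x powr 2))"
        by (subst ennreal_mult', simp, subst ennreal_plus, simp, simp, subst ennreal_mult') auto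
      finally show "ennreal (sup_abs I T x powr p) \<le> ennreal (w powr p) * (1 + ennreal (1 / (25 * K)\<^sup>2) * ennreal (sup_abs I ?T x powr 2))" .
    qed
    also have "\<dots> = ennreal (w powr p) * (1 + ennreal (1 / (25 * K)\<^sup>2) * (\<integral>\<^sup>+x. sup_abs I ?T x powr 2 \<partial>P))"
    proof -
      have m2: "(\<lambda>x. ennreal (sup_abs I ?T x powr 2)) \<in> borel_measurable P"
        using sup_abs_integrable[OF T'] by (intro measurable_compose[OF _ measurable_ennreal] powr_real_measurable) auto
      show ?thesis
        using m2 by (subst nn_integral_cmult) (auto simp: nn_integral_add nn_integral_cmult P.emeasure_space_1)
    qed
    also have "\<dots> \<le> ennreal (w powr p) * (1 + ennreal (1 / (25 * K)\<^sup>2) * ennreal ((25 * K) powr 2))"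
      using \<open>(\<integral>\<^sup>+x. sup_abs I ?T x powr 2 \<partial>P) \<le> (25 * K) powr 2\<close>
      by (intro mult_left_mono add_left_mono) auto
    also have "\<dots> = ennreal (2 * w powr p)"
    proof -
      have "ennreal (1 / (25 * K)\<^sup>2) * ennreal ((25 * K) powr 2) = ennreal (1 / (25 * K)\<^sup>2 * (25 * K) powr 2)"
        by (rule ennreal_mult'[symmetric]) simp
      also have "1 / (25 * K)\<^sup>2 * (25 * K) powr 2 = 1" using K3 by simp
      finally have "1 + ennreal (1 / (25 * K)\<^sup>2) * ennreal ((25 * K) powr 2) = ennreal 2" by simp
      then show ?thesis by (simp add: mult.commute ennreal_mult')
    qed
    also have "\<dots> \<le> ennreal (sym_const powr p)"
    proof (rule ennreal_leI)
      have "2 powr 1 \<le> (2 :: real) powr p" using p by (intro powr_mono) auto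
      then have "2 * w powr p \<le> 2 powr p * w powr p" by (intro mult_right_mono) auto
      also have "\<dots> = (2 * w) powr p" by (simp only: powr_mult)
      also have "2 * w = sym_const" unfolding c w_def by simp
      finally show "2 * w powr p \<le> sym_const powr p" .
    qed
    finally show ?thesis .
  qed
qed

end

subsection \<open>Symmetrization\<close>

locale centered_laws = real_laws \<nu> for \<nu> :: "nat \<Rightarrow> real measure" +
  fixes I :: "nat set" and \<alpha> :: real
  assumes fin_I: "finite I" and ne_I: "I \<noteq> {}" and \<alpha>_ge_1: "1 \<le> \<alpha>"
    and moments: "\<And>i r. 1 \<le> r \<Longrightarrow> integrable (\<nu> i) (\<lambda>x. \<bar>x\<bar> powr r)"
    and mean_zero: "\<And>i. (\<integral>x. x \<partial>\<nu> i) = 0"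
    and regular: "\<And>i r. 2 \<le> r \<Longrightarrow>
      (\<integral>x. \<bar>x\<bar> powr (2 * r) \<partial>\<nu> i) \<le> \<alpha> powr (2 * r) * (\<integral>x. \<bar>x\<bar> powr r \<partial>\<nu> i)\<^sup>2"
begin

definition sym_law :: "nat \<Rightarrow> real measure"
  where "sym_law i = distr (\<nu> i \<Otimes>\<^sub>M \<nu> i) borel (\<lambda>p. fst p - snd p)"

lemma diff_measurable: "(\<lambda>p. fst p - snd p) \<in> borel_measurable (\<nu> i \<Otimes>\<^sub>M \<nu> i)"
  by measurable

lemma integrable_id: "integrable (\<nu> i) (\<lambda>x. x)"
proof -
  have "integrable (\<nu> i) (\<lambda>x. \<bar>x\<bar>)" using moments[of 1 i] by simp
  then show ?thesis by (subst integrable_abs_iff[symmetric]) simp_all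
qed

text \<open>For an independent copy the norms of order \<open>r\<close> of the variable and of the
  difference are comparable: from above by the triangle inequality, from below by Jensen's
  inequality and the zero mean. The loss \<open>2 * 2 powr (2 * r)\<close> is at most
  \<open>4 powr (2 * r)\<close>, hence the constant \<open>4 * \<alpha>\<close>.\<close>

lemma sym_law_regular: "regular_law (sym_law i) (4 * \<alpha>)"
proof -
  interpret n: prob_space "\<nu> i" by (rule prob_law)
  interpret pr: pair_prob_space "\<nu> i" "\<nu> i" ..
  have s: "symmetric_law (sym_law i)"
  proof (intro symmetric_law.intro symmetric_law_axioms.intro)
    show "prob_space (sym_law i)" unfolding sym_law_def by (rule pr.prob_space_distr[OF diff_measurable])
    show "sets (sym_law i) = sets borel" unfolding sym_law_def by simp
    have "distr (sym_law i) borel uminus = distr (\<nu> i \<Otimes>\<^sub>M \<nu> i) borel (\<lambda>p. snd p - fst p)"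
      unfolding sym_law_def by (subst distr_distr[OF _ diff_measurable]) (auto simp: comp_def)
    also have "\<dots> = distr (distr (\<nu> i \<Otimes>\<^sub>M \<nu> i) (\<nu> i \<Otimes>\<^sub>M \<nu> i) (\<lambda>(x, y). (y, x))) borel (\<lambda>p. snd p - fst p)"
      by (subst pr.distr_pair_swap) simp
    also have "\<dots> = distr (\<nu> i \<Otimes>\<^sub>M \<nu> i) borel (\<lambda>p. fst p - snd p)"
    proof (subst distr_distr)
      show "(\<lambda>p. snd p - fst p) \<in> borel_measurable (\<nu> i \<Otimes>\<^sub>M \<nu> i)" by measurable
      show "(\<lambda>(x, y). (y, x)) \<in> measurable (\<nu> i \<Otimes>\<^sub>M \<nu> i) (\<nu> i \<Otimes>\<^sub>M \<nu> i)" by (rule measurable_pair_swap')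
      show "distr (\<nu> i \<Otimes>\<^sub>M \<nu> i) borel ((\<lambda>p. snd p - fst p) \<circ> (\<lambda>(x, y). (y, x))) = distr (\<nu> i \<Otimes>\<^sub>M \<nu> i) borel (\<lambda>p. fst p - snd p)"
        by (intro distr_cong) auto
    qed
    finally show "distr (sym_law i) borel uminus = sym_law i" unfolding sym_law_def .
  qed
  have le: "\<bar>fst q - snd q\<bar> powr r \<le> 2 powr r * (\<bar>fst q\<bar> powr r + \<bar>snd q\<bar> powr r)" if "1 \<le> r" for r :: real and q :: "real \<times> real"
  proof -
    have "\<bar>fst q - snd q\<bar> powr r \<le> (\<bar>fst q\<bar> + \<bar>snd q\<bar>) powr r" using that by (intro powr_mono2) auto
    also have "\<dots> \<le> 2 powr r * (\<bar>fst q\<bar> powr r + \<bar>snd q\<bar> powr r)" using that by (intro powr_add_le) auto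
    finally show ?thesis .
  qed
  have comp: "integrable (\<nu> i \<Otimes>\<^sub>M \<nu> i) (\<lambda>q. \<bar>fst q\<bar> powr r)" "integrable (\<nu> i \<Otimes>\<^sub>M \<nu> i) (\<lambda>q. \<bar>snd q\<bar> powr r)" if "1 \<le> r" for r
    using pr.integrable_fst_component[OF moments[OF that]] pr.integrable_snd_component[OF moments[OF that]] by auto
  have pint: "integrable (\<nu> i \<Otimes>\<^sub>M \<nu> i) (\<lambda>q. \<bar>fst q - snd q\<bar> powr r)" if "1 \<le> r" for r
  proof (rule Bochner_Integration.integrable_bound)
    show "integrable (\<nu> i \<Otimes>\<^sub>M \<nu> i) (\<lambda>q. 2 powr r * (\<bar>fst q\<bar> powr r + \<bar>snd q\<bar> powr r))" using comp[OF that] by simp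
    show "AE q in \<nu> i \<Otimes>\<^sub>M \<nu> i. norm (\<bar>fst q - snd q\<bar> powr r) \<le> norm (2 powr r * (\<bar>fst q\<bar> powr r + \<bar>snd q\<bar> powr r))"
      using le[OF that] by (intro always_eventually allI) simp
  qed measurable
  have int_eq: "(\<integral>x. \<bar>x\<bar> powr r \<partial>sym_law i) = (\<integral>q. \<bar>fst q - snd q\<bar> powr r \<partial>(\<nu> i \<Otimes>\<^sub>M \<nu> i))" for r
    unfolding sym_law_def by (rule integral_distr[OF diff_measurable]) measurable
  have upper: "(\<integral>q. \<bar>fst q - snd q\<bar> powr r \<partial>(\<nu> i \<Otimes>\<^sub>M \<nu> i)) \<le> 2 * 2 powr r * (\<integral>x. \<bar>x\<bar> powr r \<partial>\<nu> i)" if r: "1 \<le> r" for r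
  proof -
    have "(\<integral>q. \<bar>fst q - snd q\<bar> powr r \<partial>(\<nu> i \<Otimes>\<^sub>M \<nu> i))
        \<le> (\<integral>q. 2 powr r * (\<bar>fst q\<bar> powr r + \<bar>snd q\<bar> powr r) \<partial>(\<nu> i \<Otimes>\<^sub>M \<nu> i))"
      using comp[OF r] pint[OF r] le[OF r] by (intro integral_mono) auto
    also have "\<dots> = 2 powr r * ((\<integral>q. \<bar>fst q\<bar> powr r \<partial>(\<nu> i \<Otimes>\<^sub>M \<nu> i)) + (\<integral>q. \<bar>snd q\<bar> powr r \<partial>(\<nu> i \<Otimes>\<^sub>M \<nu> i)))"
      using comp[OF r] by simp
    also have "(\<integral>q. \<bar>fst q\<bar> powr r \<partial>(\<nu> i \<Otimes>\<^sub>M \<nu> i)) = (\<integral>x. \<bar>x\<bar> powr r \<partial>\<nu> i)"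
      using pr.integral_fst'[OF comp(1)[OF r]] n.prob_space by simp
    also have "(\<integral>q. \<bar>snd q\<bar> powr r \<partial>(\<nu> i \<Otimes>\<^sub>M \<nu> i)) = (\<integral>x. \<bar>x\<bar> powr r \<partial>\<nu> i)"
      using pr.integral_fst'[OF comp(2)[OF r]] n.prob_space by simp
    finally show ?thesis by simp
  qed
  have lower: "(\<integral>x. \<bar>x\<bar> powr r \<partial>\<nu> i) \<le> (\<integral>q. \<bar>fst q - snd q\<bar> powr r \<partial>(\<nu> i \<Otimes>\<^sub>M \<nu> i))" if r: "1 \<le> r" for r
  proof -
    have pt: "ennreal (\<bar>x\<bar> powr r) \<le> (\<integral>\<^sup>+y. ennreal (\<bar>x - y\<bar> powr r) \<partial>\<nu> i)" for x
    proof -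
      have i: "integrable (\<nu> i) (\<lambda>y. \<bar>x - y\<bar>)" using integrable_id by auto
      have "x = (\<integral>y. x - y \<partial>\<nu> i)" using integrable_id mean_zero n.prob_space by simp
      then have "\<bar>x\<bar> = \<bar>\<integral>y. x - y \<partial>\<nu> i\<bar>" by simp
      also have "\<dots> \<le> (\<integral>y. \<bar>x - y\<bar> \<partial>\<nu> i)" by (rule integral_abs_bound)
      finally have "\<bar>x\<bar> powr r \<le> (\<integral>y. \<bar>x - y\<bar> \<partial>\<nu> i) powr r" using r by (intro powr_mono2) auto
      then have "ennreal (\<bar>x\<bar> powr r) \<le> ennreal ((\<integral>y. \<bar>x - y\<bar> \<partial>\<nu> i) powr r)" by (rule ennreal_leI)
      also have "\<dots> \<le> (\<integral>\<^sup>+y. ennreal (\<bar>x - y\<bar> powr r) \<partial>\<nu> i)" by (rule n.power_mean[OF i _ r]) simp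
      finally show ?thesis .
    qed
    have "ennreal (\<integral>x. \<bar>x\<bar> powr r \<partial>\<nu> i) = (\<integral>\<^sup>+x. ennreal (\<bar>x\<bar> powr r) \<partial>\<nu> i)"
      using moments[OF r] by (intro nn_integral_eq_integral[symmetric]) auto
    also have "\<dots> \<le> (\<integral>\<^sup>+x. (\<integral>\<^sup>+y. ennreal (\<bar>x - y\<bar> powr r) \<partial>\<nu> i) \<partial>\<nu> i)" by (intro nn_integral_mono pt)
    also have "\<dots> = (\<integral>\<^sup>+q. ennreal (\<bar>fst q - snd q\<bar> powr r) \<partial>(\<nu> i \<Otimes>\<^sub>M \<nu> i))"
      by (subst sigma_finite_measure.nn_integral_fst[OF prob_space_imp_sigma_finite[OF prob_law], symmetric]) simp_all
    also have "\<dots> = ennreal (\<integral>q. \<bar>fst q - snd q\<bar> powr r \<partial>(\<nu> i \<Otimes>\<^sub>M \<nu> i))"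
      using pint[OF r] by (intro nn_integral_eq_integral) auto
    finally show ?thesis by (subst (asm) ennreal_le_iff) (auto intro: Bochner_Integration.integral_nonneg)
  qed
  show ?thesis
  proof (intro regular_law.intro s regular_law_axioms.intro)
    show "1 \<le> 4 * \<alpha>" using \<alpha>_ge_1 by simp
    show "integrable (sym_law i) (\<lambda>x. \<bar>x\<bar> powr r)" if "1 \<le> r" for r
      unfolding sym_law_def using pint[OF that] by (subst integrable_distr_eq[OF diff_measurable]) auto
    show "(\<integral>x. \<bar>x\<bar> powr (2 * r) \<partial>sym_law i) \<le> (4 * \<alpha>) powr (2 * r) * (\<integral>x. \<bar>x\<bar> powr r \<partial>sym_law i)\<^sup>2"
      if r: "2 \<le> r" for r
    proof -
      have nu0: "0 \<le> (\<integral>x. \<bar>x\<bar> powr r \<partial>\<nu> i)" by (intro Bochner_Integration.integral_nonneg) simp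
      have "(\<integral>x. \<bar>x\<bar> powr (2 * r) \<partial>sym_law i) \<le> 2 * 2 powr (2 * r) * (\<integral>x. \<bar>x\<bar> powr (2 * r) \<partial>\<nu> i)"
        unfolding int_eq using r by (intro upper) simp
      also have "\<dots> \<le> 2 * 2 powr (2 * r) * (\<alpha> powr (2 * r) * (\<integral>x. \<bar>x\<bar> powr r \<partial>\<nu> i)\<^sup>2)"
        by (intro mult_left_mono regular[OF r]) auto
      also have "\<dots> \<le> 2 * 2 powr (2 * r) * (\<alpha> powr (2 * r) * (\<integral>x. \<bar>x\<bar> powr r \<partial>sym_law i)\<^sup>2)"
        unfolding int_eq using r nu0 by (intro mult_left_mono power_mono lower) auto
      also have "\<dots> \<le> (2 powr (2 * r) * 2 powr (2 * r)) * (\<alpha> powr (2 * r) * (\<integral>x. \<bar>x\<bar> powr r \<partial>sym_law i)\<^sup>2)"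
      proof (intro mult_right_mono)
        have "2 powr 1 \<le> (2 :: real) powr (2 * r)" using r by (intro powr_mono) auto
        then show "2 \<le> (2 :: real) powr (2 * r)" by simp
      qed auto
      also have "2 powr (2 * r) * 2 powr (2 * r) = (4 :: real) powr (2 * r)" by (simp flip: powr_mult)
      also have "4 powr (2 * r) * (\<alpha> powr (2 * r) * (\<integral>x. \<bar>x\<bar> powr r \<partial>sym_law i)\<^sup>2)
          = (4 * \<alpha>) powr (2 * r) * (\<integral>x. \<bar>x\<bar> powr r \<partial>sym_law i)\<^sup>2" by (simp only: powr_mult mult.assoc)
      finally show ?thesis .
    qed
  qed
qed

sublocale sym: regular_laws I sym_law "4 * \<alpha>"
  by (intro regular_laws.intro fin_I ne_I sym_law_regular)

abbreviation P where "P \<equiv> PiM I \<nu>"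

sublocale P: prob_space P by (rule prob_PiM)

sublocale PP: pair_prob_space P P ..

lemma component_measurable: "i \<in> I \<Longrightarrow> (\<lambda>x. x i) \<in> borel_measurable P"
  using measurable_component_singleton[of i I \<nu>] measurable_cong_sets[OF refl sets_laws] by blast

lemma sum_measurable: "(\<lambda>x. \<Sum>i\<in>I. t i * x i) \<in> borel_measurable P" for t :: "nat \<Rightarrow> real"
  by (intro borel_measurable_sum borel_measurable_times borel_measurable_const component_measurable) auto

lemma sup_abs_measurable: "finite T \<Longrightarrow> sup_abs I T \<in> borel_measurable P"
  unfolding sup_abs_def[abs_def] by (intro borel_measurable_Max borel_measurable_abs sum_measurable)

lemma sup_abs_measurable_sym: "finite T \<Longrightarrow> T \<noteq> {} \<Longrightarrow> sup_abs I T \<in> borel_measurable sym.P"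
  using sym.sup_abs_integrable by auto

lemma sum_integrable: "integrable P (\<lambda>x. \<Sum>i\<in>I. t i * x i)" for t :: "nat \<Rightarrow> real"
  using integrable_sum_components[of I "\<lambda>i y. t i * y" 0] integrable_id by simp

definition diff :: "(nat \<Rightarrow> real) \<times> (nat \<Rightarrow> real) \<Rightarrow> (nat \<Rightarrow> real)"
  where "diff q = (\<lambda>i\<in>I. fst q i - snd q i)"

lemma diff_prod_measurable: "diff \<in> measurable (P \<Otimes>\<^sub>M P) sym.P"
  unfolding diff_def
proof (rule measurable_restrict)
  fix i assume i: "i \<in> I"
  have "(\<lambda>q. fst q i - snd q i) \<in> borel_measurable (P \<Otimes>\<^sub>M P)"
    by (intro borel_measurable_diff measurable_compose[OF measurable_fst component_measurable[OF i]]
        measurable_compose[OF measurable_snd component_measurable[OF i]])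
  then show "(\<lambda>q. fst q i - snd q i) \<in> measurable (P \<Otimes>\<^sub>M P) (sym_law i)"
    using measurable_cong_sets[OF refl sym.sets_laws] by blast
qed

text \<open>The coordinates of a difference of independent copies are again independent: the
  indicator of a box factors over coordinates, and so do both iterated integrals.\<close>

lemma distr_diff: "distr (P \<Otimes>\<^sub>M P) sym.P diff = sym.P"
proof (rule sym.PiM_eqI)
  fix A assume A: "\<And>i. i \<in> I \<Longrightarrow> A i \<in> sets (sym_law i)"
  have Ab: "A i \<in> sets borel" if "i \<in> I" for i using A[OF that] by (simp add: sym.sets_laws)
  have box: "Pi\<^sub>E I A \<in> sets sym.P" using A fin_I by (intro sets_PiM_I_finite) auto
  have one: "(\<integral>\<^sup>+x. (\<integral>\<^sup>+y. indicator (A i) (x - y) \<partial>\<nu> i) \<partial>\<nu> i) = emeasure (sym_law i) (A i)" if i: "i \<in> I" for i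
  proof -
    interpret n: prob_space "\<nu> i" by (rule prob_law)
    have [measurable]: "A i \<in> sets borel" by (rule Ab[OF i])
    have "(\<integral>\<^sup>+x. (\<integral>\<^sup>+y. indicator (A i) (x - y) \<partial>\<nu> i) \<partial>\<nu> i)
      = (\<integral>\<^sup>+q. indicator (A i) (fst q - snd q) \<partial>(\<nu> i \<Otimes>\<^sub>M \<nu> i))"
      by (subst sigma_finite_measure.nn_integral_fst[OF prob_space_imp_sigma_finite[OF prob_law], symmetric]) simp_all
    also have "\<dots> = (\<integral>\<^sup>+z. indicator (A i) z \<partial>sym_law i)"
      unfolding sym_law_def by (rule nn_integral_distr[symmetric, OF diff_measurable]) simp
    finally show ?thesis using A[OF i] by simp
  qed
  have ind: "indicator (Pi\<^sub>E I A) (diff q) = (\<Prod>i\<in>I. indicator (A i) (fst q i - snd q i) :: ennreal)" for q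
  proof (cases "\<forall>i\<in>I. fst q i - snd q i \<in> A i")
    case True
    then have "diff q \<in> Pi\<^sub>E I A" unfolding diff_def by auto
    then show ?thesis using True by simp
  next
    case False
    then obtain i where i: "i \<in> I" "fst q i - snd q i \<notin> A i" by auto
    then have "diff q \<notin> Pi\<^sub>E I A" unfolding diff_def by (auto simp: PiE_iff)
    moreover have "(\<Prod>i\<in>I. indicator (A i) (fst q i - snd q i) :: ennreal) = 0"
      using fin_I i by (intro prod_zero bexI[of _ i]) auto
    ultimately show ?thesis by simp
  qed
  have ind_meas: "(\<lambda>y. indicator (A i) (x - y) :: ennreal) \<in> borel_measurable (\<nu> i)" if "i \<in> I" for x i
    using Ab[OF that] by measurable
  have inner_meas: "(\<lambda>x. \<integral>\<^sup>+y. indicator (A i) (x - y) \<partial>\<nu> i) \<in> borel_measurable (\<nu> i)" if "i \<in> I" for i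
  proof -
    interpret n: prob_space "\<nu> i" by (rule prob_law)
    show ?thesis using Ab[OF that] by measurable
  qed
  have "emeasure (distr (P \<Otimes>\<^sub>M P) sym.P diff) (Pi\<^sub>E I A) = (\<integral>\<^sup>+z. indicator (Pi\<^sub>E I A) z \<partial>distr (P \<Otimes>\<^sub>M P) sym.P diff)"
    using box by simp
  also have "\<dots> = (\<integral>\<^sup>+q. indicator (Pi\<^sub>E I A) (diff q) \<partial>(P \<Otimes>\<^sub>M P))"
    using box by (intro nn_integral_distr diff_prod_measurable) simp
  also have "\<dots> = (\<integral>\<^sup>+x. (\<integral>\<^sup>+y. indicator (Pi\<^sub>E I A) (diff (x, y)) \<partial>P) \<partial>P)"
    using measurable_compose[OF diff_prod_measurable borel_measurable_indicator[OF box]]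
    by (intro P.nn_integral_fst[symmetric])
  also have "\<dots> = (\<integral>\<^sup>+x. (\<Prod>i\<in>I. \<integral>\<^sup>+y. indicator (A i) (x i - y) \<partial>\<nu> i) \<partial>P)"
    unfolding ind fst_conv snd_conv
    by (intro nn_integral_cong product_nn_integral_prod[OF fin_I] ind_meas)
  also have "\<dots> = (\<Prod>i\<in>I. \<integral>\<^sup>+x. (\<integral>\<^sup>+y. indicator (A i) (x - y) \<partial>\<nu> i) \<partial>\<nu> i)"
    by (intro product_nn_integral_prod[OF fin_I] inner_meas)
  also have "\<dots> = (\<Prod>i\<in>I. emeasure (sym_law i) (A i))" by (intro prod.cong refl one)
  finally show "emeasure (distr (P \<Otimes>\<^sub>M P) sym.P diff) (Pi\<^sub>E I A) = (\<Prod>i\<in>I. emeasure (sym_law i) (A i))" .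
qed (use fin_I in simp_all)

lemma nn_integral_sym:
  assumes "f \<in> borel_measurable sym.P"
  shows "(\<integral>\<^sup>+z. f z \<partial>sym.P) = (\<integral>\<^sup>+x. (\<integral>\<^sup>+y. f (diff (x, y)) \<partial>P) \<partial>P)"
proof -
  have "(\<integral>\<^sup>+z. f z \<partial>sym.P) = (\<integral>\<^sup>+q. f (diff q) \<partial>(P \<Otimes>\<^sub>M P))"
    using nn_integral_distr[OF diff_prod_measurable, of f] assms unfolding distr_diff by simp
  also have "\<dots> = (\<integral>\<^sup>+x. (\<integral>\<^sup>+y. f (diff (x, y)) \<partial>P) \<partial>P)"
    using measurable_compose[OF diff_prod_measurable assms] by (intro P.nn_integral_fst[symmetric])
  finally show ?thesis .
qed

lemma sum_diff: "(\<Sum>i\<in>I. t i * diff (x, y) i) = (\<Sum>i\<in>I. t i * x i) - (\<Sum>i\<in>I. t i * y i)" for t :: "nat \<Rightarrow> real"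
  unfolding diff_def by (simp add: sum_subtractf right_diff_distrib)

lemma nn_integral_pair_le:
  assumes f: "f \<in> borel_measurable P" and c: "c \<noteq> \<top>"
  shows "(\<integral>\<^sup>+x. (\<integral>\<^sup>+y. c * (f x + f y) \<partial>P) \<partial>P) = 2 * c * (\<integral>\<^sup>+x. f x \<partial>P)"
proof -
  have "(\<integral>\<^sup>+y. c * (f x + f y) \<partial>P) = c * (f x + (\<integral>\<^sup>+y. f y \<partial>P))" for x
    using f by (subst nn_integral_cmult) (auto simp: nn_integral_add P.emeasure_space_1)
  then have "(\<integral>\<^sup>+x. (\<integral>\<^sup>+y. c * (f x + f y) \<partial>P) \<partial>P) = c * ((\<integral>\<^sup>+x. f x \<partial>P) + (\<integral>\<^sup>+x. f x \<partial>P))"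
    using f by (simp add: nn_integral_cmult nn_integral_add P.emeasure_space_1)
  then show ?thesis by (simp only: mult_2[symmetric] mult.assoc mult.left_commute)
qed

text \<open>Averaging over a copy \<open>y\<close> with mean zero recovers the linear forms at
  \<open>x\<close>. Jensen's inequality is applied to the supremum and then to the power.\<close>

lemma sup_abs_desymmetrize:
  assumes T: "finite T" "T \<noteq> {}" and p: "1 \<le> p"
  shows "(\<integral>\<^sup>+x. sup_abs I T x powr p \<partial>P) \<le> (\<integral>\<^sup>+z. sup_abs I T z powr p \<partial>sym.P)"
proof -
  have pt: "ennreal (sup_abs I T x powr p) \<le> (\<integral>\<^sup>+y. ennreal (sup_abs I T (diff (x, y)) powr p) \<partial>P)" for x
  proof -
    have i: "integrable P (\<lambda>y. \<bar>\<Sum>i\<in>I. t i * diff (x, y) i\<bar>)" for t :: "nat \<Rightarrow> real"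
      unfolding sum_diff using sum_integrable by auto
    have isup: "integrable P (\<lambda>y. sup_abs I T (diff (x, y)))"
      unfolding sup_abs_def by (intro integrable_Max_real T i)
    have "\<bar>\<Sum>i\<in>I. t i * x i\<bar> \<le> (\<integral>y. sup_abs I T (diff (x, y)) \<partial>P)" if t: "t \<in> T" for t
    proof -
      have "(\<integral>y. (\<Sum>i\<in>I. t i * y i) \<partial>P) = (\<Sum>i\<in>I. t i * (\<integral>y. y i \<partial>P))"
        using integrable_component[OF _ integrable_id] by (subst Bochner_Integration.integral_sum) auto
      also have "\<dots> = 0"
        using integral_component[of "\<lambda>y. y"] by (intro sum.neutral) (simp add: mean_zero)
      finally have "(\<Sum>i\<in>I. t i * x i) = (\<integral>y. (\<Sum>i\<in>I. t i * diff (x, y) i) \<partial>P)"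
        unfolding sum_diff using sum_integrable[of t] by (simp add: P.prob_space)
      then have "\<bar>\<Sum>i\<in>I. t i * x i\<bar> \<le> (\<integral>y. \<bar>\<Sum>i\<in>I. t i * diff (x, y) i\<bar> \<partial>P)"
        by (simp add: integral_abs_bound)
      also have "\<dots> \<le> (\<integral>y. sup_abs I T (diff (x, y)) \<partial>P)"
        by (intro integral_mono i isup sup_abs_ge T t)
      finally show ?thesis .
    qed
    then have "sup_abs I T x \<le> (\<integral>y. sup_abs I T (diff (x, y)) \<partial>P)"
      using T by (simp add: sup_abs_le_iff)
    then have "ennreal (sup_abs I T x powr p) \<le> ennreal ((\<integral>y. sup_abs I T (diff (x, y)) \<partial>P) powr p)"
      using p sup_abs_nonneg[OF T] by (intro ennreal_leI powr_mono2) auto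
    also have "\<dots> \<le> (\<integral>\<^sup>+y. ennreal (sup_abs I T (diff (x, y)) powr p) \<partial>P)"
      using isup sup_abs_nonneg[OF T] p by (intro P.power_mean)
    finally show ?thesis .
  qed
  have "(\<lambda>z. ennreal (sup_abs I T z powr p)) \<in> borel_measurable sym.P"
    using sup_abs_measurable_sym[OF T]
    by (intro measurable_compose[OF _ measurable_ennreal] powr_real_measurable borel_measurable_const)
  from nn_integral_sym[OF this] show ?thesis using pt by (simp add: nn_integral_mono)
qed

theorem strong_moment:
  assumes T: "finite T" "T \<noteq> {}" and p: "1 \<le> p" and W: "0 < W"
    and mean: "(\<integral>\<^sup>+x. sup_abs I T x \<partial>P) \<le> ennreal W"
    and weak: "\<And>t. t \<in> T \<Longrightarrow> (\<integral>\<^sup>+x. \<bar>\<Sum>i\<in>I. t i * x i\<bar> powr p \<partial>P) \<le> ennreal (W powr p)"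
  shows "(\<integral>\<^sup>+x. sup_abs I T x powr p \<partial>P) \<le> ennreal ((4 * W * sym.sym_const) powr p)"
proof -
  \<comment> \<open>The factor 4 is dictated by the weak moments: symmetrization gives
    \<open>2 * (2 * c * W) powr p \<le> (4 * c * W) powr p\<close>, which equals 1. The mean needs
    only a factor 2.\<close>
  define c where "c = 1 / (4 * W)"
  have c: "0 < c" "0 \<le> c" using W by (auto simp: c_def)
  let ?T = "(\<lambda>t i. c * t i) ` T"
  have T': "finite ?T" "?T \<noteq> {}" using T by auto
  have sc: "sup_abs I ?T x = c * sup_abs I T x" for x by (rule sup_abs_scale[OF T c(2)])
  have S0: "0 \<le> sup_abs I T x" for x by (rule sup_abs_nonneg[OF T])
  have "(\<integral>z. sup_abs I ?T z \<partial>sym.P) \<le> 1"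
  proof -
    have meas: "(\<lambda>z. ennreal (sup_abs I ?T z)) \<in> borel_measurable sym.P"
      using sup_abs_measurable_sym[OF T'] by (intro measurable_compose[OF _ measurable_ennreal])
    have "ennreal (\<integral>z. sup_abs I ?T z \<partial>sym.P) = (\<integral>\<^sup>+z. sup_abs I ?T z \<partial>sym.P)"
      using sym.sup_abs_integrable[OF T'] sup_abs_nonneg[OF T'] by (intro nn_integral_eq_integral[symmetric]) auto
    also have "\<dots> = (\<integral>\<^sup>+x. (\<integral>\<^sup>+y. ennreal (sup_abs I ?T (diff (x, y))) \<partial>P) \<partial>P)"
      by (rule nn_integral_sym[OF meas])
    also have "\<dots> \<le> (\<integral>\<^sup>+x. (\<integral>\<^sup>+y. ennreal c * (ennreal (sup_abs I T x) + ennreal (sup_abs I T y)) \<partial>P) \<partial>P)"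
    proof (intro nn_integral_mono)
      fix x y
      have "sup_abs I T (diff (x, y)) \<le> sup_abs I T x + sup_abs I T y"
      proof -
        have "\<bar>\<Sum>i\<in>I. t i * diff (x, y) i\<bar> \<le> sup_abs I T x + sup_abs I T y" if "t \<in> T" for t
          unfolding sum_diff using sup_abs_ge[OF T(1) that, where I = I and x = x] sup_abs_ge[OF T(1) that, where I = I and x = y] by linarith
        then show ?thesis using T by (simp add: sup_abs_le_iff)
      qed
      then have "c * sup_abs I T (diff (x, y)) \<le> c * (sup_abs I T x + sup_abs I T y)"
        using c by (intro mult_left_mono)
      then have "ennreal (sup_abs I ?T (diff (x, y))) \<le> ennreal (c * (sup_abs I T x + sup_abs I T y))"
        unfolding sc by (rule ennreal_leI)
      also have "\<dots> = ennreal c * (ennreal (sup_abs I T x) + ennreal (sup_abs I T y))"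
        using c S0 by (simp add: ennreal_mult' ennreal_plus)
      finally show "ennreal (sup_abs I ?T (diff (x, y))) \<le> ennreal c * (ennreal (sup_abs I T x) + ennreal (sup_abs I T y))" .
    qed
    also have "\<dots> = 2 * ennreal c * (\<integral>\<^sup>+x. sup_abs I T x \<partial>P)"
      using sup_abs_measurable[OF T(1)] by (intro nn_integral_pair_le measurable_compose[OF _ measurable_ennreal]) auto
    also have "\<dots> \<le> 2 * ennreal c * ennreal W" by (intro mult_left_mono mean) simp
    also have "\<dots> = ennreal (2 * c * W)" using c by (simp add: ennreal_mult')
    also have "\<dots> \<le> ennreal 1" unfolding c_def using W by (intro ennreal_leI) simp
    finally show ?thesis by (subst (asm) ennreal_le_iff) auto
  qed
  moreover have "(\<integral>z. \<bar>\<Sum>i\<in>I. t i * z i\<bar> powr p \<partial>sym.P) \<le> 1" if t: "t \<in> ?T" for t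
  proof -
    obtain s where s: "s \<in> T" "t = (\<lambda>i. c * s i)" using t by auto
    let ?f = "\<lambda>x. ennreal (\<bar>\<Sum>i\<in>I. s i * x i\<bar> powr p)"
    have ts: "(\<Sum>i\<in>I. t i * x i) = c * (\<Sum>i\<in>I. s i * x i)" for x
      unfolding s sum_distrib_left by (simp add: mult.assoc)
    have meas: "(\<lambda>z. ennreal (\<bar>\<Sum>i\<in>I. t i * z i\<bar> powr p)) \<in> borel_measurable sym.P"
      using sym.integrable_powr_sum[OF p, of t] by (intro measurable_compose[OF _ measurable_ennreal]) auto
    have fm: "?f \<in> borel_measurable P"
      by (intro measurable_compose[OF _ measurable_ennreal] powr_real_measurable borel_measurable_abs
          sum_measurable borel_measurable_const)
    have "ennreal (\<integral>z. \<bar>\<Sum>i\<in>I. t i * z i\<bar> powr p \<partial>sym.P) = (\<integral>\<^sup>+z. \<bar>\<Sum>i\<in>I. t i * z i\<bar> powr p \<partial>sym.P)"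
      using sym.integrable_powr_sum[OF p] by (intro nn_integral_eq_integral[symmetric]) auto
    also have "\<dots> = (\<integral>\<^sup>+x. (\<integral>\<^sup>+y. ennreal (\<bar>\<Sum>i\<in>I. t i * diff (x, y) i\<bar> powr p) \<partial>P) \<partial>P)"
      by (rule nn_integral_sym[OF meas])
    also have "\<dots> \<le> (\<integral>\<^sup>+x. (\<integral>\<^sup>+y. ennreal ((2 * c) powr p) * (?f x + ?f y) \<partial>P) \<partial>P)"
    proof (intro nn_integral_mono)
      fix x y
      let ?a = "\<Sum>i\<in>I. s i * x i" and ?b = "\<Sum>i\<in>I. s i * y i"
      have "\<bar>\<Sum>i\<in>I. t i * diff (x, y) i\<bar> powr p = c powr p * \<bar>?a - ?b\<bar> powr p"
        unfolding ts sum_diff abs_mult using c by (simp add: powr_mult)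
      also have "\<dots> \<le> c powr p * (\<bar>?a\<bar> + \<bar>?b\<bar>) powr p"
        using p by (intro mult_left_mono powr_mono2) auto
      also have "\<dots> \<le> c powr p * (2 powr p * (\<bar>?a\<bar> powr p + \<bar>?b\<bar> powr p))"
        using p by (intro mult_left_mono powr_add_le) auto
      also have "\<dots> = (2 * c) powr p * (\<bar>?a\<bar> powr p + \<bar>?b\<bar> powr p)" by (simp add: powr_mult)
      finally have "ennreal (\<bar>\<Sum>i\<in>I. t i * diff (x, y) i\<bar> powr p) \<le> ennreal ((2 * c) powr p * (\<bar>?a\<bar> powr p + \<bar>?b\<bar> powr p))"
        by (rule ennreal_leI)
      also have "\<dots> = ennreal ((2 * c) powr p) * (?f x + ?f y)" by (simp add: ennreal_mult' ennreal_plus)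
      finally show "ennreal (\<bar>\<Sum>i\<in>I. t i * diff (x, y) i\<bar> powr p) \<le> ennreal ((2 * c) powr p) * (?f x + ?f y)" .
    qed
    also have "\<dots> = 2 * ennreal ((2 * c) powr p) * (\<integral>\<^sup>+x. ?f x \<partial>P)"
      by (rule nn_integral_pair_le[OF fm]) simp
    also have "\<dots> \<le> 2 * ennreal ((2 * c) powr p) * ennreal (W powr p)" by (intro mult_left_mono weak s) simp
    also have "\<dots> = ennreal (2 * (2 * c) powr p * W powr p)" by (simp add: ennreal_mult')
    also have "\<dots> \<le> ennreal 1"
    proof (rule ennreal_leI)
      have "2 powr 1 \<le> (2 :: real) powr p" using p by (intro powr_mono) auto
      then have "2 * ((2 * c) powr p * W powr p) \<le> 2 powr p * ((2 * c) powr p * W powr p)"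
        by (intro mult_right_mono) auto
      also have "\<dots> = (2 * ((2 * c) * W)) powr p" by (simp only: powr_mult)
      also have "2 * ((2 * c) * W) = 1" unfolding c_def using W by simp
      finally show "2 * (2 * c) powr p * W powr p \<le> 1" by simp
    qed
    finally show ?thesis by (subst (asm) ennreal_le_iff) auto
  qed
  ultimately have main: "(\<integral>\<^sup>+z. sup_abs I ?T z powr p \<partial>sym.P) \<le> sym.sym_const powr p"
    by (rule sym.strong_moment_symmetric[OF T' p])
  have "(\<integral>\<^sup>+x. sup_abs I T x powr p \<partial>P) = (\<integral>\<^sup>+x. ennreal ((4 * W) powr p) * ennreal (sup_abs I ?T x powr p) \<partial>P)"
  proof (rule nn_integral_cong)
    fix x
    have "4 * W * c = 1" unfolding c_def using W by simp
    then have "sup_abs I T x = (4 * W) * sup_abs I ?T x" unfolding sc mult.assoc[symmetric] by simp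
    then have "sup_abs I T x powr p = (4 * W) powr p * sup_abs I ?T x powr p" by (metis powr_mult)
    then show "ennreal (sup_abs I T x powr p) = ennreal ((4 * W) powr p) * ennreal (sup_abs I ?T x powr p)"
      by (simp add: ennreal_mult')
  qed
  also have "\<dots> = ennreal ((4 * W) powr p) * (\<integral>\<^sup>+x. sup_abs I ?T x powr p \<partial>P)"
    using sup_abs_measurable[OF T'(1)]
    by (intro nn_integral_cmult measurable_compose[OF _ measurable_ennreal] powr_real_measurable borel_measurable_const)
  also have "\<dots> \<le> ennreal ((4 * W) powr p) * ennreal (sym.sym_const powr p)"
    by (intro mult_left_mono order_trans[OF sup_abs_desymmetrize[OF T' p] main]) simp
  also have "\<dots> = ennreal ((4 * W * sym.sym_const) powr p)" by (simp add: ennreal_mult' powr_mult)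
  finally show ?thesis .
qed

end

subsection \<open>Moments with values in the extended half-line\<close>

lemma ennreal_powr_ennreal: "0 \<le> x \<Longrightarrow> ennreal_powr (ennreal x) p = ennreal (x powr p)"
  unfolding ennreal_powr_def by simp

lemma ennreal_powr_mono: "x \<le> y \<Longrightarrow> 0 \<le> p \<Longrightarrow> ennreal_powr x p \<le> ennreal_powr y p"
proof (cases "y = \<top>")
  case False
  assume *: "x \<le> y" "0 \<le> p"
  then have "x \<noteq> \<top>" using False by (auto simp: top_unique)
  moreover have "enn2real x \<le> enn2real y" using * False by (intro enn2real_mono) (auto simp: less_top)
  then have "enn2real x powr p \<le> enn2real y powr p" using *(2) by (intro powr_mono2) auto
  ultimately show ?thesis using False unfolding ennreal_powr_def by (simp add: ennreal_leI)
qed (simp add: ennreal_powr_def)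

lemma ennreal_powr_measurable:
  assumes f: "f \<in> borel_measurable M"
  shows "(\<lambda>x. ennreal_powr (f x) p) \<in> borel_measurable M"
proof -
  have [measurable]: "(\<lambda>x. enn2real (f x) powr p) \<in> borel_measurable M"
    by (intro powr_real_measurable borel_measurable_enn2real f borel_measurable_const)
  have [measurable]: "Measurable.pred M (\<lambda>x. f x = \<top>)" using f by measurable
  show ?thesis unfolding ennreal_powr_def by measurable
qed

lemma ennreal_powr_inverse_le_iff:
  assumes p: "0 < p" and w: "0 \<le> w"
  shows "ennreal_powr y (1 / p) \<le> ennreal w \<longleftrightarrow> y \<le> ennreal (w powr p)"
proof (cases y rule: ennreal_cases)
  case (real r)
  have "r powr (1 / p) \<le> w \<longleftrightarrow> r \<le> w powr p"
  proof
    assume "r powr (1 / p) \<le> w"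
    then have "(r powr (1 / p)) powr p \<le> w powr p" using p by (intro powr_mono2) auto
    then show "r \<le> w powr p" using p real by (simp add: powr_powr)
  next
    assume "r \<le> w powr p"
    then have "r powr (1 / p) \<le> (w powr p) powr (1 / p)" using p real by (intro powr_mono2) auto
    then show "r powr (1 / p) \<le> w" using p w by (simp add: powr_powr)
  qed
  then show ?thesis using real w by (simp add: ennreal_powr_ennreal)
next
  case top
  then show ?thesis by (simp add: ennreal_powr_def top_unique)
qed

text \<open>The half of continuity that monotone convergence needs: a finite bound on the powers
  bounds the \<open>a m\<close> themselves, and the power is monotone.\<close>

lemma ennreal_powr_SUP_le:
  assumes p: "0 < p" and a: "\<And>m. 0 \<le> a m"
  shows "ennreal_powr (SUP m. ennreal (a m)) p \<le> (SUP m. ennreal (a m powr p))"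
proof (cases "SUP m. ennreal (a m powr p)" rule: ennreal_cases)
  case (real c)
  have "ennreal (a m) \<le> ennreal (c powr (1 / p))" for m
  proof -
    have "ennreal (a m powr p) \<le> ennreal c" unfolding real(2)[symmetric] by (rule SUP_upper) simp
    then have "a m powr p \<le> c" using real by simp
    then have "(a m powr p) powr (1 / p) \<le> c powr (1 / p)" using p by (intro powr_mono2) auto
    then show ?thesis using p a[of m] by (simp add: powr_powr ennreal_leI)
  qed
  then have "ennreal_powr (SUP m. ennreal (a m)) p \<le> ennreal_powr (ennreal (c powr (1 / p))) p"
    using p by (intro ennreal_powr_mono SUP_least) auto
  also have "\<dots> = ennreal c" using p real by (simp add: ennreal_powr_ennreal powr_powr)
  finally show ?thesis using real by simp
next
  case top
  then show ?thesis by (simp only: top_greatest)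
qed

lemma moment_norm_distr:
  assumes Y: "Y \<in> measurable M N" and S: "S \<in> borel_measurable N"
  shows "moment_norm (distr M N Y) p S = moment_norm M p (\<lambda>\<omega>. S (Y \<omega>))"
  unfolding moment_norm_def using nn_integral_distr[OF Y, of "\<lambda>x. ennreal_powr (S x) p"] S
  by (simp add: ennreal_powr_measurable)

lemma Lp_norm_eq:
  assumes "integrable M (\<lambda>\<omega>. \<bar>S \<omega>\<bar> powr p)"
  shows "Lp_norm M p S = ennreal ((\<integral>\<omega>. \<bar>S \<omega>\<bar> powr p \<partial>M) powr (1 / p))"
proof -
  have "(\<integral>\<^sup>+\<omega>. ennreal (\<bar>S \<omega>\<bar> powr p) \<partial>M) = ennreal (\<integral>\<omega>. \<bar>S \<omega>\<bar> powr p \<partial>M)"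
    using assms by (intro nn_integral_eq_integral) auto
  then show ?thesis unfolding moment_norm_def
    by (simp add: ennreal_powr_ennreal Bochner_Integration.integral_nonneg)
qed

subsection \<open>Arbitrary index sets\<close>

abbreviation (input) sup_ennreal :: "nat \<Rightarrow> (nat \<Rightarrow> real) set \<Rightarrow> (nat \<Rightarrow> real) \<Rightarrow> ennreal"
  where "sup_ennreal n T x \<equiv> SUP t\<in>T. ennreal \<bar>\<Sum>i=1..n. t i * x i\<bar>"

lemma sup_ennreal_cong: "(\<And>i. i \<in> {1..n} \<Longrightarrow> x i = y i) \<Longrightarrow> sup_ennreal n T x = sup_ennreal n T y"
  by (auto intro!: SUP_cong arg_cong[where f = "\<lambda>s. ennreal \<bar>s\<bar>"] sum.cong)

lemma sup_abs_cong: "(\<And>i. i \<in> I \<Longrightarrow> x i = y i) \<Longrightarrow> sup_abs I T x = sup_abs I T y"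
  unfolding sup_abs_def by (auto intro!: arg_cong[where f = Max] image_cong arg_cong[where f = abs] sum.cong)

text \<open>The functions \<open>t \<mapsto> \<Sum> t\<^sub>i x\<^sub>i\<close> are continuous for every \<open>x\<close>, so a countable dense subset of
  \<open>T\<close> has the same suprema for all \<open>x\<close> simultaneously.\<close>

lemma finite_approximation:
  fixes T :: "(nat \<Rightarrow> real) set"
  assumes "T \<noteq> {}"
  obtains U :: "nat \<Rightarrow> (nat \<Rightarrow> real) set" where "\<And>m. finite (U m)" "\<And>m. U m \<noteq> {}" "\<And>m. U m \<subseteq> T"
    "incseq U" "\<And>x. sup_ennreal n T x = (SUP m. ennreal (sup_abs {1..n} (U m) x))"
proof -
  obtain D where D: "countable D" "D \<subseteq> T" "T \<subseteq> closure D" using separable[of T] by blast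
  have ne: "D \<noteq> {}" using D assms by auto
  define U where "U m = from_nat_into D ` {..m}" for m :: nat
  have U: "finite (U m)" "U m \<noteq> {}" for m by (simp_all add: U_def)
  have U_sub: "U m \<subseteq> T" for m 
  proof (unfold U_def, rule image_subsetI)
    fix k show "from_nat_into D k \<in> T" by (rule subsetD[OF D(2) from_nat_into[OF ne]])
  qed
  have eq: "sup_ennreal n T x = (SUP m. ennreal (sup_abs {1..n} (U m) x))" for x
  proof (rule antisym)
    let ?R = "SUP m. ennreal (sup_abs {1..n} (U m) x)"
    have "D \<subseteq> {t. ennreal \<bar>\<Sum>i=1..n. t i * x i\<bar> \<le> ?R}"
    proof
      fix t assume t: "t \<in> D"
      obtain m where m: "from_nat_into D m = t" using from_nat_into_surj[OF D(1) t] by (elim exE)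
      have "t \<in> U m" unfolding U_def m[symmetric] by (rule imageI) simp
      then have "\<bar>\<Sum>i=1..n. t i * x i\<bar> \<le> sup_abs {1..n} (U m) x" by (intro sup_abs_ge U)
      then have "ennreal \<bar>\<Sum>i=1..n. t i * x i\<bar> \<le> ennreal (sup_abs {1..n} (U m) x)" by (rule ennreal_leI)
      also have "\<dots> \<le> ?R" by (rule SUP_upper) simp
      finally show "t \<in> {t. ennreal \<bar>\<Sum>i=1..n. t i * x i\<bar> \<le> ?R}" by (subst mem_Collect_eq)
    qed
    moreover have "closed {t. ennreal \<bar>\<Sum>i=1..n. t i * x i\<bar> \<le> ?R}"
      by (intro closed_Collect_le continuous_on_const continuous_on_ennreal continuous_on_rabs
          continuous_on_sum continuous_on_mult continuous_on_product_coordinates)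
    ultimately show "sup_ennreal n T x \<le> ?R"
      using closure_minimal[of D] D(3) by (intro SUP_least) blast
  next
    show "(SUP m. ennreal (sup_abs {1..n} (U m) x)) \<le> sup_ennreal n T x"
    proof (rule SUP_least)
      fix m
      have "sup_abs {1..n} (U m) x \<in> (\<lambda>t. \<bar>\<Sum>i=1..n. t i * x i\<bar>) ` U m"
        unfolding sup_abs_def using U by (intro Max_in) auto
      then obtain t where t: "t \<in> U m" "sup_abs {1..n} (U m) x = \<bar>\<Sum>i=1..n. t i * x i\<bar>" by auto
      show "ennreal (sup_abs {1..n} (U m) x) \<le> sup_ennreal n T x"
        unfolding t(2) using t(1) U_sub[of m] by (intro SUP_upper) blast
    qed
  qed
  have "incseq U" unfolding U_def incseq_def by auto
  from that[OF U U_sub this eq] show thesis .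
qed

lemma sup_abs_process_measurable:
  assumes "finite T" "\<And>i. i \<in> I \<Longrightarrow> X i \<in> borel_measurable M"
  shows "(\<lambda>\<omega>. sup_abs I T (\<lambda>i. X i \<omega>)) \<in> borel_measurable M"
  unfolding sup_abs_def using assms
  by (intro borel_measurable_Max borel_measurable_abs borel_measurable_sum borel_measurable_times
      borel_measurable_const)

lemma sup_ennreal_measurable:
  assumes "T \<noteq> {}" "\<And>i. i \<in> {1..n} \<Longrightarrow> X i \<in> borel_measurable M"
  shows "(\<lambda>\<omega>. sup_ennreal n T (\<lambda>i. X i \<omega>)) \<in> borel_measurable M"
proof -
  obtain U :: "nat \<Rightarrow> (nat \<Rightarrow> real) set" where U: "\<And>m. finite (U m)" "\<And>m. U m \<noteq> {}" "\<And>m. U m \<subseteq> T" "incseq U"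
    "\<And>x. sup_ennreal n T x = (SUP m. ennreal (sup_abs {1..n} (U m) x))"
    by (rule finite_approximation[OF assms(1), where n = n]) (rule that)
  show ?thesis unfolding U(5)
    by (intro borel_measurable_SUP measurable_compose[OF _ measurable_ennreal] sup_abs_process_measurable U assms) auto
qed

lemma admissible_measurable:
  assumes "prob_space M" "admissible_variables M \<alpha> n X" "i \<in> {1..n}"
  shows "X i \<in> borel_measurable M"
  using assms unfolding admissible_variables_def prob_space.indep_vars_def[OF assms(1)] by auto

text \<open>The index set consisting of the zero vector meets every normalization, so the bound on
  \<open>K\<close> can be read off from it.\<close>

lemma (in regular_laws) sym_const_pos: "0 < sym_const"
proof -
  have "sup_abs I {\<lambda>_. 0} x = 0" for x unfolding sup_abs_def by simp
  then have "3 \<le> normalized_process.K \<alpha>" by (intro strong_moment_ge_2(2)[of "{\<lambda>_. 0}" 2]) auto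
  then show ?thesis unfolding sym_const_def using \<alpha>_ge_1 by (intro mult_pos_pos) auto
qed

lemma admissible_moment:
  fixes M :: "'a measure"
  assumes M: "prob_space M" and adm: "admissible_variables M \<alpha> n X" and n: "1 \<le> n" and p: "1 \<le> p"
    and T: "T \<noteq> {}" and C: "4 * regular_laws.sym_const (4 * max \<alpha> 1) \<le> C" "0 < C"
  shows "moment_norm M p (\<lambda>\<omega>. sup_ennreal n T (\<lambda>i. X i \<omega>))
    \<le> ennreal C * ((\<integral>\<^sup>+\<omega>. sup_ennreal n T (\<lambda>i. X i \<omega>) \<partial>M)
        + (SUP t\<in>T. Lp_norm M p (\<lambda>\<omega>. \<Sum>i=1..n. t i * X i \<omega>)))" (is "?L \<le> ennreal C * ?R")
proof -
  interpret M: prob_space M by (rule M)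
  let ?I = "{1..n}"
  \<comment> \<open>The regular-law estimates are stated for constants at least 1; enlarging
    \<open>\<alpha>\<close> only weakens the growth condition.\<close>
  define \<beta> where "\<beta> = max \<alpha> 1"
  \<comment> \<open>The locales assume their properties for all indices. Outside
    \<open>{1..n}\<close> the point mass at 0 has them trivially.\<close>
  define \<nu> where "\<nu> i = (if i \<in> ?I then distr M borel (X i) else return borel (0 :: real))" for i
  have X [measurable]: "X i \<in> borel_measurable M" if "i \<in> ?I" for i by (rule admissible_measurable[OF M adm that])
  have mom: "integrable M (\<lambda>\<omega>. \<bar>X i \<omega>\<bar> powr r)" if "i \<in> ?I" "1 \<le> r" for i r
    using adm that unfolding admissible_variables_def by auto
  have abs_powr: "(\<lambda>x :: real. \<bar>x\<bar> powr r) \<in> borel_measurable borel" for r by measurable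
  have int_\<nu>: "(\<integral>x. \<bar>x\<bar> powr r \<partial>\<nu> i) = (\<integral>\<omega>. \<bar>X i \<omega>\<bar> powr r \<partial>M)" if "i \<in> ?I" for i r
    unfolding \<nu>_def using that by (simp add: integral_distr[OF X abs_powr])
  have ret: "(\<integral>x. f x \<partial>\<nu> i) = f 0" "integrable (\<nu> i) f" if "i \<notin> ?I" "f \<in> borel_measurable borel" for i and f :: "real \<Rightarrow> real"
    using that unfolding \<nu>_def by (auto simp: integral_return nn_integral_return intro!: integrableI_bounded)
  interpret centered_laws \<nu> ?I \<beta>
  proof (intro centered_laws.intro real_laws.intro centered_laws_axioms.intro)
    show "prob_space (\<nu> i)" for i
      unfolding \<nu>_def by (auto intro!: M.prob_space_distr X prob_space_return)
    show "sets (\<nu> i) = sets borel" for i unfolding \<nu>_def by simp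
    show "finite ?I" "?I \<noteq> {}" "1 \<le> \<beta>" using n by (auto simp: \<beta>_def)
    show "integrable (\<nu> i) (\<lambda>x. \<bar>x\<bar> powr r)" if "1 \<le> r" for i r
    proof (cases "i \<in> ?I")
      case True
      then show ?thesis unfolding \<nu>_def using mom[OF True that] by (simp add: integrable_distr_eq[OF X abs_powr])
    qed (intro ret abs_powr)
    show "(\<integral>x. x \<partial>\<nu> i) = 0" for i
    proof (cases "i \<in> ?I")
      case True
      then have "(\<integral>x. x \<partial>\<nu> i) = M.expectation (X i)" unfolding \<nu>_def by (simp add: integral_distr[OF X])
      then show ?thesis using adm True unfolding admissible_variables_def by simp
    qed (simp add: ret)
    show "(\<integral>x. \<bar>x\<bar> powr (2 * r) \<partial>\<nu> i) \<le> \<beta> powr (2 * r) * (\<integral>x. \<bar>x\<bar> powr r \<partial>\<nu> i)\<^sup>2" if r: "2 \<le> r" for i r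
    proof (cases "i \<in> ?I")
      case True
      let ?H = "\<lambda>q. \<integral>\<omega>. \<bar>X i \<omega>\<bar> powr q \<partial>M"
      have H0: "0 \<le> ?H q" for q by (intro Bochner_Integration.integral_nonneg) simp
      have "Lp_norm M (2 * r) (X i) \<le> ennreal \<alpha> * Lp_norm M r (X i)"
        using adm True r unfolding admissible_variables_def by simp
      also have "\<dots> \<le> ennreal \<beta> * Lp_norm M r (X i)" unfolding \<beta>_def by (intro mult_right_mono ennreal_leI) auto
      finally have "ennreal (?H (2 * r) powr (1 / (2 * r))) \<le> ennreal (\<beta> * ?H r powr (1 / r))"
        using r mom[OF True] by (simp add: Lp_norm_eq ennreal_mult'')
      then have "?H (2 * r) powr (1 / (2 * r)) \<le> \<beta> * ?H r powr (1 / r)"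
        by (subst (asm) ennreal_le_iff) (auto simp: \<beta>_def)
      then have "(?H (2 * r) powr (1 / (2 * r))) powr (2 * r) \<le> (\<beta> * ?H r powr (1 / r)) powr (2 * r)"
        using r by (intro powr_mono2) auto
      also have "\<dots> = \<beta> powr (2 * r) * ?H r powr 2" using r by (simp add: powr_mult powr_powr)
      also have "?H r powr 2 = (?H r)\<^sup>2" using H0[of r] by simp
      finally show ?thesis using r H0[of "2 * r"] unfolding int_\<nu>[OF True] by (simp add: powr_powr)
    next
      case False
      then show ?thesis using r by (simp add: ret[OF False abs_powr])
    qed
  qed
  have P_eq: "distr M (PiM ?I (\<lambda>_. borel)) (\<lambda>\<omega>. \<lambda>i\<in>?I. X i \<omega>) = P"
  proof -
    have "distr M (PiM ?I (\<lambda>_. borel)) (\<lambda>\<omega>. \<lambda>i\<in>?I. X i \<omega>) = PiM ?I (\<lambda>i. distr M borel (X i))"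
      using adm ne_I unfolding admissible_variables_def
      by (subst M.indep_vars_iff_distr_eq_PiM'[symmetric]) (auto intro: X)
    also have "\<dots> = P" by (intro PiM_cong) (auto simp: \<nu>_def)
    finally show ?thesis .
  qed
  have sets_P: "sets (PiM ?I \<nu>) = sets (PiM ?I (\<lambda>_. borel))" by (intro sets_PiM_cong refl sets_laws)
  have Y: "(\<lambda>\<omega>. \<lambda>i\<in>?I. X i \<omega>) \<in> measurable M (PiM ?I (\<lambda>_. borel))" by (intro measurable_restrict X)
  have nn: "(\<integral>\<^sup>+x. ennreal (f x) \<partial>P) = (\<integral>\<^sup>+\<omega>. ennreal (f (\<lambda>i\<in>?I. X i \<omega>)) \<partial>M)" if "f \<in> borel_measurable P" for f
  proof -
    have "(\<lambda>x. ennreal (f x)) \<in> borel_measurable (PiM ?I (\<lambda>_. borel))"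
      using that measurable_cong_sets[OF sets_P refl] by (intro measurable_compose[OF _ measurable_ennreal]) blast
    then show ?thesis unfolding P_eq[symmetric] by (intro nn_integral_distr Y) simp
  qed
  obtain U :: "nat \<Rightarrow> (nat \<Rightarrow> real) set" where U: "\<And>m. finite (U m)" "\<And>m. U m \<noteq> {}" "\<And>m. U m \<subseteq> T" "incseq U"
    and U_eq: "\<And>x. sup_ennreal n T x = (SUP m. ennreal (sup_abs ?I (U m) x))"
    by (rule finite_approximation[OF T, where n = n]) (rule that)
  define s where "s m \<omega> = sup_abs ?I (U m) (\<lambda>i. X i \<omega>)" for m \<omega>
  have s0: "0 \<le> s m \<omega>" for m \<omega> unfolding s_def by (rule sup_abs_nonneg[OF U(1,2)])
  have s_le: "ennreal (s m \<omega>) \<le> sup_ennreal n T (\<lambda>i. X i \<omega>)" for m \<omega>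
    unfolding s_def U_eq by (rule SUP_upper) simp
  have s_restrict: "sup_abs ?I (U m) (\<lambda>i\<in>?I. X i \<omega>) = s m \<omega>" for m \<omega>
    unfolding s_def by (rule sup_abs_cong) simp
  have sum_restrict: "(\<Sum>i=1..n. t i * (\<lambda>i\<in>?I. X i \<omega>) i) = (\<Sum>i=1..n. t i * X i \<omega>)" for t :: "nat \<Rightarrow> real" and \<omega>
    by (intro sum.cong) auto
  have s_meas: "s m \<in> borel_measurable M" for m
    unfolding s_def[abs_def] by (intro sup_abs_process_measurable U X)
  \<comment> \<open>The slack \<open>e\<close> keeps the normalizing constant \<open>W\<close>
    positive even when the bracket is zero, since \<open>strong_moment\<close> divides by
    it.\<close>
  have main: "?L \<le> ennreal C * (?R + ennreal e)" if e: "0 < e" and fin: "?R < \<top>" for e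
  proof -
    define W where "W = enn2real ?R + e"
    have W: "0 < W" "?R + ennreal e = ennreal W"
      using e fin by (auto simp: W_def add_nonneg_pos ennreal_plus)
    have le_W: "?R \<le> ennreal W" unfolding W(2)[symmetric] by (rule add_increasing2) auto
    have bound: "(\<integral>\<^sup>+\<omega>. ennreal (s m \<omega> powr p) \<partial>M) \<le> ennreal ((C * W) powr p)" for m
    proof -
      have "(\<integral>\<^sup>+x. sup_abs ?I (U m) x \<partial>P) = (\<integral>\<^sup>+\<omega>. ennreal (s m \<omega>) \<partial>M)"
        using nn[OF sup_abs_measurable[OF U(1)], of m] unfolding s_restrict .
      also have "\<dots> \<le> (\<integral>\<^sup>+\<omega>. sup_ennreal n T (\<lambda>i. X i \<omega>) \<partial>M)" by (intro nn_integral_mono s_le)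
      also have "\<dots> \<le> ennreal W" by (rule order_trans[OF _ le_W]) simp
      finally have mean: "(\<integral>\<^sup>+x. sup_abs ?I (U m) x \<partial>P) \<le> ennreal W" .
      have weak: "(\<integral>\<^sup>+x. \<bar>\<Sum>i\<in>?I. t i * x i\<bar> powr p \<partial>P) \<le> ennreal (W powr p)" if t: "t \<in> U m" for t
      proof -
        have "(\<integral>\<^sup>+x. \<bar>\<Sum>i\<in>?I. t i * x i\<bar> powr p \<partial>P) = (\<integral>\<^sup>+\<omega>. ennreal (\<bar>\<Sum>i=1..n. t i * X i \<omega>\<bar> powr p) \<partial>M)"
          unfolding sum_restrict[symmetric]
          by (intro nn powr_real_measurable borel_measurable_abs sum_measurable borel_measurable_const)
        also have "\<dots> = (\<integral>\<^sup>+\<omega>. ennreal_powr (ennreal \<bar>\<Sum>i=1..n. t i * X i \<omega>\<bar>) p \<partial>M)"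
          by (simp add: ennreal_powr_ennreal)
        also have "\<dots> \<le> ennreal (W powr p)"
        proof (subst ennreal_powr_inverse_le_iff[symmetric])
          have "Lp_norm M p (\<lambda>\<omega>. \<Sum>i=1..n. t i * X i \<omega>) \<le> (SUP t\<in>T. Lp_norm M p (\<lambda>\<omega>. \<Sum>i=1..n. t i * X i \<omega>))"
            using t U(3)[of m] by (intro SUP_upper) auto
          also have "\<dots> \<le> ennreal W" by (rule order_trans[OF _ le_W]) simp
          finally show "ennreal_powr (\<integral>\<^sup>+\<omega>. ennreal_powr (ennreal \<bar>\<Sum>i=1..n. t i * X i \<omega>\<bar>) p \<partial>M) (1 / p) \<le> ennreal W"
            unfolding moment_norm_def .
        qed (use p W in auto)
        finally show ?thesis .
      qed
      have "(\<integral>\<^sup>+\<omega>. ennreal (s m \<omega> powr p) \<partial>M) = (\<integral>\<^sup>+x. sup_abs ?I (U m) x powr p \<partial>P)"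
        using nn[of "\<lambda>x. sup_abs ?I (U m) x powr p"] sup_abs_measurable[OF U(1), of m]
        unfolding s_restrict by (simp add: powr_real_measurable)
      also have "\<dots> \<le> ennreal ((4 * W * sym.sym_const) powr p)"
        by (rule strong_moment[OF U(1,2) p W(1) mean weak])
      also have "\<dots> \<le> ennreal ((C * W) powr p)"
      proof (intro ennreal_leI powr_mono2)
        have "W * (4 * sym.sym_const) \<le> W * C"
          using C(1) W(1) unfolding \<beta>_def by (intro mult_left_mono) auto
        then show "4 * W * sym.sym_const \<le> C * W" by (simp add: ac_simps)
      qed (use p W sym.sym_const_pos in auto)
      finally show ?thesis .
    qed
    have "(\<integral>\<^sup>+\<omega>. ennreal_powr (sup_ennreal n T (\<lambda>i. X i \<omega>)) p \<partial>M) \<le> (\<integral>\<^sup>+\<omega>. (SUP m. ennreal (s m \<omega> powr p)) \<partial>M)"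
      unfolding U_eq s_def[symmetric] using p s0 by (intro nn_integral_mono ennreal_powr_SUP_le) auto
    also have "\<dots> = (SUP m. \<integral>\<^sup>+\<omega>. ennreal (s m \<omega> powr p) \<partial>M)"
    proof (rule nn_integral_monotone_convergence_SUP)
      show "incseq (\<lambda>m \<omega>. ennreal (s m \<omega> powr p))"
      proof (intro incseq_SucI le_funI ennreal_leI powr_mono2)
        fix m \<omega>
        have "U m \<subseteq> U (Suc m)" using U(4) by (simp add: incseq_Suc_iff)
        then show "s m \<omega> \<le> s (Suc m) \<omega>"
          unfolding s_def sup_abs_def using U(1,2) by (intro Max_mono) auto
      qed (use p s0 in auto)
      show "(\<lambda>\<omega>. ennreal (s m \<omega> powr p)) \<in> borel_measurable M" for m
        by (intro measurable_compose[OF _ measurable_ennreal] powr_real_measurable s_meas borel_measurable_const)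
    qed
    also have "\<dots> \<le> ennreal ((C * W) powr p)" by (intro SUP_least bound)
    finally have "?L \<le> ennreal (C * W)"
      unfolding moment_norm_def using p C W by (subst ennreal_powr_inverse_le_iff) auto
    then show ?thesis unfolding W(2) using C W by (simp add: ennreal_mult')
  qed
  show ?thesis
  proof (rule ennreal_le_epsilon)
    fix e :: real assume fin: "ennreal C * ?R < \<top>" and e: "0 < e"
    have "?R < \<top>"
    proof (rule ccontr)
      assume "\<not> ?R < \<top>"
      then have "?R = \<top>" by (simp only: less_top[symmetric] not_not)
      show False using fin C(2) unfolding \<open>?R = \<top>\<close> by (simp add: ennreal_mult_top)
    qed
    \<comment> \<open>The slack is taken as \<open>e / C\<close>, so that it becomes
      \<open>e\<close> after multiplication by the constant.\<close>
    then have "?L \<le> ennreal C * (?R + ennreal (e / C))" using e C by (intro main) auto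
    also have "\<dots> = ennreal C * ?R + ennreal (C * (e / C))" using C e by (simp only: distrib_left ennreal_mult'[OF less_imp_le[OF C(2)]])
    also have "C * (e / C) = e" using C by simp
    finally show "?L \<le> ennreal C * ?R + ennreal e" .
  qed
qed

subsection \<open>Transfer between probability spaces\<close>

context
  fixes M :: "'a measure" and \<alpha> :: real and n :: nat and X :: "nat \<Rightarrow> 'a \<Rightarrow> real"
  assumes M: "prob_space M" and adm: "admissible_variables M \<alpha> n X" and n: "1 \<le> n"
begin

interpretation M: prob_space M by (rule M)

text \<open>Restriction to \<open>{1..n}\<close> is needed because the product measure lives on
  extensional functions; the sums and suprema see only these coordinates.\<close>

definition sample :: "'a \<Rightarrow> nat \<Rightarrow> real" where "sample \<omega> = (\<lambda>i\<in>{1..n}. X i \<omega>)"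

definition law :: "(nat \<Rightarrow> real) measure" where "law = distr M (PiM {1..n} (\<lambda>_. borel)) sample"

lemma sample_measurable: "sample \<in> measurable M (PiM {1..n} (\<lambda>_. borel))"
  unfolding sample_def[abs_def] by (intro measurable_restrict admissible_measurable[OF M adm])

lemma prob_space_law: "prob_space law"
  unfolding law_def by (rule M.prob_space_distr[OF sample_measurable])

lemma coordinate_measurable:
  "i \<in> {1..n} \<Longrightarrow> (\<lambda>x. x i) \<in> borel_measurable (PiM {1..n} (\<lambda>_. borel :: real measure))"
  by (rule measurable_component_singleton)

lemma admissible_law: "admissible_variables law \<alpha> n (\<lambda>i x. x i)"
proof -
  interpret L: prob_space law by (rule prob_space_law)
  have c: "(\<lambda>x. x i) \<in> borel_measurable law" if "i \<in> {1..n}" for i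
    unfolding law_def using coordinate_measurable[OF that] by simp
  have s: "sample \<omega> i = X i \<omega>" if "i \<in> {1..n}" for \<omega> i unfolding sample_def using that by simp
  have marginal: "distr law borel (\<lambda>x. x i) = distr M borel (X i)" if "i \<in> {1..n}" for i
    unfolding law_def using that s
    by (subst distr_distr[OF coordinate_measurable[OF that] sample_measurable]) (auto intro!: distr_cong)
  have "distr law (PiM {1..n} (\<lambda>_. borel)) (\<lambda>x. \<lambda>i\<in>{1..n}. x i) = law"
    unfolding law_def
    by (subst distr_distr[OF measurable_restrict[OF coordinate_measurable] sample_measurable])
      (auto intro!: distr_cong simp: sample_def)
  also have "\<dots> = PiM {1..n} (\<lambda>i. distr M borel (X i))"
    unfolding law_def sample_def[abs_def] using adm n unfolding admissible_variables_def
    by (subst M.indep_vars_iff_distr_eq_PiM'[symmetric]) (auto intro: admissible_measurable[OF M adm])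
  also have "\<dots> = PiM {1..n} (\<lambda>i. distr law borel (\<lambda>x. x i))" by (intro PiM_cong refl marginal[symmetric])
  finally have "L.indep_vars (\<lambda>_. borel) (\<lambda>i x. x i) {1..n}"
    using n c by (subst L.indep_vars_iff_distr_eq_PiM') auto
  moreover have "integrable law (\<lambda>x. \<bar>x i\<bar> powr q)" if i: "i \<in> {1..n}" and q: "1 \<le> q" for i q
  proof -
    have m: "(\<lambda>x. \<bar>x i\<bar> powr q) \<in> borel_measurable (PiM {1..n} (\<lambda>_. borel :: real measure))"
      by (intro powr_real_measurable borel_measurable_abs coordinate_measurable i borel_measurable_const)
    show ?thesis unfolding law_def integrable_distr_eq[OF sample_measurable m] s[OF i]
      using adm i q unfolding admissible_variables_def by auto
  qed
  moreover have "L.expectation (\<lambda>x. x i) = 0" if i: "i \<in> {1..n}" for i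
  proof -
    have "L.expectation (\<lambda>x. x i) = M.expectation (X i)"
      unfolding law_def integral_distr[OF sample_measurable coordinate_measurable[OF i]] s[OF i] ..
    then show ?thesis using adm i unfolding admissible_variables_def by simp
  qed
  moreover have "Lp_norm law q (\<lambda>x. x i) = Lp_norm M q (X i)" if i: "i \<in> {1..n}" for i q
  proof -
    have "(\<lambda>x. ennreal \<bar>x i\<bar>) \<in> borel_measurable (PiM {1..n} (\<lambda>_. borel :: real measure))"
      by (intro measurable_compose[OF _ measurable_ennreal] borel_measurable_abs coordinate_measurable i)
    from moment_norm_distr[OF sample_measurable this] show ?thesis unfolding law_def s[OF i] .
  qed
  ultimately show ?thesis using adm unfolding admissible_variables_def by auto
qed

text \<open>Both sides depend only on the joint law of the variables. The change of variables uses
  measurability of the supremum, which holds for arbitrary \<open>T\<close> by the countable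
  approximation.\<close>

lemma moment_comparison_transfer:
  assumes comp: "moment_comparison law \<alpha> C" and p: "1 \<le> p" and T: "T \<noteq> {}" "T \<subseteq> ({1..n} \<rightarrow>\<^sub>E (UNIV :: real set))"
  shows "moment_norm M p (\<lambda>\<omega>. sup_ennreal n T (\<lambda>i. X i \<omega>))
    \<le> ennreal C * ((\<integral>\<^sup>+\<omega>. sup_ennreal n T (\<lambda>i. X i \<omega>) \<partial>M)
        + (SUP t\<in>T. Lp_norm M p (\<lambda>\<omega>. \<Sum>i=1..n. t i * X i \<omega>)))"
proof -
  let ?N = "PiM {1..n} (\<lambda>_. borel :: real measure)"
  have sup: "sup_ennreal n T (sample \<omega>) = sup_ennreal n T (\<lambda>i. X i \<omega>)" for \<omega>
    by (rule sup_ennreal_cong) (simp add: sample_def)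
  have sup_meas: "sup_ennreal n T \<in> borel_measurable ?N"
    using sup_ennreal_measurable[OF T(1) coordinate_measurable] .
  have lin: "(\<Sum>i=1..n. t i * sample \<omega> i) = (\<Sum>i=1..n. t i * X i \<omega>)" for t \<omega>
    by (intro sum.cong) (auto simp: sample_def)
  have "moment_norm law p (sup_ennreal n T)
    \<le> ennreal C * ((\<integral>\<^sup>+x. sup_ennreal n T x \<partial>law) + (SUP t\<in>T. Lp_norm law p (\<lambda>x. \<Sum>i=1..n. t i * x i)))"
    using comp n admissible_law p T unfolding moment_comparison_def by blast
  moreover have "moment_norm law p (sup_ennreal n T) = moment_norm M p (\<lambda>\<omega>. sup_ennreal n T (\<lambda>i. X i \<omega>))"
    unfolding law_def moment_norm_distr[OF sample_measurable sup_meas] sup ..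
  moreover have "(\<integral>\<^sup>+x. sup_ennreal n T x \<partial>law) = (\<integral>\<^sup>+\<omega>. sup_ennreal n T (\<lambda>i. X i \<omega>) \<partial>M)"
    unfolding law_def using nn_integral_distr[OF sample_measurable, of "sup_ennreal n T"] sup_meas
    unfolding sup by simp
  moreover have "Lp_norm law p (\<lambda>x. \<Sum>i=1..n. t i * x i) = Lp_norm M p (\<lambda>\<omega>. \<Sum>i=1..n. t i * X i \<omega>)" for t :: "nat \<Rightarrow> real"
  proof -
    have "(\<lambda>x. ennreal \<bar>\<Sum>i=1..n. t i * x i\<bar>) \<in> borel_measurable ?N"
      by (intro measurable_compose[OF _ measurable_ennreal] borel_measurable_abs borel_measurable_sum
          borel_measurable_times borel_measurable_const coordinate_measurable)
    from moment_norm_distr[OF sample_measurable this] show ?thesis unfolding law_def lin .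
  qed
  ultimately show ?thesis by simp
qed

end

(* A bare "EX C. comparison_constant TYPE('a) \<alpha> C" would let C depend on the type 'a of sample
   points. The constant is therefore chosen for one fixed type, and every such constant
   is asserted to serve probability spaces over all types 'a. *)

theorem theorem1p1:
  fixes \<alpha> :: real
  assumes "0 < \<alpha>"
  shows "(\<exists>C>0. comparison_constant TYPE(nat \<Rightarrow> real) \<alpha> C) \<and>
         (\<forall>C>0. comparison_constant TYPE(nat \<Rightarrow> real) \<alpha> C \<longrightarrow> comparison_constant TYPE('a) \<alpha> C)"
proof (intro conjI allI impI)
  let ?C = "max 1 (4 * regular_laws.sym_const (4 * max \<alpha> 1))"
  have "comparison_constant TYPE(nat \<Rightarrow> real) \<alpha> ?C"
    unfolding comparison_constant_def moment_comparison_def by (intro allI impI admissible_moment) auto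
  then show "\<exists>C>0. comparison_constant TYPE(nat \<Rightarrow> real) \<alpha> C" by (intro exI[of _ ?C]) auto
next
  fix C :: real
  assume C: "comparison_constant TYPE(nat \<Rightarrow> real) \<alpha> C"
  \<comment> \<open>Here \<open>C\<close> is any constant known to serve the sample space of real
    sequences, so the estimate on \<open>M\<close> is drawn from the joint law and not from
    \<open>admissible_moment\<close>.\<close>
  have "moment_comparison (law M n X) \<alpha> C"
    if "prob_space M" "1 \<le> n" "admissible_variables M \<alpha> n X" for M :: "'a measure" and n X
    using C prob_space_law[OF that(1,3,2)] unfolding comparison_constant_def by blast
  then show "comparison_constant TYPE('a) \<alpha> C"
    unfolding comparison_constant_def moment_comparison_def[of "M :: 'a measure" for M]
    by (intro allI impI moment_comparison_transfer)
qed

end
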